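(* Let $0<\alpha<1$. There exists a $\delta>0$ such that for all initial values $h_0\in H^1(S^1)$ with $\|h_0-\bar h_0\|_{H^1(S^1)}<\delta$ there is a weak solution $$h\in C\big([0,\infty);H^1(S^1)\big)\cap L_{\alpha+1,\mathrm{loc}}\big((0,\infty);W^3_{\alpha+1}(S^1)\big)$$ of $$\partial_t h+\partial_\theta\Big(h^{\alpha+2}\,|\partial_\theta h+\partial_\theta^3h|^{\alpha-1}(\partial_\theta h+\partial_\theta^3 h)\Big)=0,\quad t>0,\ \theta\in S^1,\qquad h(0,\cdot)=h_0,$$ that exists globally in time. Moreover, there exists a time $0<t^\ast<\infty$ such that $$h(t,\theta)=\bar h_0+v(\theta)\quad\text{with}\quad v(\theta)=v_{-1}(t^\ast)e^{-i\theta}+v_1(t^\ast)e^{i\theta},\qquad t\ge t^\ast,\ \theta\in S^1.$$ Here $v_{\pm1}$ denote the Fourier coefficients corresponding to the Fourier modes $n=\pm1$, which are constant for times $t\ge t^\ast$.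
   Context: $S^1$ is identified with $[0,2\pi]$ with periodic boundary conditions; $L_p(S^1)$, $W^k_p(S^1)$, $H^k(S^1)=W^k_2(S^1)$ are the usual spaces of $2\pi$-periodic (real-valued) functions. The average of a function is $\bar v=\frac1{2\pi}\int_{S^1}v\,d\theta$, and initial values have positive average, $\bar h_0>0$. The Fourier coefficients are $v_{\pm1}(t)=\frac1{2\pi}\int_{S^1}h(t,\theta)e^{\mp i\theta}\,d\theta$. Write $\psi(s)=|s|^{\alpha-1}s$. A weak solution on $[0,T]$ with initial value $h_0$ is a function $h\in L_{\alpha+1}((0,T);W^3_{\alpha+1}(S^1))\cap C([0,T];H^1(S^1))$ with $\partial_th\in L_{\frac{\alpha+1}{\alpha}}((0,T);(W^1_{\alpha+1}(S^1))')$, $h(0,\cdot)=h_0$, and $$\int_0^T\langle\partial_th(t),\varphi(t)\rangle_{W^1_{\alpha+1}(S^1)}\,dt=\int_0^T\int_{S^1}h^{\alpha+2}\psi(\partial_\theta h+\partial_\theta^3h)\,\partial_\theta\varphi\,d\theta\,dt$$ for all $\varphi\in L_{\alpha+1}((0,T);W^1_{\alpha+1}(S^1))$, where $h^{\alpha+2}$ is understood as $|h|^{\alpha+2}$ and $\langle\cdot,\cdot\rangle_{W^1_{\alpha+1}(S^1)}$ is the duality pairing. A global weak solution is a function that is a weak solution on $[0,T]$ for every $T>0$.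
   Formalization: The number δ is allowed to depend on the (fixed, positive) average of the initial value; a single δ for all positive averages is impossible, since by scaling it would remove the smallness condition, and c(ε+cos 2θ) with 0<ε<1 and small c is then a counterexample. *)

theory Defs
  imports "HOL-Analysis.Analysis"
begin

section \<open>Function spaces on the circle\<close>

text \<open>
  Elements of function spaces are represented by functions, not by classes modulo null sets. Hence
  all norms below are seminorms on representatives, and they do not distinguish functions that
  agree almost everywhere. Functions on the circle are \<open>2\<pi>\<close>-periodic functions on the real line;
  integrals are taken over one period.
\<close>

abbreviation circle :: "real measure" where
  "circle \<equiv> lebesgue_on {0..2 * pi}"

definition periodic :: "(real \<Rightarrow> real) \<Rightarrow> bool" where
  "periodic f \<longleftrightarrow> (\<forall>\<theta>. f (\<theta> + 2 * pi) = f \<theta>)"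

definition smooth :: "(real \<Rightarrow> real) \<Rightarrow> bool" where
  "smooth f \<longleftrightarrow> (\<forall>k x. (deriv ^^ k) f field_differentiable (at x))"

definition Lp :: "real \<Rightarrow> (real \<Rightarrow> real) set" where
  "Lp p = {f. periodic f \<and> f \<in> borel_measurable circle \<and> integrable circle (\<lambda>\<theta>. \<bar>f \<theta>\<bar> powr p)}"

definition is_weak_deriv :: "nat \<Rightarrow> (real \<Rightarrow> real) \<Rightarrow> (real \<Rightarrow> real) \<Rightarrow> bool" where
  "is_weak_deriv k f g \<longleftrightarrow>
     (\<forall>\<phi>. smooth \<phi> \<and> periodic \<phi> \<longrightarrow>
        (\<integral>\<theta>. f \<theta> * (deriv ^^ k) \<phi> \<theta> \<partial>circle) = (- 1) ^ k * (\<integral>\<theta>. g \<theta> * \<phi> \<theta> \<partial>circle))"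

definition Sobolev :: "nat \<Rightarrow> real \<Rightarrow> (real \<Rightarrow> real) set" where
  "Sobolev k p = {f \<in> Lp p. \<forall>j\<le>k. \<exists>g\<in>Lp p. is_weak_deriv j f g}"

text \<open>
  A chosen representative of the weak derivative, which is unique up to null sets if it exists.
\<close>

definition weak_deriv :: "nat \<Rightarrow> (real \<Rightarrow> real) \<Rightarrow> real \<Rightarrow> real" where
  "weak_deriv k f = (SOME g. g \<in> Lp 1 \<and> is_weak_deriv k f g)"

definition Sobolev_norm :: "nat \<Rightarrow> real \<Rightarrow> (real \<Rightarrow> real) \<Rightarrow> real" where
  "Sobolev_norm k p f = (\<Sum>j\<le>k. \<integral>\<theta>. \<bar>weak_deriv j f \<theta>\<bar> powr p \<partial>circle) powr (1 / p)"

definition average :: "(real \<Rightarrow> real) \<Rightarrow> real" where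
  "average f = 1 / (2 * pi) * (\<integral>\<theta>. f \<theta> \<partial>circle)"

definition fourier_coeff :: "int \<Rightarrow> (real \<Rightarrow> real) \<Rightarrow> complex" where
  "fourier_coeff n f =
     1 / (2 * of_real pi) * (\<integral>\<theta>. of_real (f \<theta>) * exp (- \<i> * of_int n * of_real \<theta>) \<partial>circle)"

text \<open>
  The topological dual of \<open>Sobolev k p\<close>; only the values of a functional on \<open>Sobolev k p\<close> matter.
  Boundedness by the seminorm makes functionals invariant under change of representatives.
\<close>

definition Sobolev_dual :: "nat \<Rightarrow> real \<Rightarrow> ((real \<Rightarrow> real) \<Rightarrow> real) set" where
  "Sobolev_dual k p = {l.
     (\<forall>f\<in>Sobolev k p. \<forall>g\<in>Sobolev k p. l (\<lambda>\<theta>. f \<theta> + g \<theta>) = l f + l g) \<and>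
     (\<forall>c. \<forall>f\<in>Sobolev k p. l (\<lambda>\<theta>. c * f \<theta>) = c * l f) \<and>
     (\<exists>C. \<forall>f\<in>Sobolev k p. \<bar>l f\<bar> \<le> C * Sobolev_norm k p f)}"

definition Sobolev_dual_norm :: "nat \<Rightarrow> real \<Rightarrow> ((real \<Rightarrow> real) \<Rightarrow> real) \<Rightarrow> real" where
  "Sobolev_dual_norm k p l = (SUP f\<in>{f \<in> Sobolev k p. Sobolev_norm k p f \<le> 1}. \<bar>l f\<bar>)"


section \<open>Functions of time with values in a function space\<close>

text \<open>
  The value space is given by a carrier \<open>X\<close> and a (semi)norm \<open>N\<close>. Measurability is strong (Bochner)
  measurability: almost everywhere approximation by simple functions with values in \<open>X\<close>.
\<close>

definition bochner_measurable ::
    "('x \<Rightarrow> real) set \<Rightarrow> (('x \<Rightarrow> real) \<Rightarrow> real) \<Rightarrow> real set \<Rightarrow> (real \<Rightarrow> 'x \<Rightarrow> real) \<Rightarrow> bool" where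
  "bochner_measurable X N I u \<longleftrightarrow>
     (\<exists>s. (\<forall>n. simple_function (lebesgue_on I) (s n) \<and> (\<forall>t\<in>I. s n t \<in> X)) \<and>
          (AE t in lebesgue_on I. u t \<in> X \<and> (\<lambda>n. N (\<lambda>x. u t x - s n t x)) \<longlonglongrightarrow> 0))"

definition bochner_Lp ::
    "real \<Rightarrow> real set \<Rightarrow> ('x \<Rightarrow> real) set \<Rightarrow> (('x \<Rightarrow> real) \<Rightarrow> real) \<Rightarrow> (real \<Rightarrow> 'x \<Rightarrow> real) set" where
  "bochner_Lp p I X N =
     {u. bochner_measurable X N I u \<and> integrable (lebesgue_on I) (\<lambda>t. N (u t) powr p)}"

definition continuous_into ::
    "real set \<Rightarrow> ('x \<Rightarrow> real) set \<Rightarrow> (('x \<Rightarrow> real) \<Rightarrow> real) \<Rightarrow> (real \<Rightarrow> 'x \<Rightarrow> real) set" where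
  "continuous_into I X N =
     {u. \<forall>t\<in>I. u t \<in> X \<and> ((\<lambda>s. N (\<lambda>x. u s x - u t x)) \<longlongrightarrow> 0) (at t within I)}"

definition bochner_Lp_loc_pos ::
    "real \<Rightarrow> ('x \<Rightarrow> real) set \<Rightarrow> (('x \<Rightarrow> real) \<Rightarrow> real) \<Rightarrow> (real \<Rightarrow> 'x \<Rightarrow> real) set" where
  "bochner_Lp_loc_pos p X N = {u. \<forall>a b. 0 < a \<and> a < b \<longrightarrow> u \<in> bochner_Lp p {a<..<b} X N}"

text \<open>
  \<open>g\<close> is the distributional time derivative of \<open>h\<close> on \<open>(0,T)\<close> with values in the dual of
  \<open>Sobolev 1 p\<close>, where \<open>h t\<close> is embedded into the dual by the integral pairing.
\<close>

definition is_time_deriv ::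
    "real \<Rightarrow> real \<Rightarrow> (real \<Rightarrow> real \<Rightarrow> real) \<Rightarrow> (real \<Rightarrow> (real \<Rightarrow> real) \<Rightarrow> real) \<Rightarrow> bool" where
  "is_time_deriv p T h g \<longleftrightarrow>
     (\<forall>\<eta> a b. smooth \<eta> \<and> 0 < a \<and> a < b \<and> b < T \<and> (\<forall>t. t \<notin> {a..b} \<longrightarrow> \<eta> t = 0) \<longrightarrow>
        (\<forall>w\<in>Sobolev 1 p.
           (\<integral>t. deriv \<eta> t * (\<integral>\<theta>. h t \<theta> * w \<theta> \<partial>circle) \<partial>lebesgue_on {0<..<T})
           = - (\<integral>t. \<eta> t * g t w \<partial>lebesgue_on {0<..<T})))"


section \<open>Weak solutions\<close>

definition \<psi> :: "real \<Rightarrow> real \<Rightarrow> real" where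
  "\<psi> \<alpha> s = \<bar>s\<bar> powr (\<alpha> - 1) * s"

definition weak_solution ::
    "real \<Rightarrow> real \<Rightarrow> (real \<Rightarrow> real) \<Rightarrow> (real \<Rightarrow> real \<Rightarrow> real) \<Rightarrow> bool" where
  "weak_solution \<alpha> T h0 h \<longleftrightarrow>
     h \<in> bochner_Lp (\<alpha> + 1) {0<..<T} (Sobolev 3 (\<alpha> + 1)) (Sobolev_norm 3 (\<alpha> + 1)) \<and>
     h \<in> continuous_into {0..T} (Sobolev 1 2) (Sobolev_norm 1 2) \<and>
     (AE \<theta> in circle. h 0 \<theta> = h0 \<theta>) \<and>
     (\<exists>ht \<in> bochner_Lp ((\<alpha> + 1) / \<alpha>) {0<..<T}
              (Sobolev_dual 1 (\<alpha> + 1)) (Sobolev_dual_norm 1 (\<alpha> + 1)).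
        is_time_deriv (\<alpha> + 1) T h ht \<and>
        (\<forall>\<phi> \<in> bochner_Lp (\<alpha> + 1) {0<..<T} (Sobolev 1 (\<alpha> + 1)) (Sobolev_norm 1 (\<alpha> + 1)).
           (\<integral>t. ht t (\<phi> t) \<partial>lebesgue_on {0<..<T})
           = (\<integral>t. (\<integral>\<theta>. \<bar>h t \<theta>\<bar> powr (\<alpha> + 2)
                           * \<psi> \<alpha> (weak_deriv 1 (h t) \<theta> + weak_deriv 3 (h t) \<theta>)
                           * weak_deriv 1 (\<phi> t) \<theta> \<partial>circle) \<partial>lebesgue_on {0<..<T})))"

definition global_weak_solution ::
    "real \<Rightarrow> (real \<Rightarrow> real) \<Rightarrow> (real \<Rightarrow> real \<Rightarrow> real) \<Rightarrow> bool" where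
  "global_weak_solution \<alpha> h0 h \<longleftrightarrow> (\<forall>T>0. weak_solution \<alpha> T h0 h)"

text \<open>
  The equation is homogeneous: if \<open>h\<close> is a global weak solution, then so is
  \<open>\<lambda>t \<theta>. c * h (c powr (2 * \<alpha> + 1) * t) \<theta>\<close> for \<open>c > 0\<close>. Hence a smallness condition on the
  deviation of the initial value from its average is a restriction only for a fixed positive
  average; a bound uniform in all positive averages would be no restriction at all.
\<close>

end

theory Submission imports Defs "HOL-Complex_Analysis.Great_Picard" begin

text \<open>
With the flux \<open>j = h powr (\<alpha> + 2) * \<psi> \<alpha> (h\<^sub>\<theta> + h\<^sub>\<theta>\<^sub>\<theta>\<^sub>\<theta>)\<close> and the weight \<open>b(h) = h powr (- (\<alpha> + 2) / \<alpha>)\<close>, truncated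
away from the mean, the equation reads \<open>h\<^sub>t + j\<^sub>\<theta> = 0\<close>, \<open>h\<^sub>\<theta> + h\<^sub>\<theta>\<^sub>\<theta>\<^sub>\<theta> = b(h) spow (1 / \<alpha>) j\<close>. Each step of the
implicit Euler scheme, projected to finitely many modes, minimises a strictly convex functional of \<open>j\<close>. The energy
\<open>Q = \<Sum> (k\<^sup>2 - 1) c\<^sub>k\<^sup>2\<close> over \<open>k \<noteq> 0\<close> loses at least a multiple of \<open>Q powr ((\<alpha> + 1) / 2)\<close> per unit of time, uniformly
in the discretisation; since the exponent is less than 1, a small energy is extinct at time 1, when only the modes
0, 1, -1 are left. Monotonicity of \<open>spow (1 / \<alpha>)\<close> bounds the difference of the fluxes of two discretisations,
so that \<open>j\<close> converges uniformly on the circle for almost every time.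
\<close>

section \<open>Averages over the circle\<close>

text \<open>The flux is the unknown of each time step because the relation solved for h_\<theta> +
  h_\<theta>\<theta>\<theta> is monotone with exponent \<rho> = 1 / \<alpha> > 1, which is
  monotonicity in a quantitative sense. The weight is frozen at the old time level to keep a step
  convex. The price is that the dissipation decreases only up to changes of the weight; a discrete
  Gronwall argument with small energy pays for it. The energy is blind to the modes 0, 1 and -1: the
  mean is conserved, the other two are controlled through the L1 norm of the flux. Higher
  derivatives of the flux are bounded only after integration in time, away from t = 0, so the fluxes
  converge only for almost every time and along a further subsequence. Sharp Fourier projections do
  not respect uniform convergence; third derivatives are therefore recovered from Fejer means of the
  scheme. A discretisation with N steps need not be extinct at time 1, it only has energy of order
  2^(-N/2). The limit is continued after time 1 by its constant value, with zero flux.\<close>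

abbreviation Average :: "(real \<Rightarrow> real) \<Rightarrow> real" (binder "AVG " 10) where
  "Average \<equiv> average"

abbreviation pavg :: "real \<Rightarrow> (real \<Rightarrow> real) \<Rightarrow> real" where
  "pavg p f \<equiv> AVG x. \<bar>f x\<bar> powr p"

abbreviation I01 :: "real \<Rightarrow> real" where
  "I01 \<equiv> indicator {0<..1}"

lemma circle_integrable: "continuous_on {0..2 * pi} f \<Longrightarrow> integrable circle (f :: real \<Rightarrow> real)"
  by (rule continuous_imp_integrable_real)

lemma circle_integrable_UNIV: "continuous_on UNIV f \<Longrightarrow> integrable circle (f :: real \<Rightarrow> real)"
  by (rule circle_integrable) (rule continuous_on_subset, auto)

lemma average_add:
  "integrable circle f \<Longrightarrow> integrable circle g \<Longrightarrow> (AVG x. f x + g x) = average f + average g"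
  by (simp add: average_def distrib_left)

lemma average_diff:
  "integrable circle f \<Longrightarrow> integrable circle g \<Longrightarrow> (AVG x. f x - g x) = average f - average g"
  by (simp add: average_def right_diff_distrib)

lemma average_cmult: "(AVG x. c * f x) = c * average f"
  by (simp add: average_def)

lemma average_cmult_right: "(AVG x. f x * c) = average f * c"
  by (simp add: average_def)

lemma average_const: "(AVG x. c) = c"
  by (simp add: average_def measure_restrict_space)

lemma average_sum:
  "(\<And>i. i \<in> I \<Longrightarrow> integrable circle (f i)) \<Longrightarrow> (AVG x. \<Sum>i\<in>I. f i x) = (\<Sum>i\<in>I. average (f i))"
  by (simp add: average_def sum_distrib_left)

lemma average_mono:
  assumes "integrable circle f" "integrable circle g" "\<And>x. x \<in> {0..2*pi} \<Longrightarrow> f x \<le> g x"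
  shows "average f \<le> average g"
  unfolding average_def
  by (intro mult_left_mono integral_mono assms) (use assms in auto)

text \<open>Also covers non-integrable f, whose integral is 0 by convention.\<close>

lemma average_nonneg: "(\<And>x. x \<in> {0..2*pi} \<Longrightarrow> 0 \<le> f x) \<Longrightarrow> 0 \<le> average f"
  unfolding average_def by (intro mult_nonneg_nonneg integral_nonneg_AE AE_I2) auto

lemma average_cong: "(\<And>x. x \<in> {0..2*pi} \<Longrightarrow> f x = g x) \<Longrightarrow> average f = average g"
  unfolding average_def by (intro arg_cong2[where f = "(*)"] Bochner_Integration.integral_cong) auto

lemma average_abs_le:
  assumes "integrable circle f"
  shows "\<bar>average f\<bar> \<le> (AVG x. \<bar>f x\<bar>)"
  unfolding average_def using integral_abs_bound[of circle f] by (simp add: abs_mult divide_right_mono)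

lemma average_le_const:
  assumes "integrable circle f" "\<And>x. x \<in> {0..2*pi} \<Longrightarrow> f x \<le> c"
  shows "average f \<le> c"
  using average_mono[OF assms(1), of "\<lambda>_. c"] assms(2) average_const by simp

lemma average_eq_integral:
  "continuous_on {0..2*pi} f \<Longrightarrow> average f = 1 / (2 * pi) * integral {0..2*pi} f"
  unfolding average_def by (subst lebesgue_integral_eq_integral) (auto intro: circle_integrable)

lemma circle_integrable_bounded:
  fixes f :: "real \<Rightarrow> real"
  assumes "f \<in> borel_measurable circle" "\<And>x. x \<in> {0..2*pi} \<Longrightarrow> \<bar>f x\<bar> \<le> c"
  shows "integrable circle f"
proof (rule Bochner_Integration.integrable_bound)
  show "integrable circle (\<lambda>_. c)" by simp
  show "AE x in circle. norm (f x) \<le> norm c" using assms by (intro AE_I2) force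
qed (use assms in simp_all)

section \<open>The Hartley basis and trigonometric polynomials\<close>

text \<open>The Hartley functions are a real basis, orthonormal for \<open>average\<close> and
  indexed by the integers alone. Differentiation sends \<open>cas k\<close> to k times
  \<open>cas (- k)\<close>, so a single real coefficient function replaces separate sine and cosine
  coefficients.\<close>

definition cas :: "int \<Rightarrow> real \<Rightarrow> real" where
  "cas k x = cos (of_int k * x) + sin (of_int k * x)"

lemma cas_0 [simp]: "cas 0 x = 1"
  by (simp add: cas_def)

lemma abs_cas_le: "\<bar>cas k x\<bar> \<le> 2"
  unfolding cas_def using abs_cos_le_one[of "of_int k * x"] abs_sin_le_one[of "of_int k * x"]
  by linarith

lemma cas_deriv: "(cas k has_real_derivative of_int k * cas (- k) x) (at x within S)"
proof -
  have "((\<lambda>x. cos (of_int k * x) + sin (of_int k * x)) has_real_derivative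
      - sin (of_int k * x) * of_int k + cos (of_int k * x) * of_int k) (at x within S)"
    by (rule derivative_eq_intros refl | simp)+
  then show ?thesis unfolding cas_def[of k, abs_def] cas_def[of "-k"] by (simp add: algebra_simps)
qed

lemma continuous_on_cas [continuous_intros]:
  fixes f :: "'a::t2_space \<Rightarrow> real"
  shows "continuous_on S f \<Longrightarrow> continuous_on S (\<lambda>x. cas k (f x))"
  unfolding cas_def by (intro continuous_on_add continuous_on_cos continuous_on_sin continuous_on_mult continuous_on_const)

lemma cas_periodic: "cas k (x + 2 * pi) = cas k x"
proof -
  have "of_int k * (x + 2 * pi) = of_int k * x + 2 * pi * of_int k" by (simp add: algebra_simps)
  then show ?thesis unfolding cas_def by (simp add: cos_add sin_add)
qed

lemma average_cas: "average (cas k) = (if k = 0 then 1 else 0)"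
proof (cases "k = 0")
  case True
  then show ?thesis by (simp add: average_const cas_0[abs_def] cong: average_cong)
next
  case False
  have "((\<lambda>x. cas k x) has_integral (- cas (-k) (2*pi) / k - (- cas (-k) 0 / k))) {0..2*pi}"
    using False
    by (intro fundamental_theorem_of_calculus)
       (auto simp flip: has_real_derivative_iff_has_vector_derivative
         intro!: derivative_eq_intros DERIV_subset[OF cas_deriv])
  then have "integral {0..2*pi} (cas k) = 0"
    using cas_periodic[of "-k" 0] by (simp add: integral_unique)
  moreover have "continuous_on {0..2*pi} (cas k)"
    using continuous_on_cas[OF continuous_on_id] by simp
  ultimately show ?thesis using False by (subst average_eq_integral) auto
qed

text \<open>With a = k x and b = l x the product is cos (a - b) + sin (a + b); taking even and odd
  parts of \<open>cas\<close> turns cos and sin back into basis functions.\<close>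

lemma cas_mult:
  "cas k x * cas l x = (cas (k - l) x + cas (l - k) x + cas (k + l) x - cas (- k - l) x) / 2"
proof -
  define a b where "a = of_int k * x" and "b = of_int l * x"
  have *: "of_int (k - l) * x = a - b" "of_int (l - k) * x = b - a" "of_int (k + l) * x = a + b"
    "of_int (- k - l) * x = - (a + b)"
    by (auto simp: a_def b_def algebra_simps)
  have **: "of_int k * x = a" "of_int l * x = b" by (auto simp: a_def b_def)
  show ?thesis unfolding cas_def * ** cos_minus sin_minus
    unfolding cos_add cos_diff sin_add sin_diff
    by (simp add: algebra_simps)
qed

lemma integrable_cas: "integrable circle (cas k)"
  by (rule circle_integrable) (use continuous_on_cas[OF continuous_on_id] in simp)

lemma average_cas_mult: "(AVG x. cas k x * cas l x) = (if k = l then 1 else 0)"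
proof -
  have "(AVG x. cas k x * cas l x)
      = (average (cas (k - l)) + average (cas (l - k)) + average (cas (k + l)) - average (cas (- k - l))) / 2"
    unfolding cas_mult divide_inverse average_cmult_right
    by (simp add: average_add average_diff integrable_cas)
  moreover have "k - l = 0 \<longleftrightarrow> k = l" "l - k = 0 \<longleftrightarrow> k = l" "- k - l = 0 \<longleftrightarrow> k + l = 0" by auto
  ultimately show ?thesis by (simp only: average_cas) auto
qed

section \<open>Trigonometric polynomials and Hartley coefficients\<close>

abbreviation modes :: "nat \<Rightarrow> int set" where
  "modes N \<equiv> {- int N..int N}"

definition trig :: "nat \<Rightarrow> (int \<Rightarrow> real) \<Rightarrow> real \<Rightarrow> real" where
  "trig N c x = (\<Sum>k\<in>modes N. c k * cas k x)"

text \<open>Differentiation on the level of coefficients; the reflection of k is inherited from the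
  derivative of \<open>cas\<close>.\<close>

definition dcoef :: "(int \<Rightarrow> real) \<Rightarrow> int \<Rightarrow> real" where
  "dcoef c k = - of_int k * c (- k)"

definition coef :: "(real \<Rightarrow> real) \<Rightarrow> int \<Rightarrow> real" where
  "coef f k = (AVG x. f x * cas k x)"

definition supp :: "nat \<Rightarrow> (int \<Rightarrow> real) \<Rightarrow> bool" where
  "supp N c \<longleftrightarrow> (\<forall>k. k \<notin> modes N \<longrightarrow> c k = 0)"

lemma sum_modes_uminus: "(\<Sum>k\<in>modes N. f (- k)) = (\<Sum>k\<in>modes N. f k)"
  by (rule sum.reindex_bij_witness[where i = uminus and j = uminus]) auto

lemma trig_deriv: "(trig N c has_real_derivative trig N (dcoef c) x) (at x within S)"
proof -
  have "trig N (dcoef c) x = (\<Sum>k\<in>modes N. c k * (of_int k * cas (- k) x))"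
    unfolding trig_def dcoef_def by (subst sum_modes_uminus[symmetric]) (simp add: mult_ac)
  then show ?thesis unfolding trig_def[of N c, abs_def]
    by (auto intro!: derivative_eq_intros cas_deriv simp: mult_ac)
qed

lemma continuous_on_trig [continuous_intros]:
  fixes f :: "'a::t2_space \<Rightarrow> real"
  shows "continuous_on S f \<Longrightarrow> continuous_on S (\<lambda>x. trig N c (f x))"
  unfolding trig_def by (intro continuous_intros)

lemma trig_periodic: "trig N c (x + 2 * pi) = trig N c x"
  by (simp add: trig_def cas_periodic)

lemma trig_diff: "trig N c x - trig N d x = trig N (\<lambda>k. c k - d k) x"
  by (simp add: trig_def sum_subtractf left_diff_distrib)

lemma trig_add: "trig N c x + trig N d x = trig N (\<lambda>k. c k + d k) x"
  by (simp add: trig_def sum.distrib distrib_right)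

lemma trig_cmult: "a * trig N c x = trig N (\<lambda>k. a * c k) x"
  by (simp add: trig_def sum_distrib_left mult_ac)

lemma trig_supp_mono: "supp N c \<Longrightarrow> N \<le> M \<Longrightarrow> trig M c x = trig N c x"
  unfolding trig_def by (rule sum.mono_neutral_right) (auto simp: supp_def)

lemma supp_mono: "supp N c \<Longrightarrow> N \<le> M \<Longrightarrow> supp M c"
  by (auto simp: supp_def)

lemma abs_trig_le: "\<bar>trig N c x\<bar> \<le> 2 * (\<Sum>k\<in>modes N. \<bar>c k\<bar>)"
proof -
  have "\<bar>trig N c x\<bar> \<le> (\<Sum>k\<in>modes N. \<bar>c k\<bar> * \<bar>cas k x\<bar>)"
    unfolding trig_def by (rule order_trans[OF sum_abs]) (simp add: abs_mult)
  also have "... \<le> (\<Sum>k\<in>modes N. \<bar>c k\<bar> * 2)"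
    by (intro sum_mono mult_left_mono abs_cas_le) auto
  finally show ?thesis by (simp add: sum_distrib_left mult_ac)
qed

lemma integrable_mult_bounded:
  fixes f g :: "real \<Rightarrow> real"
  assumes "integrable circle f" "g \<in> borel_measurable circle" "\<And>x. x \<in> {0..2*pi} \<Longrightarrow> \<bar>g x\<bar> \<le> c"
  shows "integrable circle (\<lambda>x. f x * g x)"
proof (rule Bochner_Integration.integrable_bound)
  show "integrable circle (\<lambda>x. c * f x)" using assms(1) by simp
  have "0 \<le> c" using assms(3)[of 0] abs_ge_zero[of "g 0"] by simp
  then show "AE x in circle. norm (f x * g x) \<le> norm (c * f x)"
    by (intro AE_I2) (use assms(3) in \<open>auto simp: abs_mult mult.commute[of "\<bar>f _\<bar>"] intro!: mult_right_mono\<close>)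
  show "(\<lambda>x. f x * g x) \<in> borel_measurable circle"
    using assms(1,2) by (intro borel_measurable_times) auto
qed

lemma integrable_mult_continuous:
  fixes f g :: "real \<Rightarrow> real"
  assumes "integrable circle f" "continuous_on {0..2*pi} g"
  shows "integrable circle (\<lambda>x. f x * g x)"
proof -
  have "compact (g ` {0..2*pi})" by (rule compact_continuous_image[OF assms(2)]) auto
  then have "bounded (g ` {0..2*pi})" by (rule compact_imp_bounded)
  then obtain c where "\<And>x. x \<in> {0..2*pi} \<Longrightarrow> \<bar>g x\<bar> \<le> c"
    unfolding bounded_iff by force
  then show ?thesis using circle_integrable[OF assms(2)] by (intro integrable_mult_bounded assms(1)) auto
qed

lemma integrable_mult_cas: "integrable circle f \<Longrightarrow> integrable circle (\<lambda>x. f x * cas k x)"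
  by (intro integrable_mult_continuous continuous_on_cas continuous_on_id)

lemma average_mult_trig:
  assumes "integrable circle f"
  shows "(AVG x. f x * trig N c x) = (\<Sum>k\<in>modes N. coef f k * c k)"
proof -
  have "(AVG x. f x * trig N c x) = (AVG x. \<Sum>k\<in>modes N. c k * (f x * cas k x))"
    by (simp add: trig_def sum_distrib_left mult_ac)
  also have "... = (\<Sum>k\<in>modes N. c k * coef f k)"
    using integrable_mult_cas[OF assms] by (subst average_sum) (auto simp: average_cmult coef_def)
  finally show ?thesis by (simp add: mult_ac)
qed

lemma integrable_trig: "integrable circle (trig N c)"
  by (rule circle_integrable_UNIV) (use continuous_on_trig[OF continuous_on_id] in simp)

lemma coef_trig: "coef (trig N c) k = (if k \<in> modes N then c k else 0)"
proof -
  have "coef (trig N c) k = (AVG x. \<Sum>l\<in>modes N. c l * (cas l x * cas k x))"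
    by (simp only: trig_def coef_def sum_distrib_right mult.assoc)
  also have "... = (\<Sum>l\<in>modes N. c l * (if l = k then 1 else 0))"
    by (subst average_sum) (auto simp: average_cmult average_cas_mult intro!: integrable_mult_cas integrable_cas)
  finally show ?thesis by (simp add: sum.delta if_distrib cong: if_cong)
qed

lemma average_trig_mult: "(AVG x. trig N c x * trig N d x) = (\<Sum>k\<in>modes N. c k * d k)"
  by (simp add: average_mult_trig[OF integrable_trig] coef_trig)

lemma average_trig_sq: "(AVG x. (trig N c x)\<^sup>2) = (\<Sum>k\<in>modes N. (c k)\<^sup>2)"
  using average_trig_mult[of N c c] by (simp add: power2_eq_square)

lemma abs_coef_le:
  assumes "integrable circle f"
  shows "\<bar>coef f k\<bar> \<le> 2 * (AVG x. \<bar>f x\<bar>)"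
proof -
  have i: "integrable circle (\<lambda>x. f x * cas k x)" by (rule integrable_mult_cas[OF assms])
  have "\<bar>coef f k\<bar> \<le> (AVG x. \<bar>f x * cas k x\<bar>)"
    unfolding coef_def by (rule average_abs_le[OF i])
  also have "... \<le> (AVG x. 2 * \<bar>f x\<bar>)"
    using abs_cas_le[of k] by (intro average_mono integrable_abs i Bochner_Integration.integrable_mult_right assms)
      (auto simp: abs_mult mult.commute[of "\<bar>cas _ _\<bar>"] mult.commute[of 2] intro!: mult_left_mono)
  finally show ?thesis by (simp add: average_cmult)
qed

lemma coef_diff:
  "integrable circle f \<Longrightarrow> integrable circle g \<Longrightarrow> coef (\<lambda>x. f x - g x) k = coef f k - coef g k"
  unfolding coef_def by (simp add: left_diff_distrib average_diff integrable_mult_cas)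

text \<open>Completing the square mode by mode: the choice c = \<open>coef f\<close> is the best
  mean-square approximation of order N. Both \<open>bessel\<close> and \<open>parseval_trig\<close>
  rest on this identity.\<close>

lemma average_diff_trig_sq:
  assumes "integrable circle f" "integrable circle (\<lambda>x. (f x)\<^sup>2)"
  shows "(AVG x. (f x - trig N c x)\<^sup>2)
    = (AVG x. (f x)\<^sup>2) - (\<Sum>k\<in>modes N. (coef f k)\<^sup>2) + (\<Sum>k\<in>modes N. (coef f k - c k)\<^sup>2)"
proof -
  have i: "integrable circle (\<lambda>x. f x * trig N c x)"
    by (intro integrable_mult_continuous assms continuous_on_trig continuous_on_id)
  have i2: "integrable circle (\<lambda>x. (trig N c x)\<^sup>2)"
    by (intro circle_integrable continuous_intros)
  have "(AVG x. (f x - trig N c x)\<^sup>2) = (AVG x. (f x)\<^sup>2 - 2 * (f x * trig N c x) + (trig N c x)\<^sup>2)"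
    by (simp add: power2_diff algebra_simps)
  also have "... = (AVG x. (f x)\<^sup>2) - 2 * (\<Sum>k\<in>modes N. coef f k * c k) + (\<Sum>k\<in>modes N. (c k)\<^sup>2)"
    using i i2 assms by (simp add: average_add average_diff average_cmult average_mult_trig average_trig_sq)
  also have "... = (AVG x. (f x)\<^sup>2) - (\<Sum>k\<in>modes N. (coef f k)\<^sup>2) + (\<Sum>k\<in>modes N. (coef f k - c k)\<^sup>2)"
    by (simp add: power2_diff sum.distrib sum_subtractf sum_distrib_left algebra_simps)
  finally show ?thesis .
qed

lemma bessel:
  assumes "integrable circle f" "integrable circle (\<lambda>x. (f x)\<^sup>2)"
  shows "(\<Sum>k\<in>modes N. (coef f k)\<^sup>2) \<le> (AVG x. (f x)\<^sup>2)"
  using average_diff_trig_sq[OF assms, of N "coef f"]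
    average_nonneg[of "\<lambda>x. (f x - trig N (coef f) x)\<^sup>2"] by simp

section \<open>Signed powers\<close>

text \<open>The odd power. For \<rho> = 1 / \<alpha> it inverts \<psi>, see
  \<open>\<psi>_spow\<close>.\<close>

definition spow :: "real \<Rightarrow> real \<Rightarrow> real" where
  "spow \<rho> s = sgn s * \<bar>s\<bar> powr \<rho>"

lemma spow_alt: "spow \<rho> s = max s 0 powr \<rho> - max (- s) 0 powr \<rho>"
  by (cases s "0 :: real" rule: linorder_cases) (auto simp: spow_def)

lemma continuous_on_spow [continuous_intros]:
  fixes f :: "'a::topological_space \<Rightarrow> real"
  assumes "0 < \<rho>" "continuous_on S f"
  shows "continuous_on S (\<lambda>x. spow \<rho> (f x))"
  unfolding spow_alt
  by (intro continuous_on_diff continuous_on_powr' continuous_on_max continuous_on_minus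
      continuous_on_const assms(2)) (use assms(1) in auto)

lemma continuous_on_abs_powr [continuous_intros]:
  fixes f :: "'a::topological_space \<Rightarrow> real"
  assumes "0 < \<rho>" "continuous_on S f"
  shows "continuous_on S (\<lambda>x. \<bar>f x\<bar> powr \<rho>)"
  by (intro continuous_on_powr' continuous_on_rabs continuous_on_const assms(2)) (use assms(1) in auto)

lemma spow_mult_self: "spow \<rho> s * s = \<bar>s\<bar> powr (\<rho> + 1)"
proof -
  have "spow \<rho> s * s = \<bar>s\<bar> powr \<rho> * \<bar>s\<bar>" by (simp add: spow_def abs_sgn mult_ac)
  then show ?thesis by (cases "s = 0") (simp_all add: powr_add)
qed

lemma abs_spow: "\<bar>spow \<rho> s\<bar> = \<bar>s\<bar> powr \<rho>"
  by (cases "s = 0") (auto simp: spow_def abs_mult)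

text \<open>Superadditivity of the power, reduced by homogeneity to u powr \<rho> \<le> u on the
  unit interval, applied to t = y / x and to 1 - t.\<close>

lemma powr_diff_le:
  fixes x y \<rho> :: real
  assumes "0 \<le> y" "y \<le> x" "1 \<le> \<rho>"
  shows "(x - y) powr \<rho> \<le> x powr \<rho> - y powr \<rho>"
proof (cases "x = 0")
  case False
  with assms have x: "0 < x" by simp
  define t where "t = y / x"
  have t: "0 \<le> t" "t \<le> 1" and y: "y = t * x" using assms x by (auto simp: t_def)
  have le: "u powr \<rho> \<le> u" if "0 \<le> u" "u \<le> 1" for u :: real
    using powr_mono'[OF assms(3) that] that by simp
  have "(1 - t) powr \<rho> + t powr \<rho> \<le> 1"
    using le[of t] le[of "1 - t"] t by simp
  then have "((1 - t) powr \<rho> + t powr \<rho>) * x powr \<rho> \<le> 1 * x powr \<rho>"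
    by (intro mult_right_mono) auto
  moreover have "(x - y) powr \<rho> = (1 - t) powr \<rho> * x powr \<rho>" "y powr \<rho> = t powr \<rho> * x powr \<rho>"
    using x t by (auto simp: y powr_mult left_diff_distrib[symmetric] simp flip: left_diff_distrib[of 1 t x, simplified])
  ultimately show ?thesis by (simp add: distrib_right)
qed (use assms in auto)

text \<open>For arguments of equal sign superadditivity gives the bound even with constant 1. For
  opposite signs the larger absolute value is at least half the distance, which costs 2 powr (-
  \<rho>). This inequality is what turns closeness of heights into closeness of fluxes.\<close>

lemma spow_strong_mono:
  fixes x y \<rho> :: real
  assumes "1 \<le> \<rho>"
  shows "2 powr (- \<rho>) * \<bar>x - y\<bar> powr (\<rho> + 1) \<le> (spow \<rho> x - spow \<rho> y) * (x - y)"
proof -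
  have *: "2 powr (- \<rho>) * (x - y) powr \<rho> \<le> spow \<rho> x - spow \<rho> y" if "y < x" for x y
  proof -
    have half: "2 powr (- \<rho>) * z powr \<rho> = (z / 2) powr \<rho>" if "0 \<le> z" for z :: real
      using that by (simp add: powr_divide powr_minus divide_simps)
    have le1: "2 powr (- \<rho>) * z \<le> z" if "0 \<le> z" for z :: real
      using that powr_mono[of "-\<rho>" 0 2] assms by (intro mult_left_le_one_le) auto
    consider "0 \<le> y" | "x \<le> 0" | "y < 0" "0 < x" by linarith
    then show ?thesis
    proof cases
      case 1
      then have "spow \<rho> x - spow \<rho> y = x powr \<rho> - y powr \<rho>" using that by (simp add: spow_alt max_def)
      then show ?thesis using powr_diff_le[of y x \<rho>] 1 that assms
        by (intro order_trans[OF le1[of "(x - y) powr \<rho>"]]) auto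
    next
      case 2
      then have "spow \<rho> x - spow \<rho> y = (- y) powr \<rho> - (- x) powr \<rho>" using that by (simp add: spow_alt max_def)
      then show ?thesis using powr_diff_le[of "-x" "-y" \<rho>] 2 that assms
        by (intro order_trans[OF le1[of "(x - y) powr \<rho>"]]) auto
    next
      case 3
      then have e: "spow \<rho> x - spow \<rho> y = x powr \<rho> + (- y) powr \<rho>" using that by (simp add: spow_alt max_def)
      have "((x - y) / 2) powr \<rho> \<le> (max x (- y)) powr \<rho>"
        using 3 assms by (intro powr_mono2) auto
      also have "... \<le> x powr \<rho> + (- y) powr \<rho>" by (simp add: max_def)
      finally show ?thesis using half[of "x - y"] that by (simp add: e)
    qed
  qed
  have sym: "2 powr (- \<rho>) * \<bar>x - y\<bar> powr (\<rho> + 1) \<le> (spow \<rho> x - spow \<rho> y) * (x - y)" if "y < x" for x y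
  proof -
    have "2 powr (- \<rho>) * \<bar>x - y\<bar> powr (\<rho> + 1) = 2 powr (- \<rho>) * (x - y) powr \<rho> * (x - y)"
      using that by (simp add: powr_add)
    also have "... \<le> (spow \<rho> x - spow \<rho> y) * (x - y)"
      using *[OF that] that by (intro mult_right_mono) auto
    finally show ?thesis .
  qed
  show ?thesis
    using sym[of x y] sym[of y x]
    by (cases x y rule: linorder_cases) (simp_all add: abs_minus_commute algebra_simps)
qed

lemma spow_Young:
  fixes x y \<rho> :: real
  assumes "1 \<le> \<rho>"
  shows "spow \<rho> x * y \<le> \<bar>y\<bar> powr (\<rho> + 1) / (\<rho> + 1) + \<rho> / (\<rho> + 1) * \<bar>x\<bar> powr (\<rho> + 1)"
proof -
  have "spow \<rho> x * y \<le> \<bar>spow \<rho> x\<bar> * \<bar>y\<bar>" by (metis abs_ge_self abs_mult)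
  also have "... = \<bar>y\<bar> * \<bar>x\<bar> powr \<rho>" by (simp add: abs_spow)
  also have "... \<le> \<bar>y\<bar> powr (\<rho> + 1) / (\<rho> + 1) + (\<bar>x\<bar> powr \<rho>) powr ((\<rho> + 1) / \<rho>) / ((\<rho> + 1) / \<rho>)"
    using assms by (intro Youngs_inequality) (auto simp: field_simps)
  also have "(\<bar>x\<bar> powr \<rho>) powr ((\<rho> + 1) / \<rho>) = \<bar>x\<bar> powr (\<rho> + 1)"
    using assms by (simp add: powr_powr)
  finally show ?thesis by (simp add: mult.commute)
qed

text \<open>For x > l the factor (x / l) powr \<rho> is at least 1. The scale l stays free, and its
  later choice does the work of Hoelder's inequality.\<close>

lemma le_powr_split:
  fixes x l \<rho> :: real
  assumes "0 \<le> x" "0 < l" "0 \<le> \<rho>"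
  shows "x \<le> l + l powr (- \<rho>) * x powr (\<rho> + 1)"
proof (cases "x \<le> l")
  case False
  then have "1 \<le> (x / l) powr \<rho>" using assms ge_one_powr_ge_zero[of "x / l" \<rho>] by simp
  then have "x * 1 \<le> x * (x / l) powr \<rho>" using assms by (intro mult_left_mono) auto
  also have "... = l powr (- \<rho>) * x powr (\<rho> + 1)"
    using assms False by (simp add: powr_divide powr_minus powr_add divide_simps)
  finally show ?thesis using assms by simp
qed (use assms in \<open>auto intro: add_increasing2\<close>)

lemma powr_le_split:
  fixes x l \<rho> :: real
  assumes "0 \<le> x" "0 < l" "0 \<le> \<rho>"
  shows "x powr \<rho> \<le> l powr \<rho> + x powr (\<rho> + 1) / l"
proof (cases "x \<le> l")
  case True
  then have "x powr \<rho> \<le> l powr \<rho>" using assms by (intro powr_mono2) auto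
  then show ?thesis using assms by (simp add: add_increasing2)
next
  case False
  then have "x powr \<rho> * 1 \<le> x powr \<rho> * (x / l)" using assms by (intro mult_left_mono) auto
  then have "x powr \<rho> \<le> x powr (\<rho> + 1) / l" using assms by (simp add: powr_add)
  then show ?thesis by (smt (verit) powr_ge_zero)
qed

lemma powr_ge_sq:
  fixes x l \<rho> :: real
  assumes "0 \<le> x" "1 \<le> \<rho>"
  shows "x\<^sup>2 \<le> 1 + x powr (\<rho> + 1)"
proof (cases "x \<le> 1")
  case True
  then show ?thesis using assms power_le_one[of x 2] by (smt (verit) powr_ge_zero)
next
  case False
  then have "x powr 2 \<le> x powr (\<rho> + 1)" using assms by (intro powr_mono) auto
  then show ?thesis using False by simp
qed

lemma \<psi>_spow:
  assumes "0 < \<alpha>" "0 < b"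
  shows "\<psi> \<alpha> (b * spow (1 / \<alpha>) s) = b powr \<alpha> * s"
proof (cases "s = 0")
  case True
  then show ?thesis by (simp add: \<psi>_def spow_def)
next
  case False
  have "\<psi> \<alpha> (b * spow (1 / \<alpha>) s) = \<bar>b * spow (1 / \<alpha>) s\<bar> powr \<alpha> * sgn (b * spow (1 / \<alpha>) s)"
    (is "?l = ?r")
  proof -
    let ?z = "b * spow (1 / \<alpha>) s"
    have z: "?z \<noteq> 0" using assms False by (simp add: spow_def sgn_eq_0_iff)
    then have "\<bar>?z\<bar> powr (\<alpha> - 1) * \<bar>?z\<bar> = \<bar>?z\<bar> powr \<alpha>"
      by (simp add: powr_diff)
    moreover have "?z = \<bar>?z\<bar> * sgn ?z" by (simp add: abs_mult_sgn)
    ultimately show ?thesis unfolding \<psi>_def by (metis mult.assoc)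
  qed
  also have "\<bar>b * spow (1 / \<alpha>) s\<bar> powr \<alpha> = b powr \<alpha> * \<bar>s\<bar>"
    using assms by (simp add: abs_mult abs_spow powr_mult powr_powr)
  also have "sgn (b * spow (1 / \<alpha>) s) = sgn s"
    using assms False by (cases s "0::real" rule: linorder_cases) (simp_all add: spow_def sgn_mult)
  finally show ?thesis by (simp add: mult.assoc abs_mult_sgn)
qed

section \<open>Fejer means\<close>

definition fejer_weight :: "nat \<Rightarrow> int \<Rightarrow> real" where
  "fejer_weight N k = 1 - of_int \<bar>k\<bar> / (real N + 1)"

definition fejer :: "nat \<Rightarrow> (real \<Rightarrow> real) \<Rightarrow> real \<Rightarrow> real" where
  "fejer N f = trig N (\<lambda>k. fejer_weight N k * coef f k)"

definition fejer_kernel :: "nat \<Rightarrow> real \<Rightarrow> real" where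
  "fejer_kernel N z = (\<Sum>k\<in>modes N. fejer_weight N k * cos (of_int k * z))"

text \<open>In a square of N + 1 by N + 1 index pairs the difference k is attained on a diagonal of
  length N + 1 - |k|, the origin of the triangular Fejer weights.\<close>

lemma sum_differences:
  fixes g :: "int \<Rightarrow> real"
  shows "(\<Sum>i\<le>N. \<Sum>j\<le>N. g (int i - int j)) = (\<Sum>k\<in>modes N. (real N + 1 - of_int \<bar>k\<bar>) * g k)"
proof (induction N)
  case 0
  then show ?case by simp
next
  case (Suc N)
  have 1: "(\<Sum>i\<le>N. g (int i - int (Suc N))) = (\<Sum>k\<in>{- int N - 1..-1}. g k)"
    by (rule sum.reindex_bij_witness[where i = "\<lambda>k. nat (k + int N + 1)" and j = "\<lambda>i. int i - int (Suc N)"]) auto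
  have 2: "(\<Sum>j\<le>Suc N. g (int (Suc N) - int j)) = (\<Sum>k\<in>{0..int N + 1}. g k)"
    by (rule sum.reindex_bij_witness[where i = "\<lambda>k. nat (int N + 1 - k)" and j = "\<lambda>i. int (Suc N) - int i"]) auto
  have 3: "(\<Sum>k\<in>{- int N - 1..-1}. g k) + (\<Sum>k\<in>{0..int N + 1}. g k) = (\<Sum>k\<in>modes (Suc N). g k)"
    by (subst sum.union_disjoint[symmetric]) (auto intro!: sum.cong)
  have "(\<Sum>i\<le>Suc N. \<Sum>j\<le>Suc N. g (int i - int j))
      = (\<Sum>i\<le>N. \<Sum>j\<le>N. g (int i - int j)) + (\<Sum>k\<in>modes (Suc N). g k)"
    using 1 2 3 by (simp add: sum.distrib)
  also have "... = (\<Sum>k\<in>modes (Suc N). (real N + 1 - of_int \<bar>k\<bar>) * g k) + (\<Sum>k\<in>modes (Suc N). g k)"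
    unfolding Suc by (intro arg_cong2[where f = "(+)"] refl sum.mono_neutral_left) auto
  also have "... = (\<Sum>k\<in>modes (Suc N). (real (Suc N) + 1 - of_int \<bar>k\<bar>) * g k)"
    by (simp add: sum.distrib[symmetric] algebra_simps)
  finally show ?case .
qed

text \<open>The kernel is a square: \<open>(N + 1) K = \<bar>\<Sum>\<^sub>j exp (i j z)\<bar>\<^sup>2\<close>.\<close>

lemma fejer_kernel_nonneg: "0 \<le> fejer_kernel N z"
proof -
  have "(\<Sum>i\<le>N. \<Sum>j\<le>N. cos (of_int (int i - int j) * z))
      = (\<Sum>i\<le>N. \<Sum>j\<le>N. cos (real i * z) * cos (real j * z) + sin (real i * z) * sin (real j * z))"
    by (simp add: left_diff_distrib cos_diff)
  also have "... = (\<Sum>i\<le>N. cos (real i * z))\<^sup>2 + (\<Sum>i\<le>N. sin (real i * z))\<^sup>2"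
    by (simp add: power2_eq_square sum_product sum.distrib)
  also have "0 \<le> ..." by simp
  finally have "0 \<le> (\<Sum>k\<in>modes N. (real N + 1 - of_int \<bar>k\<bar>) * cos (of_int k * z))"
    unfolding sum_differences[of "\<lambda>k. cos (of_int k * z)" N] .
  also have "... = (real N + 1) * fejer_kernel N z"
    unfolding fejer_kernel_def sum_distrib_left
    by (intro sum.cong refl) (simp add: fejer_weight_def field_simps)
  finally show ?thesis by (simp add: zero_le_mult_iff)
qed

lemma continuous_on_fejer_kernel [continuous_intros]:
  fixes f :: "'a::t2_space \<Rightarrow> real"
  shows "continuous_on S f \<Longrightarrow> continuous_on S (\<lambda>x. fejer_kernel N (f x))"
  unfolding fejer_kernel_def by (intro continuous_intros)

lemma sum_modes_odd:
  assumes "\<And>k. f (- k) = - (f k :: real)"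
  shows "(\<Sum>k\<in>modes N. f k) = 0"
proof -
  have "(\<Sum>k\<in>modes N. f k) = - (\<Sum>k\<in>modes N. f k)"
    by (subst sum_modes_uminus[symmetric]) (simp add: assms sum_negf)
  then show ?thesis by simp
qed

text \<open>The product cas k x * cas k y equals cos (k (x - y)) + sin (k (x + y)). The sine part is
  odd in k and cancels against the even weights, which leaves a convolution.\<close>

lemma fejer_eq:
  assumes "integrable circle f"
  shows "fejer N f x = (AVG y. f y * fejer_kernel N (x - y))"
proof -
  have k: "(\<Sum>k\<in>modes N. fejer_weight N k * (cas k x * cas k y)) = fejer_kernel N (x - y)" for y
  proof -
    have "cas k x * cas k y = cos (of_int k * (x - y)) + sin (of_int k * (x + y))" for k
      unfolding cas_def right_diff_distrib distrib_left cos_diff sin_add by (simp add: algebra_simps)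
    moreover have "(\<Sum>k\<in>modes N. fejer_weight N k * sin (of_int k * (x + y))) = 0"
      by (rule sum_modes_odd) (simp add: fejer_weight_def)
    ultimately show ?thesis by (simp add: fejer_kernel_def distrib_left sum.distrib)
  qed
  have "fejer N f x = (\<Sum>k\<in>modes N. (AVG y. fejer_weight N k * cas k x * (f y * cas k y)))"
    unfolding fejer_def trig_def coef_def average_cmult by (simp add: mult_ac)
  also have "... = (AVG y. \<Sum>k\<in>modes N. fejer_weight N k * cas k x * (f y * cas k y))"
    by (rule average_sum[symmetric]) (intro Bochner_Integration.integrable_mult_right impI integrable_mult_cas assms)
  also have "(\<lambda>y. \<Sum>k\<in>modes N. fejer_weight N k * cas k x * (f y * cas k y)) = (\<lambda>y. f y * fejer_kernel N (x - y))"
    unfolding k[symmetric] sum_distrib_left by (simp add: mult_ac)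
  finally show ?thesis .
qed

lemma fejer_trig: "fejer N (trig M c) x = trig N (\<lambda>k. fejer_weight N k * (if k \<in> modes M then c k else 0)) x"
  by (simp add: fejer_def coef_trig)

lemma integrable_mult_fejer_kernel:
  "integrable circle f \<Longrightarrow> integrable circle (\<lambda>y. f y * fejer_kernel N (x - y))"
  by (intro integrable_mult_continuous continuous_on_fejer_kernel continuous_intros)

lemma average_fejer_kernel: "(AVG y. fejer_kernel N (x - y)) = 1"
proof -
  have t: "trig 0 (\<lambda>_. 1) = (\<lambda>_. 1)" by (simp add: trig_def fun_eq_iff)
  have "(AVG y. 1 * fejer_kernel N (x - y)) = fejer N (trig 0 (\<lambda>_. 1)) x"
    unfolding t by (rule fejer_eq[symmetric]) simp
  also have "fejer N (trig 0 (\<lambda>_. 1)) x = (\<Sum>k\<in>modes N. if k = 0 then 1 else 0)"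
    unfolding fejer_trig trig_def by (intro sum.cong) (auto simp: fejer_weight_def)
  finally show ?thesis by simp
qed

text \<open>The left side is a Fejer mean of a function with modes 1 and -1 only, and these are
  multiplied by 1 - 1 / (N + 1). Hence the kernel averages 1 - cos to 1 / (N + 1), the rate used in
  \<open>fejer_uniform_limit\<close>.\<close>

lemma average_fejer_kernel_cos:
  assumes "1 \<le> N"
  shows "(AVG y. cos (x - y) * fejer_kernel N (x - y)) = 1 - 1 / (real N + 1)"
proof -
  define d :: "int \<Rightarrow> real" where
    "d k = (if k = 1 then (cos x + sin x) / 2 else if k = -1 then (cos x - sin x) / 2 else 0)" for k
  have m1: "modes 1 = {-1, 0, 1}" by auto
  have cs: "cos (x - y) = trig 1 d y" for y
    unfolding trig_def m1 by (simp add: d_def cas_def cos_diff field_simps)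
  have "(AVG y. cos (x - y) * fejer_kernel N (x - y)) = fejer N (trig 1 d) x"
    unfolding cs by (rule fejer_eq[symmetric]) (rule integrable_trig)
  also have "... = (\<Sum>k\<in>modes N. if k \<in> modes 1 then fejer_weight N k * d k * cas k x else 0)"
    unfolding fejer_trig trig_def by (intro sum.cong) auto
  also have "... = (\<Sum>k\<in>modes 1. fejer_weight N k * d k * cas k x)"
    using assms by (subst sum.inter_restrict[symmetric]) (auto intro!: sum.cong)
  also have "... = (\<Sum>k\<in>modes 1. (1 - 1 / (real N + 1)) * (d k * cas k x))"
    unfolding m1 by (intro sum.cong) (auto simp: d_def fejer_weight_def)
  also have "... = (1 - 1 / (real N + 1)) * cos (x - x)"
    unfolding cs trig_def sum_distrib_left ..
  finally show ?thesis by simp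
qed

lemma fejer_bound:
  assumes "integrable circle f" "\<And>y. y \<in> {0..2*pi} \<Longrightarrow> \<bar>f y\<bar> \<le> c"
  shows "\<bar>fejer N f x\<bar> \<le> c"
proof -
  have i: "integrable circle (\<lambda>y. f y * fejer_kernel N (x - y))" by (rule integrable_mult_fejer_kernel[OF assms(1)])
  have "\<bar>fejer N f x\<bar> \<le> (AVG y. \<bar>f y * fejer_kernel N (x - y)\<bar>)"
    unfolding fejer_eq[OF assms(1)] by (rule average_abs_le[OF i])
  also have "... \<le> (AVG y. c * fejer_kernel N (x - y))"
  proof (rule average_mono)
    show "integrable circle (\<lambda>y. \<bar>f y * fejer_kernel N (x - y)\<bar>)" using i by (rule integrable_abs)
    show "integrable circle (\<lambda>y. c * fejer_kernel N (x - y))" by (intro circle_integrable continuous_intros)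
  qed (use assms(2) fejer_kernel_nonneg in \<open>auto simp: abs_mult intro!: mult_right_mono\<close>)
  finally show ?thesis by (simp add: average_cmult average_fejer_kernel)
qed

lemma one_minus_cos_pos:
  assumes "x \<in> {0..2*pi}" "y \<in> {0..2*pi}" "x \<noteq> y" "{x, y} \<noteq> {0, 2*pi}"
  shows "0 < 1 - cos (x - y)"
proof (rule ccontr)
  assume "\<not> 0 < 1 - cos (x - y)"
  then have "cos (x - y) = 1" using cos_le_one[of "x - y"] by linarith
  then obtain n :: int where n: "x - y = of_int n * (2 * pi)" using cos_one_2pi_int[of "x - y"] by auto
  have "x - y \<le> 2 * pi" "- (2 * pi) \<le> x - y" using assms by auto
  then have "of_int n * (2*pi) \<le> 1 * (2 * pi)" "(-1) * (2*pi) \<le> of_int n * (2*pi)" unfolding n[symmetric] by auto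
  then have a: "of_int n * (2*pi) \<le> 1 * (2 * pi)" and b: "(-1) * (2*pi) \<le> of_int n * (2*pi)" .
  have "of_int n \<le> (1 :: real)" by (rule mult_right_le_imp_le[OF a]) simp
  moreover have "-1 \<le> (of_int n :: real)" by (rule mult_right_le_imp_le[OF b]) simp
  ultimately have "n \<le> 1" "-1 \<le> n" by linarith+
  then consider "n = 0" | "n = 1" | "n = -1" by linarith
  then show False using n assms by cases auto
qed

text \<open>Uniform continuity in the form of Korovkin's theorem: 1 - cos (x - y) vanishes only
  where x and y are the same point of the circle, so it has a positive minimum on the compact set of
  pairs where f varies by at least e. A large multiple of it dominates the variation there.\<close>

lemma modulus_one_minus_cos:
  assumes f: "continuous_on {0..2*pi} f" "f 0 = (f (2*pi) :: real)" and e: "0 < e"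
  obtains C where "0 \<le> C" "\<And>x y. x \<in> {0..2*pi} \<Longrightarrow> y \<in> {0..2*pi} \<Longrightarrow> \<bar>f y - f x\<bar> \<le> e + C * (1 - cos (x - y))"
proof -
  let ?I = "{0..2*pi} :: real set"
  have "bounded (f ` ?I)" by (intro compact_imp_bounded compact_continuous_image f) auto
  then obtain B where B: "\<And>x. x \<in> ?I \<Longrightarrow> \<bar>f x\<bar> \<le> B" unfolding bounded_iff by force
  then have B0: "0 \<le> B" using B[of 0] by fastforce
  let ?K = "{z \<in> ?I \<times> ?I. e \<le> \<bar>f (snd z) - f (fst z)\<bar>}"
  have cf: "continuous_on (?I \<times> ?I) (\<lambda>z. \<bar>f (snd z) - f (fst z)\<bar>)"
    by (intro continuous_intros continuous_on_compose2[OF f(1)]) auto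
  have "closed ?K"
  proof -
    have "closed ((?I \<times> ?I) \<inter> (\<lambda>z. \<bar>f (snd z) - f (fst z)\<bar>) -` {e..})"
      by (rule continuous_closed_preimage[OF cf]) (auto intro: closed_Times)
    moreover have "(?I \<times> ?I) \<inter> (\<lambda>z. \<bar>f (snd z) - f (fst z)\<bar>) -` {e..} = ?K" by blast
    ultimately show ?thesis by metis
  qed
  moreover have "bounded ?K"
    by (rule bounded_subset[of "?I \<times> ?I"]) (auto intro: bounded_Times)
  ultimately have K: "compact ?K" by (simp add: compact_eq_bounded_closed)
  show thesis
  proof (cases "?K = {}")
    case True
    have "\<bar>f y - f x\<bar> \<le> e + 0 * (1 - cos (x - y))" if "x \<in> ?I" "y \<in> ?I" for x y
    proof -
      have "(x, y) \<notin> ?K" using True by blast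
      then show ?thesis using that by simp
    qed
    then show thesis by (intro that[of 0]) auto
  next
    case False
    have "continuous_on ?K (\<lambda>z. 1 - cos (fst z - snd z))" by (intro continuous_intros)
    then obtain z where z: "z \<in> ?K" "\<And>w. w \<in> ?K \<Longrightarrow> 1 - cos (fst z - snd z) \<le> 1 - cos (fst w - snd w)"
      using continuous_attains_inf[OF K False] by blast
    define m where "m = 1 - cos (fst z - snd z)"
    have "0 < m" unfolding m_def
    proof (rule one_minus_cos_pos)
      show "fst z \<noteq> snd z" using z(1) e by auto
      show "{fst z, snd z} \<noteq> {0, 2 * pi}"
        using z(1) e f(2) by (auto simp: doubleton_eq_iff)
    qed (use z(1) in auto)
    have "\<bar>f y - f x\<bar> \<le> e + (2 * B / m) * (1 - cos (x - y))" if xy: "x \<in> ?I" "y \<in> ?I" for x y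
    proof (cases "(x, y) \<in> ?K")
      case True
      then have "m \<le> 1 - cos (x - y)" using z(2)[OF True] by (simp add: m_def)
      then have "(2 * B / m) * m \<le> (2 * B / m) * (1 - cos (x - y))"
        using B0 \<open>0 < m\<close> by (intro mult_left_mono) auto
      moreover have "\<bar>f y - f x\<bar> \<le> 2 * B" using B[OF xy(1)] B[OF xy(2)] by linarith
      ultimately show ?thesis using \<open>0 < m\<close> e by simp
    next
      case False
      then have "\<bar>f y - f x\<bar> \<le> e" using xy by simp
      moreover have "0 \<le> (2 * B / m) * (1 - cos (x - y))"
        using B0 \<open>0 < m\<close> cos_le_one[of "x - y"] by (intro mult_nonneg_nonneg) auto
      ultimately show ?thesis by linarith
    qed
    then show thesis using B0 \<open>0 < m\<close> by (intro that[of "2 * B / m"]) auto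
  qed
qed

text \<open>The kernel is nonnegative with mean 1, so integrating the bound of
  \<open>modulus_one_minus_cos\<close> against it leaves the error e / 2 + C / (N + 1).\<close>

theorem fejer_uniform_limit:
  assumes f: "continuous_on {0..2*pi} f" "f 0 = f (2*pi)"
  shows "uniform_limit {0..2*pi} (\<lambda>N. fejer N f) f sequentially"
proof (rule uniform_limitI)
  fix e :: real assume e: "0 < e"
  obtain C where C: "0 \<le> C"
    "\<And>x y. x \<in> {0..2*pi} \<Longrightarrow> y \<in> {0..2*pi} \<Longrightarrow> \<bar>f y - f x\<bar> \<le> e / 2 + C * (1 - cos (x - y))"
    using modulus_one_minus_cos[OF f, of "e/2"] e by auto
  have ff: "integrable circle f" by (rule circle_integrable[OF f(1)])
  have bound: "\<bar>fejer N f x - f x\<bar> \<le> e / 2 + C * (1 / (real N + 1))"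
    if N: "1 \<le> N" and x: "x \<in> {0..2*pi}" for N x
  proof -
    let ?k = "\<lambda>y. fejer_kernel N (x - y)"
    have ik: "integrable circle ?k" by (intro circle_integrable continuous_intros)
    have i: "integrable circle (\<lambda>y. (f y - f x) * ?k y)"
      using ff by (intro integrable_mult_fejer_kernel) simp
    have ic: "integrable circle (\<lambda>y. cos (x - y) * ?k y)" by (intro circle_integrable continuous_intros)
    have "fejer N f x - f x = (AVG y. (f y - f x) * ?k y)"
      unfolding left_diff_distrib
      by (subst average_diff)
         (use ff ik in \<open>auto simp: fejer_eq[OF ff] average_cmult average_fejer_kernel intro: integrable_mult_fejer_kernel\<close>)
    also have "\<bar>...\<bar> \<le> (AVG y. \<bar>(f y - f x) * ?k y\<bar>)" by (rule average_abs_le[OF i])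
    also have "... \<le> (AVG y. (e / 2 + C) * ?k y - C * (cos (x - y) * ?k y))"
    proof (rule average_mono)
      fix y assume "y \<in> {0..2*pi}"
      then have "\<bar>f y - f x\<bar> * ?k y \<le> (e / 2 + C * (1 - cos (x - y))) * ?k y"
        using C(2)[OF x] fejer_kernel_nonneg by (intro mult_right_mono) auto
      then show "\<bar>(f y - f x) * ?k y\<bar> \<le> (e / 2 + C) * ?k y - C * (cos (x - y) * ?k y)"
        unfolding abs_mult abs_of_nonneg[OF fejer_kernel_nonneg] by (simp add: algebra_simps)
    qed (use i ic ik in \<open>auto intro!: integrable_abs Bochner_Integration.integrable_diff Bochner_Integration.integrable_mult_right\<close>)
    also have "... = (e / 2 + C) - C * (1 - 1 / (real N + 1))"
      using ic ik by (subst average_diff)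
        (auto simp: average_cmult average_fejer_kernel average_fejer_kernel_cos[OF N]
          intro!: Bochner_Integration.integrable_mult_right)
    finally show ?thesis by (simp add: algebra_simps)
  qed
  have "(\<lambda>N. C * (1 / (real N + 1))) \<longlonglongrightarrow> C * 0"
    by (intro tendsto_mult tendsto_const) (use LIMSEQ_inverse_real_of_nat in \<open>simp add: inverse_eq_divide add.commute\<close>)
  then have "\<forall>\<^sub>F N in sequentially. C * (1 / (real N + 1)) < e / 2" using e by (intro order_tendstoD) auto
  then show "\<forall>\<^sub>F N in sequentially. \<forall>x\<in>{0..2*pi}. dist (fejer N f x) (f x) < e"
    using eventually_ge_at_top[of 1]
  proof eventually_elim
    case (elim N)
    show ?case
    proof
      fix x assume x: "x \<in> {0..2*pi}"
      show "dist (fejer N f x) (f x) < e"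
        using bound[OF elim(2) x] elim(1) unfolding dist_real_def by linarith
    qed
  qed
qed

section \<open>Approximation of measurable functions\<close>

text \<open>Continuous functions that approximate f almost everywhere are clamped to [-K, K], made
  to vanish at both ends of the period, and replaced by Fejer means.\<close>

lemma bounded_ae_trig_approx:
  assumes f: "f \<in> borel_measurable circle" and K: "\<And>x. x \<in> {0..2*pi} \<Longrightarrow> \<bar>f x\<bar> \<le> K"
  obtains N :: "nat \<Rightarrow> nat" and c :: "nat \<Rightarrow> int \<Rightarrow> real"
  where "\<And>n x. x \<in> {0..2*pi} \<Longrightarrow> \<bar>trig (N n) (c n) x\<bar> \<le> K + 1"
    "AE x in circle. (\<lambda>n. trig (N n) (c n) x) \<longlonglongrightarrow> f x"
proof -
  let ?I = "{0..2*pi} :: real set"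
  have K0: "0 \<le> K" using K[of 0] abs_ge_zero[of "f 0"] by simp
  have "f measurable_on ?I" using f by (subst measurable_on_iff_borel_measurable) auto
  then obtain Z g where Z: "negligible Z" and g: "\<And>n. continuous_on UNIV (g n)"
    and lim: "\<And>x. x \<notin> Z \<Longrightarrow> (\<lambda>n. g n x) \<longlonglongrightarrow> (if x \<in> ?I then f x else 0)"
    unfolding measurable_on_def by blast
  \<comment> \<open>A cutoff that tends to 1 inside the period and vanishes at 0 and 2 pi, so that u
    is continuous on the circle.\<close>
  define \<kappa> where "\<kappa> n x = min 1 (real n * (x * (2*pi - x)))" for n :: nat and x :: real
  define u where "u n x = max (- K) (min K (g n x)) * \<kappa> n x" for n x
  have cu: "continuous_on ?I (u n)" for n
    unfolding u_def \<kappa>_def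
    by (intro continuous_intros continuous_on_subset[OF g]) auto
  have u0: "u n 0 = u n (2*pi)" for n by (simp add: u_def \<kappa>_def)
  have chi: "0 \<le> \<kappa> n x" "\<kappa> n x \<le> 1" if "x \<in> ?I" for n x
    using that by (auto simp: \<kappa>_def intro!: mult_nonneg_nonneg)
  have uK: "\<bar>u n x\<bar> \<le> K" if "x \<in> ?I" for n x
  proof -
    have "\<bar>max (- K) (min K (g n x))\<bar> \<le> K" using K0 by (auto simp: max_def min_def)
    then have "\<bar>u n x\<bar> \<le> K * 1"
      unfolding u_def abs_mult using chi[OF that] K0 by (intro mult_mono) auto
    then show ?thesis by simp
  qed
  have "\<exists>N. \<forall>x\<in>?I. \<bar>fejer N (u n) x - u n x\<bar> < 1 / (real n + 1)" for n
  proof -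
    have "\<forall>\<^sub>F N in sequentially. \<forall>x\<in>?I. dist (fejer N (u n) x) (u n x) < 1 / (real n + 1)"
      by (rule uniform_limitD[OF fejer_uniform_limit[OF cu u0]]) auto
    then obtain N where "\<forall>x\<in>?I. dist (fejer N (u n) x) (u n x) < 1 / (real n + 1)"
      using eventually_happens'[OF sequentially_bot] by blast
    then show ?thesis by (auto simp: dist_real_def)
  qed
  then obtain N where N: "\<And>n x. x \<in> ?I \<Longrightarrow> \<bar>fejer (N n) (u n) x - u n x\<bar> < 1 / (real n + 1)"
    by metis
  have "negligible (Z \<union> {0, 2*pi})" using Z by simp
  then have "AE x in lebesgue. x \<notin> Z \<union> {0, 2*pi}"
    unfolding negligible_iff_null_sets by (rule AE_not_in)
  then have "AE x in circle. x \<notin> Z \<union> {0, 2*pi}"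
    by (subst AE_restrict_space_iff) (simp, erule eventually_mono, simp)
  then have ae: "AE x in circle. (\<lambda>n. fejer (N n) (u n) x) \<longlonglongrightarrow> f x"
  proof (rule AE_mp, intro AE_I2 impI)
    fix x assume "x \<in> space circle" and x: "x \<notin> Z \<union> {0, 2*pi}"
    then have xI: "x \<in> ?I" by simp
    have p: "0 < x * (2*pi - x)" using x xI by (intro mult_pos_pos) auto
    have "(\<lambda>n. max (- K) (min K (g n x))) \<longlonglongrightarrow> max (- K) (min K (f x))"
      using lim[of x] x xI by (intro tendsto_intros) auto
    moreover have "max (- K) (min K (f x)) = f x" using K[OF xI] by auto
    moreover have "(\<lambda>n. \<kappa> n x) \<longlonglongrightarrow> 1"
    proof (rule tendsto_eventually)
      obtain n0 :: nat where n0: "1 / (x * (2*pi - x)) < real n0" using reals_Archimedean2 by blast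
      have "\<kappa> n x = 1" if "n0 \<le> n" for n
      proof -
        have "1 < real n0 * (x * (2*pi - x))" using n0 p by (simp add: pos_divide_less_eq)
        also have "... \<le> real n * (x * (2*pi - x))" using that p by (intro mult_right_mono) auto
        finally show ?thesis by (simp add: \<kappa>_def)
      qed
      then show "\<forall>\<^sub>F n in sequentially. \<kappa> n x = 1" by (auto simp: eventually_sequentially)
    qed
    ultimately have 1: "(\<lambda>n. u n x) \<longlonglongrightarrow> f x"
      unfolding u_def
      using tendsto_mult[of "\<lambda>n. max (- K) (min K (g n x))" "f x" sequentially "\<lambda>n. \<kappa> n x" 1] by simp
    have "(\<lambda>n. 1 / (real n + 1)) \<longlonglongrightarrow> 0"
      using LIMSEQ_inverse_real_of_nat by (simp add: inverse_eq_divide add.commute)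
    then have 2: "(\<lambda>n. fejer (N n) (u n) x - u n x) \<longlonglongrightarrow> 0"
      by (rule Lim_null_comparison[rotated]) (use N[OF xI] in \<open>auto intro!: eventuallyI less_imp_le\<close>)
    show "(\<lambda>n. fejer (N n) (u n) x) \<longlonglongrightarrow> f x" using tendsto_add[OF 2 1] by simp
  qed
  have "\<bar>fejer (N n) (u n) x\<bar> \<le> K + 1" for n x
    by (rule order_trans[OF fejer_bound[OF circle_integrable[OF cu] uK]]) auto
  then show thesis
    using that[of N "\<lambda>n k. fejer_weight (N n) k * coef (u n) k"] ae by (simp add: fejer_def)
qed

text \<open>Tests f against bounded trigonometric polynomials tending to sgn f almost everywhere; in
  the limit the integral of |f| is 0.\<close>

lemma coef_zero_imp_AE_zero:
  assumes f: "integrable circle f" and z: "\<And>k. coef f k = 0"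
  shows "AE x in circle. f x = 0"
proof -
  have m: "(\<lambda>x. sgn (f x)) \<in> borel_measurable circle" using f by auto
  have sgn1: "\<bar>sgn (f x)\<bar> \<le> 1" for x by (simp add: sgn_if)
  obtain N :: "nat \<Rightarrow> nat" and c where N: "\<And>n x. x \<in> {0..2*pi} \<Longrightarrow> \<bar>trig (N n) (c n) x\<bar> \<le> 1 + 1"
    and ae: "AE x in circle. (\<lambda>n. trig (N n) (c n) x) \<longlonglongrightarrow> sgn (f x)"
    using bounded_ae_trig_approx[OF m, of 1] sgn1 by blast
  have "(\<lambda>n. \<integral>x. f x * trig (N n) (c n) x \<partial>circle) \<longlonglongrightarrow> (\<integral>x. f x * sgn (f x) \<partial>circle)"
  proof (rule integral_dominated_convergence)
    show "integrable circle (\<lambda>x. 2 * \<bar>f x\<bar>)" using f by simp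
    show "AE x in circle. (\<lambda>n. f x * trig (N n) (c n) x) \<longlonglongrightarrow> f x * sgn (f x)"
      using ae by eventually_elim (intro tendsto_intros)
    show "(\<lambda>x. f x * sgn (f x)) \<in> borel_measurable circle" using f by auto
    show "(\<lambda>x. f x * trig (N n) (c n) x) \<in> borel_measurable circle" for n
      using f borel_measurable_integrable[OF integrable_trig] by auto
    show "AE x in circle. norm (f x * trig (N n) (c n) x) \<le> 2 * \<bar>f x\<bar>" for n
    proof (intro AE_I2)
      fix x assume "x \<in> space circle"
      then show "norm (f x * trig (N n) (c n) x) \<le> 2 * \<bar>f x\<bar>"
        using mult_left_mono[OF N[of x n], of "\<bar>f x\<bar>"] by (simp add: abs_mult)
    qed
  qed
  moreover have "(\<integral>x. f x * trig M d x \<partial>circle) = 0" for M d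
    using average_mult_trig[OF f, of M d] z by (simp add: average_def)
  ultimately have "(\<integral>x. f x * sgn (f x) \<partial>circle) = 0" by (simp add: LIMSEQ_const_iff)
  then have "(\<integral>x. \<bar>f x\<bar> \<partial>circle) = 0" by (simp add: abs_sgn)
  then show ?thesis
    by (subst (asm) integral_nonneg_eq_0_iff_AE) (use f in auto)
qed

section \<open>Weak derivatives\<close>

abbreviation pint :: "real \<Rightarrow> (real \<Rightarrow> real) \<Rightarrow> real" where
  "pint p f \<equiv> \<integral>x. \<bar>f x\<bar> powr p \<partial>circle"

lemma deriv_trig: "(deriv ^^ k) (trig N c) = trig N ((dcoef ^^ k) c)"
proof (induction k)
  case (Suc k)
  have "deriv (trig N d) = trig N (dcoef d)" for d
    by (rule ext) (rule DERIV_imp_deriv[OF trig_deriv])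
  with Suc show ?case by simp
qed simp

lemma smooth_trig: "smooth (trig N c)"
  unfolding smooth_def deriv_trig by (metis trig_deriv field_differentiable_def)

lemma periodic_trig: "periodic (trig N c)"
  by (simp add: periodic_def trig_periodic)

lemma cas_eq_trig: "cas k = trig (nat \<bar>k\<bar>) (\<lambda>l. if l = k then 1 else 0)"
proof -
  have "- \<bar>k\<bar> \<le> k" "k \<le> \<bar>k\<bar>" by linarith+
  then show ?thesis
    by (simp add: fun_eq_iff trig_def if_distrib[of "\<lambda>z. z * _"] sum.delta cong: if_cong)
qed

lemma periodic_deriv:
  assumes "periodic f"
  shows "periodic (deriv f)"
proof -
  have "(f has_field_derivative D) (at (x + 2*pi)) \<longleftrightarrow> (f has_field_derivative D) (at x)" for D x
    using DERIV_shift[of f D x "2*pi"] assms by (simp add: periodic_def)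
  then show ?thesis by (simp add: periodic_def deriv_def)
qed

lemma periodic_deriv_iter: "periodic f \<Longrightarrow> periodic ((deriv ^^ k) f)"
  by (induction k) (auto intro: periodic_deriv)

lemma smooth_deriv: "smooth f \<Longrightarrow> ((deriv ^^ k) f has_real_derivative (deriv ^^ Suc k) f x) (at x)"
  by (simp add: smooth_def field_differentiable_derivI)

lemma smooth_continuous: "smooth f \<Longrightarrow> continuous_on S ((deriv ^^ k) f)"
  by (meson DERIV_isCont continuous_at_imp_continuous_on smooth_deriv)

lemma Lp_integrable:
  assumes "f \<in> Lp p" "1 \<le> p"
  shows "integrable circle f"
proof (rule Bochner_Integration.integrable_bound)
  show "integrable circle (\<lambda>x. 1 + \<bar>f x\<bar> powr p)" using assms by (simp add: Lp_def)
  show "f \<in> borel_measurable circle" using assms by (simp add: Lp_def)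
  have "y \<le> 1 + y powr p" if "0 \<le> y" for y
  proof (cases "y \<le> 1")
    case False
    then have "y powr 1 \<le> y powr p" using assms(2) by (intro powr_mono) auto
    then show ?thesis using that by simp
  qed (use powr_ge_zero[of y p] in linarith)
  then show "AE x in circle. norm (f x) \<le> norm (1 + \<bar>f x\<bar> powr p)"
    by (intro AE_I2) (metis abs_ge_zero abs_ge_self order_trans real_norm_def)
qed

lemma Lp_1_iff: "f \<in> Lp 1 \<longleftrightarrow> periodic f \<and> integrable circle f"
proof -
  have "integrable circle (\<lambda>x. \<bar>f x\<bar>) \<longleftrightarrow> integrable circle f" if "f \<in> borel_measurable circle"
    using that by (rule integrable_abs_iff)
  moreover have "(\<lambda>x. \<bar>f x\<bar> powr 1) = (\<lambda>x. \<bar>f x\<bar>)" by simp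
  ultimately show ?thesis unfolding Lp_def mem_Collect_eq using borel_measurable_integrable[of circle f] by metis
qed

lemma Lp_subset_Lp_1: "1 \<le> p \<Longrightarrow> f \<in> Lp p \<Longrightarrow> f \<in> Lp 1"
  unfolding Lp_1_iff using Lp_integrable[of f p] unfolding Lp_def by blast

text \<open>Basis functions are admissible test functions, so f determines all Hartley coefficients
  of a weak derivative. With \<open>coef_zero_imp_AE_zero\<close> this yields uniqueness.\<close>

lemma weak_deriv_coef:
  assumes "is_weak_deriv k f g"
  shows "coef g l = (- 1) ^ k * (AVG x. f x * (deriv ^^ k) (cas l) x)"
proof -
  have "smooth (cas l)" "periodic (cas l)"
    unfolding cas_eq_trig by (rule smooth_trig, rule periodic_trig)
  then have eq: "(\<integral>y. f y * (deriv ^^ k) (cas l) y \<partial>circle) = (- 1) ^ k * (\<integral>y. g y * cas l y \<partial>circle)"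
    using assms unfolding is_weak_deriv_def by blast
  have "(- 1) ^ k * ((- 1) ^ k * z) = z" for z :: real
    by (cases "even k") auto
  then have "(\<integral>y. g y * cas l y \<partial>circle) = (- 1) ^ k * (\<integral>y. f y * (deriv ^^ k) (cas l) y \<partial>circle)"
    unfolding eq by (rule sym)
  then show ?thesis unfolding coef_def average_def by simp
qed

lemma weak_deriv_unique:
  assumes "is_weak_deriv k f g" "is_weak_deriv k f g'" "integrable circle g" "integrable circle g'"
  shows "AE x in circle. g x = g' x"
proof -
  have "AE x in circle. g x - g' x = 0"
    by (rule coef_zero_imp_AE_zero)
       (use assms in \<open>auto simp: coef_diff weak_deriv_coef[OF assms(1)] weak_deriv_coef[OF assms(2)]\<close>)
  then show ?thesis by simp
qed

lemma weak_deriv_AE: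
  assumes "is_weak_deriv k f g" "g \<in> Lp 1"
  shows "weak_deriv k f \<in> Lp 1" "is_weak_deriv k f (weak_deriv k f)"
    "AE x in circle. weak_deriv k f x = g x"
proof -
  show *: "weak_deriv k f \<in> Lp 1" "is_weak_deriv k f (weak_deriv k f)"
    using someI[of "\<lambda>g. g \<in> Lp 1 \<and> is_weak_deriv k f g" g] assms by (auto simp: weak_deriv_def)
  show "AE x in circle. weak_deriv k f x = g x"
    by (rule weak_deriv_unique[OF *(2) assms(1)]) (use * assms in \<open>auto simp: Lp_1_iff\<close>)
qed

lemma Sobolev_weak_deriv:
  assumes "f \<in> Sobolev k p" "1 \<le> p" "j \<le> k"
  shows "weak_deriv j f \<in> Lp p" "is_weak_deriv j f (weak_deriv j f)"
proof -
  obtain g where g: "g \<in> Lp p" "is_weak_deriv j f g" using assms by (auto simp: Sobolev_def)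
  then have "g \<in> Lp 1" using Lp_subset_Lp_1[OF assms(2)] by blast
  note w = weak_deriv_AE[OF g(2) this]
  show "is_weak_deriv j f (weak_deriv j f)" by (rule w)
  have "integrable circle (\<lambda>x. \<bar>weak_deriv j f x\<bar> powr p)"
  proof (subst integrable_cong_AE[where g = "\<lambda>x. \<bar>g x\<bar> powr p"])
    show "AE x in circle. \<bar>weak_deriv j f x\<bar> powr p = \<bar>g x\<bar> powr p"
      using w(3) by eventually_elim simp
  qed (use g w in \<open>auto simp: Lp_def\<close>)
  then show "weak_deriv j f \<in> Lp p" using w(1) by (auto simp: Lp_def)
qed

text \<open>The norm refers to chosen representatives; any other integrable weak derivatives agree
  with them almost everywhere, so the norm may be computed from classical derivatives.\<close>

lemma Sobolev_norm_eq:
  assumes "\<And>j. j \<le> k \<Longrightarrow> g j \<in> Lp 1 \<and> is_weak_deriv j f (g j)"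
  shows "Sobolev_norm k p f = (\<Sum>j\<le>k. pint p (g j)) powr (1 / p)"
  unfolding Sobolev_norm_def
proof (intro arg_cong[where f = "\<lambda>z. z powr (1/p)"] sum.cong refl)
  fix j assume "j \<in> {..k}"
  with assms have g: "g j \<in> Lp 1" "is_weak_deriv j f (g j)" by auto
  note w = weak_deriv_AE[OF g(2,1)]
  have m: "weak_deriv j f \<in> borel_measurable circle" "g j \<in> borel_measurable circle"
    using g(1) w(1) by (auto simp: Lp_def)
  show "pint p (weak_deriv j f) = pint p (g j)"
  proof (rule integral_cong_AE)
    show "AE x in circle. \<bar>weak_deriv j f x\<bar> powr p = \<bar>g j x\<bar> powr p"
      using w(3) by eventually_elim simp
  qed (use m in measurable)
qed

lemma is_weak_deriv_0: "is_weak_deriv 0 f f"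
  by (simp add: is_weak_deriv_def)

lemma integrable_mult_smooth:
  "integrable circle f \<Longrightarrow> smooth \<phi> \<Longrightarrow> integrable circle (\<lambda>x. f x * (deriv ^^ k) \<phi> x)"
  by (rule integrable_mult_continuous) (auto intro: smooth_continuous)

lemma is_weak_deriv_add:
  assumes "is_weak_deriv k f f'" "is_weak_deriv k g g'" "integrable circle f" "integrable circle g"
    "integrable circle f'" "integrable circle g'"
  shows "is_weak_deriv k (\<lambda>x. f x + g x) (\<lambda>x. f' x + g' x)"
  unfolding is_weak_deriv_def
proof safe
  fix \<phi> assume p: "smooth \<phi>" "periodic \<phi>"
  note i = integrable_mult_smooth[OF _ p(1)]
  note i0 = integrable_mult_smooth[where k = 0, simplified, OF _ p(1)]
  show "(\<integral>y. (f y + g y) * (deriv ^^ k) \<phi> y \<partial>circle) = (- 1) ^ k * (\<integral>y. (f' y + g' y) * \<phi> y \<partial>circle)"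
    using assms(1,2) p i[OF assms(3)] i[OF assms(4)] i0[OF assms(5)] i0[OF assms(6)]
    by (simp add: is_weak_deriv_def distrib_right distrib_left)
qed

lemma is_weak_deriv_cmult:
  assumes "is_weak_deriv k f f'"
  shows "is_weak_deriv k (\<lambda>x. c * f x) (\<lambda>x. c * f' x)"
  using assms by (simp add: is_weak_deriv_def mult.assoc)

lemma is_weak_deriv_diff:
  assumes "is_weak_deriv k f f'" "is_weak_deriv k g g'" "integrable circle f" "integrable circle g"
    "integrable circle f'" "integrable circle g'"
  shows "is_weak_deriv k (\<lambda>x. f x - g x) (\<lambda>x. f' x - g' x)"
  using is_weak_deriv_add[OF assms(1) is_weak_deriv_cmult[OF assms(2), of "-1"]] assms by simp

lemma integral_by_parts_circle:
  assumes f: "\<And>x. (f has_real_derivative f' x) (at x)" "continuous_on UNIV f'" "f (2*pi) = f 0"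
    and g: "\<And>x. (g has_real_derivative g' x) (at x)" "continuous_on UNIV g'" "g (2*pi) = g 0"
  shows "(\<integral>y. f y * g' y \<partial>circle) = - (\<integral>y. f' y * g y \<partial>circle)"
proof -
  have cf: "continuous_on UNIV f" "continuous_on UNIV g"
    by (meson f(1) g(1) DERIV_isCont continuous_at_imp_continuous_on)+
  have i: "integrable circle (\<lambda>x. f x * g' x)" "integrable circle (\<lambda>x. f' x * g x)"
    by (intro circle_integrable_UNIV continuous_intros cf f g)+
  have "((\<lambda>x. f x * g' x + f' x * g x) has_integral (f (2*pi) * g (2*pi) - f 0 * g 0)) {0..2*pi}"
    by (intro fundamental_theorem_of_calculus)
       (auto simp flip: has_real_derivative_iff_has_vector_derivative
         intro!: DERIV_mult' DERIV_subset[OF f(1)] DERIV_subset[OF g(1)])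
  then have "integral {0..2*pi} (\<lambda>x. f x * g' x + f' x * g x) = 0"
    using f(3) g(3) by (simp add: integral_unique)
  moreover have "(\<integral>x. f x * g' x + f' x * g x \<partial>circle) = integral {0..2*pi} (\<lambda>x. f x * g' x + f' x * g x)"
    by (rule lebesgue_integral_eq_integral) (use i in auto)
  ultimately show ?thesis using i by simp
qed

lemma is_weak_deriv_Suc:
  assumes f: "\<And>x. (f has_real_derivative f' x) (at x)" "continuous_on UNIV f'" "periodic f"
    and g: "is_weak_deriv k f' g"
  shows "is_weak_deriv (Suc k) f g"
  unfolding is_weak_deriv_def
proof safe
  fix \<phi> assume p: "smooth \<phi>" "periodic \<phi>"
  have per: "h (2*pi) = h 0" if "periodic h" for h
    using that unfolding periodic_def by (metis add_0)
  have "(\<integral>y. f y * (deriv ^^ Suc k) \<phi> y \<partial>circle) = - (\<integral>y. f' y * (deriv ^^ k) \<phi> y \<partial>circle)"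
    by (rule integral_by_parts_circle)
       (use f p per periodic_deriv_iter smooth_deriv smooth_continuous in blast)+
  then show "(\<integral>y. f y * (deriv ^^ Suc k) \<phi> y \<partial>circle) = (- 1) ^ Suc k * (\<integral>y. g y * \<phi> y \<partial>circle)"
    using g p by (simp add: is_weak_deriv_def)
qed

section \<open>Parseval\<close>

text \<open>Truncation of f at a height K followed by a bounded trigonometric approximation gives
  one polynomial close to f in mean square. Projections of every larger order are at least as close,
  by \<open>average_diff_trig_sq\<close>.\<close>

lemma parseval_trig:
  assumes f: "integrable circle f" "integrable circle (\<lambda>x. (f x)\<^sup>2)" and e: "0 < e"
  shows "\<exists>R. \<forall>N\<ge>R. (AVG x. (f x - trig N (coef f) x)\<^sup>2) < e"
proof -
  have fm: "f \<in> borel_measurable circle" using f by auto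
  define g where "g K x = max (- real K) (min (real K) (f x))" for K x
  have gm: "g K \<in> borel_measurable circle" for K unfolding g_def using fm by measurable
  have dfg: "\<bar>f x - g K x\<bar> \<le> \<bar>f x\<bar>" for K x by (auto simp: g_def)
  have sq: "(f x - g K x)\<^sup>2 \<le> (f x)\<^sup>2" for K x using dfg[of x K] by (rule abs_le_square_iff[THEN iffD1])
  have i1: "integrable circle (\<lambda>x. (f x - g K x)\<^sup>2)" for K
    by (rule Bochner_Integration.integrable_bound[OF f(2)])
       (use fm gm sq in \<open>auto intro!: AE_I2 borel_measurable_power borel_measurable_diff\<close>)
  have "(\<lambda>K. \<integral>x. (f x - g K x)\<^sup>2 \<partial>circle) \<longlonglongrightarrow> (\<integral>x. 0 \<partial>circle)"
  proof (rule integral_dominated_convergence[OF _ _ f(2)])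
    show "AE x in circle. (\<lambda>K. (f x - g K x)\<^sup>2) \<longlonglongrightarrow> 0"
    proof (intro AE_I2 tendsto_eventually)
      fix x
      obtain K0 :: nat where "\<bar>f x\<bar> < real K0" using reals_Archimedean2 by blast
      then have "(f x - g K x)\<^sup>2 = 0" if "K0 \<le> K" for K using that by (auto simp: g_def)
      then show "\<forall>\<^sub>F K in sequentially. (f x - g K x)\<^sup>2 = 0" by (auto simp: eventually_sequentially)
    qed
  qed (use i1 sq in auto)
  then have "(\<lambda>K. (AVG x. (f x - g K x)\<^sup>2)) \<longlonglongrightarrow> 0"
    unfolding average_def by (intro tendsto_mult_right_zero) simp
  then obtain K where K: "(AVG x. (f x - g K x)\<^sup>2) < e / 4"
    using order_tendstoD(2)[of _ 0 sequentially "e/4"] e eventually_happens'[OF sequentially_bot] by fastforce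
  have gK: "\<bar>g K x\<bar> \<le> real K" for x by (auto simp: g_def)
  obtain N :: "nat \<Rightarrow> nat" and c where T: "\<And>n x. x \<in> {0..2*pi} \<Longrightarrow> \<bar>trig (N n) (c n) x\<bar> \<le> real K + 1"
    and ae: "AE x in circle. (\<lambda>n. trig (N n) (c n) x) \<longlonglongrightarrow> g K x"
    using bounded_ae_trig_approx[OF gm gK] by blast
  have tm: "trig M d \<in> borel_measurable circle" for M d using integrable_trig by auto
  have b2: "(g K x - trig (N n) (c n) x)\<^sup>2 \<le> (2 * real K + 1)\<^sup>2" if "x \<in> {0..2*pi}" for n x
    using gK[of x] T[OF that, of n] by (intro abs_le_square_iff[THEN iffD1]) auto
  have i2: "integrable circle (\<lambda>x. (g K x - trig (N n) (c n) x)\<^sup>2)" for n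
    by (rule circle_integrable_bounded[of _ "(2 * real K + 1)\<^sup>2"]) (use gm tm b2 in \<open>auto intro!: borel_measurable_power borel_measurable_diff\<close>)
  have "(\<lambda>n. \<integral>x. (g K x - trig (N n) (c n) x)\<^sup>2 \<partial>circle) \<longlonglongrightarrow> (\<integral>x. 0 \<partial>circle)"
  proof (rule integral_dominated_convergence)
    show "integrable circle (\<lambda>x. (2 * real K + 1)\<^sup>2)" by simp
    show "AE x in circle. (\<lambda>n. (g K x - trig (N n) (c n) x)\<^sup>2) \<longlonglongrightarrow> 0"
      using ae by eventually_elim (auto intro!: tendsto_eq_intros)
    show "AE x in circle. norm ((g K x - trig (N n) (c n) x)\<^sup>2) \<le> (2 * real K + 1)\<^sup>2" for n
      using b2 by (intro AE_I2) auto
  qed (use i2 in auto)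
  then have "(\<lambda>n. (AVG x. (g K x - trig (N n) (c n) x)\<^sup>2)) \<longlonglongrightarrow> 0"
    unfolding average_def by (intro tendsto_mult_right_zero) simp
  then obtain n where n: "(AVG x. (g K x - trig (N n) (c n) x)\<^sup>2) < e / 4"
    using order_tendstoD(2)[of _ 0 sequentially "e/4"] e eventually_happens'[OF sequentially_bot] by fastforce
  have i3: "integrable circle (\<lambda>x. (f x - trig M d x)\<^sup>2)" for M d
  proof -
    have "integrable circle (\<lambda>x. f x * trig M d x)" "integrable circle (\<lambda>x. (trig M d x)\<^sup>2)"
      by (intro integrable_mult_continuous f continuous_intros, intro circle_integrable continuous_intros)
    then show ?thesis using f(2) by (simp add: power2_diff mult.assoc)
  qed
  have "(AVG x. (f x - trig (N n) (c n) x)\<^sup>2)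
      \<le> (AVG x. 2 * (f x - g K x)\<^sup>2 + 2 * (g K x - trig (N n) (c n) x)\<^sup>2)"
  proof (rule average_mono[OF i3])
    fix x
    have "(a + b)\<^sup>2 \<le> 2 * a\<^sup>2 + 2 * b\<^sup>2" for a b :: real
      using sum_squares_bound[of a b] by (simp add: power2_sum)
    from this[of "f x - g K x" "g K x - trig (N n) (c n) x"]
    show "(f x - trig (N n) (c n) x)\<^sup>2 \<le> 2 * (f x - g K x)\<^sup>2 + 2 * (g K x - trig (N n) (c n) x)\<^sup>2" by simp
  qed (use i1 i2 in simp)
  also have "... < e" using K n i1 i2 by (simp add: average_add average_cmult)
  finally have *: "(AVG x. (f x - trig (N n) (c n) x)\<^sup>2) < e" .
  have "(AVG x. (f x - trig M (coef f) x)\<^sup>2) < e" if M: "N n \<le> M" for M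
  proof -
    have "(\<Sum>k\<in>modes (N n). (coef f k)\<^sup>2) \<le> (\<Sum>k\<in>modes M. (coef f k)\<^sup>2)"
      using M by (intro sum_mono2) auto
    moreover have "0 \<le> (\<Sum>k\<in>modes (N n). (coef f k - c n k)\<^sup>2)" by (intro sum_nonneg) auto
    ultimately show ?thesis
      using * average_diff_trig_sq[OF f, of M "coef f"] average_diff_trig_sq[OF f, of "N n" "c n"] by simp
  qed
  then show ?thesis by blast
qed

section \<open>The discrete scheme\<close>

text \<open>Eigenvalues of the form given by the average of h_\<theta>^2 - (h - mean)^2, whose
  kernel consists of the modes 0, 1 and -1. The product k * lam k, the symbol of the first plus the
  third derivative, agrees with k (k^2 - 1) also at k = 0.\<close>

definition lam :: "int \<Rightarrow> real" where
  "lam k = (if k = 0 then 0 else of_int (k\<^sup>2 - 1))"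

lemma lam_nonneg: "0 \<le> lam k"
proof (cases "k = 0")
  case False
  then have "0 < k\<^sup>2" by simp
  then have "0 \<le> k\<^sup>2 - 1" by linarith
  then have "0 \<le> (of_int (k\<^sup>2 - 1) :: real)" unfolding of_int_0_le_iff .
  then show ?thesis by (simp add: lam_def)
qed (simp add: lam_def)

lemma lam_uminus [simp]: "lam (- k) = lam k"
  by (simp add: lam_def)

lemma lam_simps [simp]: "lam 0 = 0" "lam 1 = 0" "lam (-1) = 0"
  by (simp_all add: lam_def)

text \<open>Coefficients live in the space of all functions on the integers with its product
  topology; fixing the modes beyond N at 0 gives a product of compact sets.\<close>

lemma compact_box: "compact {j :: int \<Rightarrow> real. \<forall>k. j k \<in> (if k \<in> modes N then {- R..R} else {0})}"
proof -
  have "{j :: int \<Rightarrow> real. \<forall>k. j k \<in> (if k \<in> modes N then {- R..R} else {0})}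
      = PiE UNIV (\<lambda>k. if k \<in> modes N then {- R..R} else {0})" by (auto simp: PiE_def Pi_def)
  moreover have "compactin (product_topology (\<lambda>_. euclidean) UNIV)
      (PiE UNIV (\<lambda>k :: int. if k \<in> modes N then {- R..R} else {0 :: real}))"
    by (subst compactin_PiE) auto
  ultimately show ?thesis
    by (simp add: euclidean_product_topology)
qed

lemma continuous_on_trig_coef:
  "continuous_on UNIV (\<lambda>z :: (int \<Rightarrow> real) \<times> real. trig N (fst z) (snd z))"
  unfolding trig_def
  by (intro continuous_on_sum continuous_on_mult continuous_on_cas continuous_on_snd continuous_on_id
      continuous_on_compose2[OF continuous_on_product_coordinates continuous_on_fst[OF continuous_on_id]]) auto

lemma continuous_on_average_param:
  fixes F :: "'a::topological_space \<Rightarrow> real \<Rightarrow> real"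
  assumes "continuous_on UNIV (\<lambda>z. F (fst z) (snd z))"
  shows "continuous_on UNIV (\<lambda>j. average (F j))"
proof -
  have c: "continuous_on {0..2*pi} (F j)" for j
  proof -
    have "continuous_on {0..2*pi} (\<lambda>x. F (fst (j, x)) (snd (j, x)))"
      by (rule continuous_on_compose2[OF assms]) (auto intro: continuous_intros)
    then show ?thesis by simp
  qed
  have "continuous_on UNIV (\<lambda>j. integral (cbox 0 (2*pi)) (F j))"
    by (rule integral_continuous_on_param)
       (auto simp: case_prod_unfold intro: continuous_on_subset[OF assms])
  then show ?thesis unfolding average_eq_integral[OF c] by (auto intro!: continuous_intros)
qed

text \<open>The tangent is taken at y. In \<open>monotone_equation\<close> that is the perturbed
  point, and no derivative of an integral has to be computed.\<close>

lemma abs_powr_convex: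
  assumes "1 \<le> \<rho>"
  shows "\<bar>y\<bar> powr (\<rho> + 1) / (\<rho> + 1) - \<bar>x\<bar> powr (\<rho> + 1) / (\<rho> + 1) \<le> spow \<rho> y * (y - x)"
proof -
  have "spow \<rho> y * (y - x) = \<bar>y\<bar> powr (\<rho> + 1) - spow \<rho> y * x"
    by (simp add: right_diff_distrib spow_mult_self)
  moreover have "\<bar>y\<bar> powr (\<rho> + 1) - \<rho> / (\<rho> + 1) * \<bar>y\<bar> powr (\<rho> + 1) = \<bar>y\<bar> powr (\<rho> + 1) / (\<rho> + 1)"
    using assms by (simp add: field_simps)
  ultimately show ?thesis using spow_Young[OF assms, of y x] by linarith
qed

text \<open>Takes the place of the first-order condition at a minimum: one-sided limits at 0 have
  opposite signs.\<close>

lemma zero_of_sign: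
  fixes F :: "real \<Rightarrow> real"
  assumes "continuous_on UNIV F" "\<And>t. 0 \<le> t * F t"
  shows "F 0 = 0"
proof -
  have "isCont F 0" using assms(1) by (simp add: continuous_on_eq_continuous_at)
  then have l: "(\<lambda>n. F (a * (1 / real (Suc n)))) \<longlonglongrightarrow> F 0" for a
    by (rule isCont_tendsto_compose)
       (use tendsto_mult[OF tendsto_const[of a] LIMSEQ_inverse_real_of_nat] in \<open>simp add: inverse_eq_divide\<close>)
  have "0 \<le> F (1 * (1 / real (Suc n)))" for n
    using assms(2)[of "1 / real (Suc n)"] by (simp add: zero_le_divide_iff)
  then have "0 \<le> F 0" using LIMSEQ_le_const[OF l[of 1]] by blast
  moreover have "F (-1 * (1 / real (Suc n))) \<le> 0" for n
    using assms(2)[of "-1 * (1 / real (Suc n))"] by (simp add: divide_le_0_iff)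
  then have "F 0 \<le> 0" using LIMSEQ_le_const2[OF l[of "-1"]] by blast
  ultimately show ?thesis by simp
qed

text \<open>The Euler--Lagrange equation of a strictly convex functional on the trigonometric polynomials.\<close>

lemma monotone_equation:
  fixes a g :: "int \<Rightarrow> real" and w :: "real \<Rightarrow> real"
  assumes \<rho>: "1 \<le> \<rho>" and w: "continuous_on UNIV w" and b0: "0 < b0" "\<And>x. b0 \<le> w x"
    and a: "\<And>k. 0 \<le> a k"
  obtains j where "supp N j"
    "\<And>k. k \<in> modes N \<Longrightarrow> a k * j k + coef (\<lambda>x. w x * spow \<rho> (trig N j x)) k = g k"
proof -
  let ?r = "\<rho> + 1"
  have r0: "0 < ?r" using \<rho> by simp
  define W where "W j = (AVG x. w x * \<bar>trig N j x\<bar> powr ?r)" for j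
  define \<Phi> where "\<Phi> j = (\<Sum>k\<in>modes N. a k * (j k)\<^sup>2 / 2) + W j / ?r - (\<Sum>k\<in>modes N. g k * j k)" for j
  have cj: "continuous_on UNIV (\<lambda>j :: int \<Rightarrow> real. j k)" for k
    by (rule continuous_on_product_coordinates)
  have cW: "continuous_on UNIV W" unfolding W_def
    by (rule continuous_on_average_param)
       (intro continuous_on_mult continuous_on_abs_powr continuous_on_trig_coef
         continuous_on_compose2[OF w] continuous_on_snd continuous_on_id, use r0 in auto)
  have c\<Phi>: "continuous_on UNIV \<Phi>"
    unfolding \<Phi>_def by (intro continuous_intros cj cW)
       (use r0 in auto)
  define \<kappa> where "\<kappa> = b0 / ?r"
  have \<kappa>: "0 < \<kappa>" using b0 r0 by (simp add: \<kappa>_def)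
  define C where "C = \<kappa> + (\<Sum>k\<in>modes N. (g k)\<^sup>2 / (2 * \<kappa>))"
  have C: "0 \<le> C" using \<kappa> by (auto simp: C_def intro!: add_nonneg_nonneg sum_nonneg)
  \<comment> \<open>The quadratic part may vanish on some modes, so coercivity has to come from the
    power term: x^2 \<le> 1 + |x| powr (\<rho> + 1) brings in all coefficients, and half of this
    gain absorbs the linear term.\<close>
  have coercive: "\<kappa> / 2 * (\<Sum>k\<in>modes N. (j k)\<^sup>2) - C \<le> \<Phi> j" for j
  proof -
    have ct: "continuous_on {0..2*pi} (trig N j)" using continuous_on_trig[OF continuous_on_id] by simp
    have ip: "integrable circle (\<lambda>x. \<bar>trig N j x\<bar> powr ?r)"
      using r0 by (intro circle_integrable continuous_intros) auto
    have "(\<Sum>k\<in>modes N. (j k)\<^sup>2) = (AVG x. (trig N j x)\<^sup>2)" by (simp add: average_trig_sq)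
    also have "... \<le> (AVG x. 1 + \<bar>trig N j x\<bar> powr ?r)"
    proof (rule average_mono)
      show "integrable circle (\<lambda>x. (trig N j x)\<^sup>2)" by (intro circle_integrable continuous_intros)
      show "integrable circle (\<lambda>x. 1 + \<bar>trig N j x\<bar> powr ?r)" using ip by simp
      show "(trig N j x)\<^sup>2 \<le> 1 + \<bar>trig N j x\<bar> powr ?r" for x
        using powr_ge_sq[of "\<bar>trig N j x\<bar>" \<rho>] \<rho> by simp
    qed
    also have "... = 1 + (AVG x. \<bar>trig N j x\<bar> powr ?r)" using ip by (simp add: average_add average_const)
    finally have 1: "b0 * ((\<Sum>k\<in>modes N. (j k)\<^sup>2) - 1) \<le> (AVG x. b0 * \<bar>trig N j x\<bar> powr ?r)"
      using b0 by (simp add: average_cmult)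
    have "(AVG x. b0 * \<bar>trig N j x\<bar> powr ?r) \<le> W j" unfolding W_def
    proof (rule average_mono)
      show "integrable circle (\<lambda>x. b0 * \<bar>trig N j x\<bar> powr ?r)" using ip by simp
      show "integrable circle (\<lambda>x. w x * \<bar>trig N j x\<bar> powr ?r)"
        using r0 by (intro circle_integrable continuous_intros continuous_on_subset[OF w]) auto
    qed (use b0 in \<open>auto intro!: mult_right_mono\<close>)
    with 1 have "b0 * ((\<Sum>k\<in>modes N. (j k)\<^sup>2) - 1) / ?r \<le> W j / ?r"
      using r0 by (intro divide_right_mono) auto
    then have "\<kappa> * ((\<Sum>k\<in>modes N. (j k)\<^sup>2) - 1) \<le> W j / ?r" by (simp add: \<kappa>_def)
    moreover have "(\<Sum>k\<in>modes N. g k * j k) \<le> (\<Sum>k\<in>modes N. \<kappa> / 2 * (j k)\<^sup>2 + (g k)\<^sup>2 / (2 * \<kappa>))"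
    proof (rule sum_mono)
      fix k
      have "0 \<le> (\<kappa> * j k - g k)\<^sup>2" by simp
      then have "2 * \<kappa> * (g k * j k) \<le> 2 * \<kappa> * (\<kappa> / 2 * (j k)\<^sup>2 + (g k)\<^sup>2 / (2 * \<kappa>))"
        using \<kappa> by (simp add: power2_diff power2_eq_square algebra_simps)
      then show "g k * j k \<le> \<kappa> / 2 * (j k)\<^sup>2 + (g k)\<^sup>2 / (2 * \<kappa>)" using \<kappa> by simp
    qed
    moreover have "0 \<le> (\<Sum>k\<in>modes N. a k * (j k)\<^sup>2 / 2)" using a by (intro sum_nonneg) auto
    moreover have "(\<Sum>k\<in>modes N. \<kappa> / 2 * (j k)\<^sup>2 + (g k)\<^sup>2 / (2 * \<kappa>))
        = \<kappa> / 2 * (\<Sum>k\<in>modes N. (j k)\<^sup>2) + (\<Sum>k\<in>modes N. (g k)\<^sup>2 / (2 * \<kappa>))"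
      by (simp add: sum.distrib sum_distrib_left)
    moreover have "\<kappa> * ((\<Sum>k\<in>modes N. (j k)\<^sup>2) - 1) = 2 * (\<kappa> / 2 * (\<Sum>k\<in>modes N. (j k)\<^sup>2)) - \<kappa>"
      by (simp add: algebra_simps)
    ultimately show ?thesis unfolding \<Phi>_def C_def by linarith
  qed
  \<comment> \<open>Since R \<ge> 1, a point outside the box has a sum of squares of at least 2 C /
    \<kappa>, hence a nonnegative value of \<Phi>, while \<Phi> vanishes at the origin.\<close>
  define R where "R = 2 * C / \<kappa> + 1"
  have R: "1 \<le> R" using C \<kappa> by (simp add: R_def)
  let ?K = "{j :: int \<Rightarrow> real. \<forall>k. j k \<in> (if k \<in> modes N then {- R..R} else {0})}"
  have z: "(\<lambda>_. 0) \<in> ?K" using R by auto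
  have "\<exists>j\<in>?K. \<forall>y\<in>?K. \<Phi> j \<le> \<Phi> y"
  proof (rule continuous_attains_inf[OF compact_box])
    show "?K \<noteq> {}" using z empty_iff by metis
    show "continuous_on ?K \<Phi>" by (rule continuous_on_subset[OF c\<Phi>]) auto
  qed
  then obtain j where j: "j \<in> ?K" and jmin: "\<And>y. y \<in> ?K \<Longrightarrow> \<Phi> j \<le> \<Phi> y" by blast
  have W0: "W (\<lambda>_. 0) = 0" using r0 by (simp add: W_def trig_def average_const)
  then have "\<Phi> (\<lambda>_. 0) = 0" by (simp add: \<Phi>_def)
  then have j0: "\<Phi> j \<le> 0" using jmin[OF z] by simp
  have sj: "supp N j" unfolding supp_def
  proof (intro allI impI)
    fix k assume k: "k \<notin> modes N"
    have "j k \<in> (if k \<in> modes N then {- R..R} else {0})" using j by blast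
    then show "j k = 0" unfolding if_not_P[OF k] by simp
  qed
  have glob: "\<Phi> j \<le> \<Phi> y" if "supp N y" for y
  proof (cases "\<forall>k\<in>modes N. \<bar>y k\<bar> \<le> R")
    case True
    have "y k \<in> (if k \<in> modes N then {- R..R} else {0})" for k
    proof (cases "k \<in> modes N")
      case k: True
      then have "\<bar>y k\<bar> \<le> R" using True by blast
      then show ?thesis unfolding if_P[OF k] by auto
    next
      case k: False
      then have "y k = 0" using \<open>supp N y\<close> by (metis supp_def)
      then show ?thesis unfolding if_not_P[OF k] by auto
    qed
    then have "y \<in> ?K" by blast
    then show ?thesis by (rule jmin)
  next
    case False
    then obtain k where k: "k \<in> modes N" "R < \<bar>y k\<bar>" by auto
    have "2 * C / \<kappa> \<le> R * 1" by (simp add: R_def)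
    also have "... \<le> R * R" using R by (intro mult_left_mono) auto
    also have "... \<le> \<bar>y k\<bar> * \<bar>y k\<bar>" using k R by (intro mult_mono) auto
    also have "... = (y k)\<^sup>2" by (simp add: power2_eq_square)
    also have "... \<le> (\<Sum>k\<in>modes N. (y k)\<^sup>2)" using k(1) by (intro member_le_sum) auto
    finally have "\<kappa> / 2 * (2 * C / \<kappa>) \<le> \<kappa> / 2 * (\<Sum>k\<in>modes N. (y k)\<^sup>2)"
      using \<kappa> by (intro mult_left_mono) auto
    then have "C \<le> \<kappa> / 2 * (\<Sum>k\<in>modes N. (y k)\<^sup>2)" using \<kappa> by simp
    then show ?thesis using coercive[of y] j0 by linarith
  qed
  have eq: "a k * j k + coef (\<lambda>x. w x * spow \<rho> (trig N j x)) k = g k" if k: "k \<in> modes N" for k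
  proof -
    define T where "T t x = trig N j x + t * cas k x" for t x
    \<comment> \<open>The residual of the equation after moving mode k by t; t / 2 is exact for the
      increment of the quadratic part. Minimality and the tangent inequality give 0 \<le> t * F
      t.\<close>
    define F where "F t = a k * (j k + t / 2) + coef (\<lambda>x. w x * spow \<rho> (T t x)) k - g k" for t
    have cT2: "continuous_on UNIV (\<lambda>z. T (fst z) (snd z))" unfolding T_def by (intro continuous_intros)
    have cT: "continuous_on S (T t)" for S t unfolding T_def by (intro continuous_intros)
    have "continuous_on UNIV (\<lambda>t. coef (\<lambda>x. w x * spow \<rho> (T t x)) k)" unfolding coef_def
      by (rule continuous_on_average_param)
         (intro continuous_intros cT2 continuous_on_compose2[OF w], use \<rho> in auto)
    then have cF: "continuous_on UNIV F" unfolding F_def by (intro continuous_intros) auto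
    have "0 \<le> t * F t" for t
    proof -
      define y where "y = j(k := j k + t)"
      have sy: "supp N y" using sj k by (auto simp: supp_def y_def)
      have Ty: "trig N y x = T t x" for x
      proof -
        have "trig N y x = (\<Sum>l\<in>modes N. j l * cas l x + (if l = k then t * cas k x else 0))"
          unfolding trig_def y_def by (intro sum.cong) (auto simp: distrib_right)
        then show ?thesis using k by (simp add: sum.distrib T_def trig_def)
      qed
      have s1: "(\<Sum>l\<in>modes N. a l * (y l)\<^sup>2 / 2) - (\<Sum>l\<in>modes N. a l * (j l)\<^sup>2 / 2) = t * (a k * (j k + t / 2))"
      proof -
        have "(\<Sum>l\<in>modes N. a l * (y l)\<^sup>2 / 2) - (\<Sum>l\<in>modes N. a l * (j l)\<^sup>2 / 2)
            = (\<Sum>l\<in>modes N. if l = k then t * (a k * (j k + t / 2)) else 0)"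
          unfolding sum_subtractf[symmetric] y_def
          by (intro sum.cong) (auto simp: power2_eq_square algebra_simps)
        then show ?thesis using k by simp
      qed
      have s2: "(\<Sum>l\<in>modes N. g l * y l) - (\<Sum>l\<in>modes N. g l * j l) = t * g k"
      proof -
        have "(\<Sum>l\<in>modes N. g l * y l) - (\<Sum>l\<in>modes N. g l * j l) = (\<Sum>l\<in>modes N. if l = k then t * g k else 0)"
          unfolding sum_subtractf[symmetric] y_def by (intro sum.cong) (auto simp: algebra_simps)
        then show ?thesis using k by simp
      qed
      have iT: "integrable circle (\<lambda>x. w x * \<bar>T t x\<bar> powr ?r)" for t
        using r0 by (intro circle_integrable continuous_intros continuous_on_subset[OF w] cT) auto
      have isp: "integrable circle (\<lambda>x. w x * spow \<rho> (T t x) * (t * cas k x))"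
        using \<rho> by (intro circle_integrable continuous_intros continuous_on_subset[OF w] cT) auto
      have "W y / ?r - W j / ?r = (AVG x. (w x * \<bar>T t x\<bar> powr ?r - w x * \<bar>T 0 x\<bar> powr ?r) * (1 / ?r))"
        unfolding average_cmult_right
        by (subst average_diff[OF iT iT]) (simp add: W_def Ty T_def diff_divide_distrib)
      also have "... \<le> (AVG x. w x * spow \<rho> (T t x) * (t * cas k x))"
      proof (rule average_mono)
        show "integrable circle (\<lambda>x. (w x * \<bar>T t x\<bar> powr ?r - w x * \<bar>T 0 x\<bar> powr ?r) * (1 / ?r))"
          using iT by (intro Bochner_Integration.integrable_mult_left Bochner_Integration.integrable_diff) auto
        fix x
        have "w x * (\<bar>T t x\<bar> powr ?r / ?r - \<bar>T 0 x\<bar> powr ?r / ?r) \<le> w x * (spow \<rho> (T t x) * (T t x - T 0 x))"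
          using b0(1) b0(2)[of x] unfolding diff_divide_distrib[symmetric]
          by (intro mult_left_mono) (use abs_powr_convex[OF \<rho>] in \<open>auto simp: diff_divide_distrib\<close>)
        then show "(w x * \<bar>T t x\<bar> powr ?r - w x * \<bar>T 0 x\<bar> powr ?r) * (1 / ?r) \<le> w x * spow \<rho> (T t x) * (t * cas k x)"
          by (simp add: T_def diff_divide_distrib right_diff_distrib mult.assoc)
      qed (rule isp)
      also have "... = t * coef (\<lambda>x. w x * spow \<rho> (T t x)) k"
        unfolding coef_def average_cmult[symmetric] by (simp add: mult_ac)
      finally have "W y / ?r - W j / ?r \<le> t * coef (\<lambda>x. w x * spow \<rho> (T t x)) k" .
      then show ?thesis using glob[OF sy] s1 s2 unfolding \<Phi>_def F_def by (simp add: algebra_simps)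
    qed
    from zero_of_sign[OF cF this] show ?thesis by (simp add: F_def T_def)
  qed
  show thesis using that[OF sj eq] .
qed

text \<open>The weight is taken at the old height, the flux at the new level: eliminating
  \<open>c (Suc n)\<close> then leaves the Euler-Lagrange equation of a convex functional of
  \<open>j (Suc n)\<close>. In the last line k * lam k stands for the first plus the third
  derivative, see \<open>dcoef_1_3\<close>.\<close>

definition scheme :: "nat \<Rightarrow> real \<Rightarrow> real \<Rightarrow> (real \<Rightarrow> real) \<Rightarrow> (nat \<Rightarrow> int \<Rightarrow> real) \<Rightarrow> (nat \<Rightarrow> int \<Rightarrow> real) \<Rightarrow> bool" where
  "scheme N \<tau> \<rho> b c j \<longleftrightarrow>
     (\<forall>n. supp N (c n) \<and> supp N (j n)) \<and>
     (\<forall>n k. c (Suc n) k = c n k - \<tau> * dcoef (j (Suc n)) k) \<and>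
     (\<forall>n. \<forall>k\<in>modes N. of_int k * lam k * c (Suc n) (- k)
        = coef (\<lambda>x. b (trig N (c n) x) * spow \<rho> (trig N (j (Suc n)) x)) k)"

lemma scheme_exists:
  fixes b :: "real \<Rightarrow> real"
  assumes \<rho>: "1 \<le> \<rho>" and b: "continuous_on UNIV b" "0 < b0" "\<And>x. b0 \<le> b x" and \<tau>: "0 \<le> \<tau>" and c0: "supp N c0"
  obtains c j where "scheme N \<tau> \<rho> b c j" "c 0 = c0"
proof -
  let ?P = "\<lambda>n (z :: (int \<Rightarrow> real) \<times> (int \<Rightarrow> real)). supp N (fst z) \<and> supp N (snd z) \<and> (n = (0::nat) \<longrightarrow> fst z = c0)"
  let ?Q = "\<lambda>(n::nat) z z'. (\<forall>k. fst z' k = fst z k - \<tau> * dcoef (snd z') k) \<and>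
      (\<forall>k\<in>modes N. of_int k * lam k * fst z' (- k) = coef (\<lambda>x. b (trig N (fst z) x) * spow \<rho> (trig N (snd z') x)) k)"
  have "\<exists>f. \<forall>n. ?P n (f n) \<and> ?Q n (f n) (f (Suc n))"
  proof (rule dependent_nat_choice)
    show "\<exists>z. ?P 0 z" using c0 by (intro exI[of _ "(c0, \<lambda>_. 0)"]) (simp add: supp_def)
  next
    fix z n assume z: "?P n z"
    have w: "continuous_on UNIV (\<lambda>x. b (trig N (fst z) x))"
      by (rule continuous_on_compose2[OF b(1)]) (auto intro: continuous_intros)
    have nn: "0 \<le> \<tau> * (of_int k)\<^sup>2 * lam k" for k using \<tau> lam_nonneg by simp
    \<comment> \<open>Since \<open>dcoef j (- k)\<close> is k * j k, the implicit term becomes the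
      quadratic coefficient \<tau> * k^2 * lam k, which is nonnegative.\<close>
    obtain j where j: "supp N j"
      "\<And>k. k \<in> modes N \<Longrightarrow> \<tau> * (of_int k)\<^sup>2 * lam k * j k + coef (\<lambda>x. b (trig N (fst z) x) * spow \<rho> (trig N j x)) k
        = of_int k * lam k * fst z (- k)"
      using monotone_equation[OF \<rho> w b(2,3), where a = "\<lambda>k. \<tau> * (of_int k)\<^sup>2 * lam k", OF nn, where N = N and g = "\<lambda>k. of_int k * lam k * fst z (- k)"] by blast
    define c where "c k = fst z k - \<tau> * dcoef j k" for k
    have "supp N c" using z j(1) by (auto simp: supp_def c_def dcoef_def)
    moreover have "of_int k * lam k * c (- k) = coef (\<lambda>x. b (trig N (fst z) x) * spow \<rho> (trig N j x)) k" if "k \<in> modes N" for k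
      using j(2)[OF that] by (simp add: c_def dcoef_def power2_eq_square algebra_simps)
    ultimately show "\<exists>z'. ?P (Suc n) z' \<and> ?Q n z z'"
      using j(1) by (intro exI[of _ "(c, j)"]) (simp add: c_def)
  qed
  then obtain f where f: "\<And>n. ?P n (f n)" "\<And>n. ?Q n (f n) (f (Suc n))" by blast
  show thesis
  proof
    show "scheme N \<tau> \<rho> b (\<lambda>n. fst (f n)) (\<lambda>n. snd (f n))"
      unfolding scheme_def using f by blast
    show "fst (f 0) = c0" using f(1)[of 0] by simp
  qed
qed

section \<open>Energy estimates for the scheme\<close>

definition qf :: "nat \<Rightarrow> (int \<Rightarrow> real) \<Rightarrow> real" where
  "qf N x = (\<Sum>k\<in>modes N. lam k * (x k)\<^sup>2)"

lemma qf_nonneg: "0 \<le> qf N x"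
  unfolding qf_def by (intro sum_nonneg mult_nonneg_nonneg lam_nonneg) auto

lemma qf_diff_le: "qf N (\<lambda>k. x k - y k) \<le> 2 * qf N x + 2 * qf N y"
proof -
  have "lam k * (x k - y k)\<^sup>2 \<le> 2 * (lam k * (x k)\<^sup>2) + 2 * (lam k * (y k)\<^sup>2)" for k
  proof -
    have "0 \<le> (x k + y k)\<^sup>2" by simp
    then have "(x k - y k)\<^sup>2 \<le> 2 * (x k)\<^sup>2 + 2 * (y k)\<^sup>2" by (simp add: power2_diff power2_sum)
    from mult_left_mono[OF this lam_nonneg[of k]] show ?thesis by (simp add: algebra_simps)
  qed
  from sum_mono[OF this] show ?thesis by (simp add: qf_def sum.distrib sum_distrib_left)
qed

lemma qf_supp_mono: "supp N x \<Longrightarrow> N \<le> M \<Longrightarrow> qf M x = qf N x"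
  unfolding qf_def by (rule sum.mono_neutral_right) (auto simp: supp_def)

lemma lam_ge: "2 \<le> \<bar>k\<bar> \<Longrightarrow> of_int (\<bar>k\<bar> * (\<bar>k\<bar> - 1)) \<le> lam k"
proof -
  assume k: "2 \<le> \<bar>k\<bar>"
  have "\<bar>k\<bar> * (\<bar>k\<bar> - 1) = k\<^sup>2 - \<bar>k\<bar>" by (simp add: right_diff_distrib power2_eq_square)
  also have "... \<le> k\<^sup>2 - 1" using k by simp
  finally have "real_of_int (\<bar>k\<bar> * (\<bar>k\<bar> - 1)) \<le> of_int (k\<^sup>2 - 1)" by (simp only: of_int_le_iff)
  then show ?thesis using k by (auto simp: lam_def)
qed

lemma lam_pos: "2 \<le> \<bar>k\<bar> \<Longrightarrow> 0 < lam k"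
  using lam_ge[of k] by (smt (verit) mult_pos_pos of_int_0_less_iff)

lemma lam_le: "lam k \<le> (of_int k)\<^sup>2"
  by (simp add: lam_def)

lemma sq_le_lam: "2 \<le> \<bar>k\<bar> \<Longrightarrow> (of_int k)\<^sup>2 \<le> 4 / 3 * lam k"
proof -
  assume k: "2 \<le> \<bar>k\<bar>"
  have "(2::int)\<^sup>2 \<le> k\<^sup>2" using k by (subst abs_le_square_iff[symmetric]) simp
  then have "(4::real) \<le> (of_int k)\<^sup>2" by (metis of_int_le_iff of_int_numeral of_int_power power2_eq_square numeral_times_numeral semiring_norm(13) semiring_norm(11))
  then show ?thesis using k by (simp add: lam_def)
qed

text \<open>The lower bound |k| (|k| - 1) of \<open>lam k\<close> makes the sum telescope on either
  side of 0.\<close>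

lemma sum_inverse_lam:
  assumes "1 \<le> R"
  shows "(\<Sum>k\<in>modes N - modes R. 1 / lam k) \<le> 2 / real R"
proof -
  have tele: "(\<Sum>k = Suc R..M. 1 / (real k - 1) - 1 / real k) \<le> 1 / real R" for M
  proof (cases "R \<le> M")
    case True
    have "(\<Sum>k = Suc R..M. 1 / (real k - 1) - 1 / real k) = 1 / real R - 1 / real M"
      using True
    proof (induction M rule: dec_induct)
      case (step n)
      then show ?case by simp
    qed simp
    then show ?thesis by simp
  qed (use assms in simp)
  have half: "(\<Sum>k\<in>{int R + 1..int N}. 1 / lam k) \<le> 1 / real R"
  proof -
    have "(\<Sum>k\<in>{int R + 1..int N}. 1 / lam k) = (\<Sum>k = Suc R..N. 1 / lam (int k))"
      by (rule sum.reindex_bij_witness[where i = int and j = nat]) auto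
    also have "... \<le> (\<Sum>k = Suc R..N. 1 / (real k - 1) - 1 / real k)"
    proof (rule sum_mono)
      fix k assume k: "k \<in> {Suc R..N}"
      then have k2: "2 \<le> k" using assms by simp
      then have "real k * (real k - 1) \<le> lam (int k)" using lam_ge[of "int k"] by simp
      moreover have p: "0 < real k * (real k - 1)" using k2 by simp
      ultimately have "1 / lam (int k) \<le> 1 / (real k * (real k - 1))" by (intro divide_left_mono) auto
      also have "... = 1 / (real k - 1) - 1 / real k" using k2 by (simp add: field_simps)
      finally show "1 / lam (int k) \<le> 1 / (real k - 1) - 1 / real k" .
    qed
    finally show ?thesis using tele[of N] by linarith
  qed
  have neg: "(\<Sum>k\<in>{- int N..- int R - 1}. 1 / lam k) = (\<Sum>k\<in>{int R + 1..int N}. 1 / lam k)"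
    by (rule sum.reindex_bij_witness[where i = uminus and j = uminus]) auto
  have "modes N - modes R = {- int N..- int R - 1} \<union> {int R + 1..int N}" by auto
  then have "(\<Sum>k\<in>modes N - modes R. 1 / lam k) = (\<Sum>k\<in>{- int N..- int R - 1}. 1 / lam k) + (\<Sum>k\<in>{int R + 1..int N}. 1 / lam k)"
    by (simp, subst sum.union_disjoint) auto
  then show ?thesis using half neg by simp
qed

text \<open>Cauchy-Schwarz with the weights \<open>lam\<close>, which are positive on these modes
  because R \<ge> 1. This is the one-dimensional Sobolev embedding in coefficient form, with a gain
  for high modes.\<close>

lemma tail_sum_le:
  assumes "1 \<le> R"
  shows "(\<Sum>k\<in>modes N - modes R. \<bar>x k\<bar>) \<le> sqrt (2 / real R * qf N x)"
proof -
  let ?I = "modes N - modes R"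
  have p: "0 < lam k" if "k \<in> ?I" for k using that assms by (intro lam_pos) auto
  have e: "\<bar>x k\<bar> = (1 / sqrt (lam k)) * (sqrt (lam k) * \<bar>x k\<bar>)" if "k \<in> ?I" for k
    using p[OF that] by simp
  have "(\<Sum>k\<in>?I. \<bar>x k\<bar>)\<^sup>2 = (\<Sum>k\<in>?I. (1 / sqrt (lam k)) * (sqrt (lam k) * \<bar>x k\<bar>))\<^sup>2"
    by (rule arg_cong[OF sum.cong[OF refl e]])
  also have "... \<le> (\<Sum>k\<in>?I. (1 / sqrt (lam k))\<^sup>2) * (\<Sum>k\<in>?I. (sqrt (lam k) * \<bar>x k\<bar>)\<^sup>2)"
    by (rule Cauchy_Schwarz_ineq_sum)
  also have "(\<Sum>k\<in>?I. (1 / sqrt (lam k))\<^sup>2) = (\<Sum>k\<in>?I. 1 / lam k)"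
    by (intro sum.cong) (auto simp: power_divide lam_nonneg)
  also have "(\<Sum>k\<in>?I. (sqrt (lam k) * \<bar>x k\<bar>)\<^sup>2) = (\<Sum>k\<in>?I. lam k * (x k)\<^sup>2)"
    by (intro sum.cong) (auto simp: power_mult_distrib lam_nonneg)
  also have "(\<Sum>k\<in>?I. 1 / lam k) * (\<Sum>k\<in>?I. lam k * (x k)\<^sup>2) \<le> (2 / real R) * qf N x"
  proof (rule mult_mono)
    show "(\<Sum>k\<in>?I. lam k * (x k)\<^sup>2) \<le> qf N x" unfolding qf_def
      by (intro sum_mono2) (auto intro!: mult_nonneg_nonneg lam_nonneg)
  qed (use sum_inverse_lam[OF assms] in \<open>auto intro!: sum_nonneg mult_nonneg_nonneg lam_nonneg\<close>)
  finally show ?thesis by (rule real_le_rsqrt)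
qed

lemma sum_abs_modes_split:
  "(\<Sum>k\<in>modes M. \<bar>x k\<bar>) \<le> (\<Sum>k\<in>modes R. \<bar>x k :: real\<bar>) + (\<Sum>k\<in>modes M - modes R. \<bar>x k\<bar>)"
proof -
  have "(\<Sum>k\<in>modes M. \<bar>x k\<bar>) \<le> (\<Sum>k\<in>modes R \<union> (modes M - modes R). \<bar>x k\<bar>)" by (rule sum_mono2) auto
  also have "... = (\<Sum>k\<in>modes R. \<bar>x k\<bar>) + (\<Sum>k\<in>modes M - modes R. \<bar>x k\<bar>)" by (rule sum.union_disjoint) auto
  finally show ?thesis .
qed

lemma tail_sum_le_dcoef:
  assumes R: "1 \<le> R"
  shows "(\<Sum>k\<in>modes M - modes R. \<bar>v k\<bar>) \<le> 1 / real R * sqrt (2 / real R * qf M (dcoef v))"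
proof -
  have "(\<Sum>k\<in>modes M - modes R. \<bar>v k\<bar>) \<le> (\<Sum>k\<in>modes M - modes R. 1 / real R * \<bar>dcoef v (- k)\<bar>)"
  proof (rule sum_mono)
    fix k assume k: "k \<in> modes M - modes R"
    then have "real R \<le> \<bar>of_int k\<bar>" by auto
    then have "real R * \<bar>v k\<bar> \<le> \<bar>of_int k\<bar> * \<bar>v k\<bar>" by (intro mult_right_mono) auto
    then show "\<bar>v k\<bar> \<le> 1 / real R * \<bar>dcoef v (- k)\<bar>" using R by (simp add: dcoef_def abs_mult field_simps)
  qed
  also have "... = 1 / real R * (\<Sum>k\<in>modes M - modes R. \<bar>dcoef v (- k)\<bar>)" by (simp add: sum_distrib_left)
  also have "(\<Sum>k\<in>modes M - modes R. \<bar>dcoef v (- k)\<bar>) = (\<Sum>k\<in>modes M - modes R. \<bar>dcoef v k\<bar>)"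
    by (rule sum.reindex_bij_witness[where i = uminus and j = uminus]) auto
  also have "1 / real R * ... \<le> 1 / real R * sqrt (2 / real R * qf M (dcoef v))"
    by (intro mult_left_mono tail_sum_le R) simp
  finally show ?thesis .
qed

text \<open>The energy is a sum of (lam k * y k)^2 / lam k over |k| \<ge> 2, and 1 / lam k is
  summable.\<close>

lemma qf_le_of_bound:
  assumes "\<And>k. \<bar>lam k * y k\<bar> \<le> A"
  shows "qf M y \<le> 2 * A\<^sup>2"
proof -
  have t: "lam k * (y k)\<^sup>2 \<le> (if k \<in> modes M - modes 1 then A\<^sup>2 * (1 / lam k) else 0)" if "k \<in> modes M" for k
  proof (cases "k \<in> modes 1")
    case True
    then have "k = -1 \<or> k = 0 \<or> k = 1" by auto
    then show ?thesis by auto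
  next
    case False
    then have l: "0 < lam k" by (intro lam_pos) auto
    have "\<bar>lam k * y k\<bar>\<^sup>2 \<le> A\<^sup>2" using assms[of k] by (intro power_mono) auto
    then have "(lam k * (y k)\<^sup>2) * lam k \<le> A\<^sup>2" by (simp add: power2_eq_square mult_ac)
    then show ?thesis using False that l by (simp add: field_simps)
  qed
  have "qf M y \<le> (\<Sum>k\<in>modes M. if k \<in> modes M - modes 1 then A\<^sup>2 * (1 / lam k) else 0)"
    unfolding qf_def by (intro sum_mono t)
  also have "... = A\<^sup>2 * (\<Sum>k\<in>modes M - modes 1. 1 / lam k)"
    by (subst sum.inter_restrict[symmetric]) (auto simp: sum_distrib_left intro!: sum.cong)
  also have "... \<le> A\<^sup>2 * (2 / real 1)" by (intro mult_left_mono sum_inverse_lam) auto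
  finally show ?thesis by simp
qed

text \<open>The growth factor is implicit: y (Suc n) multiplies x (Suc n). Strong induction gives (1
  - y n) * x n \<le> (1 - y n) * 2 * x m, and 1 - y n \<ge> 1/2 can be cancelled. Only the sum of
  the rates matters, so the bound does not see the number of steps.\<close>

lemma gronwall_half:
  fixes x y z :: "nat \<Rightarrow> real"
  assumes nn: "\<And>n. 0 \<le> x n" "\<And>n. 0 \<le> y n" "\<And>n. 0 \<le> z n"
    and step: "\<And>n. Suc n < N \<Longrightarrow> x (Suc n) + z (Suc n) \<le> x n + y (Suc n) * x (Suc n)"
    and y: "(\<Sum>n<N. y n) \<le> 1 / 2"
    and mn: "m \<le> n" "n < N"
  shows "x n + (\<Sum>i\<in>{m<..n}. z i) \<le> 2 * x m"
proof -
  have sy: "(\<Sum>i\<in>{m<..n}. y i) \<le> 1 / 2" if "n < N" for n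
    using sum_mono2[of "{..<N}" "{m<..n}" y] that y nn(2) by fastforce
  have gen: "x n + (\<Sum>i\<in>{m<..n}. z i) \<le> x m + (\<Sum>i\<in>{m<..n}. y i * x i)" if "m \<le> n" "n < N" for n
    using that
  proof (induction n rule: dec_induct)
    case (step n)
    have "{m<..Suc n} = insert (Suc n) {m<..n}" using step by auto
    then show ?case using step assms(4)[of n] by simp
  qed simp
  have x2: "x n \<le> 2 * x m" if "m \<le> n" "n < N" for n
    using that
  proof (induction n rule: less_induct)
    case (less n)
    show ?case
    proof (cases "n = m")
      case True
      then show ?thesis using nn(1)[of m] by simp
    next
      case False
      then have mn: "m < n" using less by simp
      have s: "{m<..n} = insert n {m<..<n}" using mn by auto
      have "x n \<le> x n + (\<Sum>i\<in>{m<..n}. z i)" using nn by (simp add: sum_nonneg)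
      also have "... \<le> x m + (\<Sum>i\<in>{m<..n}. y i * x i)" using gen less mn by simp
      also have "(\<Sum>i\<in>{m<..n}. y i * x i) = y n * x n + (\<Sum>i\<in>{m<..<n}. y i * x i)" by (simp add: s)
      also have "(\<Sum>i\<in>{m<..<n}. y i * x i) \<le> (\<Sum>i\<in>{m<..<n}. y i * (2 * x m))"
        using less nn by (intro sum_mono mult_left_mono) auto
      also have "... = (\<Sum>i\<in>{m<..<n}. y i) * (2 * x m)" by (simp add: sum_distrib_right)
      also have "(\<Sum>i\<in>{m<..<n}. y i) \<le> 1 / 2 - y n" using sy[of n] less(3) by (simp add: s)
      finally have "x n \<le> x m + (y n * x n + (1 / 2 - y n) * (2 * x m))"
        using nn by (simp add: mult_right_mono)
      then have "(1 - y n) * x n \<le> (1 - y n) * (2 * x m)" by (simp add: algebra_simps)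
      moreover have "y n \<le> 1 / 2" using sy[of n] less(3) nn(2) by (simp add: s) (smt (verit) sum_nonneg)
      ultimately show ?thesis by (simp add: mult_le_cancel_left)
    qed
  qed
  have "x n + (\<Sum>i\<in>{m<..n}. z i) \<le> x m + (\<Sum>i\<in>{m<..n}. y i * x i)" by (rule gen[OF mn])
  also have "(\<Sum>i\<in>{m<..n}. y i * x i) \<le> (\<Sum>i\<in>{m<..n}. y i * (2 * x m))"
    using mn nn x2 by (intro sum_mono mult_left_mono) auto
  also have "... = (\<Sum>i\<in>{m<..n}. y i) * (2 * x m)" by (simp add: sum_distrib_right)
  also have "... \<le> 1 / 2 * (2 * x m)" using sy[OF mn(2)] nn by (intro mult_right_mono) auto
  finally show ?thesis by simp
qed

section \<open>The weight and the discrete flow: energy identity and growth of the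
  dissipation\<close>

locale weight =
  fixes \<rho> b0 b1 L :: real and b :: "real \<Rightarrow> real"
  assumes \<rho>: "1 < \<rho>" and b0: "0 < b0" and b_ge: "\<And>x. b0 \<le> b x" and b_le: "\<And>x. b x \<le> b1"
    and L: "0 \<le> L" and b_lip: "\<And>x y. \<bar>b x - b y\<bar> \<le> L * \<bar>x - y\<bar>"
begin

lemma b_pos: "0 < b x"
  using b0 b_ge less_le_trans by blast

lemma b1_pos: "0 < b1"
  using b_pos b_le less_le_trans by blast

lemma continuous_on_b: "continuous_on S b"
proof (rule continuous_onI)
  fix x e :: real assume e: "0 < e"
  have "\<bar>b y - b x\<bar> \<le> e" if "\<bar>y - x\<bar> < e / (L + 1)" for y
  proof -
    have "\<bar>b y - b x\<bar> \<le> L * \<bar>y - x\<bar>" by (rule b_lip)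
    also have "... \<le> (L + 1) * (e / (L + 1))" using that L e by (intro mult_mono) auto
    finally show ?thesis using L by simp
  qed
  then show "\<exists>d>0. \<forall>y\<in>S. dist y x < d \<longrightarrow> dist (b y) (b x) \<le> e"
    using e L by (intro exI[of _ "e / (L + 1)"]) (auto simp: dist_real_def)
qed

lemma continuous_on_b_comp [continuous_intros]:
  fixes f :: "'a::t2_space \<Rightarrow> real"
  shows "continuous_on S f \<Longrightarrow> continuous_on S (\<lambda>x. b (f x))"
  by (rule continuous_on_compose2[OF continuous_on_b[of UNIV]]) auto

end

text \<open>Time step and number of modes are tied together, so that N steps cover the unit time
  interval and a single index governs the refinement.\<close>

locale discrete_flow = weight +
  fixes N :: nat and \<tau> :: real and c j :: "nat \<Rightarrow> int \<Rightarrow> real"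
  assumes scheme: "scheme N \<tau> \<rho> b c j" and N: "1 \<le> N" and \<tau>: "\<tau> = 1 / real N"
begin

definition h where "h n = trig N (c n)"
definition J where "J n = trig N (j (Suc n))"
definition D where "D n = (AVG x. b (h n x) * \<bar>J n x\<bar> powr (\<rho> + 1))"
text \<open>The numerical dissipation of an implicit step. It enters the energy identity with the
  factor \<tau>^2 but \<open>diss_diff\<close> only with \<tau>; the latter is what bounds its time
  integral and thereby the derivatives of the flux.\<close>

definition S where "S n = qf N (dcoef (j (Suc n)))"
definition flux_coef where "flux_coef n = coef (\<lambda>x. b (h n x) * spow \<rho> (J n x))"

lemma \<tau>_pos: "0 < \<tau>" using N \<tau> by simp

lemma supp_c: "supp N (c n)" and supp_j: "supp N (j n)"
  and c_Suc: "c (Suc n) k = c n k - \<tau> * dcoef (j (Suc n)) k"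
  using scheme by (auto simp: scheme_def)

lemma flux_coef_eq: "k \<in> modes N \<Longrightarrow> of_int k * lam k * c (Suc n) (- k) = flux_coef n k"
  using scheme unfolding scheme_def flux_coef_def h_def J_def by blast

lemma continuous_on_h [continuous_intros]:
  fixes f :: "'a::t2_space \<Rightarrow> real"
  shows "continuous_on A f \<Longrightarrow> continuous_on A (\<lambda>x. h n (f x))"
  unfolding h_def by (intro continuous_intros)

lemma continuous_on_J [continuous_intros]:
  fixes f :: "'a::t2_space \<Rightarrow> real"
  shows "continuous_on A f \<Longrightarrow> continuous_on A (\<lambda>x. J n (f x))"
  unfolding J_def by (intro continuous_intros)

lemma integrable_flux: "integrable circle (\<lambda>x. b (h n x) * spow \<rho> (J m x))"
  by (intro circle_integrable continuous_intros) (use \<rho> in auto)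

lemma integrable_diss: "integrable circle (\<lambda>x. b (h n x) * \<bar>J m x\<bar> powr (\<rho> + 1))"
  by (intro circle_integrable continuous_intros) (use \<rho> in auto)

lemma D_nonneg: "0 \<le> D n"
  unfolding D_def using b_pos by (intro average_nonneg) (simp add: less_imp_le)

lemma S_nonneg: "0 \<le> S n"
  unfolding S_def by (rule qf_nonneg)

text \<open>The flux equation tested with a trigonometric polynomial; reflecting k moves the
  derivative to the test function.\<close>

lemma average_flux_trig:
  "(AVG x. b (h n x) * spow \<rho> (J n x) * trig N y x) = (\<Sum>k\<in>modes N. lam k * c (Suc n) k * dcoef y k)"
proof -
  have "(AVG x. b (h n x) * spow \<rho> (J n x) * trig N y x) = (\<Sum>k\<in>modes N. flux_coef n k * y k)"
    unfolding flux_coef_def by (rule average_mult_trig[OF integrable_flux])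
  also have "... = (\<Sum>k\<in>modes N. of_int k * lam k * c (Suc n) (- k) * y k)"
    by (intro sum.cong) (simp_all add: flux_coef_eq)
  also have "... = (\<Sum>k\<in>modes N. lam k * c (Suc n) k * dcoef y k)"
    by (subst sum_modes_uminus[symmetric]) (simp add: dcoef_def mult_ac)
  finally show ?thesis .
qed

lemma average_flux_J:
  "(AVG x. b (h n x) * spow \<rho> (J n x) * J m x) = (\<Sum>k\<in>modes N. lam k * c (Suc n) k * dcoef (j (Suc m)) k)"
  unfolding J_def[of m] by (rule average_flux_trig)

lemma D_eq: "D n = (AVG x. b (h n x) * spow \<rho> (J n x) * J n x)"
  by (simp add: D_def mult.assoc spow_mult_self)

lemma energy: "qf N (c (Suc n)) + \<tau>\<^sup>2 * S n + 2 * \<tau> * D n = qf N (c n)"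
proof -
  have "qf N (c n) = (\<Sum>k\<in>modes N. lam k * (c (Suc n) k + \<tau> * dcoef (j (Suc n)) k)\<^sup>2)"
    by (simp add: qf_def c_Suc)
  also have "... = qf N (c (Suc n)) + \<tau>\<^sup>2 * S n + 2 * \<tau> * (\<Sum>k\<in>modes N. lam k * c (Suc n) k * dcoef (j (Suc n)) k)"
    unfolding qf_def S_def sum_distrib_left sum.distrib[symmetric]
    by (intro sum.cong refl) (simp add: power2_eq_square algebra_simps)
  finally show ?thesis by (simp add: D_eq average_flux_J)
qed

lemma energy_sum: "qf N (c (m + n)) + \<tau>\<^sup>2 * (\<Sum>i<n. S (m + i)) + 2 * \<tau> * (\<Sum>i<n. D (m + i)) = qf N (c m)"
proof (induction n)
  case (Suc n)
  then show ?case using energy[of "m + n"] unfolding sum.lessThan_Suc distrib_left add_Suc_right by linarith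
qed simp

lemma energy_terms_nonneg: "0 \<le> \<tau>\<^sup>2 * (\<Sum>i<n. S i)" "0 \<le> 2 * \<tau> * (\<Sum>i<n. D i)"
  using \<tau>_pos by (auto intro!: mult_nonneg_nonneg sum_nonneg S_nonneg D_nonneg)

lemma qf_c_le: "qf N (c n) \<le> qf N (c 0)"
  using energy_sum[of 0 n] energy_terms_nonneg[of n] by simp

lemma sum_D_le: "\<tau> * (\<Sum>i<n. D i) \<le> qf N (c 0) / 2"
  using energy_sum[of 0 n] energy_terms_nonneg[of n] qf_nonneg[of N "c n"] by simp

lemma sum_S_le: "\<tau>\<^sup>2 * (\<Sum>i<n. S i) \<le> qf N (c 0)"
  using energy_sum[of 0 n] energy_terms_nonneg[of n] qf_nonneg[of N "c n"] by simp

text \<open>The equation of one step is tested with the flux of the next, a discrete substitute for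
  differentiating the dissipation in time. After Young's inequality it compares D (Suc n) with D n
  and gains \<tau> * S (Suc n).\<close>

lemma diss_diff: "D (Suc n) + \<tau> * S (Suc n) = (AVG x. b (h n x) * spow \<rho> (J n x) * J (Suc n) x)"
proof -
  have "(AVG x. b (h n x) * spow \<rho> (J n x) * J (Suc n) x)
      = (\<Sum>k\<in>modes N. lam k * (c (Suc (Suc n)) k + \<tau> * dcoef (j (Suc (Suc n))) k) * dcoef (j (Suc (Suc n))) k)"
    unfolding average_flux_J by (simp add: c_Suc[of "Suc n"])
  also have "... = D (Suc n) + \<tau> * S (Suc n)"
    unfolding D_eq average_flux_J S_def qf_def sum_distrib_left sum.distrib[symmetric]
    by (intro sum.cong refl) (simp add: power2_eq_square algebra_simps)
  finally show ?thesis by simp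
qed

lemma average_J_powr_le: "pavg (\<rho> + 1) (J n) \<le> D n / b0"
proof -
  have i: "integrable circle (\<lambda>x. \<bar>J n x\<bar> powr (\<rho> + 1))"
    by (intro circle_integrable continuous_intros) (use \<rho> in auto)
  have "(AVG x. b0 * \<bar>J n x\<bar> powr (\<rho> + 1)) \<le> D n"
    unfolding D_def using i b_ge by (intro average_mono integrable_diss) (auto intro!: mult_right_mono)
  then show ?thesis using b0 by (simp add: average_cmult field_simps)
qed

lemma average_abs_J_le:
  assumes "0 < l"
  shows "(AVG x. \<bar>J n x\<bar>) \<le> l + l powr (- \<rho>) * D n / b0"
proof -
  have i: "integrable circle (\<lambda>x. \<bar>J n x\<bar> powr (\<rho> + 1))"
    by (intro circle_integrable continuous_intros) (use \<rho> in auto)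
  have "(AVG x. \<bar>J n x\<bar>) \<le> (AVG x. l + l powr (- \<rho>) * \<bar>J n x\<bar> powr (\<rho> + 1))"
  proof (rule average_mono)
    show "integrable circle (\<lambda>x. \<bar>J n x\<bar>)" by (intro circle_integrable continuous_intros)
    show "\<bar>J n x\<bar> \<le> l + l powr (- \<rho>) * \<bar>J n x\<bar> powr (\<rho> + 1)" for x
      using le_powr_split[of "\<bar>J n x\<bar>" l \<rho>] assms \<rho> by simp
  qed (use i in simp)
  also have "... = l + l powr (- \<rho>) * pavg (\<rho> + 1) (J n)"
    using i by (simp add: average_add average_const average_cmult)
  also have "... \<le> l + l powr (- \<rho>) * (D n / b0)"
    by (intro add_left_mono mult_left_mono average_J_powr_le) auto
  finally show ?thesis by simp
qed

lemma abs_j_le: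
  assumes "0 < l"
  shows "\<bar>j (Suc n) k\<bar> \<le> 2 * (l + l powr (- \<rho>) * D n / b0)"
proof (cases "k \<in> modes N")
  case True
  then have "j (Suc n) k = coef (J n) k" by (simp add: J_def coef_trig)
  also have "\<bar>...\<bar> \<le> 2 * (AVG x. \<bar>J n x\<bar>)"
    unfolding J_def by (rule abs_coef_le[OF integrable_trig])
  also have "... \<le> 2 * (l + l powr (- \<rho>) * D n / b0)"
    by (intro mult_left_mono average_abs_J_le assms) auto
  finally show ?thesis .
next
  case False
  then have "j (Suc n) k = 0" using supp_j by (auto simp: supp_def)
  then show ?thesis using assms D_nonneg[of n] b0 by (auto intro!: add_nonneg_nonneg mult_nonneg_nonneg divide_nonneg_pos)
qed

text \<open>S does not see the modes 1 and -1. They are bounded by the L1 norm of the flux and hence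
  by D, all higher modes by S.\<close>

lemma abs_dcoef_sum_le:
  assumes "0 < l"
  shows "(\<Sum>k\<in>modes N. \<bar>dcoef (j (Suc n)) k\<bar>) \<le> 4 * (l + l powr (- \<rho>) * D n / b0) + sqrt (2 * S n)"
proof -
  let ?f = "\<lambda>k. \<bar>dcoef (j (Suc n)) k\<bar>"
  have "(\<Sum>k\<in>modes N. ?f k) \<le> (\<Sum>k\<in>modes 1. ?f k) + (\<Sum>k\<in>modes N - modes 1. ?f k)" by (rule sum_abs_modes_split)
  also have "(\<Sum>k\<in>modes N - modes 1. ?f k) \<le> sqrt (2 / real 1 * S n)"
    unfolding S_def by (rule tail_sum_le) simp
  also have "(\<Sum>k\<in>modes 1. ?f k) = \<bar>j (Suc n) 1\<bar> + \<bar>j (Suc n) (-1)\<bar>"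
  proof -
    have "modes 1 = {-1, 0, 1}" by auto
    then show ?thesis by (simp add: dcoef_def)
  qed
  finally show ?thesis using abs_j_le[OF assms, of n 1] abs_j_le[OF assms, of n "-1"] by simp
qed

lemma h_diff_le:
  assumes "0 < l"
  shows "\<bar>h n x - h (Suc n) x\<bar> \<le> 2 * \<tau> * (4 * (l + l powr (- \<rho>) * D n / b0) + sqrt (2 * S n))"
proof -
  have "h n x - h (Suc n) x = \<tau> * trig N (dcoef (j (Suc n))) x"
    unfolding h_def trig_diff trig_cmult by (simp add: c_Suc)
  also have "\<bar>...\<bar> = \<tau> * \<bar>trig N (dcoef (j (Suc n))) x\<bar>" using \<tau>_pos by (simp add: abs_mult)
  also have "... \<le> \<tau> * (2 * (\<Sum>k\<in>modes N. \<bar>dcoef (j (Suc n)) k\<bar>))"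
    using \<tau>_pos by (intro mult_left_mono abs_trig_le) auto
  also have "... \<le> \<tau> * (2 * (4 * (l + l powr (- \<rho>) * D n / b0) + sqrt (2 * S n)))"
    using \<tau>_pos abs_dcoef_sum_le[OF assms] by (intro mult_left_mono) auto
  finally show ?thesis by (simp only: mult.assoc mult.left_commute)
qed

text \<open>The quantity followed by the Gronwall argument: \<rho> / (\<rho> + 1) is the share of
  the dissipation left by Young's inequality, and the S part absorbs that change of height which
  only S controls.\<close>

definition X where "X n = \<rho> / (\<rho> + 1) * D n + \<tau> * S n / 2"

text \<open>The growth rate. D (n - 1) bounds the change of height in the preceding step, and l is
  the scale left free in the L1 bound of the flux.\<close>

definition Y where
  "Y l n = \<tau> * (8 * (L / b0)\<^sup>2 * D n + 16 * (L / b0) * (l + l powr (- \<rho>) * D (n - 1) / b0))"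

lemma X_nonneg: "0 \<le> X n"
  using D_nonneg S_nonneg \<rho> \<tau>_pos by (simp add: X_def)

lemma D_le_X: "D n \<le> 2 * X n"
proof -
  define s where "s = \<rho> / (\<rho> + 1)"
  have "1 / 2 \<le> s" using \<rho> by (simp add: s_def field_simps)
  then have "1 / 2 * D n \<le> s * D n" by (intro mult_right_mono D_nonneg)
  moreover have "0 \<le> \<tau> * S n" using S_nonneg \<tau>_pos by simp
  ultimately show ?thesis unfolding X_def s_def[symmetric] by simp
qed

text \<open>With an unchanged weight, Young's inequality in \<open>diss_diff\<close> would make D
  decrease. The weight changes by a relative amount of at most L / b0 times the change of height,
  and \<open>h_diff_le\<close> bounds that change by D n and sqrt (S n).\<close>

lemma X_step:
  assumes l: "0 < l"
  shows "X (Suc n) + \<tau> * S (Suc n) / 2 \<le> X n + Y l (Suc n) * X (Suc n)"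
proof -
  let ?r = "\<rho> + 1"
  define K where "K = L / b0"
  have K: "0 \<le> K" using L b0 by (simp add: K_def)
  define A where "A = l + l powr (- \<rho>) * D n / b0"
  define H where "H = 2 * \<tau> * (4 * A + sqrt (2 * S n))"
  let ?D' = "D (Suc n)"
  have hd: "\<bar>h n x - h (Suc n) x\<bar> \<le> H" for x unfolding H_def A_def by (rule h_diff_le[OF l])
  have H: "0 \<le> H" using hd[of 0] by linarith
  have "?D' + \<tau> * S (Suc n) = (AVG x. b (h n x) * (spow \<rho> (J n x) * J (Suc n) x))"
    by (simp add: diss_diff mult.assoc)
  also have "... \<le> (AVG x. b (h (Suc n) x) * \<bar>J (Suc n) x\<bar> powr ?r * ((1 + K * H) / ?r)
        + b (h n x) * \<bar>J n x\<bar> powr ?r * (\<rho> / ?r))"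
  proof (rule average_mono)
    show "integrable circle (\<lambda>x. b (h n x) * (spow \<rho> (J n x) * J (Suc n) x))"
      by (intro circle_integrable continuous_intros) (use \<rho> in auto)
    show "integrable circle (\<lambda>x. b (h (Suc n) x) * \<bar>J (Suc n) x\<bar> powr ?r * ((1 + K * H) / ?r)
        + b (h n x) * \<bar>J n x\<bar> powr ?r * (\<rho> / ?r))"
      using integrable_diss by (intro Bochner_Integration.integrable_add Bochner_Integration.integrable_mult_left) auto
    fix x
    have "b (h n x) \<le> b (h (Suc n) x) + L * H"
    proof -
      have "\<bar>b (h n x) - b (h (Suc n) x)\<bar> \<le> L * H"
        using b_lip[of "h n x" "h (Suc n) x"] mult_left_mono[OF hd[of x] L] by linarith
      then show ?thesis by linarith
    qed
    also have "L * H = b0 * (K * H)" using b0 by (simp add: K_def)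
    also have "b (h (Suc n) x) + b0 * (K * H) \<le> b (h (Suc n) x) * (1 + K * H)"
      using mult_right_mono[OF b_ge[of "h (Suc n) x"], of "K * H"] K H by (simp add: distrib_left)
    finally have bb: "b (h n x) \<le> b (h (Suc n) x) * (1 + K * H)" .
    have "b (h n x) * (spow \<rho> (J n x) * J (Suc n) x)
        \<le> b (h n x) * (\<bar>J (Suc n) x\<bar> powr ?r / ?r + \<rho> / ?r * \<bar>J n x\<bar> powr ?r)"
      using \<rho> b_pos by (intro mult_left_mono spow_Young) (auto simp: less_imp_le)
    also have "... = b (h n x) * (\<bar>J (Suc n) x\<bar> powr ?r / ?r) + b (h n x) * \<bar>J n x\<bar> powr ?r * (\<rho> / ?r)"
      by (simp add: distrib_left mult_ac)
    also have "b (h n x) * (\<bar>J (Suc n) x\<bar> powr ?r / ?r) \<le> b (h (Suc n) x) * (1 + K * H) * (\<bar>J (Suc n) x\<bar> powr ?r / ?r)"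
      using bb \<rho> by (intro mult_right_mono) auto
    finally show "b (h n x) * (spow \<rho> (J n x) * J (Suc n) x)
      \<le> b (h (Suc n) x) * \<bar>J (Suc n) x\<bar> powr ?r * ((1 + K * H) / ?r) + b (h n x) * \<bar>J n x\<bar> powr ?r * (\<rho> / ?r)"
      by (simp add: mult_ac)
  qed
  also have "... = ?D' * ((1 + K * H) / ?r) + D n * (\<rho> / ?r)"
    unfolding D_def average_cmult_right[symmetric]
    by (intro average_add Bochner_Integration.integrable_mult_left impI integrable_diss)
  finally have "?D' + \<tau> * S (Suc n) \<le> ?D' * (1 / ?r) + K * H * ?D' / ?r + \<rho> / ?r * D n"
    by (simp add: add_divide_distrib distrib_left mult_ac)
  moreover have "?D' - ?D' * (1 / ?r) = \<rho> / ?r * ?D'" using \<rho> by (simp add: field_simps)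
  moreover have "K * H * ?D' / ?r \<le> K * H * ?D' / 1"
    using \<rho> K H D_nonneg[of "Suc n"] by (intro divide_left_mono mult_nonneg_nonneg) auto
  then have "K * H * ?D' / ?r \<le> K * H * ?D'" by simp
  ultimately have 1: "\<rho> / ?r * ?D' + \<tau> * S (Suc n) \<le> \<rho> / ?r * D n + K * H * ?D'"
    by linarith
  have "K * H * ?D' = \<tau> * (8 * K * A * ?D' + 2 * (2 * K * ?D') * sqrt (2 * S n) / 2)"
    by (simp add: H_def algebra_simps)
  \<comment> \<open>Completing the square splits off sqrt (S n) such that exactly \<tau> * S n / 2
    remains, the S part of \<open>X n\<close>.\<close>
  also have "... \<le> \<tau> * (8 * K * A * ?D' + (4 * K\<^sup>2 * ?D'\<^sup>2 + S n / 2))"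
  proof -
    have "0 \<le> (2 * K * ?D' - sqrt (2 * S n) / 2)\<^sup>2" by simp
    also have "... = 4 * K\<^sup>2 * ?D'\<^sup>2 + S n / 2 - 2 * (2 * K * ?D') * sqrt (2 * S n) / 2"
      using S_nonneg[of n] by (simp add: power2_diff power_mult_distrib power_divide)
    finally show ?thesis using \<tau>_pos by (intro mult_left_mono) auto
  qed
  also have "... = \<tau> * (8 * K * A + 4 * K\<^sup>2 * ?D') * ?D' + \<tau> * S n / 2"
    by (simp add: power2_eq_square algebra_simps)
  also have "\<tau> * (8 * K * A + 4 * K\<^sup>2 * ?D') * ?D' \<le> \<tau> * (8 * K * A + 4 * K\<^sup>2 * ?D') * (2 * X (Suc n))"
    using \<tau>_pos K D_nonneg l b0 by (intro mult_left_mono D_le_X mult_nonneg_nonneg add_nonneg_nonneg)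
      (auto simp: A_def intro!: mult_nonneg_nonneg add_nonneg_nonneg divide_nonneg_pos)
  also have "\<tau> * (8 * K * A + 4 * K\<^sup>2 * ?D') * (2 * X (Suc n)) = Y l (Suc n) * X (Suc n)"
    by (simp add: Y_def A_def K_def algebra_simps)
  finally show ?thesis using 1 by (simp add: X_def)
qed

end

context discrete_flow begin

lemma sum_Y_le:
  assumes l: "0 < l"
  shows "(\<Sum>n<N. Y l n) \<le> 16 * (L / b0) * l + (4 * (L / b0)\<^sup>2 + 16 * (L / b0) * (l powr (- \<rho>) / b0)) * qf N (c 0)"
proof -
  define K where "K = L / b0"
  have K: "0 \<le> K" using L b0 by (simp add: K_def)
  define p where "p = l powr (- \<rho>) / b0"
  have p: "0 \<le> p" using b0 by (simp add: p_def)
  obtain M where M: "N = Suc M" using N by (cases N) auto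
  then have MM: "{..<N} = {..<Suc M}" by simp
  have 1: "\<tau> * (\<Sum>n<N. D n) \<le> qf N (c 0) / 2" by (rule sum_D_le)
  \<comment> \<open>Truncated subtraction makes D 0 occur twice, hence the crude factor 2.\<close>
  have "(\<Sum>n<N. D (n - 1)) = D 0 + (\<Sum>n<M. D n)"
    unfolding MM sum.lessThan_Suc_shift by simp
  also have "D 0 \<le> (\<Sum>n<N. D n)" using N by (intro member_le_sum) (auto intro: D_nonneg)
  also have "(\<Sum>n<M. D n) \<le> (\<Sum>n<N. D n)" unfolding MM using D_nonneg by simp
  finally have "\<tau> * (\<Sum>n<N. D (n - 1)) \<le> \<tau> * (2 * (\<Sum>n<N. D n))"
    using \<tau>_pos by (intro mult_left_mono) auto
  with 1 have 2: "\<tau> * (\<Sum>n<N. D (n - 1)) \<le> qf N (c 0)" by simp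
  have "(\<Sum>n<N. Y l n) = 8 * K\<^sup>2 * (\<tau> * (\<Sum>n<N. D n)) + 16 * K * (l * (\<tau> * real N)) + 16 * K * p * (\<tau> * (\<Sum>n<N. D (n - 1)))"
    unfolding Y_def K_def[symmetric]
    by (simp add: sum.distrib sum_distrib_left distrib_left p_def mult_ac)
  also have "\<tau> * real N = 1" using N \<tau> by simp
  also have "8 * K\<^sup>2 * (\<tau> * (\<Sum>n<N. D n)) \<le> 8 * K\<^sup>2 * (qf N (c 0) / 2)"
    by (intro mult_left_mono 1) auto
  also have "16 * K * p * (\<tau> * (\<Sum>n<N. D (n - 1))) \<le> 16 * K * p * qf N (c 0)"
    using K p by (intro mult_left_mono 2) auto
  finally show ?thesis by (simp add: K_def p_def algebra_simps)
qed

end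

context weight begin

text \<open>Smallness of the initial energy under which, for some scale l, the rates
  \<open>Y l\<close> sum to at most 1/2 by \<open>sum_Y_le\<close>. The condition does not involve
  the discretisation.\<close>

definition tame :: "real \<Rightarrow> bool" where
  "tame q \<longleftrightarrow> (\<exists>l>0. 16 * (L / b0) * l + (4 * (L / b0)\<^sup>2 + 16 * (L / b0) * (l powr (- \<rho>) / b0)) * q \<le> 1 / 2)"

lemma tame_exists: "\<exists>q0>0. \<forall>q\<le>q0. tame q"
proof -
  define K where "K = L / b0"
  have K: "0 \<le> K" using L b0 by (simp add: K_def)
  \<comment> \<open>First l makes the part without q at most 1/4; then q0 is chosen depending on
    l.\<close>
  define l where "l = 1 / (64 * K + 1)"
  have l: "0 < l" using K by (simp add: l_def)
  have "16 * K * l \<le> 1 / 4" using K by (simp add: l_def divide_simps)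
  define A where "A = 4 * K\<^sup>2 + 16 * K * (l powr (- \<rho>) / b0)"
  have A: "0 \<le> A" using K b0 by (simp add: A_def)
  define q0 where "q0 = 1 / (4 * (A + 1))"
  have "tame q" if "q \<le> q0" for q
  proof -
    have "A * q \<le> A * q0" using that A by (intro mult_left_mono)
    also have "... \<le> 1 / 4" using A by (simp add: q0_def divide_simps)
    finally have "16 * K * l + A * q \<le> 1 / 2" using \<open>16 * K * l \<le> 1 / 4\<close> by linarith
    then show ?thesis unfolding tame_def K_def[symmetric] using l A_def by blast
  qed
  moreover have "0 < q0" using A by (simp add: q0_def)
  ultimately show ?thesis by blast
qed

end

section \<open>Decay of the dissipation in time and of the coefficients in the mode number\<close>

context discrete_flow begin

lemma X_bound:
  assumes q: "tame (qf N (c 0))" and mn: "m \<le> n" "n < N"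
  shows "X n + (\<Sum>i\<in>{m<..n}. \<tau> * S i / 2) \<le> 2 * X m"
proof -
  obtain l where l: "0 < l" and y: "16 * (L / b0) * l + (4 * (L / b0)\<^sup>2 + 16 * (L / b0) * (l powr (- \<rho>) / b0)) * qf N (c 0) \<le> 1 / 2"
    using q by (auto simp: tame_def)
  show ?thesis
  proof (rule gronwall_half[where y = "Y l" and N = N])
    show "0 \<le> Y l n" for n
      using l L b0 \<tau>_pos D_nonneg unfolding Y_def
      by (intro mult_nonneg_nonneg add_nonneg_nonneg divide_nonneg_pos) auto
    show "(\<Sum>n<N. Y l n) \<le> 1 / 2" using sum_Y_le[OF l] y by linarith
    show "X (Suc n) + \<tau> * S (Suc n) / 2 \<le> X n + Y l (Suc n) * X (Suc n)" for n by (rule X_step[OF l])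
  qed (use mn X_nonneg S_nonneg \<tau>_pos in auto)
qed

text \<open>X never exceeds twice an earlier value, so its value at step n is at most twice its mean
  over the past, and the energy bounds the time integral. This is a smoothing effect of order 1 / t,
  independent of the initial flux.\<close>

lemma X_decay:
  assumes q: "tame (qf N (c 0))" and n: "n < N"
  shows "real (Suc n) * \<tau> * X n \<le> 2 * qf N (c 0)"
proof -
  have "X n \<le> 2 * X m" if "m \<le> n" for m
    using X_bound[OF q that n] sum_nonneg[of "{m<..n}" "\<lambda>i. \<tau> * S i / 2"] \<tau>_pos S_nonneg by fastforce
  then have "(\<Sum>m<Suc n. X n) \<le> (\<Sum>m<Suc n. 2 * X m)" by (intro sum_mono) auto
  also have "... = 2 * (\<rho> / (\<rho> + 1) * (\<Sum>m<Suc n. D m) + \<tau> * (\<Sum>m<Suc n. S m) / 2)"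
    by (simp only: X_def sum.distrib sum_distrib_left[symmetric] sum_divide_distrib[symmetric])
  also have "... \<le> 2 * (1 * (\<Sum>m<Suc n. D m) + \<tau> * (\<Sum>m<Suc n. S m) / 2)"
    using \<rho> D_nonneg by (intro mult_left_mono add_right_mono mult_right_mono sum_nonneg) auto
  finally have "real (Suc n) * X n \<le> 2 * (\<Sum>m<Suc n. D m) + \<tau> * (\<Sum>m<Suc n. S m)" by simp
  then have "\<tau> * (real (Suc n) * X n) \<le> \<tau> * (2 * (\<Sum>m<Suc n. D m) + \<tau> * (\<Sum>m<Suc n. S m))"
    using \<tau>_pos by (intro mult_left_mono) auto
  also have "... = 2 * (\<tau> * (\<Sum>m<Suc n. D m)) + \<tau>\<^sup>2 * (\<Sum>m<Suc n. S m)"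
    by (simp add: power2_eq_square algebra_simps)
  also have "... \<le> 2 * qf N (c 0)" using sum_D_le[of "Suc n"] sum_S_le[of "Suc n"] by linarith
  finally show ?thesis by (simp only: mult_ac)
qed

lemma D_decay:
  assumes q: "tame (qf N (c 0))" and n: "n < N" and a: "0 < a" "a \<le> real (Suc n) * \<tau>"
  shows "D n \<le> 4 * qf N (c 0) / a"
proof -
  have "a * D n \<le> real (Suc n) * \<tau> * (2 * X n)"
    using a D_le_X[of n] D_nonneg \<tau>_pos by (intro mult_mono) auto
  also have "... = 2 * (real (Suc n) * \<tau> * X n)" by (simp only: mult_ac)
  also have "... \<le> 4 * qf N (c 0)" using X_decay[OF q n] by linarith
  finally show ?thesis using a by (simp add: field_simps)
qed

lemma S_sum_decay:
  assumes q: "tame (qf N (c 0))" and n: "n < N" and m: "m \<le> n" and a: "0 < a" "a \<le> real (Suc m) * \<tau>"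
  shows "\<tau> * (\<Sum>i\<in>{m<..n}. S i) \<le> 8 * qf N (c 0) / a"
proof -
  have "(\<Sum>i\<in>{m<..n}. \<tau> * S i / 2) = \<tau> * (\<Sum>i\<in>{m<..n}. S i) / 2"
    by (simp add: sum_distrib_left sum_divide_distrib)
  then have 1: "\<tau> * (\<Sum>i\<in>{m<..n}. S i) \<le> 4 * X m"
    using X_bound[OF q m n] X_nonneg[of n] by simp
  have "a * X m \<le> real (Suc m) * \<tau> * X m" using a X_nonneg by (intro mult_right_mono) auto
  also have "... \<le> 2 * qf N (c 0)" using X_decay[OF q, of m] m n by simp
  finally have "X m \<le> 2 * qf N (c 0) / a" using a by (simp add: field_simps)
  moreover have "8 * qf N (c 0) / a = 4 * (2 * qf N (c 0) / a)" by simp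
  ultimately show ?thesis using 1 by linarith
qed

lemma c_diff_le:
  assumes l: "0 < l" and mn: "m \<le> n"
  shows "\<bar>c n k - c m k\<bar> \<le> 2 * \<bar>of_int k\<bar> * (l * (real (n - m) * \<tau>) + l powr (- \<rho>) / b0 * (\<tau> * (\<Sum>i\<in>{m..<n}. D i)))"
  using mn
proof (induction n rule: dec_induct)
  case (step n)
  let ?K = "2 * \<bar>of_int k\<bar> :: real"
  have "\<bar>c (Suc n) k - c n k\<bar> = \<tau> * \<bar>of_int k\<bar> * \<bar>j (Suc n) (- k)\<bar>"
    using \<tau>_pos by (simp add: c_Suc dcoef_def abs_mult)
  also have "... \<le> \<tau> * \<bar>of_int k\<bar> * (2 * (l + l powr (- \<rho>) * D n / b0))"
    using \<tau>_pos by (intro mult_left_mono abs_j_le l) auto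
  also have "... = ?K * (l * \<tau> + l powr (- \<rho>) / b0 * (\<tau> * D n))" by (simp add: algebra_simps)
  finally have "\<bar>c (Suc n) k - c m k\<bar> \<le> ?K * (l * (real (n - m) * \<tau>) + l powr (- \<rho>) / b0 * (\<tau> * (\<Sum>i\<in>{m..<n}. D i)))
      + ?K * (l * \<tau> + l powr (- \<rho>) / b0 * (\<tau> * D n))"
    using step.IH by linarith
  also have "... = ?K * (l * (real (Suc n - m) * \<tau>) + l powr (- \<rho>) / b0 * (\<tau> * (\<Sum>i\<in>{m..<Suc n}. D i)))"
    using step.hyps by (simp add: Suc_diff_le algebra_simps)
  finally show ?case .
qed simp

lemma c_diff_le':
  assumes l: "0 < l" and mn: "m \<le> n"
  shows "\<bar>c n k - c m k\<bar> \<le> 2 * \<bar>of_int k\<bar> * (l * (real (n - m) * \<tau>) + l powr (- \<rho>) / b0 * qf N (c 0))"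
proof -
  have "(\<Sum>i\<in>{m..<n}. D i) \<le> (\<Sum>i<n. D i)" by (rule sum_mono2) (auto intro: D_nonneg)
  then have "\<tau> * (\<Sum>i\<in>{m..<n}. D i) \<le> \<tau> * (\<Sum>i<n. D i)" using \<tau>_pos by (intro mult_left_mono) auto
  also have "... \<le> qf N (c 0)" using sum_D_le[of n] qf_nonneg[of N "c 0"] by linarith
  finally have "\<tau> * (\<Sum>i\<in>{m..<n}. D i) \<le> qf N (c 0)" .
  then show ?thesis
    using b0 by (intro order_trans[OF c_diff_le[OF l mn]] mult_left_mono add_left_mono) auto
qed

lemma c_zero_mode: "c n 0 = c 0 0"
  by (induction n) (auto simp: c_Suc dcoef_def)

lemma average_flux_le:
  assumes l: "0 < l"
  shows "pavg \<rho> (J n) \<le> l powr \<rho> + D n / (b0 * l)"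
proof -
  have i: "integrable circle (\<lambda>x. \<bar>J n x\<bar> powr \<rho>)" "integrable circle (\<lambda>x. \<bar>J n x\<bar> powr (\<rho> + 1))"
    by (intro circle_integrable continuous_intros; use \<rho> in simp)+
  have "pavg \<rho> (J n) \<le> (AVG x. l powr \<rho> + (1 / l) * \<bar>J n x\<bar> powr (\<rho> + 1))"
    using i powr_le_split[of "\<bar>J n _\<bar>" l \<rho>] l \<rho> by (intro average_mono) auto
  also have "... = l powr \<rho> + (1 / l) * pavg (\<rho> + 1) (J n)"
    using i(2) by (subst average_add) (auto simp: average_const average_cmult simp del: times_divide_eq_left)
  also have "... \<le> l powr \<rho> + (1 / l) * (D n / b0)"
    using l by (intro add_left_mono mult_left_mono average_J_powr_le) auto
  finally show ?thesis by (simp add: mult.commute)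
qed

lemma flux_coef_le: "\<bar>flux_coef n k\<bar> \<le> 2 * b1 * pavg \<rho> (J n)"
proof -
  have "\<bar>flux_coef n k\<bar> \<le> 2 * (AVG x. \<bar>b (h n x) * spow \<rho> (J n x)\<bar>)"
    unfolding flux_coef_def by (rule abs_coef_le[OF integrable_flux])
  also have "(AVG x. \<bar>b (h n x) * spow \<rho> (J n x)\<bar>) \<le> (AVG x. b1 * \<bar>J n x\<bar> powr \<rho>)"
  proof (rule average_mono)
    show "integrable circle (\<lambda>x. \<bar>b (h n x) * spow \<rho> (J n x)\<bar>)" using integrable_flux by (rule integrable_abs)
    show "integrable circle (\<lambda>x. b1 * \<bar>J n x\<bar> powr \<rho>)"
      by (intro circle_integrable continuous_intros; use \<rho> in simp)
    show "\<bar>b (h n x) * spow \<rho> (J n x)\<bar> \<le> b1 * \<bar>J n x\<bar> powr \<rho>" for x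
      unfolding abs_mult abs_spow using b_le[of "h n x"] b_pos[of "h n x"] by (intro mult_right_mono) auto
  qed
  finally show ?thesis by (simp add: average_cmult)
qed

text \<open>The flux equation read backwards: k * lam k * c is, up to reflection, a coefficient of
  the flux term and is bounded by its L1 norm. This is cubic decay in k.\<close>

lemma c_decay: "\<bar>of_int k * lam k * c (Suc n) k\<bar> \<le> 2 * b1 * pavg \<rho> (J n)"
proof (cases "k \<in> modes N")
  case True
  then have "of_int k * lam k * c (Suc n) k = - flux_coef n (- k)"
    using flux_coef_eq[of "-k" n] by simp
  then show ?thesis using flux_coef_le[of n "-k"] by simp
next
  case False
  then have "c (Suc n) k = 0" using supp_c by (auto simp: supp_def)
  then show ?thesis using b1_pos by (auto intro!: mult_nonneg_nonneg average_nonneg)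
qed

text \<open>Here the equation bounds the energy by the flux, in the direction opposite to the energy
  identity. The two together form a difference inequality with a sublinear power.\<close>

lemma qf_le_diss: "qf N (c (Suc n)) \<le> 8 * b1\<^sup>2 * (pavg \<rho> (J n))\<^sup>2"
proof -
  define F where "F = 2 * b1 * pavg \<rho> (J n)"
  have "\<bar>lam k * c (Suc n) k\<bar> \<le> F" for k
  proof (cases "k = 0")
    case False
    then have "1 * \<bar>lam k * c (Suc n) k\<bar> \<le> \<bar>of_int k\<bar> * \<bar>lam k * c (Suc n) k\<bar>" by (intro mult_right_mono) auto
    also have "... \<le> F" using c_decay[of k n] by (simp add: F_def abs_mult mult_ac)
    finally show ?thesis by simp
  qed (use b1_pos in \<open>auto simp: F_def lam_def intro!: mult_nonneg_nonneg average_nonneg\<close>)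
  then have "qf N (c (Suc n)) \<le> 2 * F\<^sup>2" by (rule qf_le_of_bound)
  then show ?thesis by (simp add: F_def power_mult_distrib)
qed

end

section \<open>Comparison of two discretisations\<close>

lemma bilinear_qf_le: "(\<Sum>k\<in>modes M. lam k * x k * y k) \<le> sqrt (qf M x) * sqrt (qf M y)"
proof -
  have "(\<Sum>k\<in>modes M. lam k * x k * y k)\<^sup>2 = (\<Sum>k\<in>modes M. (sqrt (lam k) * x k) * (sqrt (lam k) * y k))\<^sup>2"
    by (intro arg_cong[where f = "\<lambda>z. z\<^sup>2"] sum.cong refl) (simp add: lam_nonneg mult_ac)
  also have "... \<le> (\<Sum>k\<in>modes M. (sqrt (lam k) * x k)\<^sup>2) * (\<Sum>k\<in>modes M. (sqrt (lam k) * y k)\<^sup>2)"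
    by (rule Cauchy_Schwarz_ineq_sum)
  also have "... = qf M x * qf M y" by (simp add: qf_def power_mult_distrib lam_nonneg)
  finally have "(\<Sum>k\<in>modes M. lam k * x k * y k)\<^sup>2 \<le> qf M x * qf M y" .
  from real_le_rsqrt[OF this] show ?thesis by (simp add: real_sqrt_mult)
qed

text \<open>Strong monotonicity bounds the distance of the fluxes by three errors: the distance of
  the heights in the energy form, the distance of the weights, and a projection error. The last
  arises because the finer flux must be cut to the modes up to N before it can test the coarser
  equation.\<close>

lemma (in weight) comparison:
  fixes N M n m :: nat
  assumes A: "discrete_flow \<rho> b0 b1 L b N \<tau> c j" and B: "discrete_flow \<rho> b0 b1 L b M \<tau>' c' j'"
    and NM: "N \<le> M"
    and H: "\<And>x. \<bar>trig N (c n) x - trig M (c' m) x\<bar> \<le> H"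
  defines "F \<equiv> \<lambda>x. trig N (j (Suc n)) x" and "G \<equiv> \<lambda>x. trig M (j' (Suc m)) x"
  shows "2 powr (- \<rho>) * b0 * (AVG x. \<bar>F x - G x\<bar> powr (\<rho> + 1))
    \<le> sqrt (qf M (\<lambda>k. c (Suc n) k - c' (Suc m) k))
        * sqrt (2 * qf N (dcoef (j (Suc n))) + 2 * qf M (dcoef (j' (Suc m))))
      + L * H * (AVG x. \<bar>G x\<bar> powr \<rho> * (\<bar>F x\<bar> + \<bar>G x\<bar>))
      + b1 * pavg \<rho> F * (2 / real N * sqrt (2 * qf M (dcoef (j' (Suc m)))))"
proof -
  interpret A: discrete_flow \<rho> b0 b1 L b N \<tau> c j by (rule A)
  interpret B: discrete_flow \<rho> b0 b1 L b M \<tau>' c' j' by (rule B)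
  have F: "F = A.J n" and G: "G = B.J m" by (simp_all add: F_def G_def A.J_def B.J_def fun_eq_iff)
  define u v where "u = j (Suc n)" and "v = j' (Suc m)"
  have su: "supp N u" and sv: "supp M v" using A.supp_j B.supp_j by (simp_all add: u_def v_def)
  have sdu: "supp N (dcoef u)" using su by (auto simp: supp_def dcoef_def)
  have suM: "supp M u" by (rule supp_mono[OF su NM])
  have H0: "0 \<le> H" using H[of 0] by linarith
  note ci = continuous_intros
  let ?a = "\<lambda>x. b (A.h n x) * spow \<rho> (A.J n x)" and ?b = "\<lambda>x. b (B.h m x) * spow \<rho> (B.J m x)"
  have iA: "integrable circle (\<lambda>x. ?a x * f x)" and iB: "integrable circle (\<lambda>x. ?b x * f x)"
    if "continuous_on {0..2*pi} f" for f
    by (rule integrable_mult_continuous[OF A.integrable_flux that])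
       (rule integrable_mult_continuous[OF B.integrable_flux that])
  have cF: "continuous_on S (\<lambda>x. A.J n x)" and cG: "continuous_on S (\<lambda>x. B.J m x)"
    and cu: "continuous_on S (trig K w)" for S K w
    using continuous_on_trig[OF continuous_on_id] by (intro ci | simp)+
  have i3: "integrable circle (\<lambda>x. (b (B.h m x) - b (A.h n x)) * spow \<rho> (B.J m x) * (A.J n x - B.J m x))"
    by (intro circle_integrable ci) (use \<rho> in auto)
  let ?F = "A.J n" and ?G = "B.J m" and ?d = "\<lambda>k. u k - v k"
  let ?I1 = "(AVG x. ?a x * trig N ?d x) - (AVG x. ?b x * trig M ?d x)"
  let ?f2 = "\<lambda>x. (b (B.h m x) - b (A.h n x)) * spow \<rho> (?G x) * (?F x - ?G x)"
  let ?f3 = "\<lambda>x. ?a x * (trig N v x - ?G x)"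
  let ?m = "\<lambda>x. b (A.h n x) * ((spow \<rho> (?F x) - spow \<rho> (?G x)) * (?F x - ?G x))"
  let ?T = "2 / real N * sqrt (2 * qf M (dcoef v))"
  have tail: "\<bar>trig N v x - ?G x\<bar> \<le> ?T" for x
  proof -
    have "?G x = trig N v x + (\<Sum>k\<in>modes M - modes N. v k * cas k x)"
      unfolding B.J_def v_def[symmetric] trig_def using NM
      by (subst sum.subset_diff[of "modes N"]) auto
    then have "\<bar>trig N v x - ?G x\<bar> \<le> (\<Sum>k\<in>modes M - modes N. \<bar>v k\<bar> * \<bar>cas k x\<bar>)"
      by (simp add: abs_mult[symmetric])
    also have "... \<le> (\<Sum>k\<in>modes M - modes N. \<bar>v k\<bar> * 2)" by (intro sum_mono mult_left_mono abs_cas_le) auto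
    also have "... = 2 * (\<Sum>k\<in>modes M - modes N. \<bar>v k\<bar>)" by (simp add: sum_distrib_left mult.commute)
    also have "(\<Sum>k\<in>modes M - modes N. \<bar>v k\<bar>) \<le> 1 / real N * sqrt (2 / real N * qf M (dcoef v))"
      by (rule tail_sum_le_dcoef[OF A.N])
    also have "sqrt (2 / real N * qf M (dcoef v)) \<le> sqrt (2 * qf M (dcoef v))"
      using A.N qf_nonneg[of M "dcoef v"] by (intro real_sqrt_le_mono mult_right_mono) (auto simp: divide_le_eq)
    finally show ?thesis by (simp add: mult_left_mono divide_right_mono)
  qed
  have "2 powr (- \<rho>) * b0 * (AVG x. \<bar>F x - G x\<bar> powr (\<rho> + 1))
      = (AVG x. 2 powr (- \<rho>) * b0 * \<bar>?F x - ?G x\<bar> powr (\<rho> + 1))"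
    by (simp add: average_cmult F G)
  also have "... \<le> average ?m"
  proof (rule average_mono)
    show "integrable circle (\<lambda>x. 2 powr (- \<rho>) * b0 * \<bar>?F x - ?G x\<bar> powr (\<rho> + 1))" "integrable circle ?m"
      by (intro circle_integrable ci; use \<rho> in auto)+
    show "2 powr (- \<rho>) * b0 * \<bar>?F x - ?G x\<bar> powr (\<rho> + 1) \<le> ?m x" for x
    proof -
      have "b0 * (2 powr (- \<rho>) * \<bar>?F x - ?G x\<bar> powr (\<rho> + 1)) \<le> ?m x"
        using b0 b_ge b_pos \<rho> by (intro mult_mono spow_strong_mono) (auto simp: less_imp_le)
      then show ?thesis by (simp only: mult_ac)
    qed
  qed
  \<comment> \<open>The first two products are the two tested equations, \<open>?f2\<close>
    exchanges the weights, and \<open>?f3\<close> restores the modes that were cut off.\<close>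
  also have "... = (AVG x. (?a x * trig N ?d x - ?b x * trig M ?d x) + ?f2 x + ?f3 x)"
  proof (rule average_cong)
    fix x
    have 1: "trig N ?d x = ?F x - trig N v x"
      by (simp add: trig_diff[symmetric] A.J_def u_def)
    have 2: "trig M ?d x = ?F x - ?G x"
      by (simp add: trig_diff[symmetric] A.J_def B.J_def u_def v_def trig_supp_mono[OF su[unfolded u_def] NM])
    show "?m x = (?a x * trig N ?d x - ?b x * trig M ?d x) + ?f2 x + ?f3 x"
      unfolding 1 2 by (simp add: algebra_simps)
  qed
  also have "... = ?I1 + average ?f2 + average ?f3"
    by (intro average_add[THEN trans] arg_cong2[where f = "(+)"] average_diff refl
        Bochner_Integration.integrable_add Bochner_Integration.integrable_diff iA iB i3
        continuous_on_diff cu cG)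
  finally have e0: "2 powr (- \<rho>) * b0 * (AVG x. \<bar>F x - G x\<bar> powr (\<rho> + 1)) \<le> ?I1 + average ?f2 + average ?f3" .
  have "?I1 = (\<Sum>k\<in>modes M. lam k * (c (Suc n) k - c' (Suc m) k) * dcoef ?d k)"
  proof -
    have "(\<Sum>k\<in>modes N. lam k * c (Suc n) k * dcoef ?d k) = (\<Sum>k\<in>modes M. lam k * c (Suc n) k * dcoef ?d k)"
      using NM A.supp_c[of "Suc n"] by (intro sum.mono_neutral_left) (auto simp: supp_def)
    then show ?thesis
      unfolding A.average_flux_trig B.average_flux_trig
      by (simp add: sum_subtractf[symmetric] left_diff_distrib right_diff_distrib)
  qed
  also have "... \<le> sqrt (qf M (\<lambda>k. c (Suc n) k - c' (Suc m) k)) * sqrt (qf M (dcoef ?d))"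
    by (rule bilinear_qf_le)
  also have "... \<le> sqrt (qf M (\<lambda>k. c (Suc n) k - c' (Suc m) k)) * sqrt (2 * qf N (dcoef u) + 2 * qf M (dcoef v))"
  proof (rule mult_left_mono)
    have "dcoef ?d = (\<lambda>k. dcoef u k - dcoef v k)" by (simp add: dcoef_def fun_eq_iff algebra_simps)
    then show "sqrt (qf M (dcoef ?d)) \<le> sqrt (2 * qf N (dcoef u) + 2 * qf M (dcoef v))"
      using qf_diff_le[of M "dcoef u" "dcoef v"] qf_supp_mono[OF sdu NM] by simp
  qed (simp add: qf_nonneg)
  finally have e1: "?I1 \<le> sqrt (qf M (\<lambda>k. c (Suc n) k - c' (Suc m) k)) * sqrt (2 * qf N (dcoef u) + 2 * qf M (dcoef v))" .
  have "average ?f2 \<le> (AVG x. L * H * (\<bar>G x\<bar> powr \<rho> * (\<bar>F x\<bar> + \<bar>G x\<bar>)))"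
  proof (rule average_mono[OF i3])
    show "integrable circle (\<lambda>x. L * H * (\<bar>G x\<bar> powr \<rho> * (\<bar>F x\<bar> + \<bar>G x\<bar>)))"
      unfolding F G by (intro circle_integrable ci) (use \<rho> in auto)
    fix x
    have bd: "\<bar>b (B.h m x) - b (A.h n x)\<bar> \<le> L * H"
      using b_lip[of "B.h m x" "A.h n x"] mult_left_mono[OF H[of x] L]
      by (simp add: A.h_def B.h_def abs_minus_commute)
    have "?f2 x \<le> \<bar>b (B.h m x) - b (A.h n x)\<bar> * \<bar>spow \<rho> (?G x)\<bar> * \<bar>?F x - ?G x\<bar>"
      by (simp add: abs_mult[symmetric])
    also have "... \<le> (L * H) * \<bar>spow \<rho> (?G x)\<bar> * (\<bar>?F x\<bar> + \<bar>?G x\<bar>)"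
      using L H0 by (intro mult_mono bd abs_triangle_ineq4) auto
    finally show "?f2 x \<le> L * H * (\<bar>G x\<bar> powr \<rho> * (\<bar>F x\<bar> + \<bar>G x\<bar>))"
      by (simp add: F G abs_spow mult.assoc)
  qed
  then have e2: "average ?f2 \<le> L * H * (AVG x. \<bar>G x\<bar> powr \<rho> * (\<bar>F x\<bar> + \<bar>G x\<bar>))" by (simp only: average_cmult)
  have "average ?f3 \<le> (AVG x. b1 * ?T * \<bar>F x\<bar> powr \<rho>)"
  proof (rule average_mono)
    show "integrable circle ?f3" by (intro iA continuous_on_diff cu cG)
    show "integrable circle (\<lambda>x. b1 * ?T * \<bar>F x\<bar> powr \<rho>)"
      unfolding F by (intro circle_integrable ci) (use \<rho> in auto)
    fix x
    have "?f3 x \<le> \<bar>b (A.h n x)\<bar> * \<bar>spow \<rho> (?F x)\<bar> * \<bar>trig N v x - ?G x\<bar>"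
      by (simp add: abs_mult[symmetric])
    also have "... \<le> b1 * \<bar>spow \<rho> (?F x)\<bar> * ?T"
      using b_pos[of "A.h n x"] b_le[of "A.h n x"] b1_pos by (intro mult_mono tail) auto
    finally show "?f3 x \<le> b1 * ?T * \<bar>F x\<bar> powr \<rho>" by (simp add: F abs_spow mult_ac)
  qed
  also have "... = b1 * pavg \<rho> F * ?T" unfolding average_cmult by (simp only: mult_ac)
  finally show ?thesis using e0 e1 e2 unfolding u_def v_def by linarith
qed

section \<open>The family of discretisations\<close>

text \<open>Steps are open on the left: for t > 0, step n consists of n / N < t \<le> (n + 1) / N.
  Thus t = 1 lies in the last step, with index N - 1.\<close>

definition step_idx :: "nat \<Rightarrow> real \<Rightarrow> nat" where
  "step_idx N t = nat \<lceil>t * real N\<rceil> - 1"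

lemma step_idx:
  assumes "0 < t" "t \<le> 1" "1 \<le> N"
  shows "step_idx N t < N" "t \<le> real (Suc (step_idx N t)) * (1 / real N)"
    "real (step_idx N t) * (1 / real N) < t"
proof -
  define m where "m = \<lceil>t * real N\<rceil>"
  have p: "0 < t * real N" using assms by simp
  have m1: "1 \<le> m" using p unfolding m_def by linarith
  have "t * real N \<le> 1 * real N" using assms by (intro mult_right_mono) auto
  then have mN: "m \<le> int N" unfolding m_def by (simp add: ceiling_le_iff)
  have s: "Suc (step_idx N t) = nat m" using m1 by (simp add: step_idx_def m_def)
  have r: "real (Suc (step_idx N t)) = of_int m" using m1 s by simp
  show "step_idx N t < N" using s mN by simp
  have "t * real N \<le> of_int m" unfolding m_def by (rule le_of_int_ceiling)
  then show "t \<le> real (Suc (step_idx N t)) * (1 / real N)" unfolding r using assms by (simp add: field_simps)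
  have "of_int m - 1 < t * real N" unfolding m_def by linarith
  then have "real (step_idx N t) < t * real N" using r by simp
  then show "real (step_idx N t) * (1 / real N) < t" using assms by (simp add: field_simps)
qed

lemma step_idx_mono: "0 \<le> s \<Longrightarrow> s \<le> t \<Longrightarrow> step_idx N s \<le> step_idx N t"
  unfolding step_idx_def by (intro diff_le_mono nat_mono ceiling_mono mult_right_mono) auto

lemma powr_uminus_small:
  assumes "0 < \<rho>" "0 < e" "0 \<le> A"
  shows "\<exists>l>0. A * l powr (- \<rho>) \<le> (e :: real)"
proof -
  define l where "l = ((A + 1) / e) powr (1 / \<rho>)"
  have l: "0 < l" using assms by (simp add: l_def)
  have "l powr \<rho> = (A + 1) / e" using assms by (simp add: l_def powr_powr)
  then have "l powr (- \<rho>) = e / (A + 1)" by (simp add: powr_minus)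
  moreover have "A * (e / (A + 1)) \<le> e" using assms by (simp add: field_simps)
  ultimately show ?thesis using l by auto
qed

text \<open>Compactness in coefficient form: the energy bound makes the tail small beyond some R, so
  only finitely many modes remain to be checked, and their number does not depend on M.\<close>

lemma sum_abs_small_if_low_modes_small:
  assumes "0 < e" "0 \<le> q"
  shows "\<exists>R\<ge>1. \<exists>\<eta>>0. \<forall>M x. qf M x \<le> q \<longrightarrow> (\<forall>k\<in>modes R. \<bar>x k\<bar> \<le> \<eta>) \<longrightarrow> (\<Sum>k\<in>modes M. \<bar>x k\<bar>) \<le> e"
proof -
  obtain R :: nat where R: "2 * q / (e / 2)\<^sup>2 + 1 < real R" using reals_Archimedean2 by blast
  have "0 \<le> 2 * q / (e / 2)\<^sup>2" using assms by simp
  then have R1: "1 \<le> R" using R by simp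
  have "2 * q / (e / 2)\<^sup>2 \<le> real R" using R by linarith
  then have "2 * q \<le> real R * (e / 2)\<^sup>2" using assms by (simp only: pos_divide_le_eq zero_less_power divide_pos_pos zero_less_numeral)
  then have "2 / real R * q \<le> (e / 2)\<^sup>2" using R1 by (simp add: field_simps)
  then have s: "sqrt (2 / real R * q) \<le> e / 2" using assms by (intro real_le_lsqrt) auto
  define \<eta> where "\<eta> = e / (2 * real (2 * R + 1))"
  have \<eta>: "0 < \<eta>" using assms by (simp add: \<eta>_def)
  have e2: "T * (e / (2 * T)) = e / 2" if "0 < T" for T :: real using that by simp
  have "(\<Sum>k\<in>modes M. \<bar>x k\<bar>) \<le> e" if q: "qf M x \<le> q" and x: "\<forall>k\<in>modes R. \<bar>x k\<bar> \<le> \<eta>" for M x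
  proof -
    have "(\<Sum>k\<in>modes M. \<bar>x k\<bar>) \<le> (\<Sum>k\<in>modes R. \<bar>x k\<bar>) + (\<Sum>k\<in>modes M - modes R. \<bar>x k\<bar>)" by (rule sum_abs_modes_split)
    also have "(\<Sum>k\<in>modes R. \<bar>x k\<bar>) \<le> real (2 * R + 1) * \<eta>"
      using sum_bounded_above[of "modes R" "\<lambda>k. \<bar>x k\<bar>" \<eta>] x by (simp add: nat_add_distrib)
    also have "... = e / 2" using e2[of "real (2 * R + 1)"] by (simp add: \<eta>_def)
    also have "(\<Sum>k\<in>modes M - modes R. \<bar>x k\<bar>) \<le> sqrt (2 / real R * qf M x)" by (rule tail_sum_le[OF R1])
    also have "... \<le> sqrt (2 / real R * q)" using q by (intro real_sqrt_le_mono mult_left_mono) auto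
    finally show ?thesis using s by linarith
  qed
  then show ?thesis using R1 \<eta> by blast
qed

lemma trig_small_if_low_modes_small:
  assumes "0 < e" "0 \<le> q"
  shows "\<exists>R\<ge>1. \<exists>\<eta>>0. \<forall>M x y. qf M x \<le> q \<longrightarrow> (\<forall>k\<in>modes R. \<bar>x k\<bar> \<le> \<eta>) \<longrightarrow> \<bar>trig M x y\<bar> \<le> e"
proof -
  obtain R \<eta> where R: "1 \<le> R" "0 < \<eta>" and *: "\<And>M x. qf M x \<le> q \<Longrightarrow> \<forall>k\<in>modes R. \<bar>x k\<bar> \<le> \<eta> \<Longrightarrow> (\<Sum>k\<in>modes M. \<bar>x k\<bar>) \<le> e / 2"
    using sum_abs_small_if_low_modes_small[of "e / 2" q] assms by auto
  have "\<bar>trig M x y\<bar> \<le> e" if "qf M x \<le> q" "\<forall>k\<in>modes R. \<bar>x k\<bar> \<le> \<eta>" for M x y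
    using abs_trig_le[of M x y] *[OF that] by linarith
  then show ?thesis using R by blast
qed

lemma abs_lam_le_of_decay: "\<bar>of_int k * lam k * x\<bar> \<le> A \<Longrightarrow> \<bar>lam k * x\<bar> \<le> A"
proof (cases "k = 0")
  case False
  then have "1 * \<bar>lam k * x\<bar> \<le> \<bar>of_int k\<bar> * \<bar>lam k * x\<bar>" by (intro mult_right_mono) auto
  then show "\<bar>of_int k * lam k * x\<bar> \<le> A \<Longrightarrow> \<bar>lam k * x\<bar> \<le> A" by (simp add: abs_mult mult.assoc)
qed (simp add: lam_def)

text \<open>A bound on the energy alone would not make it small. The cubic decay bounds lam k * x k,
  so that the energy is dominated by the sum of |x k|.\<close>

lemma qf_small_if_low_modes_small:
  assumes "0 < e" "0 \<le> A"
  shows "\<exists>R. \<exists>\<eta>>0. \<forall>M x. (\<forall>k. \<bar>of_int k * lam k * x k\<bar> \<le> A) \<longrightarrow> (\<forall>k\<in>modes R. \<bar>x k\<bar> \<le> \<eta>) \<longrightarrow> qf M x \<le> e"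
proof -
  have "0 < e / (A + 1)" using assms by simp
  then obtain R \<eta> where R: "0 < \<eta>" and *: "\<And>M x. qf M x \<le> 2 * A\<^sup>2 \<Longrightarrow> \<forall>k\<in>modes R. \<bar>x k\<bar> \<le> \<eta> \<Longrightarrow> (\<Sum>k\<in>modes M. \<bar>x k\<bar>) \<le> e / (A + 1)"
    using sum_abs_small_if_low_modes_small[of "e / (A + 1)" "2 * A\<^sup>2"] by auto
  have "qf M x \<le> e" if A: "\<forall>k. \<bar>of_int k * lam k * x k\<bar> \<le> A" and x: "\<forall>k\<in>modes R. \<bar>x k\<bar> \<le> \<eta>" for M x
  proof -
    have l: "\<bar>lam k * x k\<bar> \<le> A" for k using A by (intro abs_lam_le_of_decay) blast
    have "qf M x \<le> (\<Sum>k\<in>modes M. A * \<bar>x k\<bar>)"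
      unfolding qf_def
    proof (rule sum_mono)
      fix k
      have "lam k * (x k)\<^sup>2 \<le> \<bar>lam k * x k\<bar> * \<bar>x k\<bar>" by (simp add: abs_mult[symmetric] power2_eq_square mult.assoc)
      also have "... \<le> A * \<bar>x k\<bar>" by (intro mult_right_mono l) simp
      finally show "lam k * (x k)\<^sup>2 \<le> A * \<bar>x k\<bar>" .
    qed
    also have "... \<le> (A + 1) * (e / (A + 1))"
      unfolding sum_distrib_left[symmetric] using *[OF qf_le_of_bound[OF l] x] assms by (intro mult_mono sum_nonneg) auto
    finally show ?thesis using assms by simp
  qed
  then show ?thesis using R by blast
qed

text \<open>The decay hypothesis bounds the energy of \<open>dcoef x\<close>, to which the criterion
  for \<open>trig\<close> applies; dividing \<eta> by R compensates the factor |k| on the low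
  modes.\<close>

lemma dtrig_small_if_low_modes_small:
  assumes "0 < e" "0 \<le> A"
  shows "\<exists>R. \<exists>\<eta>>0. \<forall>M x y. (\<forall>k. \<bar>of_int k * lam k * x k\<bar> \<le> A) \<longrightarrow> (\<forall>k\<in>modes R. \<bar>x k\<bar> \<le> \<eta>) \<longrightarrow>
    \<bar>trig M (dcoef x) y\<bar> \<le> e"
proof -
  obtain R \<eta> where R: "1 \<le> R" and \<eta>: "0 < \<eta>" and
    small: "\<And>M x y. qf M x \<le> 2 * A\<^sup>2 \<Longrightarrow> \<forall>k\<in>modes R. \<bar>x k\<bar> \<le> \<eta> \<Longrightarrow> \<bar>trig M x y\<bar> \<le> e"
    using trig_small_if_low_modes_small[of e "2 * A\<^sup>2"] assms by auto
  have "\<bar>trig M (dcoef x) y\<bar> \<le> e"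
    if A: "\<forall>k. \<bar>of_int k * lam k * x k\<bar> \<le> A" and x: "\<forall>k\<in>modes R. \<bar>x k\<bar> \<le> \<eta> / real R" for M x y
  proof (rule small)
    show "\<forall>k\<in>modes R. \<bar>dcoef x k\<bar> \<le> \<eta>"
    proof
      fix k assume k: "k \<in> modes R"
      have "\<bar>dcoef x k\<bar> = \<bar>of_int k\<bar> * \<bar>x (- k)\<bar>" by (simp add: dcoef_def abs_mult)
      also have "... \<le> real R * (\<eta> / real R)" using x k by (intro mult_mono) auto
      finally show "\<bar>dcoef x k\<bar> \<le> \<eta>" using R by simp
    qed
    have "\<bar>lam k * dcoef x k\<bar> \<le> A" for k
      using A[rule_format, of "- k"] by (simp add: dcoef_def abs_mult mult_ac)
    then show "qf M (dcoef x) \<le> 2 * A\<^sup>2" by (rule qf_le_of_bound)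
  qed
  then show ?thesis using \<eta> R by (intro exI[of _ R] exI[of _ "\<eta> / real R"]) auto
qed

text \<open>Interpolation: low modes are bounded by the L1 norm and thus by the power average, high
  modes by the energy of the derivative. The estimate is kept affine in s because s will be a
  numerical dissipation, which is bounded only after integration in time.\<close>

lemma trig_small_if_powr_average_small:
  assumes e: "0 < e" and \<rho>: "0 < \<rho>"
  shows "\<exists>\<eta>>0. \<forall>M d s y. 0 \<le> s \<longrightarrow> pavg (\<rho> + 1) (trig M d) \<le> \<eta> * (1 + s) \<longrightarrow>
     qf M (dcoef d) \<le> s \<longrightarrow> supp M d \<longrightarrow> \<bar>trig M d y\<bar> \<le> e * (1 + s)"
proof -
  \<comment> \<open>Beyond 8 / e the high modes contribute 2 / R, which is at most e / 4.\<close>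
  obtain R :: nat where R: "8 / e + 2 < real R" using reals_Archimedean2 by blast
  have "0 < 8 / e" using e by simp
  then have "2 < real R" using R by linarith
  then have R2: "2 \<le> R" by simp
  have "8 \<le> real R * e" using R e by (simp add: field_simps)
  then have RE: "2 * (1 / real R) \<le> e / 4" using R2 by (simp add: field_simps)
  define K where "K = 4 * real (2 * R + 1)"
  have K: "0 < K" by (simp add: K_def)
  \<comment> \<open>Keeps the contribution of the 2 R + 1 low modes to the coefficient sum at e / 4;
    \<eta> is l powr (\<rho> + 1), so that both terms of \<open>le_powr_split\<close> are of size
    l.\<close>
  define l where "l = e / (4 * K)"
  have l: "0 < l" using e K by (simp add: l_def)
  define \<eta> where "\<eta> = l * l powr \<rho>"
  have \<eta>: "0 < \<eta>" using l by (simp add: \<eta>_def)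
  have "\<bar>trig M d y\<bar> \<le> e * (1 + s)"
    if s: "0 \<le> s" and a: "pavg (\<rho> + 1) (trig M d) \<le> \<eta> * (1 + s)"
      and q: "qf M (dcoef d) \<le> s" and sd: "supp M d" for M d s y
  proof -
    have c: "\<bar>d k\<bar> \<le> 2 * (l + l * (1 + s))" for k
    proof (cases "k \<in> modes M")
      case True
      have i: "integrable circle (\<lambda>x. \<bar>trig M d x\<bar> powr (\<rho> + 1))"
        by (intro circle_integrable continuous_intros) (use \<rho> in auto)
      have "\<bar>d k\<bar> = \<bar>coef (trig M d) k\<bar>" using True by (simp add: coef_trig)
      also have "... \<le> 2 * (AVG x. \<bar>trig M d x\<bar>)" by (rule abs_coef_le[OF integrable_trig])
      also have "(AVG x. \<bar>trig M d x\<bar>) \<le> (AVG x. l + l powr (- \<rho>) * \<bar>trig M d x\<bar> powr (\<rho> + 1))"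
        using i le_powr_split[of "\<bar>trig M d _\<bar>" l \<rho>] l \<rho> by (intro average_mono integrable_abs integrable_trig) auto
      also have "... = l + l powr (- \<rho>) * pavg (\<rho> + 1) (trig M d)"
        using i by (simp add: average_add average_const average_cmult)
      also have "... \<le> l + l powr (- \<rho>) * (\<eta> * (1 + s))" using a by (intro add_left_mono mult_left_mono) auto
      also have "l powr (- \<rho>) * (\<eta> * (1 + s)) = l * (1 + s)" using l by (simp add: \<eta>_def powr_minus)
      finally show ?thesis by simp
    next
      case False
      then show ?thesis using sd l s by (auto simp: supp_def)
    qed
    have "(\<Sum>k\<in>modes M. \<bar>d k\<bar>) \<le> (\<Sum>k\<in>modes R. \<bar>d k\<bar>) + (\<Sum>k\<in>modes M - modes R. \<bar>d k\<bar>)" by (rule sum_abs_modes_split)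
    also have "(\<Sum>k\<in>modes R. \<bar>d k\<bar>) \<le> real (2 * R + 1) * (2 * (l + l * (1 + s)))"
      using sum_bounded_above[of "modes R" "\<lambda>k. \<bar>d k\<bar>" "2 * (l + l * (1 + s))"] c by (simp add: nat_add_distrib)
    also have "... = K / 2 * (l + l * (1 + s))" by (simp add: K_def algebra_simps)
    also have "... \<le> K / 2 * (2 * (l * (1 + s)))" using K l s by (intro mult_left_mono) (auto simp: distrib_left)
    also have "... = e / 4 * (1 + s)" using K by (simp add: l_def)
    also have "(\<Sum>k\<in>modes M - modes R. \<bar>d k\<bar>) \<le> 1 / real R * sqrt (2 / real R * qf M (dcoef d))"
      using R2 by (intro tail_sum_le_dcoef) simp
    also have "... \<le> 1 / real R * (1 + s)"
    proof (rule mult_left_mono)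
      have "sqrt (2 / real R * qf M (dcoef d)) \<le> sqrt (1 * s)"
        using R2 q s qf_nonneg[of M "dcoef d"] by (intro real_sqrt_le_mono mult_mono) (auto simp: divide_le_eq)
      also have "... \<le> 1 + s"
        using s by (intro real_le_lsqrt) (auto simp: power2_eq_square algebra_simps)
      finally show "sqrt (2 / real R * qf M (dcoef d)) \<le> 1 + s" .
    qed simp
    finally have sm: "(\<Sum>k\<in>modes M. \<bar>d k\<bar>) \<le> e / 4 * (1 + s) + 1 / real R * (1 + s)" by simp
    have "\<bar>trig M d y\<bar> \<le> 2 * (e / 4 * (1 + s) + 1 / real R * (1 + s))"
      by (rule order_trans[OF abs_trig_le mult_left_mono[OF sm]]) simp
    also have "... = (e / 2 + 2 * (1 / real R)) * (1 + s)" by (simp add: algebra_simps)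
    also have "... \<le> e * (1 + s)" using RE e s by (intro mult_right_mono) auto
    finally show ?thesis .
  qed
  then show ?thesis using \<eta> by blast
qed

section \<open>The family of schemes: equicontinuity and a convergent subsequence\<close>

locale flow_family = weight +
  fixes c0 :: "int \<Rightarrow> real" and c j :: "nat \<Rightarrow> nat \<Rightarrow> int \<Rightarrow> real" and Q0 :: real
  assumes flow: "\<And>N. 1 \<le> N \<Longrightarrow> discrete_flow \<rho> b0 b1 L b N (1 / real N) (c N) (j N)"
    and init: "\<And>N k. c N 0 k = (if k \<in> modes N then c0 k else 0)"
    and Q0: "\<And>N. qf N c0 \<le> Q0" and tameQ0: "\<And>q. q \<le> Q0 \<Longrightarrow> tame q"
begin

text \<open>The value at the end of the step containing t; \<open>cl\<close> is the value at its
  beginning, where the scheme evaluates the weight.\<close>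

definition cc where "cc N t = c N (Suc (step_idx N t))"
definition cl where "cl N t = c N (step_idx N t)"
abbreviation cc_close :: "(nat \<Rightarrow> nat) \<Rightarrow> int \<Rightarrow> real \<Rightarrow> nat \<Rightarrow> bool" where
  "cc_close \<nu> k e i0 \<equiv> \<forall>i\<ge>i0. \<forall>i'\<ge>i0. \<forall>t. 0 < t \<longrightarrow> t \<le> 1 \<longrightarrow> \<bar>cc (\<nu> i) t k - cc (\<nu> i') t k\<bar> \<le> e"

definition jj where "jj N t = j N (Suc (step_idx N t))"
definition SS where "SS N t = qf N (dcoef (jj N t))"
definition DD where "DD N t = (AVG x. b (trig N (cl N t) x) * \<bar>trig N (jj N t) x\<bar> powr (\<rho> + 1))"

lemma Q0_nonneg: "0 \<le> Q0"
  using Q0[of 0] qf_nonneg[of 0 c0] by linarith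

lemma qf_init: "qf N (c N 0) = qf N c0"
  unfolding qf_def by (intro sum.cong) (auto simp: init)

lemma tame_init: "tame (qf N (c N 0))"
  unfolding qf_init by (rule tameQ0[OF Q0])

lemma qf_c: "1 \<le> N \<Longrightarrow> qf N (c N n) \<le> Q0"
  using discrete_flow.qf_c_le[OF flow, of N n] Q0[of N] by (simp add: qf_init)

lemma supp_cc: "1 \<le> N \<Longrightarrow> supp N (cc N t)" and supp_cl: "1 \<le> N \<Longrightarrow> supp N (cl N t)"
  and supp_jj: "1 \<le> N \<Longrightarrow> supp N (jj N t)"
  unfolding cc_def cl_def jj_def using discrete_flow.supp_c[OF flow] discrete_flow.supp_j[OF flow] by auto

lemma SS_eq: "1 \<le> N \<Longrightarrow> SS N t = discrete_flow.S N (j N) (step_idx N t)"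
  by (simp add: SS_def jj_def discrete_flow.S_def[OF flow])

lemma DD_eq: "1 \<le> N \<Longrightarrow> DD N t = discrete_flow.D \<rho> b N (c N) (j N) (step_idx N t)"
  by (simp add: DD_def cl_def jj_def discrete_flow.D_def[OF flow] discrete_flow.h_def[OF flow]
      discrete_flow.J_def[OF flow])

lemma SS_nonneg: "0 \<le> SS N t"
  unfolding SS_def by (rule qf_nonneg)

lemma DD_le:
  assumes "1 \<le> N" "0 < a" "a \<le> t" "t \<le> 1"
  shows "DD N t \<le> 4 * Q0 / a"
proof -
  interpret A: discrete_flow \<rho> b0 b1 L b N "1 / real N" "c N" "j N" by (rule flow[OF assms(1)])
  have t: "0 < t" using assms by linarith
  have "DD N t \<le> 4 * qf N (c N 0) / a"
    unfolding DD_eq[OF assms(1)]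
    using step_idx[OF t assms(4,1)] assms by (intro A.D_decay[OF tame_init]) auto
  also have "... \<le> 4 * Q0 / a" using assms qf_c[OF assms(1), of 0] by (intro divide_right_mono) auto
  finally show ?thesis .
qed

lemma c_displacement:
  assumes N: "1 \<le> N" and l: "0 < l" and mn: "m \<le> n"
  shows "\<bar>c N n k - c N m k\<bar> \<le> 2 * \<bar>of_int k\<bar> * (l * (real (n - m) * (1 / real N)) + l powr (- \<rho>) / b0 * Q0)"
proof -
  interpret A: discrete_flow \<rho> b0 b1 L b N "1 / real N" "c N" "j N" by (rule flow[OF N])
  show ?thesis
    using qf_c[OF N, of 0] b0
    by (intro order_trans[OF A.c_diff_le'[OF l mn]] mult_left_mono add_left_mono) auto
qed

text \<open>The modes 1 and -1 escape the energy; they are bounded by their initial value plus their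
  displacement over the unit time interval.\<close>

lemma low_mode:
  assumes N: "1 \<le> N" and t: "0 < t" "t \<le> 1" and l: "0 < l" and k: "\<bar>k\<bar> \<le> 1"
  shows "\<bar>cc N t k\<bar> \<le> \<bar>c0 k\<bar> + 2 * (l + l powr (- \<rho>) / b0 * Q0)"
proof -
  have "\<bar>c N (Suc (step_idx N t)) k - c N 0 k\<bar>
      \<le> 2 * \<bar>of_int k\<bar> * (l * (real (Suc (step_idx N t) - 0) * (1 / real N)) + l powr (- \<rho>) / b0 * Q0)"
    by (rule c_displacement[OF N l]) auto
  also have "... \<le> 2 * 1 * (l * 1 + l powr (- \<rho>) / b0 * Q0)"
    using step_idx(1)[OF t N] l N k Q0_nonneg b0
    by (intro mult_mono add_right_mono mult_left_mono add_nonneg_nonneg mult_nonneg_nonneg) (auto simp: divide_le_eq)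
  finally have "\<bar>cc N t k - c N 0 k\<bar> \<le> 2 * (l + l powr (- \<rho>) / b0 * Q0)" by (simp add: cc_def)
  moreover have "\<bar>c N 0 k\<bar> \<le> \<bar>c0 k\<bar>" by (simp add: init)
  ultimately show ?thesis by linarith
qed

text \<open>The displacement bound is l times the elapsed time plus l powr (- \<rho>) times the
  energy. First l is taken large to make the second part small, and only then the time span is
  shortened.\<close>

lemma c_displacement_small:
  assumes e: "0 < e"
  shows "\<exists>d>0. \<forall>N n m. 1 \<le> N \<longrightarrow> m \<le> n \<longrightarrow> real (n - m) * (1 / real N) \<le> d \<longrightarrow> \<bar>c N n k - c N m k\<bar> \<le> e"
proof -
  define K where "K = 2 * \<bar>of_int k :: real\<bar>"
  have K: "0 \<le> K" by (simp add: K_def)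
  have "\<exists>l>0. K * Q0 / b0 * l powr (- \<rho>) \<le> e / 2"
    using \<rho> e K Q0_nonneg b0 by (intro powr_uminus_small) auto
  then obtain l where l: "0 < l" "K * Q0 / b0 * l powr (- \<rho>) \<le> e / 2" by blast
  define d where "d = e / (2 * (K * l + 1))"
  have Kl: "0 \<le> K * l" using K l by simp
  then have d: "0 < d" using e by (simp add: d_def)
  have kd: "K * l * d \<le> e / 2" using Kl e by (simp add: d_def divide_simps)
  have "\<bar>c N n k - c N m k\<bar> \<le> e" if "1 \<le> N" "m \<le> n" "real (n - m) * (1 / real N) \<le> d" for N n m
  proof -
    have "\<bar>c N n k - c N m k\<bar> \<le> K * (l * (real (n - m) * (1 / real N)) + l powr (- \<rho>) / b0 * Q0)"
      unfolding K_def by (rule c_displacement[OF that(1) l(1) that(2)])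
    also have "... \<le> K * (l * d + l powr (- \<rho>) / b0 * Q0)"
      using K l that by (intro mult_left_mono add_right_mono) auto
    also have "... = K * l * d + K * Q0 / b0 * l powr (- \<rho>)" by (simp add: distrib_left mult_ac)
    finally show ?thesis using kd l by linarith
  qed
  then show ?thesis using d by blast
qed

text \<open>The three clauses concern two positive times, the two ends of a single step, and the
  initial time. Since step functions jump, such a modulus can hold only for N large enough.\<close>

definition equi where
  "equi e k d N0 \<longleftrightarrow> (\<forall>N\<ge>N0.
    (\<forall>s t. 0 < s \<longrightarrow> s \<le> t \<longrightarrow> t \<le> 1 \<longrightarrow> t - s \<le> d \<longrightarrow> \<bar>cc N t k - cc N s k\<bar> \<le> e) \<and>
    (\<forall>t. 0 < t \<longrightarrow> t \<le> 1 \<longrightarrow> \<bar>cc N t k - cl N t k\<bar> \<le> e) \<and>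
    (\<forall>t. 0 < t \<longrightarrow> t \<le> 1 \<longrightarrow> t \<le> d \<longrightarrow> \<bar>cc N t k - c N 0 k\<bar> \<le> e))"

lemma equiD:
  assumes "equi e k d N0" "N0 \<le> N"
  shows "0 < s \<Longrightarrow> s \<le> t \<Longrightarrow> t \<le> 1 \<Longrightarrow> t - s \<le> d \<Longrightarrow> \<bar>cc N t k - cc N s k\<bar> \<le> e"
    "0 < t \<Longrightarrow> t \<le> 1 \<Longrightarrow> \<bar>cc N t k - cl N t k\<bar> \<le> e"
    "0 < t \<Longrightarrow> t \<le> 1 \<Longrightarrow> t \<le> d \<Longrightarrow> \<bar>cc N t k - c N 0 k\<bar> \<le> e"
  using assms by (auto simp: equi_def)

lemma equicontinuity:
  assumes e: "0 < e"
  shows "\<exists>d>0. \<exists>N0\<ge>1. equi e k d N0"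
proof -
  obtain d where d: "0 < d" and
    D: "\<And>N n m. 1 \<le> N \<Longrightarrow> m \<le> n \<Longrightarrow> real (n - m) * (1 / real N) \<le> d \<Longrightarrow> \<bar>c N n k - c N m k\<bar> \<le> e"
    using c_displacement_small[OF e, of k] by blast
  \<comment> \<open>From N0 on a step is shorter than d / 2, so rounding to the grid still fits into
    d.\<close>
  obtain N0 :: nat where N0: "2 / d < real N0" using reals_Archimedean2 by blast
  then have N01: "1 \<le> N0" using d by (cases N0) (auto simp: divide_simps)
  have inv: "1 / real N \<le> d / 2" if "N0 \<le> N" for N
  proof -
    have "2 / d < real N" using N0 that by (simp add: less_le_trans)
    then show ?thesis using d N01 that by (simp add: field_simps)
  qed
  have 1: "\<bar>cc N t k - cc N s k\<bar> \<le> e" if "N0 \<le> N" "0 < s" "s \<le> t" "t \<le> 1" "t - s \<le> d / 2" for N s t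
    unfolding cc_def
  proof (rule D)
    show N: "1 \<le> N" using that N01 by simp
    show m: "Suc (step_idx N s) \<le> Suc (step_idx N t)" using step_idx_mono[of s t N] that by simp
    have "real (Suc (step_idx N t) - Suc (step_idx N s)) * (1 / real N)
        = real (step_idx N t) * (1 / real N) - real (Suc (step_idx N s)) * (1 / real N) + 1 / real N"
      using m N by (simp add: of_nat_diff field_simps)
    also have "... \<le> t - s + 1 / real N"
      using step_idx(2)[of s N] step_idx(3)[of t N] that N by simp
    finally show "real (Suc (step_idx N t) - Suc (step_idx N s)) * (1 / real N) \<le> d"
      using inv[OF that(1)] that by linarith
  qed
  have 2: "\<bar>cc N t k - cl N t k\<bar> \<le> e" if "N0 \<le> N" "0 < t" "t \<le> 1" for N t
    unfolding cc_def cl_def using that N01 inv[OF that(1)] d by (intro D) auto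
  have 3: "\<bar>cc N t k - c N 0 k\<bar> \<le> e" if "N0 \<le> N" "0 < t" "t \<le> 1" "t \<le> d / 2" for N t
    unfolding cc_def
  proof (rule D)
    show N: "1 \<le> N" using that N01 by simp
    have "real (Suc (step_idx N t) - 0) * (1 / real N) = real (step_idx N t) * (1 / real N) + 1 / real N"
      by (simp add: add_divide_distrib)
    also have "... \<le> d" using step_idx(3)[OF that(2,3) N] inv[OF that(1)] that by linarith
    finally show "real (Suc (step_idx N t) - 0) * (1 / real N) \<le> d" .
  qed simp
  show ?thesis
    unfolding equi_def using 1 2 3 d N01 by (intro exI[of _ "d / 2"] conjI exI[of _ N0] allI impI) auto
qed

lemma cc_bounded: "\<exists>B. \<forall>N t k. 1 \<le> N \<longrightarrow> 0 < t \<longrightarrow> t \<le> 1 \<longrightarrow> \<bar>cc N t k\<bar> \<le> B"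
proof -
  define B where "B = \<bar>c0 0\<bar> + \<bar>c0 1\<bar> + \<bar>c0 (-1)\<bar> + 2 * (1 + Q0 / b0) + sqrt Q0"
  have qb: "0 \<le> Q0 / b0" using Q0_nonneg b0 by simp
  have s: "0 \<le> sqrt Q0" using Q0_nonneg by simp
  have "\<bar>cc N t k\<bar> \<le> B" if N: "1 \<le> N" and t: "0 < t" "t \<le> 1" for N t k
  proof -
    show ?thesis
    proof (cases "\<bar>k\<bar> \<le> 1")
      case True
      then have "k = 0 \<or> k = 1 \<or> k = -1" by linarith
      then have "\<bar>c0 k\<bar> \<le> \<bar>c0 0\<bar> + \<bar>c0 1\<bar> + \<bar>c0 (-1)\<bar>" by auto
      moreover have "\<bar>cc N t k\<bar> \<le> \<bar>c0 k\<bar> + 2 * (1 + Q0 / b0)" using low_mode[OF N t _ True, of 1] by simp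
      ultimately show ?thesis using s unfolding B_def by linarith
    next
      case k: False
      show ?thesis
      proof (cases "k \<in> modes N")
        case True
        have "1 \<le> lam k" using lam_ge[of k] k mult_mono[of 1 "\<bar>k\<bar>" 1 "\<bar>k\<bar> - 1"]
          by (smt (verit) of_int_1_le_iff)
        then have "1 * (cc N t k)\<^sup>2 \<le> lam k * (cc N t k)\<^sup>2" by (intro mult_right_mono) auto
        also have "... \<le> qf N (cc N t)" unfolding qf_def
          by (rule member_le_sum[OF True]) (auto intro!: mult_nonneg_nonneg lam_nonneg)
        also have "... \<le> Q0" unfolding cc_def by (rule qf_c[OF N])
        finally have "\<bar>cc N t k\<bar> \<le> sqrt Q0" by (intro real_le_rsqrt) simp
        then show ?thesis using qb by (simp add: B_def)
      next
        case False
        then have "cc N t k = 0" using supp_cc[OF N] by (auto simp: supp_def)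
        then show ?thesis using qb s by (simp add: B_def)
      qed
    qed
  qed
  then show ?thesis by blast
qed

text \<open>Arzela-Ascoli for step functions: a diagonal sequence converges for all modes at all
  rational times, and the asymptotic equicontinuity makes each mode Cauchy uniformly in
  time.\<close>

lemma subsequence_exists:
  obtains \<nu> :: "nat \<Rightarrow> nat" where "strict_mono \<nu>" "\<And>i. 1 \<le> \<nu> i"
    "\<And>k e. 0 < e \<Longrightarrow> \<exists>i0. cc_close \<nu> k e i0"
proof -
  obtain B where B: "\<And>N t k. 1 \<le> N \<Longrightarrow> 0 < t \<Longrightarrow> t \<le> 1 \<Longrightarrow> \<bar>cc N t k\<bar> \<le> B" using cc_bounded by blast
  let ?S = "(UNIV :: int set) \<times> {t \<in> \<rat>. 0 < t \<and> t \<le> (1 :: real)}"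
  have "countable ?S" by (intro countable_SIGMA countable_subset[OF _ countable_rat]) auto
  \<comment> \<open>The diagonal argument; the successor keeps the order N at least 1.\<close>
  then obtain \<kappa> where \<kappa>: "strict_mono (\<kappa> :: nat \<Rightarrow> nat)"
    "\<And>x. x \<in> ?S \<Longrightarrow> \<exists>l. (\<lambda>n. (case x of (k, t) \<Rightarrow> cc (Suc (\<kappa> n)) t k)) \<longlonglongrightarrow> l"
    by (rule function_convergent_subsequence[of ?S "\<lambda>n (k, t). cc (Suc n) t k" B])
       (use B in auto)
  define \<nu> where "\<nu> i = Suc (\<kappa> i)" for i
  have \<nu>: "strict_mono \<nu>" using \<kappa>(1) by (simp add: strict_mono_def \<nu>_def)
  have \<nu>i: "i \<le> \<nu> i" for i using seq_suble[OF \<nu>] .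
  have "\<exists>i0. cc_close \<nu> k e i0" if e: "0 < e" for k e
  proof -
    obtain d N0 where d: "0 < d" and eq: "\<And>N s t. N0 \<le> N \<Longrightarrow> 0 < s \<Longrightarrow> s \<le> t \<Longrightarrow> t \<le> 1 \<Longrightarrow> t - s \<le> d \<Longrightarrow> \<bar>cc N t k - cc N s k\<bar> \<le> e / 3"
      using equicontinuity[of "e / 3" k] e unfolding equi_def by (auto; metis)
    obtain P :: nat where P: "1 / d < real P" using reals_Archimedean2 by blast
    have P1: "1 \<le> P" using P d by (cases P) (auto simp: divide_simps)
    have Pd: "1 / real P \<le> d" using P P1 d by (simp add: field_simps)
    let ?G = "(\<lambda>p. real p / real P) ` {1..P}"
    have "\<exists>i0. \<forall>i\<ge>i0. \<forall>i'\<ge>i0. \<bar>cc (\<nu> i) q k - cc (\<nu> i') q k\<bar> \<le> e / 3" if "q \<in> ?G" for q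
    proof -
      have "(k, q) \<in> ?S" using that P1 by auto
      from \<kappa>(2)[OF this] obtain l where "(\<lambda>n. cc (\<nu> n) q k) \<longlonglongrightarrow> l" by (auto simp: \<nu>_def)
      then have "Cauchy (\<lambda>n. cc (\<nu> n) q k)" by (rule LIMSEQ_imp_Cauchy)
      then obtain i0 where "\<forall>i\<ge>i0. \<forall>i'\<ge>i0. dist (cc (\<nu> i) q k) (cc (\<nu> i') q k) < e / 3"
        unfolding Cauchy_def using e by (metis divide_pos_pos zero_less_numeral)
      then show ?thesis by (intro exI[of _ i0]) (auto simp: dist_real_def intro: less_imp_le)
    qed
    then obtain I where I: "\<And>q i i'. q \<in> ?G \<Longrightarrow> I q \<le> i \<Longrightarrow> I q \<le> i' \<Longrightarrow> \<bar>cc (\<nu> i) q k - cc (\<nu> i') q k\<bar> \<le> e / 3" by metis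
    define i0 where "i0 = max N0 (Max (I ` ?G))"
    have "\<bar>cc (\<nu> i) t k - cc (\<nu> i') t k\<bar> \<le> e" if i: "i0 \<le> i" "i0 \<le> i'" and t: "0 < t" "t \<le> 1" for i i' t
    proof -
      \<comment> \<open>The first point of the grid of mesh 1 / P that is not before t. There are
        only P such points, so one index serves them all.\<close>
      define q where "q = real (Suc (step_idx P t)) / real P"
      have sp: "step_idx P t < P" "t \<le> real (Suc (step_idx P t)) / real P" "real (step_idx P t) / real P < t"
        using step_idx[OF t P1] by auto
      have qG: "q \<in> ?G" unfolding q_def using sp(1) by (intro imageI) auto
      have q: "t \<le> q" "q \<le> 1" "q - t \<le> d"
      proof -
        show "t \<le> q" using sp(2) by (simp add: q_def)
        show "q \<le> 1" using sp(1) by (simp add: q_def divide_le_eq)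
        have "q = real (step_idx P t) / real P + 1 / real P" by (simp add: q_def add_divide_distrib)
        then show "q - t \<le> d" using sp(3) Pd by linarith
      qed
      have "I q \<le> Max (I ` ?G)" using qG by (intro Max_ge) auto
      then have "I q \<le> i" "I q \<le> i'" using i by (auto simp: i0_def)
      from I[OF qG this] have 1: "\<bar>cc (\<nu> i) q k - cc (\<nu> i') q k\<bar> \<le> e / 3" .
      have "N0 \<le> \<nu> i" "N0 \<le> \<nu> i'" using i \<nu>i[of i] \<nu>i[of i'] by (auto simp: i0_def)
      then have "\<bar>cc (\<nu> i) q k - cc (\<nu> i) t k\<bar> \<le> e / 3" "\<bar>cc (\<nu> i') q k - cc (\<nu> i') t k\<bar> \<le> e / 3"
        using eq[OF _ t(1) q] by auto
      with 1 show ?thesis by linarith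
    qed
    then show ?thesis by blast
  qed
  then show thesis using that[of \<nu>] \<nu> by (simp add: \<nu>_def)
qed

end

section \<open>Extinction\<close>

text \<open>As long as f stays above A / 2, each step loses at least K * (A / 2) powr \<gamma>, and
  p such losses use up all of A.\<close>

lemma halving:
  fixes f :: "nat \<Rightarrow> real"
  assumes K: "0 \<le> K" and \<gamma>: "0 \<le> \<gamma>" and A: "0 < A"
    and step: "\<And>n. f (Suc n) + K * f (Suc n) powr \<gamma> \<le> f n"
    and f: "f n \<le> A" and p: "A \<le> K * (A / 2) powr \<gamma> * real p"
  shows "f (n + p) \<le> A / 2"
proof (rule ccontr)
  assume "\<not> ?thesis"
  then have big: "A / 2 < f (n + p)" by simp
  have dec: "f (Suc k) \<le> f k" for k using step[of k] K by (smt (verit) mult_nonneg_nonneg powr_ge_zero)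
  have anti: "f (n + p) \<le> f (n + i)" if "i \<le> p" for i
    using lift_Suc_antimono_le[of f "n + i" "n + p"] dec that by simp
  have "f (n + i) + K * (A / 2) powr \<gamma> * real i \<le> f n" if "i \<le> p" for i
    using that
  proof (induction i)
    case (Suc i)
    have "A / 2 \<le> f (Suc (n + i))" using anti[of "Suc i"] Suc big by simp
    then have "K * (A / 2) powr \<gamma> \<le> K * f (Suc (n + i)) powr \<gamma>"
      using A K \<gamma> by (intro mult_left_mono powr_mono2) auto
    then show ?case using Suc step[of "n + i"] by (simp add: distrib_left)
  qed simp
  from this[of p] big f p A show False by simp
qed

text \<open>The q-th halving takes about N * T * \<beta>^q steps, a geometric sequence because
  \<gamma> < 1, and the smallness condition bounds the sum by N / 2. Rounding up costs at most one
  step per halving, so stopping after N div 2 halvings spends at most another N / 2. The resulting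
  bound tends to 0 with N, which is enough for extinction of the limit.\<close>

lemma extinction:
  fixes f :: "nat \<Rightarrow> real"
  assumes K: "0 < K" and \<gamma>: "0 < \<gamma>" "\<gamma> < 1" and A: "0 < A" and f0: "f 0 \<le> A" and N: "1 \<le> N"
    and step: "\<And>n. f (Suc n) + 1 / real N * K * f (Suc n) powr \<gamma> \<le> f n"
    and small: "2 powr \<gamma> * A powr (1 - \<gamma>) / K / (1 - (1 / 2) powr (1 - \<gamma>)) \<le> 1 / 2"
  shows "f N \<le> A / 2 ^ (N div 2)"
proof -
  define \<beta> where "\<beta> = (1 / 2 :: real) powr (1 - \<gamma>)"
  have \<beta>: "0 < \<beta>" "\<beta> < 1" using \<gamma> powr_less_mono2[of "1 - \<gamma>" "1/2" 1] by (auto simp: \<beta>_def)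
  define T where "T = 2 powr \<gamma> * A powr (1 - \<gamma>) / K"
  have T: "0 < T" using A K by (simp add: T_def)
  define a where "a q = A / 2 ^ q" for q :: nat
  have a: "0 < a q" for q using A by (simp add: a_def)
  define p where "p q = nat \<lceil>real N * (T * \<beta> ^ q)\<rceil>" for q :: nat
  have p1: "real N * (T * \<beta> ^ q) \<le> real (p q)" for q
    unfolding p_def by (rule real_nat_ceiling_ge)
  have p2: "real (p q) \<le> real N * (T * \<beta> ^ q) + 1" for q
    unfolding p_def using T \<beta> by (simp add: of_nat_nat ceiling_le_iff)
  have Ta: "K * (a q / 2) powr \<gamma> * (T * \<beta> ^ q) = a q" for q
  proof -
    have b: "\<beta> ^ q = (1 / 2 ^ q) powr (1 - \<gamma>)"
      using \<beta> by (simp add: \<beta>_def powr_power powr_divide powr_powr flip: powr_realpow) (simp add: powr_powr mult.commute)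
    have "A powr (1 - \<gamma>) * \<beta> ^ q = a q powr (1 - \<gamma>)"
      unfolding b a_def using A by (simp add: powr_mult[symmetric])
    then have "K * (a q / 2) powr \<gamma> * (T * \<beta> ^ q) = (a q / 2) powr \<gamma> * 2 powr \<gamma> * a q powr (1 - \<gamma>)"
      using K by (simp add: T_def)
    also have "... = a q powr \<gamma> * a q powr (1 - \<gamma>)" using a[of q] by (simp add: powr_divide)
    also have "... = a q" using a[of q] by (simp add: powr_add[symmetric])
    finally show ?thesis .
  qed
  have hit: "f (\<Sum>i<q. p i) \<le> a q" for q
  proof (induction q)
    case (Suc q)
    have "f ((\<Sum>i<q. p i) + p q) \<le> a q / 2"
    proof (rule halving[where K = "1 / real N * K" and \<gamma> = \<gamma>])
      have "a q = K * (a q / 2) powr \<gamma> * (T * \<beta> ^ q)" by (rule Ta[symmetric])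
      also have "... \<le> K * (a q / 2) powr \<gamma> * (1 / real N * real (p q))"
        using p1[of q] K N by (intro mult_left_mono) (auto simp: field_simps)
      finally show "a q \<le> 1 / real N * K * (a q / 2) powr \<gamma> * real (p q)" by (simp only: mult_ac)
    qed (use K \<gamma> a Suc step in auto)
    then show ?case by (simp add: a_def)
  qed (use f0 in \<open>simp add: a_def\<close>)
  define q where "q = N div 2"
  have "real (\<Sum>i<q. p i) \<le> (\<Sum>i<q. real N * (T * \<beta> ^ i) + 1)"
    unfolding of_nat_sum by (intro sum_mono p2)
  also have "... = real N * (T * (\<Sum>i<q. \<beta> ^ i)) + real q" by (simp add: sum.distrib sum_distrib_left)
  also have "... \<le> real N * (1 / 2) + real q"
  proof -
    have "(\<Sum>i<q. \<beta> ^ i) \<le> 1 / (1 - \<beta>)"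
      using sum_le_suminf[of "\<lambda>i. \<beta> ^ i" "{..<q}"] \<beta> by (simp add: suminf_geometric summable_geometric)
    then have "T * (\<Sum>i<q. \<beta> ^ i) \<le> T * (1 / (1 - \<beta>))" using T by (intro mult_left_mono) auto
    also have "... \<le> 1 / 2" using small by (simp add: T_def \<beta>_def)
    finally show ?thesis by (intro add_right_mono mult_left_mono) auto
  qed
  also have "... \<le> real N" by (simp add: q_def)
  finally have nN: "(\<Sum>i<q. p i) \<le> N" by linarith
  have "f (Suc n) \<le> f n" for n using step[of n] K by (smt (verit) mult_nonneg_nonneg powr_ge_zero of_nat_0_le_iff divide_nonneg_nonneg)
  then have "f N \<le> f (\<Sum>i<q. p i)" using nN by (rule lift_Suc_antimono_le)
  also have "... \<le> a q" by (rule hit)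
  finally show ?thesis by (simp add: a_def q_def)
qed

context weight begin

text \<open>For \<rho> = 1 / \<alpha> this is (\<alpha> + 1) / 2.\<close>

definition ext_exp where "ext_exp = (\<rho> + 1) / (2 * \<rho>)"
text \<open>Here 32 is 8 from \<open>qf_le_diss\<close> times the square of the factor 2 left by the
  optimal scale in \<open>qf_step\<close>.\<close>

definition ext_const where "ext_const = 2 * b0 * (32 * b1\<^sup>2) powr (- ext_exp)"

lemma ext_exp: "0 < ext_exp" "ext_exp < 1"
  using \<rho> by (auto simp: ext_exp_def field_simps)

lemma ext_const_pos: "0 < ext_const"
  using b0 b1_pos by (simp add: ext_const_def)

end

text \<open>Optimising l in \<open>average_flux_le\<close> bounds the mean of |J| powr \<rho> by the
  power \<rho> / (\<rho> + 1) of the dissipation. Inserted into \<open>qf_le_diss\<close> and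
  inverted, this bounds the dissipation from below by the power \<open>ext_exp\<close> of the
  energy.\<close>

lemma (in discrete_flow) qf_step:
  "qf N (c (Suc n)) + \<tau> * ext_const * qf N (c (Suc n)) powr ext_exp \<le> qf N (c n)"
proof -
  define q where "q = qf N (c (Suc n))"
  define m where "m = pavg \<rho> (J n)"
  have m0: "0 \<le> m" unfolding m_def by (rule average_nonneg) simp
  have qm: "q \<le> 8 * b1\<^sup>2 * m\<^sup>2" unfolding q_def m_def by (rule qf_le_diss)
  have q0: "0 \<le> q" by (simp add: q_def qf_nonneg)
  have ml: "m \<le> l powr \<rho> + D n / (b0 * l)" if "0 < l" for l
    unfolding m_def by (rule average_flux_le[OF that])
  have "ext_const * q powr ext_exp \<le> 2 * D n"
  proof (cases "D n = 0")
    case True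
    \<comment> \<open>Without dissipation the optimal scale would be 0; arbitrarily small scales
      take its place.\<close>
    have "m \<le> e" if e: "0 < e" for e
    proof -
      have "m \<le> (e powr (1 / \<rho>)) powr \<rho>" using ml[of "e powr (1 / \<rho>)"] e True by simp
      then show ?thesis using e \<rho> by (simp add: powr_powr)
    qed
    then have "m \<le> 0" by (rule field_le_epsilon[of m 0, simplified])
    then show ?thesis using m0 qm q0 True by simp
  next
    case False
    then have d: "0 < D n / b0" using D_nonneg[of n] b0 by simp
    define d where "d = D n / b0"
    have dp: "0 < d" using d by (simp add: d_def)
    \<comment> \<open>The scale that balances the two terms of
      \<open>average_flux_le\<close>.\<close>
    define l where "l = d powr (1 / (\<rho> + 1))"
    have l: "0 < l" using dp by (simp add: l_def)
    have "l powr \<rho> = d powr (\<rho> / (\<rho> + 1))" by (simp add: l_def powr_powr)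
    moreover have "D n / (b0 * l) = d powr (\<rho> / (\<rho> + 1))"
    proof -
      have "D n / (b0 * l) = d / l" by (simp add: d_def)
      moreover have "d powr 1 = d" using dp by simp
      ultimately have "D n / (b0 * l) = d powr 1 / d powr (1 / (\<rho> + 1))" by (simp only: l_def)
      also have "... = d powr (1 - 1 / (\<rho> + 1))" by (simp only: powr_diff)
      also have "1 - 1 / (\<rho> + 1) = \<rho> / (\<rho> + 1)" using \<rho> by (simp add: field_simps)
      finally show ?thesis .
    qed
    ultimately have "m \<le> 2 * d powr (\<rho> / (\<rho> + 1))" using ml[OF l] by simp
    then have "m\<^sup>2 \<le> (2 * d powr (\<rho> / (\<rho> + 1)))\<^sup>2" using m0 by (intro power_mono)
    also have "... = 4 * d powr (2 * \<rho> / (\<rho> + 1))"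
      using dp by (simp add: power_mult_distrib powr_power)
    finally have "8 * b1\<^sup>2 * m\<^sup>2 \<le> 8 * b1\<^sup>2 * (4 * d powr (2 * \<rho> / (\<rho> + 1)))" by (intro mult_left_mono) auto
    then have "q \<le> (32 * b1\<^sup>2) * d powr (2 * \<rho> / (\<rho> + 1))" using qm by simp
    then have "q powr ext_exp \<le> ((32 * b1\<^sup>2) * d powr (2 * \<rho> / (\<rho> + 1))) powr ext_exp"
      using q0 ext_exp by (intro powr_mono2) auto
    also have "... = (32 * b1\<^sup>2) powr ext_exp * d"
      using dp \<rho> by (simp add: powr_mult powr_powr ext_exp_def)
    finally have "ext_const * q powr ext_exp \<le> ext_const * ((32 * b1\<^sup>2) powr ext_exp * d)"
      using ext_const_pos by (intro mult_left_mono) auto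
    also have "... = 2 * b0 * d" using b1_pos by (simp add: ext_const_def powr_minus)
    finally show ?thesis using b0 by (simp add: d_def)
  qed
  then have "\<tau> * (ext_const * q powr ext_exp) \<le> \<tau> * (2 * D n)" using \<tau>_pos by (intro mult_left_mono) auto
  moreover have "0 \<le> \<tau>\<^sup>2 * S n" using S_nonneg by simp
  ultimately show ?thesis using energy[of n] by (simp add: q_def)
qed

section \<open>Uniform limits\<close>

lemma finite_pair_threshold:
  assumes "finite S" "\<And>k. k \<in> S \<Longrightarrow> \<exists>i0::nat. \<forall>i\<ge>i0. \<forall>i'\<ge>i0. P k i i'"
  shows "\<exists>i0. \<forall>k\<in>S. \<forall>i\<ge>i0. \<forall>i'\<ge>i0. P k i i'"
  using assms
proof (induction S)
  case (insert k S)
  obtain a where a: "\<forall>k\<in>S. \<forall>i\<ge>a. \<forall>i'\<ge>a. P k i i'"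
    using insert.IH[OF insert.prems[OF insertI2]] by blast
  obtain e where e: "\<forall>i\<ge>e. \<forall>i'\<ge>e. P k i i'" using insert.prems[OF insertI1] by blast
  show ?case by (rule exI[of _ "max a e"]) (use a e in auto)
qed auto

lemma finite_radius_threshold:
  assumes "finite S" "\<And>k. k \<in> S \<Longrightarrow> \<exists>d>0. \<exists>n0. P k d n0"
    and mono: "\<And>k d n0 d' n0'. P k d n0 \<Longrightarrow> 0 < d' \<Longrightarrow> d' \<le> (d :: real) \<Longrightarrow> n0 \<le> (n0' :: nat) \<Longrightarrow> P k d' n0'"
  shows "\<exists>d>0. \<exists>n0. \<forall>k\<in>S. P k d n0"
  using assms(1,2)
proof (induction S)
  case empty
  then show ?case by (auto intro: exI[of _ 1])
next
  case (insert k S)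
  obtain d n where d: "0 < d" "\<forall>k\<in>S. P k d n"
    using insert.IH[OF insert.prems[OF insertI2]] by blast
  obtain e m where e: "0 < e" "P k e m" using insert.prems[OF insertI1] by blast
  show ?case
    by (rule exI[of _ "min d e"], intro conjI exI[of _ "max n m"]) (use d e mono in auto)
qed

lemma uniformly_Cauchy_lim:
  fixes f :: "nat \<Rightarrow> 'a \<Rightarrow> real"
  assumes "\<And>e. 0 < e \<Longrightarrow> \<exists>i0. \<forall>i\<ge>i0. \<forall>i'\<ge>i0. \<forall>x\<in>S. \<bar>f i x - f i' x\<bar> \<le> e"
  shows "\<And>x. x \<in> S \<Longrightarrow> (\<lambda>i. f i x) \<longlonglongrightarrow> lim (\<lambda>i. f i x)"
    "\<And>e. 0 < e \<Longrightarrow> \<exists>i0. \<forall>i\<ge>i0. \<forall>x\<in>S. \<bar>f i x - lim (\<lambda>i. f i x)\<bar> \<le> e"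
proof -
  show conv: "(\<lambda>i. f i x) \<longlonglongrightarrow> lim (\<lambda>i. f i x)" if "x \<in> S" for x
  proof -
    have "Cauchy (\<lambda>i. f i x)" unfolding Cauchy_def
    proof (intro allI impI)
      fix e :: real assume "0 < e"
      then obtain i0 where "\<forall>i\<ge>i0. \<forall>i'\<ge>i0. \<forall>x\<in>S. \<bar>f i x - f i' x\<bar> \<le> e / 2" using assms[of "e/2"] by auto
      then show "\<exists>M. \<forall>m\<ge>M. \<forall>n\<ge>M. dist (f m x) (f n x) < e"
        using that \<open>0 < e\<close> by (intro exI[of _ i0]) (force simp: dist_real_def)
    qed
    then show ?thesis using Cauchy_convergent convergent_LIMSEQ_iff by blast
  qed
  fix e :: real assume "0 < e"
  then obtain i0 where i0: "\<forall>i\<ge>i0. \<forall>i'\<ge>i0. \<forall>x\<in>S. \<bar>f i x - f i' x\<bar> \<le> e" using assms by blast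
  have "\<bar>f i x - lim (\<lambda>i. f i x)\<bar> \<le> e" if "i0 \<le> i" "x \<in> S" for i x
  proof (rule LIMSEQ_le_const2)
    show "(\<lambda>i'. \<bar>f i x - f i' x\<bar>) \<longlonglongrightarrow> \<bar>f i x - lim (\<lambda>i. f i x)\<bar>"
      by (intro tendsto_intros conv that)
    show "\<exists>N. \<forall>n\<ge>N. \<bar>f i x - f n x\<bar> \<le> e" using i0 that by blast
  qed
  then show "\<exists>i0. \<forall>i\<ge>i0. \<forall>x\<in>S. \<bar>f i x - lim (\<lambda>i. f i x)\<bar> \<le> e" by blast
qed

lemma uniform_limit_DERIV:
  fixes f f' :: "nat \<Rightarrow> real \<Rightarrow> real"
  assumes d: "\<And>n x. (f n has_real_derivative f' n x) (at x)"
    and u: "\<And>e. 0 < e \<Longrightarrow> \<exists>n0. \<forall>n\<ge>n0. \<forall>x. \<bar>f' n x - g' x\<bar> \<le> e"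
    and l: "\<And>x. (\<lambda>n. f n x) \<longlonglongrightarrow> g x"
  shows "(g has_real_derivative g' x) (at x)"
proof -
  have 1: "(f n has_derivative (\<lambda>h. f' n x * h)) (at x within UNIV)" for n x
    using d by (simp add: has_field_derivative_def)
  have 2: "\<forall>\<^sub>F n in sequentially. \<forall>x\<in>UNIV. \<forall>h. norm (f' n x * h - g' x * h) \<le> e * norm h" if "0 < e" for e
  proof -
    obtain n0 where n0: "\<forall>n\<ge>n0. \<forall>x. \<bar>f' n x - g' x\<bar> \<le> e" using u \<open>0 < e\<close> by blast
    have "norm (f' n x * h - g' x * h) \<le> e * norm h" if "n0 \<le> n" for n x h
    proof -
      have "\<bar>f' n x - g' x\<bar> * \<bar>h\<bar> \<le> e * \<bar>h\<bar>" using n0 that by (intro mult_right_mono) auto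
      then show ?thesis by (simp add: left_diff_distrib[symmetric] abs_mult)
    qed
    then show ?thesis by (auto simp: eventually_sequentially)
  qed
  obtain k where k: "\<And>x. (\<lambda>n. f n x) \<longlonglongrightarrow> k x" "\<And>x. (k has_derivative (\<lambda>h. g' x * h)) (at x)"
    using has_derivative_sequence[OF convex_UNIV 1 2 UNIV_I l[of 0]] by auto
  have "k = g" using LIMSEQ_unique[OF k(1) l] by auto
  then show ?thesis using k(2) by (simp add: has_field_derivative_def)
qed

lemma uniform_limit_continuous_on:
  fixes f :: "nat \<Rightarrow> real \<Rightarrow> real"
  assumes "\<And>n. continuous_on UNIV (f n)" "\<And>e. 0 < e \<Longrightarrow> \<exists>n0. \<forall>n\<ge>n0. \<forall>x. \<bar>f n x - g x\<bar> \<le> e"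
  shows "continuous_on UNIV g"
proof (rule uniform_limit_theorem[of _ f])
  show "uniform_limit UNIV f g sequentially"
  proof (rule uniform_limitI)
    fix e :: real assume "0 < e"
    then obtain n0 where "\<forall>n\<ge>n0. \<forall>x. \<bar>f n x - g x\<bar> \<le> e / 2" using assms(2)[of "e/2"] by auto
    then have "\<forall>n\<ge>n0. \<forall>x\<in>UNIV. dist (f n x) (g x) \<le> e / 2" by (simp add: dist_real_def)
    moreover have "e / 2 < e" using \<open>0 < e\<close> by simp
    ultimately have "\<forall>n\<ge>n0. \<forall>x\<in>UNIV. dist (f n x) (g x) < e" using le_less_trans by blast
    then show "\<forall>\<^sub>F n in sequentially. \<forall>x\<in>UNIV. dist (f n x) (g x) < e"
      unfolding eventually_sequentially by blast
  qed
qed (use assms(1) in auto)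

lemma dcoef_diff: "dcoef (\<lambda>k. x k - y k) = (\<lambda>k. dcoef x k - dcoef y k)"
  by (simp add: dcoef_def fun_eq_iff algebra_simps)

lemma supp_dcoef: "supp N x \<Longrightarrow> supp N (dcoef x)"
  by (auto simp: supp_def dcoef_def)

lemma trig_diff_levels:
  assumes "supp N x" "supp M y"
  shows "trig N x z - trig M y z = trig (max N M) (\<lambda>k. x k - y k) z"
  using trig_supp_mono[OF assms(1), of "max N M" z] trig_supp_mono[OF assms(2), of "max N M" z]
  by (simp add: trig_diff[symmetric])

lemma qf_diff_levels:
  assumes "supp N x" "supp M y"
  shows "qf (max N M) (\<lambda>k. x k - y k) \<le> 2 * qf N x + 2 * qf M y"
  using qf_diff_le[of "max N M" x y] qf_supp_mono[OF assms(1), of "max N M"] qf_supp_mono[OF assms(2), of "max N M"]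
  by simp

section \<open>Limits of the heights and of their first derivatives\<close>

locale flow_limit = flow_family +
  fixes \<nu> :: "nat \<Rightarrow> nat"
  assumes \<nu>_mono: "strict_mono \<nu>" and \<nu>1: "\<And>i. 1 \<le> \<nu> i"
    and cc_cauchy: "\<And>k e. 0 < e \<Longrightarrow> \<exists>i0. cc_close \<nu> k e i0"
begin

definition H where "H i t = trig (\<nu> i) (cc (\<nu> i) t)"
definition Hl where "Hl i t = trig (\<nu> i) (cl (\<nu> i) t)"
definition H1 where "H1 i t = trig (\<nu> i) (dcoef (cc (\<nu> i) t))"
definition G where "G i t = trig (\<nu> i) (jj (\<nu> i) t)"
definition h where "h t x = lim (\<lambda>i. H i t x)"
definition h1 where "h1 t x = lim (\<lambda>i. H1 i t x)"

lemma \<nu>_ge: "i \<le> \<nu> i"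
  by (rule seq_suble[OF \<nu>_mono])

lemma Q0_4: "0 \<le> 4 * Q0"
  using Q0_nonneg by simp

lemma cc_cauchy_modes:
  assumes "0 < e"
  shows "\<exists>i0. \<forall>k\<in>modes R. cc_close \<nu> k e i0"
  by (rule finite_pair_threshold) (use cc_cauchy[OF assms] in auto)

lemma equicontinuity_modes:
  assumes "0 < e"
  shows "\<exists>d>0. \<exists>N0. \<forall>k\<in>modes R. equi e k d N0"
proof (rule finite_radius_threshold)
  show "\<exists>d>0. \<exists>N0. equi e k d N0" for k using equicontinuity[OF assms, of k] by blast
qed (auto simp: equi_def)

lemma qf_c_diff: "1 \<le> N \<Longrightarrow> 1 \<le> M \<Longrightarrow> qf (max N M) (\<lambda>k. c N n k - c M m k) \<le> 4 * Q0"
  using qf_diff_levels[of N "c N n" M "c M m"] discrete_flow.supp_c[OF flow] qf_c[of N n] qf_c[of M m] by fastforce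

lemma H_cauchy:
  assumes "0 < e"
  shows "\<exists>i0. \<forall>i\<ge>i0. \<forall>i'\<ge>i0. \<forall>x\<in>{0<..1} \<times> UNIV. \<bar>H i (fst x) (snd x) - H i' (fst x) (snd x)\<bar> \<le> e"
proof -
  obtain R \<eta> where \<eta>: "0 < \<eta>" and
    small: "\<And>M x y. qf M x \<le> 4 * Q0 \<Longrightarrow> \<forall>k\<in>modes R. \<bar>x k\<bar> \<le> \<eta> \<Longrightarrow> \<bar>trig M x y\<bar> \<le> e"
    using trig_small_if_low_modes_small[OF assms Q0_4] by blast
  obtain i0 where i0: "\<forall>k\<in>modes R. cc_close \<nu> k \<eta> i0"
    using cc_cauchy_modes[OF \<eta>] by blast
  have "\<bar>H i t y - H i' t y\<bar> \<le> e" if "i0 \<le> i" "i0 \<le> i'" "0 < t" "t \<le> 1" for i i' t y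
    unfolding H_def trig_diff_levels[OF supp_cc[OF \<nu>1] supp_cc[OF \<nu>1]]
  proof (rule small)
    show "qf (max (\<nu> i) (\<nu> i')) (\<lambda>k. cc (\<nu> i) t k - cc (\<nu> i') t k) \<le> 4 * Q0"
      unfolding cc_def by (rule qf_c_diff[OF \<nu>1 \<nu>1])
  qed (use i0 that in blast)
  then show ?thesis by (intro exI[of _ i0]) auto
qed

lemma H_Hl:
  assumes "0 < e"
  shows "\<exists>i0. \<forall>i\<ge>i0. \<forall>t y. 0 < t \<longrightarrow> t \<le> 1 \<longrightarrow> \<bar>H i t y - Hl i t y\<bar> \<le> e"
proof -
  obtain R \<eta> where \<eta>: "0 < \<eta>" and
    small: "\<And>M x y. qf M x \<le> 4 * Q0 \<Longrightarrow> \<forall>k\<in>modes R. \<bar>x k\<bar> \<le> \<eta> \<Longrightarrow> \<bar>trig M x y\<bar> \<le> e"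
    using trig_small_if_low_modes_small[OF assms Q0_4] by blast
  obtain d N0 where N0: "\<forall>k\<in>modes R. equi \<eta> k d N0"
    using equicontinuity_modes[OF \<eta>, of R] by blast
  have "\<bar>H i t y - Hl i t y\<bar> \<le> e" if "N0 \<le> i" "0 < t" "t \<le> 1" for i t y
    unfolding H_def Hl_def trig_diff
  proof (rule small)
    show "qf (\<nu> i) (\<lambda>k. cc (\<nu> i) t k - cl (\<nu> i) t k) \<le> 4 * Q0"
      using qf_c_diff[OF \<nu>1 \<nu>1, of i i] by (simp add: cc_def cl_def)
    show "\<forall>k\<in>modes R. \<bar>cc (\<nu> i) t k - cl (\<nu> i) t k\<bar> \<le> \<eta>"
      using equiD(2)[OF _ order_trans[OF that(1) \<nu>_ge] that(2,3)] N0 by blast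
  qed
  then show ?thesis by blast
qed

lemma H_lim: "0 < t \<Longrightarrow> t \<le> 1 \<Longrightarrow> (\<lambda>i. H i t y) \<longlonglongrightarrow> h t y"
  and H_ulim: "0 < e \<Longrightarrow> \<exists>i0. \<forall>i\<ge>i0. \<forall>t y. 0 < t \<longrightarrow> t \<le> 1 \<longrightarrow> \<bar>H i t y - h t y\<bar> \<le> e"
proof -
  note u = uniformly_Cauchy_lim[of "{0<..1} \<times> UNIV" "\<lambda>i x. H i (fst x) (snd x)", OF H_cauchy, folded h_def]
  show "0 < t \<Longrightarrow> t \<le> 1 \<Longrightarrow> (\<lambda>i. H i t y) \<longlonglongrightarrow> h t y" using u(1)[of "(t, y)"] by simp
  show "0 < e \<Longrightarrow> \<exists>i0. \<forall>i\<ge>i0. \<forall>t y. 0 < t \<longrightarrow> t \<le> 1 \<longrightarrow> \<bar>H i t y - h t y\<bar> \<le> e"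
    using u(2)[of e] by (simp add: Ball_def imp_conjL)
qed

lemma Hl_ulim:
  assumes "0 < e"
  shows "\<exists>i0. \<forall>i\<ge>i0. \<forall>t x. 0 < t \<longrightarrow> t \<le> 1 \<longrightarrow> \<bar>Hl i t x - h t x\<bar> \<le> e"
proof -
  obtain i1 where 1: "\<forall>i\<ge>i1. \<forall>t x. 0 < t \<longrightarrow> t \<le> 1 \<longrightarrow> \<bar>H i t x - h t x\<bar> \<le> e / 2" using H_ulim[of "e/2"] assms by auto
  obtain i2 where 2: "\<forall>i\<ge>i2. \<forall>t x. 0 < t \<longrightarrow> t \<le> 1 \<longrightarrow> \<bar>H i t x - Hl i t x\<bar> \<le> e / 2" using H_Hl[of "e/2"] assms by auto
  have "\<bar>Hl i t x - h t x\<bar> \<le> e" if "max i1 i2 \<le> i" "0 < t" "t \<le> 1" for i t x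
  proof -
    have "\<bar>H i t x - h t x\<bar> \<le> e / 2" "\<bar>H i t x - Hl i t x\<bar> \<le> e / 2" using 1 2 that by auto
    then show ?thesis by linarith
  qed
  then show ?thesis by blast
qed

lemma cc_decay:
  assumes a: "0 < a" "a \<le> t" "t \<le> 1" and N: "1 \<le> N"
  shows "\<bar>of_int k * lam k * cc N t k\<bar> \<le> 2 * b1 * (1 + 4 * Q0 / a / b0)"
proof -
  interpret A: discrete_flow \<rho> b0 b1 L b N "1 / real N" "c N" "j N" by (rule flow[OF N])
  have "\<bar>of_int k * lam k * cc N t k\<bar> \<le> 2 * b1 * pavg \<rho> (A.J (step_idx N t))"
    unfolding cc_def by (rule A.c_decay)
  also have "... \<le> 2 * b1 * (1 powr \<rho> + A.D (step_idx N t) / (b0 * 1))"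
    using b1_pos by (intro mult_left_mono A.average_flux_le) auto
  also have "... \<le> 2 * b1 * (1 + 4 * Q0 / a / b0)"
  proof (intro mult_left_mono add_mono)
    have "A.D (step_idx N t) / b0 \<le> 4 * Q0 / a / b0"
      using DD_le[OF N a] b0 by (intro divide_right_mono) (auto simp: DD_eq[OF N])
    then show "A.D (step_idx N t) / (b0 * 1) \<le> 4 * Q0 / a / b0" by simp
  qed (use b1_pos in auto)
  finally show ?thesis .
qed

lemma cc_decay_diff:
  assumes a: "0 < a" "a \<le> t" "t \<le> 1" "a \<le> s" "s \<le> 1" and N: "1 \<le> N" "1 \<le> M"
  shows "\<bar>of_int k * lam k * (cc N t k - cc M s k)\<bar> \<le> 4 * b1 * (1 + 4 * Q0 / a / b0)"
  using cc_decay[OF a(1-3) N(1), of k] cc_decay[OF a(1,4,5) N(2), of k]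
  unfolding right_diff_distrib by linarith

lemma decay_const_nonneg: "0 < a \<Longrightarrow> 0 \<le> 4 * b1 * (1 + 4 * Q0 / a / b0)"
  using b1_pos Q0_nonneg b0 by (intro mult_nonneg_nonneg add_nonneg_nonneg) auto

text \<open>Uniformity holds on [a, 1] only: the cubic decay of the coefficients rests on the
  dissipation bound, which deteriorates as t tends to 0.\<close>

lemma H1_cauchy:
  assumes a: "0 < a" and e: "0 < e"
  shows "\<exists>i0. \<forall>i\<ge>i0. \<forall>i'\<ge>i0. \<forall>x\<in>{a..1} \<times> UNIV. \<bar>H1 i (fst x) (snd x) - H1 i' (fst x) (snd x)\<bar> \<le> e"
proof -
  obtain R \<eta> where \<eta>: "0 < \<eta>" and
    small: "\<And>M x y. \<forall>k. \<bar>of_int k * lam k * x k\<bar> \<le> 4 * b1 * (1 + 4 * Q0 / a / b0) \<Longrightarrow>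
      \<forall>k\<in>modes R. \<bar>x k\<bar> \<le> \<eta> \<Longrightarrow> \<bar>trig M (dcoef x) y\<bar> \<le> e"
    using dtrig_small_if_low_modes_small[OF e decay_const_nonneg[OF a]] by blast
  obtain i0 where i0: "\<forall>k\<in>modes R. cc_close \<nu> k \<eta> i0"
    using cc_cauchy_modes[OF \<eta>] by blast
  have "\<bar>H1 i t y - H1 i' t y\<bar> \<le> e" if "i0 \<le> i" "i0 \<le> i'" "a \<le> t" "t \<le> 1" for i i' t y
    unfolding H1_def trig_diff_levels[OF supp_dcoef[OF supp_cc[OF \<nu>1]] supp_dcoef[OF supp_cc[OF \<nu>1]]] dcoef_diff[symmetric]
  proof (rule small)
    show "\<forall>k. \<bar>of_int k * lam k * (cc (\<nu> i) t k - cc (\<nu> i') t k)\<bar> \<le> 4 * b1 * (1 + 4 * Q0 / a / b0)"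
      using cc_decay_diff[OF a that(3,4,3,4) \<nu>1 \<nu>1] by blast
    show "\<forall>k\<in>modes R. \<bar>cc (\<nu> i) t k - cc (\<nu> i') t k\<bar> \<le> \<eta>" using i0 that a by auto
  qed
  then show ?thesis by (intro exI[of _ i0]) auto
qed

lemma H1_lim: "0 < t \<Longrightarrow> t \<le> 1 \<Longrightarrow> (\<lambda>i. H1 i t y) \<longlonglongrightarrow> h1 t y"
  and H1_ulim: "0 < e \<Longrightarrow> 0 < a \<Longrightarrow> \<exists>i0. \<forall>i\<ge>i0. \<forall>t y. a \<le> t \<longrightarrow> t \<le> 1 \<longrightarrow> \<bar>H1 i t y - h1 t y\<bar> \<le> e"
proof -
  note u = uniformly_Cauchy_lim[of "{a..1} \<times> UNIV" "\<lambda>i x. H1 i (fst x) (snd x)" for a, OF H1_cauchy, folded h1_def]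
  show "0 < t \<Longrightarrow> t \<le> 1 \<Longrightarrow> (\<lambda>i. H1 i t y) \<longlonglongrightarrow> h1 t y" using u(1)[of t "(t, y)"] by simp
  show "0 < e \<Longrightarrow> 0 < a \<Longrightarrow> \<exists>i0. \<forall>i\<ge>i0. \<forall>t y. a \<le> t \<longrightarrow> t \<le> 1 \<longrightarrow> \<bar>H1 i t y - h1 t y\<bar> \<le> e"
    using u(2)[of a e] by (simp add: Ball_def imp_conjL)
qed

lemma continuous_H: "continuous_on A (H i t)" and continuous_Hl: "continuous_on A (Hl i t)"
  and continuous_H1: "continuous_on A (H1 i t)" and continuous_G: "continuous_on A (G i t)"
  unfolding H_def Hl_def H1_def G_def using continuous_on_trig[OF continuous_on_id] by auto

lemma h_deriv: "0 < t \<Longrightarrow> t \<le> 1 \<Longrightarrow> (h t has_real_derivative h1 t y) (at y)"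
proof (rule uniform_limit_DERIV[of "\<lambda>i. H i t" "\<lambda>i. H1 i t"])
  show "(H i t has_real_derivative H1 i t x) (at x)" for i x unfolding H_def H1_def by (rule trig_deriv)
  assume t: "0 < t" "t \<le> 1"
  show "0 < e \<Longrightarrow> \<exists>n0. \<forall>n\<ge>n0. \<forall>x. \<bar>H1 n t x - h1 t x\<bar> \<le> e" for e using H1_ulim[of e t] t by auto
  show "(\<lambda>n. H n t x) \<longlonglongrightarrow> h t x" for x by (rule H_lim[OF t])
qed

lemma continuous_h: "0 < t \<Longrightarrow> t \<le> 1 \<Longrightarrow> continuous_on UNIV (h t)"
  by (rule uniform_limit_continuous_on[of "\<lambda>i. H i t", OF continuous_H]) (use H_ulim in blast)

lemma continuous_h1: "0 < t \<Longrightarrow> t \<le> 1 \<Longrightarrow> continuous_on UNIV (h1 t)"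
proof (rule uniform_limit_continuous_on[of "\<lambda>i. H1 i t", OF continuous_H1])
  assume t: "0 < t" "t \<le> 1"
  show "0 < e \<Longrightarrow> \<exists>n0. \<forall>n\<ge>n0. \<forall>x. \<bar>H1 n t x - h1 t x\<bar> \<le> e" for e using H1_ulim[of e t] t by auto
qed

lemma periodic_h: "0 < t \<Longrightarrow> t \<le> 1 \<Longrightarrow> periodic (h t)"
  unfolding periodic_def h_def H_def by (simp add: trig_periodic)

lemma periodic_h1: "0 < t \<Longrightarrow> t \<le> 1 \<Longrightarrow> periodic (h1 t)"
  unfolding periodic_def h1_def H1_def by (simp add: trig_periodic)

lemma time_continuity:
  assumes e: "0 < e" and a: "0 < a"
  shows "\<exists>d>0. \<forall>s t y. a \<le> s \<longrightarrow> s \<le> t \<longrightarrow> t \<le> 1 \<longrightarrow> t - s \<le> d \<longrightarrow>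
    \<bar>h t y - h s y\<bar> \<le> e \<and> \<bar>h1 t y - h1 s y\<bar> \<le> e"
proof -
  obtain R \<eta> where \<eta>: "0 < \<eta>" and
    small: "\<And>M x y. qf M x \<le> 4 * Q0 \<Longrightarrow> \<forall>k\<in>modes R. \<bar>x k\<bar> \<le> \<eta> \<Longrightarrow> \<bar>trig M x y\<bar> \<le> e"
    using trig_small_if_low_modes_small[OF e Q0_4] by blast
  obtain R' \<eta>' where \<eta>': "0 < \<eta>'" and
    small': "\<And>M x y. \<forall>k. \<bar>of_int k * lam k * x k\<bar> \<le> 4 * b1 * (1 + 4 * Q0 / a / b0) \<Longrightarrow>
      \<forall>k\<in>modes R'. \<bar>x k\<bar> \<le> \<eta>' \<Longrightarrow> \<bar>trig M (dcoef x) y\<bar> \<le> e"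
    using dtrig_small_if_low_modes_small[OF e decay_const_nonneg[OF a]] by blast
  obtain d N0 where d: "0 < d" and D: "\<And>k. k \<in> modes R \<Longrightarrow> equi \<eta> k d N0"
    using equicontinuity_modes[OF \<eta>, of R] by blast
  obtain d' N0' where d': "0 < d'" and D': "\<And>k. k \<in> modes R' \<Longrightarrow> equi \<eta>' k d' N0'"
    using equicontinuity_modes[OF \<eta>', of R'] by blast
  have "\<bar>h t y - h s y\<bar> \<le> e \<and> \<bar>h1 t y - h1 s y\<bar> \<le> e"
    if st: "a \<le> s" "s \<le> t" "t \<le> 1" "t - s \<le> min d d'" for s t y
  proof
    have pos: "0 < s" "0 < t" "s \<le> 1" using st a by linarith+
    have fin: "\<bar>H i t y - H i s y\<bar> \<le> e" if "N0 \<le> i" for i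
      unfolding H_def trig_diff
    proof (rule small)
      show "qf (\<nu> i) (\<lambda>k. cc (\<nu> i) t k - cc (\<nu> i) s k) \<le> 4 * Q0"
        using qf_c_diff[OF \<nu>1 \<nu>1, of i i] by (simp add: cc_def)
      show "\<forall>k\<in>modes R. \<bar>cc (\<nu> i) t k - cc (\<nu> i) s k\<bar> \<le> \<eta>"
      proof
        fix k assume k: "k \<in> modes R"
        show "\<bar>cc (\<nu> i) t k - cc (\<nu> i) s k\<bar> \<le> \<eta>"
          by (rule equiD(1)[OF D[OF k] order_trans[OF that \<nu>_ge] pos(1) st(2,3)]) (use st(4) in linarith)
      qed
    qed
    show "\<bar>h t y - h s y\<bar> \<le> e"
    proof (rule LIMSEQ_le_const2)
      show "(\<lambda>i. \<bar>H i t y - H i s y\<bar>) \<longlonglongrightarrow> \<bar>h t y - h s y\<bar>"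
        using pos st by (intro tendsto_intros H_lim) auto
    qed (use fin in blast)
    have fin': "\<bar>H1 i t y - H1 i s y\<bar> \<le> e" if "N0' \<le> i" for i
      unfolding H1_def trig_diff dcoef_diff[symmetric]
    proof (rule small')
      show "\<forall>k. \<bar>of_int k * lam k * (cc (\<nu> i) t k - cc (\<nu> i) s k)\<bar> \<le> 4 * b1 * (1 + 4 * Q0 / a / b0)"
        using cc_decay_diff[OF a _ st(3) st(1) pos(3) \<nu>1 \<nu>1] st by auto
      show "\<forall>k\<in>modes R'. \<bar>cc (\<nu> i) t k - cc (\<nu> i) s k\<bar> \<le> \<eta>'"
      proof
        fix k assume k: "k \<in> modes R'"
        show "\<bar>cc (\<nu> i) t k - cc (\<nu> i) s k\<bar> \<le> \<eta>'"
          by (rule equiD(1)[OF D'[OF k] order_trans[OF that \<nu>_ge] pos(1) st(2,3)]) (use st(4) in linarith)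
      qed
    qed
    show "\<bar>h1 t y - h1 s y\<bar> \<le> e"
    proof (rule LIMSEQ_le_const2)
      show "(\<lambda>i. \<bar>H1 i t y - H1 i s y\<bar>) \<longlonglongrightarrow> \<bar>h1 t y - h1 s y\<bar>"
        using pos st by (intro tendsto_intros H1_lim) auto
    qed (use fin' in blast)
  qed
  then show ?thesis using d d' by (intro exI[of _ "min d d'"]) auto
qed

text \<open>The mean is conserved exactly, the modes 1 and -1 move little by
  \<open>low_mode\<close>, and the energy bounds the rest. The estimate serves to keep h where the
  truncation of the weight is inactive.\<close>

lemma h_near_mean:
  assumes l: "0 < l" and t: "0 < t" "t \<le> 1"
  shows "\<bar>h t y - c0 0\<bar> \<le> 2 * (\<bar>c0 1\<bar> + \<bar>c0 (-1)\<bar> + 4 * (l + l powr (- \<rho>) / b0 * Q0)) + 2 * sqrt (2 * Q0)"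
proof (rule LIMSEQ_le_const2)
  show "(\<lambda>i. \<bar>H i t y - c0 0\<bar>) \<longlonglongrightarrow> \<bar>h t y - c0 0\<bar>" using t by (intro tendsto_intros H_lim)
  have "\<bar>H i t y - c0 0\<bar> \<le> 2 * (\<bar>c0 1\<bar> + \<bar>c0 (-1)\<bar> + 4 * (l + l powr (- \<rho>) / b0 * Q0)) + 2 * sqrt (2 * Q0)" for i
  proof -
    let ?N = "\<nu> i"
    interpret A: discrete_flow \<rho> b0 b1 L b ?N "1 / real ?N" "c ?N" "j ?N" by (rule flow[OF \<nu>1])
    define E where "E = l + l powr (- \<rho>) / b0 * Q0"
    define x where "x k = (if k = 0 then 0 else cc ?N t k)" for k
    have z: "cc ?N t 0 = c0 0" using A.c_zero_mode[of "Suc (step_idx ?N t)"] by (simp add: cc_def init)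
    have "H i t y - trig ?N x y = (\<Sum>k\<in>modes ?N. if k = 0 then c0 0 else 0)"
      unfolding H_def trig_diff unfolding trig_def x_def by (intro sum.cong) (auto simp: z)
    then have e: "H i t y - c0 0 = trig ?N x y" by simp
    have one: "\<bar>x k\<bar> \<le> \<bar>c0 k\<bar> + 2 * E" if k: "\<bar>k\<bar> = 1" for k
      using low_mode[OF \<nu>1 t l, of k i] k by (auto simp: x_def E_def)
    have m1: "modes 1 = {-1, 0, 1}" by auto
    have "(\<Sum>k\<in>modes ?N. \<bar>x k\<bar>) \<le> (\<Sum>k\<in>modes 1. \<bar>x k\<bar>) + (\<Sum>k\<in>modes ?N - modes 1. \<bar>x k\<bar>)" by (rule sum_abs_modes_split)
    also have "(\<Sum>k\<in>modes 1. \<bar>x k\<bar>) = \<bar>x (-1)\<bar> + \<bar>x 1\<bar>" unfolding m1 by (simp add: x_def)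
    also have "... \<le> \<bar>c0 1\<bar> + \<bar>c0 (-1)\<bar> + 4 * E" using one[of 1] one[of "-1"] by simp
    also have "(\<Sum>k\<in>modes ?N - modes 1. \<bar>x k\<bar>) \<le> sqrt (2 * Q0)"
    proof -
      have "(\<Sum>k\<in>modes ?N - modes 1. \<bar>x k\<bar>) \<le> sqrt (2 / real 1 * qf ?N x)" by (rule tail_sum_le) simp
      also have "qf ?N x = qf ?N (cc ?N t)" unfolding qf_def by (intro sum.cong) (auto simp: x_def)
      also have "sqrt (2 / real 1 * qf ?N (cc ?N t)) \<le> sqrt (2 * Q0)"
        using qf_c[OF \<nu>1, of i "Suc (step_idx ?N t)"] by (simp add: cc_def)
      finally show ?thesis .
    qed
    finally have "(\<Sum>k\<in>modes ?N. \<bar>x k\<bar>) \<le> \<bar>c0 1\<bar> + \<bar>c0 (-1)\<bar> + 4 * E + sqrt (2 * Q0)" by simp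
    from order_trans[OF abs_trig_le mult_left_mono[OF this]] show ?thesis
      unfolding e E_def[symmetric] distrib_left[of 2 "_ + _" "sqrt _", symmetric] by simp
  qed
  then show "\<exists>N. \<forall>n\<ge>N. \<bar>H n t y - c0 0\<bar> \<le> 2 * (\<bar>c0 1\<bar> + \<bar>c0 (-1)\<bar> + 4 * (l + l powr (- \<rho>) / b0 * Q0)) + 2 * sqrt (2 * Q0)"
    by blast
qed

text \<open>The discrete energies at time 1 tend to 0, and with them, by \<open>tail_sum_le\<close>,
  everything beyond the modes 0, 1 and -1.\<close>

lemma extinct_at_1:
  assumes A: "0 < A" "Q0 \<le> A"
    and small: "2 powr ext_exp * A powr (1 - ext_exp) / ext_const / (1 - (1 / 2) powr (1 - ext_exp)) \<le> 1 / 2"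
  obtains p q where "\<And>x. h 1 x = c0 0 + p * cas 1 x + q * cas (-1) x"
proof -
  have Qn: "qf N (cc N 1) \<le> A / 2 ^ (N div 2)" if N: "1 \<le> N" for N
  proof -
    interpret A: discrete_flow \<rho> b0 b1 L b N "1 / real N" "c N" "j N" by (rule flow[OF N])
    have "qf N (c N N) \<le> A / 2 ^ (N div 2)"
      by (rule extinction[OF ext_const_pos ext_exp A(1) _ N _ small])
         (use qf_c[OF N, of 0] A(2) A.qf_step in auto)
    moreover have "cc N 1 = c N N" using N by (simp add: cc_def step_idx_def)
    ultimately show ?thesis by simp
  qed
  define u where "u k = lim (\<lambda>i. cc (\<nu> i) 1 k)" for k
  have u: "(\<lambda>i. cc (\<nu> i) 1 k) \<longlonglongrightarrow> u k" for k
    unfolding u_def by (rule uniformly_Cauchy_lim(1)[of "{0<..1}" "\<lambda>i t. cc (\<nu> i) t k"]) (simp_all add: Ball_def imp_conjL cc_cauchy)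
  have "h 1 x = c0 0 + u 1 * cas 1 x + u (-1) * cas (-1) x" for x
  proof -
    define r where "r i = H i 1 x - (c0 0 + cc (\<nu> i) 1 1 * cas 1 x + cc (\<nu> i) 1 (-1) * cas (-1) x)" for i
    have rb: "\<bar>r i\<bar> \<le> 2 * sqrt (2 * (A / 2 ^ (\<nu> i div 2)))" for i
    proof -
      let ?N = "\<nu> i"
      interpret A: discrete_flow \<rho> b0 b1 L b ?N "1 / real ?N" "c ?N" "j ?N" by (rule flow[OF \<nu>1])
      have z: "cc ?N 1 0 = c0 0" using A.c_zero_mode[of "Suc (step_idx ?N 1)"] by (simp add: cc_def init)
      have m1: "modes 1 = {-1, 0, 1}" by auto
      have sub: "modes 1 \<subseteq> modes ?N" using \<nu>1[of i] by auto
      have "H i 1 x = (\<Sum>k\<in>modes ?N - modes 1. cc ?N 1 k * cas k x) + (\<Sum>k\<in>modes 1. cc ?N 1 k * cas k x)"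
        unfolding H_def trig_def by (rule sum.subset_diff[OF sub]) simp
      also have "(\<Sum>k\<in>modes 1. cc ?N 1 k * cas k x) = c0 0 + cc ?N 1 1 * cas 1 x + cc ?N 1 (-1) * cas (-1) x"
        unfolding m1 by (simp add: z)
      finally have "r i = (\<Sum>k\<in>modes ?N - modes 1. cc ?N 1 k * cas k x)" by (simp add: r_def)
      also have "\<bar>...\<bar> \<le> (\<Sum>k\<in>modes ?N - modes 1. \<bar>cc ?N 1 k\<bar> * 2)"
        by (rule order_trans[OF sum_abs]) (auto simp: abs_mult intro!: sum_mono mult_left_mono abs_cas_le)
      also have "... = 2 * (\<Sum>k\<in>modes ?N - modes 1. \<bar>cc ?N 1 k\<bar>)" by (simp add: sum_distrib_left mult.commute)
      also have "(\<Sum>k\<in>modes ?N - modes 1. \<bar>cc ?N 1 k\<bar>) \<le> sqrt (2 / real 1 * qf ?N (cc ?N 1))"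
        by (rule tail_sum_le) simp
      also have "... \<le> sqrt (2 * (A / 2 ^ (?N div 2)))" using Qn[OF \<nu>1, of i] by simp
      finally show ?thesis by simp
    qed
    have "(\<lambda>i. 2 * sqrt (2 * (A / 2 ^ (\<nu> i div 2)))) \<longlonglongrightarrow> 2 * sqrt (2 * 0)"
    proof (intro tendsto_intros)
      have "filterlim (\<lambda>n::nat. n div 2) at_top sequentially"
        unfolding filterlim_at_top eventually_sequentially
      proof
        fix Z :: nat
        show "\<exists>N. \<forall>n\<ge>N. Z \<le> n div 2" by (rule exI[of _ "2 * Z"]) auto
      qed
      then have "filterlim (\<lambda>i. \<nu> i div 2) at_top sequentially"
        by (rule filterlim_compose) (rule filterlim_subseq[OF \<nu>_mono])
      then have "(\<lambda>i. (1 / 2 :: real) ^ (\<nu> i div 2)) \<longlonglongrightarrow> 0"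
        by (rule filterlim_compose[OF LIMSEQ_realpow_zero, rotated 2]) auto
      from tendsto_mult_left[OF this, of A] show "(\<lambda>i. A / 2 ^ (\<nu> i div 2)) \<longlonglongrightarrow> 0"
        by (simp add: power_divide)
    qed
    then have "(\<lambda>i. 2 * sqrt (2 * (A / 2 ^ (\<nu> i div 2)))) \<longlonglongrightarrow> 0" by simp
    then have r0: "r \<longlonglongrightarrow> 0" by (rule Lim_null_comparison[rotated]) (use rb in auto)
    have "(\<lambda>i. r i + (c0 0 + cc (\<nu> i) 1 1 * cas 1 x + cc (\<nu> i) 1 (-1) * cas (-1) x))
        \<longlonglongrightarrow> 0 + (c0 0 + u 1 * cas 1 x + u (-1) * cas (-1) x)"
      by (intro tendsto_intros r0 u)
    then have "(\<lambda>i. H i 1 x) \<longlonglongrightarrow> c0 0 + u 1 * cas 1 x + u (-1) * cas (-1) x" by (simp add: r_def)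
    then show ?thesis using LIMSEQ_unique[OF H_lim[of 1 x]] by simp
  qed
  then show thesis by (rule that)
qed

end

section \<open>Attainment of the initial value in H1\<close>

lemma sum_power2_le3: "(a + b + c)\<^sup>2 \<le> 3 * (a\<^sup>2 + b\<^sup>2 + (c :: real)\<^sup>2)"
proof -
  have "0 \<le> (a - b)\<^sup>2 + (b - c)\<^sup>2 + (a - c)\<^sup>2" by simp
  then show ?thesis by (simp add: power2_eq_square algebra_simps)
qed

lemma sum_bound_15:
  fixes z u v w d :: real
  shows "z \<le> 3 * (u + v + w) \<Longrightarrow> u \<le> d \<Longrightarrow> v \<le> 3 * d \<Longrightarrow> w \<le> d \<Longrightarrow> z \<le> 15 * d"
  by (simp add: algebra_simps)

lemma average_sq_diff_le3:
  assumes "integrable circle (\<lambda>x. (u x - v x)\<^sup>2)" "integrable circle (\<lambda>x. (v x - w x)\<^sup>2)"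
    "integrable circle (\<lambda>x. (w x - z x)\<^sup>2)" "integrable circle (\<lambda>x. (u x - z x)\<^sup>2)"
  shows "(AVG x. (u x - z x)\<^sup>2) \<le> 3 * ((AVG x. (u x - v x)\<^sup>2) + (AVG x. (v x - w x)\<^sup>2) + (AVG x. (w x - z x)\<^sup>2))"
proof -
  have "(AVG x. (u x - z x)\<^sup>2) \<le> (AVG x. 3 * ((u x - v x)\<^sup>2 + (v x - w x)\<^sup>2 + (w x - z x)\<^sup>2))"
  proof (rule average_mono)
    show "(u x - z x)\<^sup>2 \<le> 3 * ((u x - v x)\<^sup>2 + (v x - w x)\<^sup>2 + (w x - z x)\<^sup>2)" for x
      using sum_power2_le3[of "u x - v x" "v x - w x" "w x - z x"] by simp
  qed (use assms in simp_all)
  then show ?thesis using assms by (simp add: average_cmult average_add)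
qed

lemma integrable_sq_diff:
  fixes f g :: "real \<Rightarrow> real"
  assumes "integrable circle (\<lambda>x. (f x)\<^sup>2)" "integrable circle f" "continuous_on {0..2*pi} g"
  shows "integrable circle (\<lambda>x. (g x - f x)\<^sup>2)"
proof -
  have "integrable circle (\<lambda>x. (g x)\<^sup>2)" by (intro circle_integrable continuous_intros assms)
  moreover have "integrable circle (\<lambda>x. f x * g x)" by (rule integrable_mult_continuous[OF assms(2,3)])
  ultimately have "integrable circle (\<lambda>x. (g x)\<^sup>2 + (f x)\<^sup>2 - 2 * (f x * g x))" using assms(1) by simp
  then show ?thesis by (simp add: power2_diff mult_ac)
qed

text \<open>Passage from the energy to the H1 seminorm: k^2 is at most 4/3 of \<open>lam k\<close>
  for |k| \<ge> 2, while the modes 1 and -1 need a bound of their own.\<close>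

lemma sum_modes_sq_le:
  assumes N: "1 \<le> N" and x: "\<And>k. k \<in> {-1, 1} \<Longrightarrow> (x k)\<^sup>2 \<le> e"
  shows "(\<Sum>k\<in>modes N. (of_int k * x k)\<^sup>2) \<le> 2 * e + 4 / 3 * qf N x"
proof -
  have "(\<Sum>k\<in>modes N. (of_int k * x k)\<^sup>2) \<le> (\<Sum>k\<in>modes N. (if k \<in> {-1, 1} then e else 0) + 4 / 3 * (lam k * (x k)\<^sup>2))"
  proof (rule sum_mono)
    fix k
    show "(of_int k * x k)\<^sup>2 \<le> (if k \<in> {-1, 1} then e else 0) + 4 / 3 * (lam k * (x k)\<^sup>2)"
    proof (cases "2 \<le> \<bar>k\<bar>")
      case True
      from mult_right_mono[OF sq_le_lam[OF this], of "(x k)\<^sup>2"] show ?thesis using True by (auto simp: power_mult_distrib)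
    next
      case False
      then have "k = 0 \<or> k = 1 \<or> k = -1" by linarith
      then show ?thesis using x[of k] by (auto simp: lam_def)
    qed
  qed
  also have "... = (\<Sum>k\<in>modes N. if k \<in> {-1, 1} then e else 0) + 4 / 3 * qf N x"
    by (simp add: sum.distrib qf_def sum_distrib_left)
  also have "(\<Sum>k\<in>modes N. if k \<in> {-1, 1} then e else 0) = 2 * e"
    using N by (subst sum.inter_restrict[symmetric]) (auto simp: Int_absorb1)
  finally show ?thesis .
qed

context flow_limit begin

text \<open>Each mode converges as t tends to 0, and the energy never exceeds its initial value. As
  in a Hilbert space, coefficientwise convergence without excess of norm is strong
  convergence.\<close>

lemma initial_limit:
  assumes h0: "integrable circle h0" "integrable circle (\<lambda>x. (h0 x)\<^sup>2)" "\<And>k. coef h0 k = c0 k"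
    and g0: "integrable circle g0" "integrable circle (\<lambda>x. (g0 x)\<^sup>2)" "\<And>k. coef g0 k = dcoef c0 k"
    and e: "0 < e"
  shows "\<exists>d>0. \<forall>t. 0 < t \<longrightarrow> t \<le> d \<longrightarrow> t \<le> 1 \<longrightarrow>
    (AVG x. (h t x - h0 x)\<^sup>2) \<le> e \<and> (AVG x. (h1 t x - g0 x)\<^sup>2) \<le> e"
proof -
  \<comment> \<open>The three errors in \<open>comb\<close> are e', 3 e' and e', and the square of a
    sum of three terms costs another factor 3.\<close>
  define e' where "e' = e / 15"
  have e': "0 < e'" using e by (simp add: e'_def)
  have ch0: "coef h0 = c0" and cg0: "coef g0 = dcoef c0" using h0(3) g0(3) by auto
  obtain R1 where R1: "\<forall>N\<ge>R1. (AVG x. (h0 x - trig N c0 x)\<^sup>2) < e'"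
    using parseval_trig[OF h0(1,2) e'] by (auto simp: ch0)
  obtain R where R: "\<forall>N\<ge>R. (AVG x. (g0 x - trig N (dcoef c0) x)\<^sup>2) < e' / 8"
    using parseval_trig[OF g0(1,2), of "e' / 8"] e' by (auto simp: cg0)
  have tail: "(\<Sum>k\<in>modes N - modes R. (of_int k * c0 k)\<^sup>2) \<le> e' / 8" if "R \<le> N" for N
  proof -
    have "(\<Sum>k\<in>modes N. (dcoef c0 k)\<^sup>2) \<le> (AVG x. (g0 x)\<^sup>2)" using bessel[OF g0(1,2), of N] by (simp add: cg0)
    moreover have "(\<Sum>k\<in>modes N. (dcoef c0 k)\<^sup>2) = (\<Sum>k\<in>modes N - modes R. (dcoef c0 k)\<^sup>2) + (\<Sum>k\<in>modes R. (dcoef c0 k)\<^sup>2)"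
      using that by (intro sum.subset_diff) auto
    moreover have "(AVG x. (g0 x - trig R (dcoef c0) x)\<^sup>2) \<le> e' / 8" using R by (simp add: less_imp_le)
    ultimately have "(\<Sum>k\<in>modes N - modes R. (dcoef c0 k)\<^sup>2) \<le> e' / 8"
      using average_diff_trig_sq[OF g0(1,2), of R "dcoef c0"] by (simp add: cg0)
    also have "(\<Sum>k\<in>modes N - modes R. (dcoef c0 k)\<^sup>2) = (\<Sum>k\<in>modes N - modes R. (of_int k * c0 k)\<^sup>2)"
      by (rule sum.reindex_bij_witness[where i = uminus and j = uminus]) (auto simp: dcoef_def power_mult_distrib)
    finally show ?thesis .
  qed
  define C where "C = (\<Sum>k\<in>modes R. (of_int k)\<^sup>2 * \<bar>c0 k\<bar>)"
  have C: "0 \<le> C" unfolding C_def by (intro sum_nonneg mult_nonneg_nonneg) auto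
  define \<eta> where "\<eta> = min 1 (e' / (8 * (C + 1)))"
  have \<eta>: "0 < \<eta>" "\<eta> \<le> 1" using e' C by (auto simp: \<eta>_def)
  have "(C + 1) * \<eta> \<le> (C + 1) * (e' / (8 * (C + 1)))" using C by (intro mult_left_mono) (auto simp: \<eta>_def)
  also have "... = e' / 8" using C by (simp add: field_simps)
  finally have C\<eta>: "C * \<eta> + \<eta> \<le> e' / 8" by (simp add: distrib_right)
  obtain d N0 where d: "0 < d" and D: "\<And>k. k \<in> modes (max 1 R) \<Longrightarrow> equi \<eta> k d N0"
    using equicontinuity_modes[OF \<eta>(1), of "max 1 R"] by blast
  have key: "(\<Sum>k\<in>modes N. (of_int k)\<^sup>2 * (cc N t k - c0 k)\<^sup>2) \<le> 3 * e'"
    if N: "N0 \<le> N" "R \<le> N" "1 \<le> N" and t: "0 < t" "t \<le> d" "t \<le> 1" for N t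
  proof -
    let ?x = "\<lambda>k. cc N t k - c0 k"
    have close: "\<bar>?x k\<bar> \<le> \<eta>" if "k \<in> modes (max 1 R)" for k
    proof -
      have "k \<in> modes N" using that N by auto
      then show ?thesis using equiD(3)[OF D[OF that] N(1) t(1,3,2)] init[of N k] by (simp only: if_True)
    qed
    \<comment> \<open>The square of the deviation is the difference of the squares minus twice the
      product with c0. This cross term is small on low modes because the deviation is, and on high
      modes because c0 is, at the price of half the left-hand side.\<close>
    have p: "lam k * (?x k)\<^sup>2 \<le> (lam k * (cc N t k)\<^sup>2 - lam k * (c0 k)\<^sup>2)
        + (if k \<in> modes R then 2 * \<eta> * ((of_int k)\<^sup>2 * \<bar>c0 k\<bar>) else 2 * (of_int k * c0 k)\<^sup>2) + lam k * (?x k)\<^sup>2 / 2" for k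
    proof -
      have eq: "lam k * (?x k)\<^sup>2 = (lam k * (cc N t k)\<^sup>2 - lam k * (c0 k)\<^sup>2) - 2 * (lam k * (c0 k * ?x k))"
        by (simp add: power2_eq_square algebra_simps)
      show ?thesis
      proof (cases "k \<in> modes R")
        case True
        have "- (c0 k * ?x k) \<le> \<bar>c0 k\<bar> * \<bar>?x k\<bar>" by (metis abs_ge_minus_self abs_mult)
        also have "... \<le> \<bar>c0 k\<bar> * \<eta>" by (intro mult_left_mono close) (use True in \<open>auto simp: max_def\<close>)
        finally have "lam k * - (c0 k * ?x k) \<le> lam k * (\<bar>c0 k\<bar> * \<eta>)" by (intro mult_left_mono lam_nonneg)
        also have "... \<le> (of_int k)\<^sup>2 * (\<bar>c0 k\<bar> * \<eta>)" using \<eta> by (intro mult_right_mono lam_le) auto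
        also have "... = \<eta> * ((of_int k)\<^sup>2 * \<bar>c0 k\<bar>)" by (simp add: mult_ac)
        finally have "- 2 * (lam k * (c0 k * ?x k)) \<le> 2 * \<eta> * ((of_int k)\<^sup>2 * \<bar>c0 k\<bar>)"
          unfolding mult_minus_right mult.assoc[of 2] by linarith
        moreover have "0 \<le> lam k * (?x k)\<^sup>2" by (simp add: lam_nonneg)
        ultimately show ?thesis unfolding if_P[OF True] using eq by linarith
      next
        case False
        have "0 \<le> lam k * (2 * c0 k + ?x k)\<^sup>2" by (simp add: lam_nonneg)
        also have "... = 4 * (lam k * (c0 k)\<^sup>2) + 4 * (lam k * (c0 k * ?x k)) + lam k * (?x k)\<^sup>2"
          by (simp add: power2_eq_square algebra_simps)
        finally have "- 2 * (lam k * (c0 k * ?x k)) \<le> 2 * (lam k * (c0 k)\<^sup>2) + lam k * (?x k)\<^sup>2 / 2" by simp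
        moreover have "lam k * (c0 k)\<^sup>2 \<le> (of_int k * c0 k)\<^sup>2"
          unfolding power_mult_distrib by (intro mult_right_mono lam_le) simp
        ultimately show ?thesis unfolding if_not_P[OF False] using eq by linarith
      qed
    qed
    have "qf N ?x \<le> (qf N (cc N t) - qf N c0)
        + (\<Sum>k\<in>modes N. if k \<in> modes R then 2 * \<eta> * ((of_int k)\<^sup>2 * \<bar>c0 k\<bar>) else 2 * (of_int k * c0 k)\<^sup>2) + qf N ?x / 2"
      unfolding qf_def sum_subtractf[symmetric] sum_divide_distrib sum.distrib[symmetric] by (rule sum_mono[OF p])
    also have "(\<Sum>k\<in>modes N. if k \<in> modes R then 2 * \<eta> * ((of_int k)\<^sup>2 * \<bar>c0 k\<bar>) else 2 * (of_int k * c0 k)\<^sup>2)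
      = 2 * (\<Sum>k\<in>modes N - modes R. (of_int k * c0 k)\<^sup>2) + 2 * \<eta> * C"
      unfolding sum_distrib_left C_def using N(2)
      by (subst sum.subset_diff[of "modes R"]) (auto intro!: arg_cong2[where f = "(+)"] sum.cong)
    finally have "qf N ?x \<le> (qf N (cc N t) - qf N c0) + (2 * (e' / 8) + 2 * \<eta> * C) + qf N ?x / 2"
      using tail[OF N(2)] by linarith
    moreover have "qf N (cc N t) \<le> qf N c0"
      using discrete_flow.qf_c_le[OF flow[OF N(3)], of "Suc (step_idx N t)"] by (simp add: cc_def qf_init)
    ultimately have q: "qf N ?x \<le> e'" using C\<eta> \<eta> by (simp add: mult.commute)
    have "(?x k)\<^sup>2 \<le> \<eta>" if "k \<in> {-1, 1}" for k
    proof -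
      have "\<bar>?x k\<bar>\<^sup>2 \<le> \<eta>\<^sup>2" using close[of k] that by (intro power_mono) auto
      also have "... \<le> \<eta>" using \<eta> by (simp add: power2_eq_square mult_left_le)
      finally show ?thesis by simp
    qed
    from sum_modes_sq_le[OF N(3) this] have "(\<Sum>k\<in>modes N. (of_int k)\<^sup>2 * (?x k)\<^sup>2) \<le> 2 * \<eta> + 4 / 3 * qf N ?x"
      by (simp add: power_mult_distrib)
    also have "... \<le> 3 * e'"
      using q C\<eta> C \<eta> e' mult_nonneg_nonneg[of C \<eta>] by linarith
    finally show ?thesis .
  qed
  have comb: "(AVG x. (u x - w x)\<^sup>2) \<le> e"
    if u: "continuous_on {0..2*pi} u" "\<And>y. \<bar>trig N y1 y - u y\<bar> \<le> sqrt e'" and w: "integrable circle w" "integrable circle (\<lambda>x. (w x)\<^sup>2)"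
      and y: "(\<Sum>k\<in>modes N. (y1 k - y2 k)\<^sup>2) \<le> 3 * e'" and z: "(AVG x. (w x - trig N y2 x)\<^sup>2) \<le> e'" for u w y1 y2 N
  proof -
    have ct: "continuous_on {0..2*pi} (trig N v)" for v using continuous_on_trig[OF continuous_on_id] by simp
    have "(AVG x. (u x - w x)\<^sup>2) \<le> 3 * ((AVG x. (u x - trig N y1 x)\<^sup>2)
        + (AVG x. (trig N y1 x - trig N y2 x)\<^sup>2) + (AVG x. (trig N y2 x - w x)\<^sup>2))"
      by (intro average_sq_diff_le3 integrable_sq_diff w ct u) (intro circle_integrable continuous_intros u ct)+
    moreover have "(AVG x. (u x - trig N y1 x)\<^sup>2) \<le> e'"
    proof (rule average_le_const)
      show "integrable circle (\<lambda>x. (u x - trig N y1 x)\<^sup>2)" by (intro circle_integrable continuous_intros u ct)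
      show "(u x - trig N y1 x)\<^sup>2 \<le> e'" for x
        using power_mono[OF u(2), of x 2] e' by (simp add: power2_commute)
    qed
    moreover have "(AVG x. (trig N y1 x - trig N y2 x)\<^sup>2) \<le> 3 * e'" using y unfolding trig_diff average_trig_sq .
    moreover have "(AVG x. (trig N y2 x - w x)\<^sup>2) \<le> e'" using z by (simp add: power2_commute)
    ultimately show ?thesis using sum_bound_15 by (simp add: e'_def)
  qed
  have "(AVG x. (h t x - h0 x)\<^sup>2) \<le> e \<and> (AVG x. (h1 t x - g0 x)\<^sup>2) \<le> e"
    if t: "0 < t" "t \<le> d" "t \<le> 1" for t
  proof -
    obtain i1 where i1: "\<forall>i\<ge>i1. \<forall>t \<theta>. 0 < t \<longrightarrow> t \<le> 1 \<longrightarrow> \<bar>H i t \<theta> - h t \<theta>\<bar> \<le> sqrt e'"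
      using H_ulim[of "sqrt e'"] e' by auto
    obtain i2 where i2: "\<forall>i\<ge>i2. \<forall>s \<theta>. t \<le> s \<longrightarrow> s \<le> 1 \<longrightarrow> \<bar>H1 i s \<theta> - h1 s \<theta>\<bar> \<le> sqrt e'"
      using H1_ulim[of "sqrt e'" t] e' t by auto
    define i where "i = Max {i1, i2, N0, R, R1}"
    have i: "i1 \<le> i" "i2 \<le> i" "N0 \<le> i" "R \<le> i" "R1 \<le> i" by (auto simp: i_def)
    define N where "N = \<nu> i"
    have N: "N0 \<le> N" "R \<le> N" "1 \<le> N" "R1 \<le> N" using i \<nu>_ge[of i] \<nu>1[of i] by (auto simp: N_def)
    have x0: "cc N t 0 = c0 0"
      using discrete_flow.c_zero_mode[OF flow[OF N(3)], of "Suc (step_idx N t)"] by (simp add: cc_def init)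
    have k1: "(\<Sum>k\<in>modes N. (of_int k)\<^sup>2 * (cc N t k - c0 k)\<^sup>2) \<le> 3 * e'" by (rule key[OF N(1-3) t])
    have "(\<Sum>k\<in>modes N. (cc N t k - c0 k)\<^sup>2) \<le> (\<Sum>k\<in>modes N. (of_int k)\<^sup>2 * (cc N t k - c0 k)\<^sup>2)"
    proof (rule sum_mono)
      fix k
      show "(cc N t k - c0 k)\<^sup>2 \<le> (of_int k)\<^sup>2 * (cc N t k - c0 k)\<^sup>2"
      proof (cases "k = 0")
        case False
        then have "1 \<le> k\<^sup>2" by (smt (verit) zero_less_power2)
        then have "(1::real) \<le> (of_int k)\<^sup>2" by (metis of_int_1_le_iff of_int_power)
        from mult_right_mono[OF this, of "(cc N t k - c0 k)\<^sup>2"] show ?thesis by simp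
      qed (simp add: x0)
    qed
    with k1 have k0: "(\<Sum>k\<in>modes N. (cc N t k - c0 k)\<^sup>2) \<le> 3 * e'" by linarith
    have k2: "(\<Sum>k\<in>modes N. (dcoef (cc N t) k - dcoef c0 k)\<^sup>2) \<le> 3 * e'"
      using k1 by (subst sum_modes_uminus[symmetric]) (simp add: dcoef_def power_mult_distrib right_diff_distrib[symmetric])
    show ?thesis
    proof (intro conjI comb[of _ N])
      show "continuous_on {0..2*pi} (h t)" "continuous_on {0..2*pi} (h1 t)"
        using continuous_h[OF t(1,3)] continuous_h1[OF t(1,3)] by (auto intro: continuous_on_subset)
      show "\<bar>trig N (cc N t) y - h t y\<bar> \<le> sqrt e'" "\<bar>trig N (dcoef (cc N t)) y - h1 t y\<bar> \<le> sqrt e'" for y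
        using i1 i2 i t unfolding N_def H_def H1_def by auto
      show "(AVG x. (h0 x - trig N c0 x)\<^sup>2) \<le> e'" using R1 N(4) by (simp add: less_imp_le)
      show "(AVG x. (g0 x - trig N (dcoef c0) x)\<^sup>2) \<le> e'" using R[rule_format, OF N(2)] e' by linarith
    qed (use h0 g0 k0 k2 in auto)
  qed
  then show ?thesis using d by blast
qed

section \<open>Cauchy estimate for the fluxes\<close>

lemma flux_averages_le:
  assumes a: "0 < a" "a \<le> t" "t \<le> 1" and N: "1 \<le> N" "1 \<le> M"
  defines "F \<equiv> trig N (jj N t)" and "F' \<equiv> trig M (jj M t)"
  shows "(AVG x. \<bar>F' x\<bar> powr \<rho> * (\<bar>F x\<bar> + \<bar>F' x\<bar>)) \<le> 3 * (4 * Q0 / a / b0)"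
    "pavg \<rho> F \<le> 1 + 4 * Q0 / a / b0"
proof -
  have p: "pavg (\<rho> + 1) (trig N (jj N t)) \<le> 4 * Q0 / a / b0"
    and q: "pavg \<rho> (trig N (jj N t)) \<le> 1 + 4 * Q0 / a / b0" if N: "1 \<le> N" for N
  proof -
    interpret A: discrete_flow \<rho> b0 b1 L b N "1 / real N" "c N" "j N" by (rule flow[OF N])
    have D: "A.D (step_idx N t) / b0 \<le> 4 * Q0 / a / b0"
      using DD_le[OF N a] b0 by (intro divide_right_mono) (auto simp: DD_eq[OF N])
    have J: "A.J (step_idx N t) = trig N (jj N t)" by (simp add: A.J_def jj_def fun_eq_iff)
    show "pavg (\<rho> + 1) (trig N (jj N t)) \<le> 4 * Q0 / a / b0"
      using A.average_J_powr_le[of "step_idx N t"] D unfolding J by linarith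
    show "pavg \<rho> (trig N (jj N t)) \<le> 1 + 4 * Q0 / a / b0"
      using A.average_flux_le[of 1 "step_idx N t"] D by (simp add: J)
  qed
  show "pavg \<rho> F \<le> 1 + 4 * Q0 / a / b0" unfolding F_def by (rule q[OF N(1)])
  have c: "continuous_on {0..2*pi} F" "continuous_on {0..2*pi} F'"
    unfolding F_def F'_def using continuous_on_trig[OF continuous_on_id] by auto
  have iF: "integrable circle (\<lambda>x. \<bar>F x\<bar> powr (\<rho> + 1))" "integrable circle (\<lambda>x. \<bar>F' x\<bar> powr (\<rho> + 1))"
    by (intro circle_integrable continuous_intros c; use \<rho> in simp)+
  have y: "v powr \<rho> * u \<le> u powr (\<rho> + 1) + v powr (\<rho> + 1)" if "0 \<le> u" "0 \<le> v" for u v :: real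
  proof (cases "u \<le> v")
    case True
    then have "v powr \<rho> * u \<le> v powr \<rho> * v" by (intro mult_left_mono) auto
    also have "... = v powr (\<rho> + 1)" using that by (cases "v = 0") (auto simp: powr_add)
    finally show ?thesis by (simp add: add_increasing)
  next
    case False
    then have "v powr \<rho> * u \<le> u powr \<rho> * u" using that \<rho> by (intro mult_right_mono powr_mono2) auto
    also have "... = u powr (\<rho> + 1)" using that by (cases "u = 0") (auto simp: powr_add)
    finally show ?thesis by (simp add: add_increasing2)
  qed
  have "(AVG x. \<bar>F' x\<bar> powr \<rho> * (\<bar>F x\<bar> + \<bar>F' x\<bar>)) \<le> (AVG x. \<bar>F x\<bar> powr (\<rho> + 1) + 2 * \<bar>F' x\<bar> powr (\<rho> + 1))"
  proof (rule average_mono)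
    show "integrable circle (\<lambda>x. \<bar>F' x\<bar> powr \<rho> * (\<bar>F x\<bar> + \<bar>F' x\<bar>))"
      by (intro circle_integrable continuous_intros c; use \<rho> in simp)
    show "\<bar>F' x\<bar> powr \<rho> * (\<bar>F x\<bar> + \<bar>F' x\<bar>) \<le> \<bar>F x\<bar> powr (\<rho> + 1) + 2 * \<bar>F' x\<bar> powr (\<rho> + 1)" for x
    proof -
      have "\<bar>F' x\<bar> powr \<rho> * \<bar>F' x\<bar> = \<bar>F' x\<bar> powr (\<rho> + 1)" by (cases "F' x = 0") (auto simp: powr_add)
      then show ?thesis using y[of "\<bar>F x\<bar>" "\<bar>F' x\<bar>"] by (simp add: distrib_left)
    qed
  qed (use iF in simp)
  also have "... = pavg (\<rho> + 1) F + 2 * pavg (\<rho> + 1) F'"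
    using iF by (simp add: average_add average_cmult)
  also have "... \<le> 4 * Q0 / a / b0 + 2 * (4 * Q0 / a / b0)"
    using p[OF N(1)] p[OF N(2)] unfolding F_def F'_def by (intro add_mono mult_left_mono) auto
  finally show "(AVG x. \<bar>F' x\<bar> powr \<rho> * (\<bar>F x\<bar> + \<bar>F' x\<bar>)) \<le> 3 * (4 * Q0 / a / b0)" by simp
qed

text \<open>\<open>comparison\<close> makes the fluxes close in the power average, up to square
  roots of numerical dissipations, and \<open>trig_small_if_powr_average_small\<close> turns this
  into closeness uniform in space. SS is controlled in time average only, so it stays in the
  estimate.\<close>

lemma G_cauchy:
  assumes e: "0 < e" and a: "0 < a"
  shows "\<exists>i0. \<forall>i\<ge>i0. \<forall>i'\<ge>i0. \<forall>t y. a \<le> t \<longrightarrow> t \<le> 1 \<longrightarrow>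
    \<bar>G i t y - G i' t y\<bar> \<le> e * (1 + SS (\<nu> i) t + SS (\<nu> i') t)"
proof -
  define D0 where "D0 = 4 * Q0 / a / b0"
  have D0: "0 \<le> D0" using Q0_nonneg a b0 by (simp add: D0_def)
  define \<kappa> where "\<kappa> = 2 powr (- \<rho>) * b0"
  have \<kappa>: "0 < \<kappa>" using b0 by (simp add: \<kappa>_def)
  obtain \<eta> where \<eta>: "0 < \<eta>" and small: "\<And>M d s y. 0 \<le> s \<Longrightarrow> pavg (\<rho> + 1) (trig M d) \<le> \<eta> * (1 + s) \<Longrightarrow>
     qf M (dcoef d) \<le> s \<Longrightarrow> supp M d \<Longrightarrow> \<bar>trig M d y\<bar> \<le> e / 2 * (1 + s)"
    using trig_small_if_powr_average_small[of "e/2" \<rho>] e \<rho> by auto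
  \<comment> \<open>One third for each of the three errors in \<open>comparison\<close>.\<close>
  define \<epsilon> where "\<epsilon> = \<kappa> * \<eta> / 3"
  have \<epsilon>: "0 < \<epsilon>" using \<kappa> \<eta> by (simp add: \<epsilon>_def)
  have e2: "0 < \<epsilon>\<^sup>2" using \<epsilon> by simp
  obtain R \<eta>' where \<eta>': "0 < \<eta>'" and
    qs: "\<And>M x. \<forall>k. \<bar>of_int k * lam k * x k\<bar> \<le> 4 * b1 * (1 + 4 * Q0 / a / b0) \<Longrightarrow>
      \<forall>k\<in>modes R. \<bar>x k\<bar> \<le> \<eta>' \<Longrightarrow> qf M x \<le> \<epsilon>\<^sup>2"
    using qf_small_if_low_modes_small[OF e2 decay_const_nonneg[OF a]] by blast
  obtain i1 where i1: "\<forall>k\<in>modes R. cc_close \<nu> k \<eta>' i1"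
    using cc_cauchy_modes[OF \<eta>'] by blast
  define \<delta> where "\<delta> = \<epsilon> / (L * (3 * D0) + 1)"
  have \<delta>: "0 < \<delta>" using \<epsilon> L D0 by (auto simp: \<delta>_def intro!: divide_pos_pos add_nonneg_pos mult_nonneg_nonneg)
  have L\<delta>: "L * \<delta> * (3 * D0) \<le> \<epsilon>"
  proof -
    have "0 \<le> L * (3 * D0)" using L D0 by simp
    then have "L * (3 * D0) * \<epsilon> \<le> (L * (3 * D0) + 1) * \<epsilon>" using \<epsilon> by simp
    then show ?thesis using \<open>0 \<le> L * (3 * D0)\<close> by (simp add: \<delta>_def divide_simps mult_ac)
  qed
  obtain i2 where i2: "\<forall>i\<ge>i2. \<forall>t y. 0 < t \<longrightarrow> t \<le> 1 \<longrightarrow> \<bar>Hl i t y - h t y\<bar> \<le> \<delta> / 2"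
    using Hl_ulim[of "\<delta> / 2"] \<delta> by auto
  obtain i3 :: nat where i3: "b1 * (1 + D0) * 2 / \<epsilon> < real i3" using reals_Archimedean2 by blast
  define i0 where "i0 = Max {i1, i2, i3}"
  have main: "\<bar>G i t y - G i' t y\<bar> \<le> e * (1 + SS (\<nu> i) t + SS (\<nu> i') t)"
    if ii: "i0 \<le> i" "i \<le> i'" and t: "a \<le> t" "t \<le> 1" for i i' t y
  proof -
    define N M where "N = \<nu> i" and "M = \<nu> i'"
    have N: "1 \<le> N" and M: "1 \<le> M" and NM: "N \<le> M"
      using \<nu>1 \<nu>_mono ii by (auto simp: N_def M_def strict_mono_less_eq)
    have iN: "i1 \<le> i" "i2 \<le> i" "i3 \<le> N" "i1 \<le> i'" "i2 \<le> i'"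
      using ii \<nu>_ge[of i] by (auto simp: i0_def N_def)
    have t0: "0 < t" using t a by simp
    define s where "s = 2 * SS N t + 2 * SS M t"
    have s: "0 \<le> s" using SS_nonneg by (simp add: s_def)
    have ss: "sqrt s \<le> 1 + s" using s by (intro real_le_lsqrt) (auto simp: power2_eq_square algebra_simps)
    have hd: "\<bar>trig N (c N (step_idx N t)) x - trig M (c M (step_idx M t)) x\<bar> \<le> \<delta>" for x
    proof -
      have "\<bar>Hl i t x - h t x\<bar> \<le> \<delta> / 2" "\<bar>Hl i' t x - h t x\<bar> \<le> \<delta> / 2" using i2 iN t t0 by auto
      then show ?thesis unfolding Hl_def cl_def N_def M_def by linarith
    qed
    let ?F = "trig N (jj N t)" and ?F' = "trig M (jj M t)" and ?q = "qf M (\<lambda>k. cc N t k - cc M t k)"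
    let ?Y = "AVG x. \<bar>?F' x\<bar> powr \<rho> * (\<bar>?F x\<bar> + \<bar>?F' x\<bar>)" and ?p = "pavg \<rho> ?F"
    let ?X = "(AVG x. \<bar>?F x - ?F' x\<bar> powr (\<rho> + 1))"
    have "\<kappa> * ?X \<le> sqrt ?q * sqrt (2 * SS N t + 2 * SS M t)
        + L * \<delta> * ?Y
        + b1 * ?p * (2 / real N * sqrt (2 * SS M t))"
      using comparison[OF flow[OF N] flow[OF M] NM hd]
      unfolding \<kappa>_def cc_def jj_def SS_def by simp
    also have "... \<le> \<epsilon> * (1 + s) + \<epsilon> * (1 + s) + \<epsilon> * (1 + s)"
    proof (intro add_mono)
      have "?q \<le> \<epsilon>\<^sup>2"
      proof (rule qs)
        show "\<forall>k. \<bar>of_int k * lam k * (cc N t k - cc M t k)\<bar> \<le> 4 * b1 * (1 + 4 * Q0 / a / b0)"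
          using cc_decay_diff[OF a t t N M] by blast
        show "\<forall>k\<in>modes R. \<bar>cc N t k - cc M t k\<bar> \<le> \<eta>'" using i1 iN t t0 unfolding N_def M_def by blast
      qed
      then have "sqrt ?q \<le> \<epsilon>" using \<epsilon> by (intro real_le_lsqrt qf_nonneg) auto
      then show "sqrt ?q * sqrt (2 * SS N t + 2 * SS M t) \<le> \<epsilon> * (1 + s)"
        using ss s \<epsilon> unfolding s_def[symmetric] by (intro mult_mono) auto
      have "L * \<delta> * ?Y \<le> L * \<delta> * (3 * D0)"
        using flux_averages_le(1)[OF a t N M] L \<delta> unfolding D0_def by (intro mult_left_mono) auto
      also have "... \<le> \<epsilon>" by (rule L\<delta>)
      also have "... \<le> \<epsilon> * (1 + s)" using \<epsilon> s by (simp add: distrib_left)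
      finally show "L * \<delta> * ?Y \<le> \<epsilon> * (1 + s)" .
      have "b1 * (1 + D0) * 2 / \<epsilon> < real N" using i3 iN(3) by linarith
      then have "b1 * (1 + D0) * (2 / real N) \<le> \<epsilon>" using N \<epsilon> by (simp add: field_simps)
      moreover have "sqrt (2 * SS M t) \<le> 1 + s"
        using SS_nonneg[of N t] by (intro order_trans[OF _ ss]) (simp add: s_def)
      moreover have "b1 * ?p \<le> b1 * (1 + D0)"
        using flux_averages_le(2)[OF a t N N] b1_pos unfolding D0_def by (intro mult_left_mono) auto
      ultimately have "b1 * ?p * (2 / real N * sqrt (2 * SS M t))
          \<le> b1 * (1 + D0) * (2 / real N * (1 + s))"
        using b1_pos D0 SS_nonneg by (intro mult_mono mult_nonneg_nonneg average_nonneg) auto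
      also have "... = b1 * (1 + D0) * (2 / real N) * (1 + s)" by simp
      also have "... \<le> \<epsilon> * (1 + s)"
        using \<open>b1 * (1 + D0) * (2 / real N) \<le> \<epsilon>\<close> s by (intro mult_right_mono) auto
      finally show "b1 * ?p * (2 / real N * sqrt (2 * SS M t)) \<le> \<epsilon> * (1 + s)" .
    qed
    also have "... = \<kappa> * (\<eta> * (1 + s))" by (simp add: \<epsilon>_def)
    finally have X: "?X \<le> \<eta> * (1 + s)" using \<kappa> by simp
    have sN: "supp M (jj N t)" by (rule supp_mono[OF supp_jj[OF N] NM])
    have eq: "trig N (jj N t) x - trig M (jj M t) x = trig M (\<lambda>k. jj N t k - jj M t k) x" for x
      unfolding trig_diff[symmetric] trig_supp_mono[OF supp_jj[OF N] NM] ..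
    have "\<bar>trig M (\<lambda>k. jj N t k - jj M t k) y\<bar> \<le> e / 2 * (1 + s)"
    proof (rule small[OF s])
      show "pavg (\<rho> + 1) (trig M (\<lambda>k. jj N t k - jj M t k)) \<le> \<eta> * (1 + s)"
        using X unfolding eq .
      show "qf M (dcoef (\<lambda>k. jj N t k - jj M t k)) \<le> s"
        unfolding dcoef_diff s_def SS_def
        using qf_diff_le[of M "dcoef (jj N t)" "dcoef (jj M t)"] qf_supp_mono[OF supp_dcoef[OF supp_jj[OF N]] NM, of t] by simp
      show "supp M (\<lambda>k. jj N t k - jj M t k)" using sN supp_jj[OF M] by (auto simp: supp_def)
    qed
    also have "... \<le> e * (1 + SS N t + SS M t)"
      using e SS_nonneg[of N t] SS_nonneg[of M t] by (simp add: s_def algebra_simps)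
    finally show ?thesis unfolding G_def N_def[symmetric] M_def[symmetric] eq .
  qed
  have "\<bar>G i t y - G i' t y\<bar> \<le> e * (1 + SS (\<nu> i) t + SS (\<nu> i') t)"
    if "i0 \<le> i" "i0 \<le> i'" "a \<le> t" "t \<le> 1" for i i' t y
  proof (cases "i \<le> i'")
    case True
    then show ?thesis using main that by blast
  next
    case False
    then have "\<bar>G i' t y - G i t y\<bar> \<le> e * (1 + SS (\<nu> i') t + SS (\<nu> i) t)" using main[of i' i] that by simp
    then show ?thesis by (simp add: abs_minus_commute add_ac)
  qed
  then show ?thesis by blast
qed

end

section \<open>Step functions in time\<close>

abbreviation step_ind :: "nat \<Rightarrow> nat \<Rightarrow> real \<Rightarrow> real" where
  "step_ind N n \<equiv> indicator {real n / real N<..real (Suc n) / real N}"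

lemma measurable_step_idx: "step_idx N \<in> measurable lebesgue (count_space UNIV)"
proof -
  have "(\<lambda>t :: real. t * real N) \<in> borel_measurable borel" by measurable
  then have "(\<lambda>t. \<lceil>t * real N\<rceil>) \<in> measurable borel (count_space UNIV)"
    by (rule measurable_compose) simp
  then have "(\<lambda>t. nat \<lceil>t * real N\<rceil> - 1) \<in> measurable borel (count_space UNIV)"
    by (rule measurable_compose[where g = "\<lambda>z. nat z - 1"]) simp
  then have "step_idx N \<in> measurable lborel (count_space UNIV)" by (simp add: step_idx_def[abs_def])
  then show ?thesis by (rule measurable_completion)
qed

lemma borel_measurable_step: "(\<lambda>t. (f (step_idx N t) :: real)) \<in> borel_measurable lebesgue"
  by (rule measurable_compose[OF measurable_step_idx]) simp

lemma step_integral_le: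
  fixes f :: "nat \<Rightarrow> real"
  assumes A: "A \<subseteq> {0<..1}" "A \<in> sets lebesgue" and f: "\<And>n. 0 \<le> f n" and N: "1 \<le> N"
    and I: "finite I" "\<And>t. t \<in> A \<Longrightarrow> step_idx N t \<in> I"
  shows "integrable lebesgue (\<lambda>t. indicator A t * f (step_idx N t))"
    "(\<integral>t. indicator A t * f (step_idx N t) \<partial>lebesgue) \<le> 1 / real N * (\<Sum>n\<in>I. f n)"
proof -
  let ?g = "\<lambda>t. \<Sum>n\<in>I. f n * step_ind N n t"
  have len: "real (Suc n) / real N - real n / real N = 1 / real N" for n by (simp add: add_divide_distrib)
  have i1: "integrable lebesgue (\<lambda>t. step_ind N n t)" for n
    by (rule integrable_real_indicator) (auto simp: divide_right_mono)
  have ig: "integrable lebesgue ?g" using i1 by (intro Bochner_Integration.integrable_sum integrable_mult_right) auto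
  have le: "indicator A t * f (step_idx N t) \<le> ?g t" for t
  proof (cases "t \<in> A")
    case True
    then have t: "0 < t" "t \<le> 1" using A by auto
    let ?n = "step_idx N t"
    have "t \<in> {real ?n / real N<..real (Suc ?n) / real N}" using step_idx[OF t N] by auto
    then have "f ?n = f ?n * step_ind N ?n t" by simp
    also have "... \<le> ?g t"
      by (rule member_le_sum[where f = "\<lambda>n. f n * step_ind N n t"])
         (use I True f in auto)
    finally show ?thesis using True by simp
  next
    case False
    then show ?thesis using f by (auto intro!: sum_nonneg)
  qed
  have m: "(\<lambda>t. indicator A t * f (step_idx N t)) \<in> borel_measurable lebesgue"
    using borel_measurable_step A(2) by (intro borel_measurable_times borel_measurable_indicator) auto
  show int: "integrable lebesgue (\<lambda>t. indicator A t * f (step_idx N t))"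
    by (rule Bochner_Integration.integrable_bound[OF ig m])
       (use le f in \<open>auto intro!: AE_I2 order_trans[OF le] simp: sum_nonneg\<close>)
  have "(\<integral>t. indicator A t * f (step_idx N t) \<partial>lebesgue) \<le> (\<integral>t. ?g t \<partial>lebesgue)"
    by (rule integral_mono[OF int ig]) (rule le)
  also have "... = (\<Sum>n\<in>I. f n * (\<integral>t. step_ind N n t \<partial>lebesgue))"
    using i1 by (subst Bochner_Integration.integral_sum) auto
  also have "... = (\<Sum>n\<in>I. f n * (1 / real N))"
    using len by (intro sum.cong refl) (simp add: divide_right_mono)
  finally show "(\<integral>t. indicator A t * f (step_idx N t) \<partial>lebesgue) \<le> 1 / real N * (\<Sum>n\<in>I. f n)"
    by (simp add: sum_divide_distrib)
qed

text \<open>Beppo Levi: the sum has finite integral, hence is finite almost everywhere.\<close>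

lemma summable_AE_of_integrals:
  fixes w :: "nat \<Rightarrow> real \<Rightarrow> real"
  assumes i: "\<And>n. integrable lebesgue (w n)" and nn: "\<And>n t. 0 \<le> w n t"
    and B: "\<And>n. (\<integral>t. w n t \<partial>lebesgue) \<le> B n" "summable B"
  shows "AE t in lebesgue. summable (\<lambda>n. w n t)" "integrable lebesgue (\<lambda>t. \<Sum>n. w n t)"
proof -
  have I0: "0 \<le> (\<integral>t. w n t \<partial>lebesgue)" for n using nn by (intro integral_nonneg_AE) auto
  then have B0: "0 \<le> B n" for n using B(1) order_trans by blast
  have "(\<integral>\<^sup>+t. (\<Sum>n. ennreal (w n t)) \<partial>lebesgue) = (\<Sum>n. \<integral>\<^sup>+t. ennreal (w n t) \<partial>lebesgue)"
    using i by (intro nn_integral_suminf) auto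
  also have "... = (\<Sum>n. ennreal (\<integral>t. w n t \<partial>lebesgue))"
    using i nn by (intro suminf_cong nn_integral_eq_integral) auto
  also have "... \<le> (\<Sum>n. ennreal (B n))"
    by (intro suminf_le ennreal_leI B(1)) auto
  also have "... = ennreal (\<Sum>n. B n)" by (rule suminf_ennreal2[OF B0 B(2)])
  finally have fin: "(\<integral>\<^sup>+t. (\<Sum>n. ennreal (w n t)) \<partial>lebesgue) \<noteq> \<infinity>"
    by (metis ennreal_less_top infinity_ennreal_def leD)
  have "AE t in lebesgue. (\<Sum>n. ennreal (w n t)) \<noteq> \<infinity>"
    by (rule nn_integral_PInf_AE[OF _ fin]) (use i in auto)
  then show s: "AE t in lebesgue. summable (\<lambda>n. w n t)"
    by eventually_elim (rule summable_suminf_not_top, use nn in auto)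
  show "integrable lebesgue (\<lambda>t. \<Sum>n. w n t)"
  proof (rule integrable_suminf[OF i])
    show "AE t in lebesgue. summable (\<lambda>n. norm (w n t))" using s nn by simp
    show "summable (\<lambda>n. \<integral>t. norm (w n t) \<partial>lebesgue)"
      by (rule summable_comparison_test'[OF B(2), of 0]) (use B(1) nn I0 in simp)
  qed
qed

text \<open>Rests on the completeness of Lebesgue measure, under which a change on a null set
  preserves measurability.\<close>

lemma borel_measurable_lebesgue_AE_limit:
  fixes F :: "nat \<Rightarrow> real \<Rightarrow> real"
  assumes "\<And>i. F i \<in> borel_measurable lebesgue" "AE t in lebesgue. (\<lambda>i. F i t) \<longlonglongrightarrow> f t"
  shows "f \<in> borel_measurable lebesgue"
proof (rule borel_measurable_AE)
  show "(\<lambda>t. lim (\<lambda>i. F i t)) \<in> borel_measurable lebesgue" using assms(1) by measurable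
  show "AE t in lebesgue. lim (\<lambda>i. F i t) = f t" using assms(2) by eventually_elim (rule limI)
qed

text \<open>Fatou's lemma, applied to powers of the fluxes, whose integrals are bounded by the
  energy.\<close>

lemma integrable_AE_limit_nonneg:
  fixes F :: "nat \<Rightarrow> real \<Rightarrow> real"
  assumes i: "\<And>i. integrable lebesgue (F i)" and nn: "\<And>i t. 0 \<le> F i t" "\<And>t. 0 \<le> f t"
    and lim: "AE t in lebesgue. (\<lambda>i. F i t) \<longlonglongrightarrow> f t" and C: "\<And>i. (\<integral>t. F i t \<partial>lebesgue) \<le> C"
  shows "integrable lebesgue f"
proof -
  have m: "f \<in> borel_measurable lebesgue"
    by (rule borel_measurable_lebesgue_AE_limit[OF _ lim]) (use i in auto)
  have "(\<integral>\<^sup>+t. ennreal (f t) \<partial>lebesgue) = (\<integral>\<^sup>+t. liminf (\<lambda>i. ennreal (F i t)) \<partial>lebesgue)"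
  proof (rule nn_integral_cong_AE)
    show "AE t in lebesgue. ennreal (f t) = liminf (\<lambda>i. ennreal (F i t))"
      using lim
    proof eventually_elim
      case (elim t)
      then have "(\<lambda>i. ennreal (F i t)) \<longlonglongrightarrow> ennreal (f t)" by (rule tendsto_ennrealI)
      then show ?case by (metis lim_imp_Liminf sequentially_bot)
    qed
  qed
  also have "... \<le> liminf (\<lambda>i. \<integral>\<^sup>+t. ennreal (F i t) \<partial>lebesgue)"
    by (rule nn_integral_liminf) (use i in auto)
  also have "... \<le> ennreal C"
  proof -
    have "(\<integral>\<^sup>+t. ennreal (F i t) \<partial>lebesgue) \<le> ennreal C" for i
      using i nn C by (subst nn_integral_eq_integral) (auto intro: ennreal_leI)
    then show ?thesis by (intro Liminf_le) (auto intro!: always_eventually)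
  qed
  finally have "(\<integral>\<^sup>+t. ennreal (f t) \<partial>lebesgue) < \<infinity>" using ennreal_less_top le_less_trans by (metis infinity_ennreal_def)
  then show ?thesis using m nn by (intro integrableI_nonneg) auto
qed

lemma average_powr_tendsto:
  fixes F :: "nat \<Rightarrow> real \<Rightarrow> real"
  assumes F: "\<And>i. continuous_on UNIV (F i)" and f: "continuous_on UNIV f"
    and u: "\<And>e. 0 < e \<Longrightarrow> \<exists>i0. \<forall>i\<ge>i0. \<forall>x. \<bar>F i x - f x\<bar> \<le> e" and p: "0 < p"
  shows "(\<lambda>i. pavg p (F i)) \<longlonglongrightarrow> pavg p f"
proof -
  obtain i0 where i0: "\<forall>i\<ge>i0. \<forall>x. \<bar>F i x - f x\<bar> \<le> 1" using u[of 1] by auto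
  have "bounded (f ` {0..2*pi})"
    by (intro compact_imp_bounded compact_continuous_image continuous_on_subset[OF f]) auto
  then obtain B where B: "\<And>x. x \<in> {0..2*pi} \<Longrightarrow> \<bar>f x\<bar> \<le> B" unfolding bounded_iff by force
  have B0: "0 \<le> B" using B[of 0] abs_ge_zero[of "f 0"] by (simp del: abs_ge_zero)
  have "integrable circle (\<lambda>x. \<bar>f x\<bar> powr p)" if "continuous_on UNIV f" for f :: "real \<Rightarrow> real"
    using that p by (intro circle_integrable_UNIV continuous_on_abs_powr)
  note i = this[OF f] this[OF F]
  have "(\<lambda>i. \<integral>x. \<bar>F (i + i0) x\<bar> powr p \<partial>circle) \<longlonglongrightarrow> (\<integral>x. \<bar>f x\<bar> powr p \<partial>circle)"
  proof (rule integral_dominated_convergence)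
    show "integrable circle (\<lambda>x. (B + 1) powr p)" by simp
    show "AE x in circle. (\<lambda>i. \<bar>F (i + i0) x\<bar> powr p) \<longlonglongrightarrow> \<bar>f x\<bar> powr p"
    proof (intro AE_I2)
      fix x
      have "(\<lambda>i. F i x) \<longlonglongrightarrow> f x"
        unfolding LIMSEQ_def dist_real_def
      proof (intro allI impI)
        fix e :: real assume e: "0 < e"
        then obtain n where n: "\<forall>i\<ge>n. \<forall>x. \<bar>F i x - f x\<bar> \<le> e / 2" using u[of "e / 2"] by auto
        have "\<bar>F i x - f x\<bar> < e" if "n \<le> i" for i
        proof -
          have "\<bar>F i x - f x\<bar> \<le> e / 2" using n that by blast
          then show ?thesis using e by linarith
        qed
        then show "\<exists>no. \<forall>i\<ge>no. \<bar>F i x - f x\<bar> < e" by blast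
      qed
      then have "(\<lambda>i. \<bar>F (i + i0) x\<bar>) \<longlonglongrightarrow> \<bar>f x\<bar>"
        by (intro tendsto_rabs LIMSEQ_ignore_initial_segment)
      then show "(\<lambda>i. \<bar>F (i + i0) x\<bar> powr p) \<longlonglongrightarrow> \<bar>f x\<bar> powr p"
        by (intro tendsto_powr') (use p in auto)
    qed
    show "AE x in circle. norm (\<bar>F (i + i0) x\<bar> powr p) \<le> (B + 1) powr p" for i
    proof (intro AE_I2)
      fix x assume "x \<in> space circle"
      then have "\<bar>f x\<bar> \<le> B" using B by simp
      moreover have "\<bar>F (i + i0) x - f x\<bar> \<le> 1" using i0 by simp
      ultimately have "\<bar>F (i + i0) x\<bar> \<le> B + 1" by linarith
      then show "norm (\<bar>F (i + i0) x\<bar> powr p) \<le> (B + 1) powr p"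
        using p by (auto intro!: powr_mono2)
    qed
  qed (use i in auto)
  then have "(\<lambda>i. \<integral>x. \<bar>F i x\<bar> powr p \<partial>circle) \<longlonglongrightarrow> (\<integral>x. \<bar>f x\<bar> powr p \<partial>circle)"
    by (rule LIMSEQ_offset)
  then show ?thesis unfolding average_def by (intro tendsto_mult tendsto_const)
qed

context flow_family begin

lemma SS_integral:
  assumes N: "1 \<le> N" and a: "0 < a" "a \<le> 1"
  shows "integrable lebesgue (\<lambda>t. indicator {a..1} t * SS N t)"
    "(\<integral>t. indicator {a..1} t * SS N t \<partial>lebesgue) \<le> 12 * Q0 / a"
proof -
  interpret A: discrete_flow \<rho> b0 b1 L b N "1 / real N" "c N" "j N" by (rule flow[OF N])
  define m where "m = step_idx N a"
  have m: "m < N" "a \<le> real (Suc m) * (1 / real N)" unfolding m_def using step_idx[OF a N] by auto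
  have I: "step_idx N t \<in> {m..N - 1}" if "t \<in> {a..1}" for t
  proof -
    have "m \<le> step_idx N t" unfolding m_def using that a by (intro step_idx_mono) auto
    moreover have "step_idx N t < N" using that a N by (intro step_idx(1)) auto
    ultimately show ?thesis by auto
  qed
  have sub: "{a..1} \<subseteq> {0<..1}" using a by auto
  have fin: "finite {m..N - 1}" by simp
  note s = step_integral_le[OF sub _ A.S_nonneg N fin I]
  show "integrable lebesgue (\<lambda>t. indicator {a..1} t * SS N t)" unfolding SS_eq[OF N] by (rule s(1)) simp
  have "(\<integral>t. indicator {a..1} t * SS N t \<partial>lebesgue) \<le> 1 / real N * (\<Sum>n\<in>{m..N - 1}. A.S n)"
    unfolding SS_eq[OF N] by (rule s(2)) simp
  \<comment> \<open>The decay estimate for the sum starts after m; the step containing a is bounded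
    separately, because its numerical dissipation is part of \<open>X m\<close>.\<close>
  also have "{m..N - 1} = insert m {m<..N - 1}" using m by auto
  also have "1 / real N * (\<Sum>n\<in>insert m {m<..N - 1}. A.S n) = 1 / real N * A.S m + 1 / real N * (\<Sum>n\<in>{m<..N - 1}. A.S n)"
    by (simp add: distrib_left add_divide_distrib)
  also have "1 / real N * (\<Sum>n\<in>{m<..N - 1}. A.S n) \<le> 8 * qf N (c N 0) / a"
    using m a N by (intro A.S_sum_decay[OF tame_init]) auto
  also have "1 / real N * A.S m \<le> 2 * A.X m"
    using A.D_nonneg[of m] \<rho> by (simp add: A.X_def)
  also have "2 * A.X m \<le> 4 * qf N (c N 0) / a"
  proof -
    have "a * A.X m \<le> real (Suc m) * (1 / real N) * A.X m" using m A.X_nonneg by (intro mult_right_mono) auto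
    also have "... \<le> 2 * qf N (c N 0)" by (rule A.X_decay[OF tame_init m(1)])
    finally show ?thesis using a by (simp add: field_simps)
  qed
  finally have "(\<integral>t. indicator {a..1} t * SS N t \<partial>lebesgue) \<le> 4 * qf N (c N 0) / a + 8 * qf N (c N 0) / a" by simp
  also have "... = 12 * qf N (c N 0) / a" by (simp add: add_divide_distrib[symmetric])
  also have "... \<le> 12 * Q0 / a" using qf_c[OF N, of 0] a by (intro divide_right_mono) auto
  finally show "(\<integral>t. indicator {a..1} t * SS N t \<partial>lebesgue) \<le> 12 * Q0 / a" .
qed

lemma diss_integral:
  assumes N: "1 \<le> N"
  defines "F \<equiv> \<lambda>t. pavg (\<rho> + 1) (trig N (jj N t))"
  shows "integrable lebesgue (\<lambda>t. I01 t * F t)"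
    "(\<integral>t. I01 t * F t \<partial>lebesgue) \<le> Q0 / (2 * b0)"
proof -
  interpret A: discrete_flow \<rho> b0 b1 L b N "1 / real N" "c N" "j N" by (rule flow[OF N])
  define f where "f n = pavg (\<rho> + 1) (A.J n)" for n
  have F: "F t = f (step_idx N t)" for t by (simp add: F_def f_def jj_def A.J_def)
  have f0: "0 \<le> f n" for n unfolding f_def by (rule average_nonneg) simp
  have I: "step_idx N t \<in> {..<N}" if "t \<in> {0<..1}" for t using step_idx(1)[of t N] that N by auto
  note s = step_integral_le[of "{0<..1}" f N "{..<N}", OF _ _ f0 N _ I]
  show "integrable lebesgue (\<lambda>t. I01 t * F t)" unfolding F by (rule s(1)) auto
  have "(\<integral>t. I01 t * F t \<partial>lebesgue) \<le> 1 / real N * (\<Sum>n<N. f n)"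
    unfolding F by (rule s(2)) auto
  also have "... \<le> 1 / real N * (\<Sum>n<N. A.D n / b0)"
    unfolding f_def by (intro mult_left_mono sum_mono A.average_J_powr_le) auto
  also have "... = (1 / real N * (\<Sum>n<N. A.D n)) / b0" by (simp add: sum_divide_distrib mult.commute)
  also have "... \<le> (qf N (c N 0) / 2) / b0" using b0 by (intro divide_right_mono A.sum_D_le) auto
  also have "... \<le> (Q0 / 2) / b0" using qf_c[OF N, of 0] b0 by (intro divide_right_mono) auto
  finally show "(\<integral>t. I01 t * F t \<partial>lebesgue) \<le> Q0 / (2 * b0)" by simp
qed

end

section \<open>Almost everywhere convergence of the fluxes\<close>

text \<open>By \<open>SS_integral\<close> with a = 1 / (n + 1), the two dissipations together have
  integral at most 24 * Q0 * (n + 1). The factor is chosen so that the right-hand side integrates to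
  at most (1 / 2)^n.\<close>

locale flow_conv = flow_limit +
  assumes fast: "\<And>n i i' t x. n \<le> i \<Longrightarrow> n \<le> i' \<Longrightarrow> 1 / real (Suc n) \<le> t \<Longrightarrow> t \<le> 1 \<Longrightarrow>
    \<bar>G i t x - G i' t x\<bar> \<le> (1 / 2) ^ n / (1 + 24 * Q0 * real (Suc n)) * (1 + SS (\<nu> i) t + SS (\<nu> i') t)"

lemma (in flow_limit) flow_conv_exists:
  obtains \<nu>' where "flow_conv \<rho> b0 b1 L b c0 c j Q0 \<nu>'"
proof -
  define e where "e n = (1 / 2) ^ n / (1 + 24 * Q0 * real (Suc n))" for n
  have e: "0 < e n" for n using Q0_nonneg by (auto simp: e_def intro!: divide_pos_pos add_pos_nonneg)
  have "\<exists>i0. \<forall>i\<ge>i0. \<forall>i'\<ge>i0. \<forall>t x. 1 / real (Suc n) \<le> t \<longrightarrow> t \<le> 1 \<longrightarrow>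
    \<bar>G i t x - G i' t x\<bar> \<le> e n * (1 + SS (\<nu> i) t + SS (\<nu> i') t)" for n
    by (rule G_cauchy[OF e]) simp
  then obtain I where I: "\<And>n i i' t x. I n \<le> i \<Longrightarrow> I n \<le> i' \<Longrightarrow> 1 / real (Suc n) \<le> t \<Longrightarrow> t \<le> 1 \<Longrightarrow>
    \<bar>G i t x - G i' t x\<bar> \<le> e n * (1 + SS (\<nu> i) t + SS (\<nu> i') t)" by metis
  \<comment> \<open>Adding all thresholds up to n makes \<sigma> strictly increasing and at least I
    n from index n on.\<close>
  define \<sigma> where "\<sigma> n = n + (\<Sum>k\<le>n. I k)" for n
  have \<sigma>: "strict_mono \<sigma>" by (rule strict_monoI_Suc) (simp add: \<sigma>_def)
  have \<sigma>I: "I n \<le> \<sigma> i" if "n \<le> i" for n i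
  proof -
    have "I n \<le> (\<Sum>k\<le>i. I k)" using that by (intro member_le_sum) auto
    then show ?thesis by (simp add: \<sigma>_def)
  qed
  have lim: "flow_limit \<rho> b0 b1 L b c0 c j Q0 (\<nu> \<circ> \<sigma>)"
  proof (intro flow_limit.intro flow_family_axioms flow_limit_axioms.intro)
    show "strict_mono (\<nu> \<circ> \<sigma>)" using \<nu>_mono \<sigma> by (rule strict_mono_o)
    show "1 \<le> (\<nu> \<circ> \<sigma>) i" for i using \<nu>1 by simp
    fix k and \<epsilon> :: real assume "0 < \<epsilon>"
    then obtain i0 where i0: "cc_close \<nu> k \<epsilon> i0"
      using cc_cauchy by blast
    have "i0 \<le> \<sigma> i" if "i0 \<le> i" for i using seq_suble[OF \<sigma>, of i] that by linarith
    then show "\<exists>i0. cc_close (\<nu> \<circ> \<sigma>) k \<epsilon> i0"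
      using i0 by (intro exI[of _ i0]) auto
  qed
  interpret X: flow_limit \<rho> b0 b1 L b c0 c j Q0 "\<nu> \<circ> \<sigma>" by (rule lim)
  have "flow_conv \<rho> b0 b1 L b c0 c j Q0 (\<nu> \<circ> \<sigma>)"
  proof (intro flow_conv.intro lim flow_conv_axioms.intro)
    fix n i i' t x assume a: "n \<le> i" "n \<le> i'" "1 / real (Suc n) \<le> t" "t \<le> 1"
    show "\<bar>X.G i t x - X.G i' t x\<bar> \<le> (1 / 2) ^ n / (1 + 24 * Q0 * real (Suc n)) * (1 + SS ((\<nu> \<circ> \<sigma>) i) t + SS ((\<nu> \<circ> \<sigma>) i') t)"
      using I[OF \<sigma>I[OF a(1)] \<sigma>I[OF a(2)] a(3,4), of x] by (simp add: X.G_def G_def e_def)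
  qed
  then show thesis by (rule that)
qed

context flow_conv begin

definition ww :: "nat \<Rightarrow> real \<Rightarrow> real" where
  "ww n t = indicator {1 / real (Suc n)..1} t *
     ((1 / 2) ^ n / (1 + 24 * Q0 * real (Suc n)) * (1 + SS (\<nu> n) t + SS (\<nu> (Suc n)) t))"

text \<open>Tail of the series of increments; as an integrable function of t it dominates all later
  fluxes in \<open>time_deriv_weak\<close>.\<close>

definition WW :: "nat \<Rightarrow> real \<Rightarrow> real" where
  "WW n t = (\<Sum>k. ww (k + n) t)"

text \<open>At such times with 0 < t \<le> 1 the increments of the fluxes are eventually dominated
  by a convergent series; almost every time qualifies by \<open>good_AE\<close>.\<close>

definition good :: "real \<Rightarrow> bool" where
  "good t \<longleftrightarrow> summable (\<lambda>n. ww n t)"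

definition g :: "real \<Rightarrow> real \<Rightarrow> real" where
  "g t x = lim (\<lambda>i. G i t x)"

lemma ww_nonneg: "0 \<le> ww n t"
  unfolding ww_def using SS_nonneg Q0_nonneg
  by (intro mult_nonneg_nonneg divide_nonneg_nonneg add_nonneg_nonneg) auto

lemma ww_integral: "integrable lebesgue (ww n)" "(\<integral>t. ww n t \<partial>lebesgue) \<le> (1 / 2) ^ n"
proof -
  define q where "q = (1 / 2) ^ n / (1 + 24 * Q0 * real (Suc n))"
  have p: "0 < 1 + 24 * Q0 * real (Suc n)" using Q0_nonneg by (intro add_pos_nonneg) auto
  have q: "0 \<le> q" using p by (simp add: q_def)
  let ?a = "1 / real (Suc n)"
  have a: "0 < ?a" "?a \<le> 1" by auto
  have i0: "integrable lebesgue (\<lambda>t. indicator {?a..1} t :: real)" by (rule integrable_real_indicator) auto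
  note s1 = SS_integral[OF \<nu>1 a, of n] and s2 = SS_integral[OF \<nu>1 a, of "Suc n"]
  have eq: "ww n t = q * (indicator {?a..1} t + indicator {?a..1} t * SS (\<nu> n) t + indicator {?a..1} t * SS (\<nu> (Suc n)) t)" for t
    unfolding ww_def q_def[symmetric] by (simp only: distrib_left distrib_right mult_1_right mult_ac)
  show "integrable lebesgue (ww n)" unfolding eq using i0 s1(1) s2(1) by (intro integrable_mult_right Bochner_Integration.integrable_add) auto
  have "(\<integral>t. ww n t \<partial>lebesgue) = q * ((\<integral>t. indicator {?a..1} t \<partial>lebesgue)
      + (\<integral>t. indicator {?a..1} t * SS (\<nu> n) t \<partial>lebesgue) + (\<integral>t. indicator {?a..1} t * SS (\<nu> (Suc n)) t \<partial>lebesgue))"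
    unfolding eq using i0 s1(1) s2(1) by simp
  also have "... \<le> q * (1 + 12 * Q0 / ?a + 12 * Q0 / ?a)"
    using q s1(2) s2(2) by (intro mult_left_mono add_mono) (auto simp: divide_le_eq)
  also have "... = q * (1 + 24 * Q0 * real (Suc n))" by simp
  also have "... = (1 / 2) ^ n" using p by (simp add: q_def)
  finally show "(\<integral>t. ww n t \<partial>lebesgue) \<le> (1 / 2) ^ n" .
qed

lemma good_AE: "AE t in lebesgue. good t"
  unfolding good_def using summable_AE_of_integrals(1)[OF ww_integral(1) ww_nonneg ww_integral(2)]
  by (simp add: summable_geometric)

lemma WW_integrable: "integrable lebesgue (WW n)"
proof -
  have "(\<integral>t. ww (k + n) t \<partial>lebesgue) \<le> (1 / 2) ^ k" for k
  proof -
    have "(1 / 2 :: real) ^ (k + n) \<le> (1 / 2) ^ k" by (intro power_decreasing) auto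
    then show ?thesis using ww_integral(2)[of "k + n"] by linarith
  qed
  from summable_AE_of_integrals(2)[OF ww_integral(1) ww_nonneg this] show ?thesis
    unfolding WW_def by (simp add: summable_geometric)
qed

lemma G_step: "good t \<Longrightarrow> 1 / real (Suc n) \<le> t \<Longrightarrow> t \<le> 1 \<Longrightarrow> n \<le> i \<Longrightarrow> \<bar>G i t x - G (Suc i) t x\<bar> \<le> ww i t"
proof -
  assume a: "1 / real (Suc n) \<le> t" "t \<le> 1" "n \<le> i"
  have "1 / real (Suc i) \<le> 1 / real (Suc n)" using a by (intro divide_left_mono) auto
  then have i: "1 / real (Suc i) \<le> t" using a by linarith
  show ?thesis using fast[of i i "Suc i", OF _ _ i a(2), of x] i a by (simp add: ww_def)
qed

lemma G_tail:
  assumes t: "good t" "1 / real (Suc n) \<le> t" "t \<le> 1" and i: "n \<le> i" "i \<le> i'"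
  shows "\<bar>G i t x - G i' t x\<bar> \<le> WW i t"
proof -
  have s: "summable (\<lambda>k. ww (k + i) t)" using t(1) unfolding good_def by (rule summable_ignore_initial_segment)
  have "\<bar>G i t x - G (i + m) t x\<bar> \<le> (\<Sum>k<m. ww (k + i) t)" for m
  proof (induction m)
    case (Suc m)
    have "\<bar>G (i + m) t x - G (Suc (i + m)) t x\<bar> \<le> ww (i + m) t" using i by (intro G_step[OF t]) auto
    then show ?case using Suc by (simp add: add.commute)
  qed simp
  from this[of "i' - i"] have "\<bar>G i t x - G i' t x\<bar> \<le> (\<Sum>k<i' - i. ww (k + i) t)" using i by simp
  also have "... \<le> WW i t" unfolding WW_def by (rule sum_le_suminf[OF s]) (auto intro: ww_nonneg)
  finally show ?thesis .
qed

lemma WW_tendsto: "good t \<Longrightarrow> (\<lambda>i. WW i t) \<longlonglongrightarrow> 0"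
  unfolding WW_def good_def by (rule suminf_exist_split2)

lemma WW_nonneg: "good t \<Longrightarrow> 0 \<le> WW n t"
  unfolding WW_def good_def using ww_nonneg by (intro suminf_nonneg summable_ignore_initial_segment) auto

lemma G_lim:
  assumes t: "good t" "0 < t" "t \<le> 1"
  shows "(\<lambda>i. G i t y) \<longlonglongrightarrow> g t y" "0 < e \<Longrightarrow> \<exists>i0. \<forall>i\<ge>i0. \<forall>y. \<bar>G i t y - g t y\<bar> \<le> e"
proof -
  obtain n :: nat where n: "1 / t < real (Suc n)" using reals_Archimedean2 by (metis less_trans of_nat_less_iff lessI)
  have n1: "1 / real (Suc n) \<le> t" using n t by (simp add: field_simps)
  have *: "\<exists>i0. \<forall>i\<ge>i0. \<forall>i'\<ge>i0. \<forall>x\<in>UNIV. \<bar>G i t x - G i' t x\<bar> \<le> e" if e: "0 < e" for e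
  proof -
    have "\<forall>\<^sub>F i in sequentially. WW i t < e" by (rule order_tendstoD(2)[OF WW_tendsto[OF t(1)] e])
    then obtain m where m: "\<And>i. m \<le> i \<Longrightarrow> WW i t < e" by (auto simp: eventually_sequentially)
    have "\<bar>G i t x - G i' t x\<bar> \<le> e" if "max m n \<le> i" "max m n \<le> i'" for i i' x
    proof (cases "i \<le> i'")
      case True
      then show ?thesis using G_tail[OF t(1) n1 t(3), of i i' x] m[of i] that by simp
    next
      case False
      then show ?thesis using G_tail[OF t(1) n1 t(3), of i' i x] m[of i'] that by (simp add: abs_minus_commute)
    qed
    then show ?thesis by blast
  qed
  note u = uniformly_Cauchy_lim[of UNIV "\<lambda>i. G i t", OF *, folded g_def]
  show "(\<lambda>i. G i t y) \<longlonglongrightarrow> g t y" using u(1) by simp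
  show "0 < e \<Longrightarrow> \<exists>i0. \<forall>i\<ge>i0. \<forall>y. \<bar>G i t y - g t y\<bar> \<le> e" using u(2) by simp
qed

lemma continuous_g: "good t \<Longrightarrow> 0 < t \<Longrightarrow> t \<le> 1 \<Longrightarrow> continuous_on UNIV (g t)"
  by (rule uniform_limit_continuous_on[of "\<lambda>i. G i t", OF continuous_G]) (rule G_lim(2))

lemma periodic_g: "periodic (g t)"
  unfolding periodic_def g_def G_def by (simp add: trig_periodic)

lemma average_powr_G_lim:
  assumes t: "good t" "0 < t" "t \<le> 1"
  shows "(\<lambda>i. pavg (\<rho> + 1) (G i t)) \<longlonglongrightarrow> pavg (\<rho> + 1) (g t)"
  by (rule average_powr_tendsto[OF continuous_G continuous_g[OF t] G_lim(2)[OF t]]) (use \<rho> in auto)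

lemma g_powr_integrable: "integrable lebesgue (\<lambda>t. I01 t * pavg (\<rho> + 1) (g t))"
proof (rule integrable_AE_limit_nonneg[where F = "\<lambda>i t. I01 t * pavg (\<rho> + 1) (G i t)"])
  show "integrable lebesgue (\<lambda>t. I01 t * pavg (\<rho> + 1) (G i t))" for i
    unfolding G_def by (rule diss_integral(1)[OF \<nu>1])
  show "(\<integral>t. I01 t * pavg (\<rho> + 1) (G i t) \<partial>lebesgue) \<le> Q0 / (2 * b0)" for i
    unfolding G_def by (rule diss_integral(2)[OF \<nu>1])
  show "AE t in lebesgue. (\<lambda>i. I01 t * pavg (\<rho> + 1) (G i t))
      \<longlonglongrightarrow> I01 t * pavg (\<rho> + 1) (g t)"
    using good_AE
  proof eventually_elim
    case (elim t)
    show ?case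
    proof (cases "t \<in> {0<..1}")
      case True
      then show ?thesis using average_powr_G_lim[OF elim] by simp
    qed simp
  qed
qed (auto intro!: mult_nonneg_nonneg average_nonneg)

end

section \<open>Third derivatives in space\<close>

lemma uniform_limit_real_iff:
  fixes F :: "nat \<Rightarrow> 'a \<Rightarrow> real"
  shows "uniform_limit X F f sequentially \<longleftrightarrow> (\<forall>e>0. \<exists>i0. \<forall>i\<ge>i0. \<forall>x\<in>X. \<bar>F i x - f x\<bar> \<le> e)"
proof
  assume *: "\<forall>e>0. \<exists>i0. \<forall>i\<ge>i0. \<forall>x\<in>X. \<bar>F i x - f x\<bar> \<le> e"
  show "uniform_limit X F f sequentially"
  proof (rule uniform_limitI)
    fix e :: real assume e: "0 < e"
    then obtain i0 where i0: "\<forall>i\<ge>i0. \<forall>x\<in>X. \<bar>F i x - f x\<bar> \<le> e / 2" using * by (metis half_gt_zero)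
    have "dist (F i x) (f x) < e" if "i0 \<le> i" "x \<in> X" for i x
    proof -
      have "\<bar>F i x - f x\<bar> \<le> e / 2" using i0 that by blast
      then show ?thesis using e unfolding dist_real_def by linarith
    qed
    then show "\<forall>\<^sub>F i in sequentially. \<forall>x\<in>X. dist (F i x) (f x) < e"
      unfolding eventually_sequentially by blast
  qed
next
  assume u: "uniform_limit X F f sequentially"
  show "\<forall>e>0. \<exists>i0. \<forall>i\<ge>i0. \<forall>x\<in>X. \<bar>F i x - f x\<bar> \<le> e"
  proof (intro allI impI)
    fix e :: real assume "0 < e"
    from uniform_limitD[OF u this] show "\<exists>i0. \<forall>i\<ge>i0. \<forall>x\<in>X. \<bar>F i x - f x\<bar> \<le> e"
      unfolding eventually_sequentially dist_real_def by (meson less_imp_le)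
  qed
qed

text \<open>One y serves all periodic functions at once, so a sequence and its limit can be moved to
  the same point of the period.\<close>

lemma periodic_reduce: "\<exists>y\<in>{0..2*pi}. \<forall>f. periodic f \<longrightarrow> f x = f y"
proof -
  define n where "n = \<lfloor>x / (2 * pi)\<rfloor>"
  define y where "y = x - of_int n * (2 * pi)"
  have shift: "f (z + of_int n * (2 * pi)) = f z" if f: "periodic f" for f :: "real \<Rightarrow> real" and z n
  proof (induction n arbitrary: z rule: int_induct[where k = 0])
    case (step1 i)
    have "z + of_int (i + 1) * (2 * pi) = (z + of_int i * (2 * pi)) + 2 * pi" by (simp add: algebra_simps)
    then show ?case using step1 f unfolding periodic_def by metis
  next
    case (step2 i)
    have "z + of_int i * (2 * pi) = (z + of_int (i - 1) * (2 * pi)) + 2 * pi" by (simp add: algebra_simps)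
    then show ?case using step2 f unfolding periodic_def by metis
  qed simp
  have "f x = f y" if "periodic f" for f :: "real \<Rightarrow> real"
    using shift[OF that, of y n] by (simp add: y_def)
  moreover have "0 \<le> y" "y \<le> 2 * pi"
  proof -
    have "of_int n \<le> x / (2 * pi)" "x / (2 * pi) < of_int n + 1" unfolding n_def by linarith+
    then show "0 \<le> y" "y \<le> 2 * pi" by (auto simp: y_def field_simps)
  qed
  ultimately show ?thesis by (intro bexI[of _ y]) auto
qed

lemma uniform_limit_periodic:
  assumes "\<And>i. periodic (F i)" "periodic f" "uniform_limit {0..2*pi} F f sequentially"
  shows "uniform_limit UNIV F f sequentially"
  unfolding uniform_limit_real_iff
proof (intro allI impI)
  fix e :: real assume "0 < e"
  then obtain i0 where i0: "\<forall>i\<ge>i0. \<forall>x\<in>{0..2*pi}. \<bar>F i x - f x\<bar> \<le> e"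
    using assms(3) unfolding uniform_limit_real_iff by blast
  have "\<bar>F i x - f x\<bar> \<le> e" if "i0 \<le> i" for i x
  proof -
    obtain y where "y \<in> {0..2*pi}" "\<forall>f. periodic f \<longrightarrow> f x = f y" using periodic_reduce by blast
    then show ?thesis using i0 that assms(1,2) by metis
  qed
  then show "\<exists>i0. \<forall>i\<ge>i0. \<forall>x\<in>UNIV. \<bar>F i x - f x\<bar> \<le> e" by blast
qed

lemma periodic_continuous_bounded:
  assumes "periodic f" "continuous_on UNIV f"
  shows "bounded (range f)"
proof -
  have "bounded (f ` {0..2*pi})"
    by (intro compact_imp_bounded compact_continuous_image continuous_on_subset[OF assms(2)]) auto
  moreover have "range f \<subseteq> f ` {0..2*pi}" using periodic_reduce assms(1) by blast
  ultimately show ?thesis by (rule bounded_subset)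
qed

text \<open>Fejer means do not increase the supremum norm, so they may be applied to a convergent
  sequence while their order grows along it. Sharp Fourier projections would not allow this.\<close>

lemma fejer_tendsto_uniformly:
  assumes F: "\<And>i. continuous_on UNIV (F i)" "uniform_limit UNIV F f sequentially"
    and f: "continuous_on UNIV f" "periodic f" and \<nu>: "\<And>i. i \<le> \<nu> i"
  shows "uniform_limit UNIV (\<lambda>i. fejer (\<nu> i) (F i)) f sequentially"
proof (rule uniform_limit_periodic)
  show "periodic (fejer (\<nu> i) (F i))" for i unfolding fejer_def by (rule periodic_trig)
  show "uniform_limit {0..2*pi} (\<lambda>i. fejer (\<nu> i) (F i)) f sequentially"
    unfolding uniform_limit_real_iff
  proof (intro allI impI)
    fix e :: real assume e: "0 < e"
    have f02: "f 0 = f (2*pi)" using f(2) unfolding periodic_def by (metis add_0)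
    obtain i1 where i1: "\<forall>i\<ge>i1. \<forall>x. \<bar>F i x - f x\<bar> \<le> e / 2"
      using F(2) e unfolding uniform_limit_real_iff by (meson UNIV_I half_gt_zero)
    obtain i2 where i2: "\<forall>i\<ge>i2. \<forall>x\<in>{0..2*pi}. \<bar>fejer i f x - f x\<bar> \<le> e / 2"
      using fejer_uniform_limit[OF continuous_on_subset[OF f(1)] f02] e
      unfolding uniform_limit_real_iff by (meson half_gt_zero subset_UNIV)
    have if': "integrable circle f" and iF: "integrable circle (F i)" for i
      using f F by (auto intro: circle_integrable_UNIV)
    have "\<bar>fejer (\<nu> i) (F i) x - f x\<bar> \<le> e" if "max i1 i2 \<le> i" "x \<in> {0..2*pi}" for i x
    proof -
      have "fejer (\<nu> i) (F i) x - fejer (\<nu> i) f x = fejer (\<nu> i) (\<lambda>x. F i x - f x) x"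
        unfolding fejer_def trig_diff coef_diff[OF iF if'] by (simp add: right_diff_distrib)
      moreover have "\<bar>fejer (\<nu> i) (\<lambda>x. F i x - f x) x\<bar> \<le> e / 2"
        by (rule fejer_bound) (use i1 that iF if' in auto)
      moreover have "\<bar>fejer (\<nu> i) f x - f x\<bar> \<le> e / 2" using i2 \<nu>[of i] that by auto
      ultimately show ?thesis by linarith
    qed
    then show "\<exists>i0. \<forall>i\<ge>i0. \<forall>x\<in>{0..2*pi}. \<bar>fejer (\<nu> i) (F i) x - f x\<bar> \<le> e" by blast
  qed
qed (rule f(2))

text \<open>By Rolle's theorem f' vanishes somewhere in the period; integrating f'' from there gives
  the bound.\<close>

lemma periodic_deriv_average_bound:
  fixes f f' f'' :: "real \<Rightarrow> real"
  assumes f: "periodic f" "\<And>x. (f has_real_derivative f' x) (at x)" and f': "periodic f'"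
    "\<And>x. (f' has_real_derivative f'' x) (at x)" and c: "continuous_on UNIV f''"
  shows "\<bar>f' x\<bar> \<le> 2 * pi * (AVG x. \<bar>f'' x\<bar>)"
proof -
  obtain y where y: "y \<in> {0..2*pi}" "f' x = f' y" using periodic_reduce f'(1) by blast
  have "f 0 = f (2*pi)" using f(1) unfolding periodic_def by (metis add_0)
  moreover have "continuous_on {0..2*pi} f" by (meson f(2) DERIV_isCont continuous_at_imp_continuous_on)
  ultimately obtain z where z: "0 < z" "z < 2*pi" "(\<lambda>h. f' z * h) = (\<lambda>h. 0)"
    using Rolle_deriv[of 0 "2*pi" f "\<lambda>x h. f' x * h"] f(2) pi_gt_zero
    by (auto simp: has_field_derivative_def)
  have z0: "f' z = 0" using z(3) by (metis mult.right_neutral)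
  have cs: "continuous_on S f''" "continuous_on S (\<lambda>x. \<bar>f'' x\<bar>)" for S
    using continuous_on_subset[OF c] by (auto intro: continuous_on_rabs)
  have *: "\<bar>f' v - f' u\<bar> \<le> integral {0..2*pi} (\<lambda>x. \<bar>f'' x\<bar>)" if "0 \<le> u" "u \<le> v" "v \<le> 2*pi" for u v
  proof -
    have "(f'' has_integral f' v - f' u) {u..v}"
      using that f'(2) by (intro fundamental_theorem_of_calculus)
        (auto simp: has_real_derivative_iff_has_vector_derivative[symmetric] intro: has_field_derivative_at_within)
    then have "f' v - f' u = integral {u..v} f''" by (simp add: integral_unique)
    also have "\<bar>...\<bar> \<le> integral {u..v} (\<lambda>x. \<bar>f'' x\<bar>)"
      using integral_norm_bound_integral[of f'' "{u..v}" "\<lambda>x. \<bar>f'' x\<bar>"] integrable_continuous_real[OF cs(1)] integrable_continuous_real[OF cs(2)]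
      by auto
    also have "... \<le> integral {0..2*pi} (\<lambda>x. \<bar>f'' x\<bar>)"
      using that integrable_continuous_real[OF cs(2)] by (intro integral_subset_le) auto
    finally show ?thesis .
  qed
  have "\<bar>f' y\<bar> \<le> integral {0..2*pi} (\<lambda>x. \<bar>f'' x\<bar>)"
  proof (cases "z \<le> y")
    case True
    then show ?thesis using *[of z y] y z z0 by simp
  next
    case False
    then show ?thesis using *[of y z] y z z0 by simp
  qed
  also have "... = 2 * pi * (AVG x. \<bar>f'' x\<bar>)" using average_eq_integral[OF cs(2)] by simp
  finally show ?thesis using y by simp
qed

text \<open>The symbol k (k^2 - 1), with the reflection that every odd derivative causes in the
  Hartley basis. At k = 0 both sides vanish.\<close>

lemma dcoef_1_3: "dcoef c k + (dcoef ^^ 3) c k = of_int k * lam k * c (- k)"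
  by (cases "k = 0") (simp_all add: numeral_3_eq_3 dcoef_def lam_def power2_eq_square algebra_simps)

context flow_conv begin

definition sc :: "nat \<Rightarrow> real \<Rightarrow> int \<Rightarrow> real" where
  "sc i t k = fejer_weight (\<nu> i) k * cc (\<nu> i) t k"

text \<open>Derivatives of the Fejer means of the heights. The scheme equates coefficients up to
  order \<nu> i, that is, sharp projections; the Fejer weights are even in k, commute with
  differentiation and turn these projections into Fejer means, see \<open>sm_3\<close>.\<close>

definition sm :: "nat \<Rightarrow> nat \<Rightarrow> real \<Rightarrow> real \<Rightarrow> real" where
  "sm n i t = trig (\<nu> i) ((dcoef ^^ n) (sc i t))"

definition bet :: "real \<Rightarrow> real \<Rightarrow> real" where
  "bet t x = b (h t x) * spow \<rho> (g t x)"

definition hder :: "nat \<Rightarrow> real \<Rightarrow> real \<Rightarrow> real" where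
  "hder n t x = lim (\<lambda>i. sm n i t x)"

lemma sm_deriv: "(sm n i t has_real_derivative sm (Suc n) i t x) (at x)"
  unfolding sm_def using trig_deriv[of "\<nu> i" "(dcoef ^^ n) (sc i t)"] by simp

lemma periodic_sm: "periodic (sm n i t)"
  unfolding sm_def by (rule periodic_trig)

lemma continuous_sm: "continuous_on UNIV (sm n i t)"
  unfolding sm_def using continuous_on_trig[OF continuous_on_id] by auto

lemma sm_0: "sm 0 i t = fejer (\<nu> i) (H i t)"
  by (auto simp: fun_eq_iff sm_def H_def fejer_def coef_trig sc_def trig_def intro!: sum.cong)

lemma sm_1: "sm 1 i t = fejer (\<nu> i) (H1 i t)"
  by (auto simp: fun_eq_iff sm_def H1_def fejer_def coef_trig sc_def trig_def dcoef_def fejer_weight_def intro!: sum.cong)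

lemma sm_3: 
  "sm 1 i t x + sm 3 i t x = fejer (\<nu> i) (\<lambda>x. b (Hl i t x) * spow \<rho> (G i t x)) x"
proof -
  interpret A: discrete_flow \<rho> b0 b1 L b "\<nu> i" "1 / real (\<nu> i)" "c (\<nu> i)" "j (\<nu> i)" by (rule flow[OF \<nu>1])
  have "(\<lambda>x. b (Hl i t x) * spow \<rho> (G i t x)) = (\<lambda>x. b (A.h (step_idx (\<nu> i) t) x) * spow \<rho> (A.J (step_idx (\<nu> i) t) x))"
    by (simp add: Hl_def G_def A.h_def A.J_def cl_def jj_def)
  then have *: "coef (\<lambda>x. b (Hl i t x) * spow \<rho> (G i t x)) k = of_int k * lam k * cc (\<nu> i) t (- k)"
    if "k \<in> modes (\<nu> i)" for k
    using A.flux_coef_eq[OF that, of "step_idx (\<nu> i) t"] by (simp add: A.flux_coef_def cc_def)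
  have "sm 1 i t x + sm 3 i t x = trig (\<nu> i) (\<lambda>k. of_int k * lam k * sc i t (- k)) x"
    by (simp add: sm_def trig_add dcoef_1_3)
  also have "... = fejer (\<nu> i) (\<lambda>x. b (Hl i t x) * spow \<rho> (G i t x)) x"
    unfolding fejer_def trig_def using * by (intro sum.cong) (simp_all add: sc_def fejer_weight_def)
  finally show ?thesis .
qed

lemma continuous_bet: "good t \<Longrightarrow> 0 < t \<Longrightarrow> t \<le> 1 \<Longrightarrow> continuous_on UNIV (bet t)"
  unfolding bet_def using continuous_g[of t] continuous_h[of t] \<rho> by (intro continuous_intros) auto

lemma periodic_bet: "0 < t \<Longrightarrow> t \<le> 1 \<Longrightarrow> periodic (bet t)"
  unfolding periodic_def bet_def using periodic_h[of t] periodic_g[of t] by (simp add: periodic_def)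

lemma bet_limit:
  assumes t: "good t" "0 < t" "t \<le> 1"
  shows "uniform_limit UNIV (\<lambda>i x. b (Hl i t x) * spow \<rho> (G i t x)) (bet t) sequentially"
  unfolding bet_def
proof (rule uniform_lim_mult)
  show ub: "uniform_limit UNIV (\<lambda>i x. b (Hl i t x)) (\<lambda>x. b (h t x)) sequentially"
    unfolding uniform_limit_real_iff
  proof (intro allI impI)
    fix e :: real assume e: "0 < e"
    obtain i0 where i0: "\<forall>i\<ge>i0. \<forall>s y. 0 < s \<longrightarrow> s \<le> 1 \<longrightarrow> \<bar>Hl i s y - h s y\<bar> \<le> e / (L + 1)"
      using Hl_ulim[of "e / (L + 1)"] e L by auto
    have "\<bar>b (Hl i t x) - b (h t x)\<bar> \<le> e" if "i0 \<le> i" for i x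
    proof -
      have "\<bar>b (Hl i t x) - b (h t x)\<bar> \<le> L * \<bar>Hl i t x - h t x\<bar>" by (rule b_lip)
      also have "... \<le> (L + 1) * (e / (L + 1))" using i0 that t L by (intro mult_mono) auto
      finally show ?thesis using L by simp
    qed
    then show "\<exists>i0. \<forall>i\<ge>i0. \<forall>x\<in>UNIV. \<bar>b (Hl i t x) - b (h t x)\<bar> \<le> e" by blast
  qed
  have gb: "bounded (range (g t))" by (rule periodic_continuous_bounded[OF periodic_g continuous_g[OF t]])
  then obtain B where B: "\<And>x. \<bar>g t x\<bar> \<le> B" unfolding bounded_iff by auto
  show "uniform_limit UNIV (\<lambda>i x. spow \<rho> (G i t x)) (\<lambda>x. spow \<rho> (g t x)) sequentially"
    unfolding uniform_limit_real_iff
  proof (intro allI impI)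
    fix e :: real assume e: "0 < e"
    have "uniformly_continuous_on {- (B + 1)..B + 1} (spow \<rho>)"
      by (rule compact_uniformly_continuous) (use \<rho> in \<open>auto intro!: continuous_intros\<close>)
    then obtain d where d: "0 < d" "\<And>u v. u \<in> {- (B + 1)..B + 1} \<Longrightarrow> v \<in> {- (B + 1)..B + 1} \<Longrightarrow>
        \<bar>v - u\<bar> < d \<Longrightarrow> \<bar>spow \<rho> v - spow \<rho> u\<bar> < e"
      using e unfolding uniformly_continuous_on_def dist_real_def by metis
    have "0 < min 1 (d / 2)" using d by simp
    then obtain i0 where i0: "\<forall>i\<ge>i0. \<forall>x. \<bar>G i t x - g t x\<bar> \<le> min 1 (d / 2)" using G_lim(2)[OF t] by blast
    have "\<bar>spow \<rho> (G i t x) - spow \<rho> (g t x)\<bar> \<le> e" if "i0 \<le> i" for i x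
    proof (rule less_imp_le, rule d(2))
      have *: "\<bar>G i t x - g t x\<bar> \<le> 1" "\<bar>G i t x - g t x\<bar> \<le> d / 2" "\<bar>g t x\<bar> \<le> B" using i0 that B by auto
      then show "g t x \<in> {- (B + 1)..B + 1}" "G i t x \<in> {- (B + 1)..B + 1}" "\<bar>G i t x - g t x\<bar> < d"
        using d(1) by (auto simp: abs_le_iff)
    qed
    then show "\<exists>i0. \<forall>i\<ge>i0. \<forall>x\<in>UNIV. \<bar>spow \<rho> (G i t x) - spow \<rho> (g t x)\<bar> \<le> e" by blast
  qed
  show "bounded (range (\<lambda>x. b (h t x)))"
    unfolding bounded_iff using b_pos b_le by (intro exI[of _ b1]) (auto simp: less_imp_le)
  show "bounded (range (\<lambda>x. spow \<rho> (g t x)))"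
    unfolding bounded_iff using B \<rho> by (intro exI[of _ "B powr \<rho>"]) (auto simp: abs_spow intro!: powr_mono2)
qed

text \<open>Orders 0 and 1 come from the uniform limits of H and H1, order 3 from the flux equation,
  and order 2 from order 3 by \<open>periodic_deriv_average_bound\<close>. Order 2 is only shown to
  be Cauchy, so its limit is named by \<open>hder\<close>.\<close>

lemma sm_limits:
  assumes t: "good t" "0 < t" "t \<le> 1"
  shows "uniform_limit UNIV (\<lambda>i. sm 0 i t) (h t) sequentially"
    "uniform_limit UNIV (\<lambda>i. sm 1 i t) (h1 t) sequentially"
    "uniform_limit UNIV (\<lambda>i. sm 3 i t) (\<lambda>x. bet t x - h1 t x) sequentially"
    "uniform_limit UNIV (\<lambda>i. sm 2 i t) (hder 2 t) sequentially"
proof -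
  show "uniform_limit UNIV (\<lambda>i. sm 0 i t) (h t) sequentially"
    unfolding sm_0
  proof (rule fejer_tendsto_uniformly[OF continuous_H _ continuous_h[OF t(2,3)] periodic_h[OF t(2,3)] \<nu>_ge])
    show "uniform_limit UNIV (\<lambda>i. H i t) (h t) sequentially"
      unfolding uniform_limit_real_iff using H_ulim t by (meson UNIV_I)
  qed
  show 1: "uniform_limit UNIV (\<lambda>i. sm 1 i t) (h1 t) sequentially"
    unfolding sm_1
  proof (rule fejer_tendsto_uniformly[OF continuous_H1 _ continuous_h1[OF t(2,3)] periodic_h1[OF t(2,3)] \<nu>_ge])
    show "uniform_limit UNIV (\<lambda>i. H1 i t) (h1 t) sequentially"
      unfolding uniform_limit_real_iff using H1_ulim t by (meson UNIV_I order_refl)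
  qed
  have "uniform_limit UNIV (\<lambda>i x. sm 1 i t x + sm 3 i t x) (bet t) sequentially"
    unfolding sm_3
  proof (rule fejer_tendsto_uniformly[OF _ bet_limit[OF t] continuous_bet[OF t] periodic_bet[OF t(2,3)] \<nu>_ge])
    show "continuous_on UNIV (\<lambda>x. b (Hl i t x) * spow \<rho> (G i t x))" for i
      using \<rho> by (intro continuous_intros continuous_Hl continuous_G) auto
  qed
  from uniform_limit_minus[OF this 1]
  show 3: "uniform_limit UNIV (\<lambda>i. sm 3 i t) (\<lambda>x. bet t x - h1 t x) sequentially" by simp
  have "\<exists>i0. \<forall>i\<ge>i0. \<forall>i'\<ge>i0. \<forall>x\<in>UNIV. \<bar>sm 2 i t x - sm 2 i' t x\<bar> \<le> e" if e: "0 < e" for e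
  proof -
    define d where "d = e / (2 * pi)"
    have "0 < d / 2" using e by (simp add: d_def)
    then obtain i0 where i0: "\<forall>i\<ge>i0. \<forall>x. \<bar>sm 3 i t x - (bet t x - h1 t x)\<bar> \<le> d / 2"
      using 3 unfolding uniform_limit_real_iff by (meson UNIV_I)
    have "\<bar>sm 2 i t x - sm 2 i' t x\<bar> \<le> e" if "i0 \<le> i" "i0 \<le> i'" for i i' x
    proof -
      have p: "periodic (\<lambda>x. sm n i t x - sm n i' t x)" for n
        using periodic_sm[of n i t] periodic_sm[of n i' t] by (simp add: periodic_def)
      have d: "((\<lambda>x. sm n i t x - sm n i' t x) has_real_derivative sm m i t x - sm m i' t x) (at x)" if "m = Suc n" for n m x
        unfolding that by (intro DERIV_diff sm_deriv)
      have "\<bar>sm 3 i t x - sm 3 i' t x\<bar> \<le> d" for x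
      proof -
        have "\<bar>sm 3 i t x - (bet t x - h1 t x)\<bar> \<le> d / 2" "\<bar>sm 3 i' t x - (bet t x - h1 t x)\<bar> \<le> d / 2"
          using i0 that by auto
        then show ?thesis by linarith
      qed
      then have "(AVG x. \<bar>sm 3 i t x - sm 3 i' t x\<bar>) \<le> d"
        by (intro average_le_const circle_integrable_UNIV continuous_intros continuous_sm) auto
      then have "2 * pi * (AVG x. \<bar>sm 3 i t x - sm 3 i' t x\<bar>) \<le> 2 * pi * d" by (intro mult_left_mono) auto
      moreover have "\<bar>sm 2 i t x - sm 2 i' t x\<bar> \<le> 2 * pi * (AVG x. \<bar>sm 3 i t x - sm 3 i' t x\<bar>)"
        by (rule periodic_deriv_average_bound[OF p[of 1] d[of 2 1] p[of 2] d[of 3 2]])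
          (auto intro!: continuous_intros continuous_sm)
      ultimately have "\<bar>sm 2 i t x - sm 2 i' t x\<bar> \<le> 2 * pi * d" by linarith
      then show ?thesis by (simp add: d_def)
    qed
    then show ?thesis by blast
  qed
  then show "uniform_limit UNIV (\<lambda>i. sm 2 i t) (hder 2 t) sequentially"
    unfolding hder_def uniform_limit_real_iff using uniformly_Cauchy_lim(2)[of UNIV "\<lambda>i. sm 2 i t"] by blast
qed

lemma hder_eq:
  assumes t: "good t" "0 < t" "t \<le> 1"
  shows "hder 0 t = h t" "hder 1 t = h1 t" "hder 3 t x = bet t x - h1 t x"
  unfolding hder_def using sm_limits(1-3)[OF t]
  by (auto simp: fun_eq_iff intro!: limI dest!: tendsto_uniform_limitI)

lemma hder_limit:
  assumes t: "good t" "0 < t" "t \<le> 1" and n: "n \<le> 3"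
  shows "uniform_limit UNIV (\<lambda>i. sm n i t) (hder n t) sequentially"
proof -
  have "n = 0 \<or> n = 1 \<or> n = 2 \<or> n = 3" using n by auto
  moreover have "hder 3 t = (\<lambda>x. bet t x - h1 t x)" using hder_eq(3)[OF t] by auto
  ultimately show ?thesis using sm_limits[OF t] hder_eq[OF t] by auto
qed

lemma continuous_hder:
  assumes "good t" "0 < t" "t \<le> 1" "n \<le> 3"
  shows "continuous_on UNIV (hder n t)"
  by (rule uniform_limit_theorem[OF _ hder_limit[OF assms]]) (auto intro!: always_eventually continuous_sm)

lemma periodic_hder: "periodic (hder n t)"
  using periodic_sm[of n _ t] unfolding periodic_def hder_def by simp

lemma hder_deriv:
  assumes t: "good t" "0 < t" "t \<le> 1" and n: "n < 3"
  shows "(hder n t has_real_derivative hder (Suc n) t x) (at x)"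
proof (rule uniform_limit_DERIV[of "\<lambda>i. sm n i t", OF sm_deriv])
  have u: "uniform_limit UNIV (\<lambda>i. sm (Suc n) i t) (hder (Suc n) t) sequentially"
    using n by (intro hder_limit t) auto
  show "0 < e \<Longrightarrow> \<exists>n0. \<forall>i\<ge>n0. \<forall>x. \<bar>sm (Suc n) i t x - hder (Suc n) t x\<bar> \<le> e" for e
    using u unfolding uniform_limit_real_iff by (meson UNIV_I)
  show "(\<lambda>i. sm n i t x) \<longlonglongrightarrow> hder n t x" for x
    using n by (intro tendsto_uniform_limitI[OF hder_limit[OF t]]) auto
qed

end

section \<open>The time derivative\<close>

lemma step_sum:
  assumes N: "1 \<le> N"
  shows "I01 t * F (step_idx N t) =
    (\<Sum>n<N. step_ind N n t * (F n :: real))"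
proof (cases "t \<in> {0<..1}")
  case True
  then have t: "0 < t" "t \<le> 1" by auto
  have u: "n = step_idx N t" if "t \<in> {real n / real N<..real (Suc n) / real N}" for n
  proof -
    have "real n < t * real N" "t * real N \<le> real (Suc n)" using that N by (auto simp: field_simps)
    moreover have "real (step_idx N t) < t * real N" "t * real N \<le> real (Suc (step_idx N t))"
      using step_idx[OF t N] N by (auto simp: field_simps)
    ultimately have "real n < real (Suc (step_idx N t))" "real (step_idx N t) < real (Suc n)" by linarith+
    then show ?thesis by simp
  qed
  have "(\<Sum>n<N. step_ind N n t * F n)
      = (\<Sum>n<N. if n = step_idx N t then F n else 0)"
  proof (intro sum.cong refl)
    fix n assume "n \<in> {..<N}"
    have "t \<in> {real (step_idx N t) / real N<..real (Suc (step_idx N t)) / real N}" using step_idx[OF t N] by auto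
    then show "step_ind N n t * F n = (if n = step_idx N t then F n else 0)"
    proof (cases "n = step_idx N t")
      case False
      then have "t \<notin> {real n / real N<..real (Suc n) / real N}" using u by blast
      then show ?thesis using False by simp
    qed simp
  qed
  then show ?thesis using True step_idx(1)[OF t N] by simp
next
  case False
  have "t \<notin> {real n / real N<..real (Suc n) / real N}" if "n < N" for n
  proof -
    have "real (Suc n) / real N \<le> 1" "0 \<le> real n / real N" using that N by auto
    then show ?thesis using False unfolding greaterThanAtMost_iff by linarith
  qed
  then show ?thesis using False by simp
qed

lemma step_bounded:
  assumes N: "1 \<le> N"
  shows "\<exists>B\<ge>0. \<forall>t x. 0 < t \<longrightarrow> t \<le> 1 \<longrightarrow> \<bar>trig N (f (step_idx N t)) x\<bar> \<le> B"
proof (intro exI conjI allI impI)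
  show "0 \<le> (\<Sum>n<N. 2 * (\<Sum>k\<in>modes N. \<bar>f n k\<bar>))" by (intro sum_nonneg mult_nonneg_nonneg) auto
  fix t x :: real assume t: "0 < t" "t \<le> 1"
  have "\<bar>trig N (f (step_idx N t)) x\<bar> \<le> 2 * (\<Sum>k\<in>modes N. \<bar>f (step_idx N t) k\<bar>)" by (rule abs_trig_le)
  also have "... \<le> (\<Sum>n<N. 2 * (\<Sum>k\<in>modes N. \<bar>f n k\<bar>))"
    by (rule member_le_sum[where f = "\<lambda>n. 2 * (\<Sum>k\<in>modes N. \<bar>f n k\<bar>)"])
       (use step_idx(1)[OF t N] in \<open>auto intro!: sum_nonneg\<close>)
  finally show "\<bar>trig N (f (step_idx N t)) x\<bar> \<le> (\<Sum>n<N. 2 * (\<Sum>k\<in>modes N. \<bar>f n k\<bar>))" .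
qed

lemma integral_deriv_interval:
  assumes \<eta>: "smooth \<eta>" and ab: "a \<le> b"
  shows "integrable lebesgue (\<lambda>t. indicator {a<..b} t * deriv \<eta> t)"
    "(\<integral>t. indicator {a<..b} t * deriv \<eta> t \<partial>lebesgue) = \<eta> b - \<eta> a"
proof -
  have d: "(\<eta> has_real_derivative deriv \<eta> x) (at x)" for x using smooth_deriv[OF \<eta>, of 0] by simp
  have c: "continuous_on UNIV (deriv \<eta>)" using smooth_continuous[OF \<eta>, of UNIV 1] by simp
  have cc: "isCont (deriv \<eta>) x" for x using c by (simp add: continuous_on_eq_continuous_at)
  have i: "(\<integral>x. deriv \<eta> x * indicator {a..b} x \<partial>lborel) = \<eta> b - \<eta> a"
    by (rule integral_FTC_Icc_real[OF ab d cc])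
  have ii: "integrable lborel (\<lambda>x. deriv \<eta> x * indicator {a..b} x)"
    by (rule borel_integrable_atLeastAtMost[OF cc])
  have l: "integrable lebesgue (\<lambda>x. deriv \<eta> x * indicator {a..b} x)"
    "(\<integral>x. deriv \<eta> x * indicator {a..b} x \<partial>lebesgue) = \<eta> b - \<eta> a"
    using i ii borel_measurable_integrable[OF ii] by (simp_all add: integrable_completion integral_completion)
  have ae: "AE t in lebesgue. indicator {a<..b} t * deriv \<eta> t = deriv \<eta> t * indicator {a..b} t"
  proof (rule AE_I')
    show "{a} \<in> null_sets lebesgue" by auto
  qed (auto simp: indicator_def)
  have m: "(\<lambda>t. indicator {a<..b} t * deriv \<eta> t) \<in> borel_measurable lebesgue"
    by (rule borel_measurable_AE[OF borel_measurable_integrable[OF l(1)]]) (use ae in \<open>simp add: eq_commute[of "deriv \<eta> _ * _"]\<close>)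
  show "integrable lebesgue (\<lambda>t. indicator {a<..b} t * deriv \<eta> t)"
    using l(1) integrable_cong_AE[OF m borel_measurable_integrable[OF l(1)] ae] by simp
  show "(\<integral>t. indicator {a<..b} t * deriv \<eta> t \<partial>lebesgue) = \<eta> b - \<eta> a"
    unfolding l(2)[symmetric] by (rule integral_cong_AE[OF m borel_measurable_integrable[OF l(1)] ae])
qed

text \<open>Abel summation over the grid. The derivative of \<eta> is integrated exactly over each
  step, which puts \<eta> at left grid points in front of the flux; \<eta> 0 = 0 removes the initial
  term.\<close>

lemma (in flow_family) discrete_time_deriv:
  assumes N: "1 \<le> N" and w: "integrable circle w" "integrable circle w'" "\<And>k. coef w' k = dcoef (coef w) k"
    and \<eta>: "smooth \<eta>" "\<eta> 0 = 0"
  shows "(\<integral>t. I01 t * (deriv \<eta> t * (AVG x. w x * trig N (cc N t) x)) \<partial>lebesgue)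
    = \<eta> 1 * (AVG x. w x * trig N (cc N 1) x)
      - (\<integral>t. I01 t * (\<eta> (real (step_idx N t) / real N) * (AVG x. w' x * trig N (jj N t) x)) \<partial>lebesgue)"
    (is "?I = ?E - ?J")
proof -
  interpret A: discrete_flow \<rho> b0 b1 L b N "1 / real N" "c N" "j N" by (rule flow[OF N])
  define \<omega> where "\<omega> n = (AVG x. w x * trig N (c N n) x)" for n
  define a where "a n = (AVG x. w' x * trig N (j N (Suc n)) x)" for n
  define e where "e n = \<eta> (real n / real N)" for n
  have step: "\<omega> (Suc n) - \<omega> n = 1 / real N * a n" for n
  proof -
    have "c N (Suc n) k - c N n k = 1 / real N * (of_int k * j N (Suc n) (- k))" for k
      using A.scheme unfolding scheme_def dcoef_def by auto
    then have "\<omega> (Suc n) - \<omega> n = (\<Sum>k\<in>modes N. coef w k * (1 / real N * (of_int k * j N (Suc n) (- k))))"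
      unfolding \<omega>_def average_mult_trig[OF w(1)] by (simp add: sum_subtractf[symmetric] right_diff_distrib[symmetric])
    also have "... = (\<Sum>k\<in>modes N. coef w (- k) * (1 / real N * (of_int (- k) * j N (Suc n) (- (- k)))))"
      by (rule sum_modes_uminus[symmetric])
    also have "... = 1 / real N * a n"
      unfolding a_def average_mult_trig[OF w(2)] w(3) sum_distrib_left dcoef_def by (intro sum.cong) auto
    finally show ?thesis .
  qed
  have le: "real n / real N \<le> real (Suc n) / real N" for n by (simp add: divide_right_mono)
  note d = integral_deriv_interval[OF \<eta>(1) le]
  have "?I
      = (\<integral>t. (\<Sum>n<N. (step_ind N n t * deriv \<eta> t) * \<omega> (Suc n)) \<partial>lebesgue)"
  proof (intro Bochner_Integration.integral_cong refl)
    fix t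
    have "I01 t * (deriv \<eta> t * (AVG x. w x * trig N (cc N t) x))
        = deriv \<eta> t * (I01 t * \<omega> (Suc (step_idx N t)))" by (simp add: \<omega>_def cc_def)
    also have "... = (\<Sum>n<N. (step_ind N n t * deriv \<eta> t) * \<omega> (Suc n))"
      unfolding step_sum[OF N, of t "\<lambda>n. \<omega> (Suc n)"] sum_distrib_left by (simp add: mult_ac)
    finally show "I01 t * (deriv \<eta> t * (AVG x. w x * trig N (cc N t) x))
      = (\<Sum>n<N. (step_ind N n t * deriv \<eta> t) * \<omega> (Suc n))" .
  qed
  also have "... = (\<Sum>n<N. (e (Suc n) - e n) * \<omega> (Suc n))"
    using d by (subst Bochner_Integration.integral_sum) (auto simp: e_def)
  finally have 1: "?I
    = (\<Sum>n<N. (e (Suc n) - e n) * \<omega> (Suc n))" .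
  have i1: "integrable lebesgue (\<lambda>t. step_ind N n t)" for n
    by (rule integrable_real_indicator) (auto simp: divide_right_mono)
  have len: "real (Suc n) / real N - real n / real N = 1 / real N" for n by (simp add: add_divide_distrib)
  have "?J
      = (\<integral>t. (\<Sum>n<N. step_ind N n t * (e n * a n)) \<partial>lebesgue)"
    unfolding step_sum[OF N, symmetric] by (simp add: e_def a_def jj_def)
  also have "... = (\<Sum>n<N. 1 / real N * (e n * a n))"
    using i1 len by (subst Bochner_Integration.integral_sum) (auto simp: divide_right_mono)
  also have "... = (\<Sum>n<N. e n * (\<omega> (Suc n) - \<omega> n))"
    unfolding step by (simp add: mult_ac)
  finally have 2: "?J
    = (\<Sum>n<N. e n * (\<omega> (Suc n) - \<omega> n))" .
  have "(\<Sum>n<N. (e (Suc n) - e n) * \<omega> (Suc n)) + (\<Sum>n<N. e n * (\<omega> (Suc n) - \<omega> n))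
      = (\<Sum>n<N. e (Suc n) * \<omega> (Suc n) - e n * \<omega> n)"
    unfolding sum.distrib[symmetric] by (intro sum.cong refl) (simp add: algebra_simps)
  also have "... = e N * \<omega> N - e 0 * \<omega> 0" by (rule sum_lessThan_telescope)
  also have "... = \<eta> 1 * (AVG x. w x * trig N (cc N 1) x)"
    using N \<eta>(2) by (simp add: e_def \<omega>_def cc_def step_idx_def)
  finally show ?thesis unfolding 1 2 by simp
qed

lemma abs_average_mult_le:
  assumes w: "integrable circle w" and f: "continuous_on {0..2*pi} f" "\<And>x. x \<in> {0..2*pi} \<Longrightarrow> \<bar>f x\<bar> \<le> C"
  shows "\<bar>(AVG x. w x * f x)\<bar> \<le> (AVG x. \<bar>w x\<bar>) * C"
proof -
  have i: "integrable circle (\<lambda>x. w x * f x)" by (rule integrable_mult_continuous[OF w f(1)])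
  have "\<bar>(AVG x. w x * f x)\<bar> \<le> (AVG x. \<bar>w x * f x\<bar>)" by (rule average_abs_le[OF i])
  also have "... \<le> (AVG x. \<bar>w x\<bar> * C)"
  proof (rule average_mono)
    show "integrable circle (\<lambda>x. \<bar>w x * f x\<bar>)" using i by simp
    show "\<bar>w x * f x\<bar> \<le> \<bar>w x\<bar> * C" if "x \<in> {0..2*pi}" for x
      unfolding abs_mult using f(2)[OF that] by (rule mult_left_mono) simp
  qed (use w in auto)
  finally show ?thesis by (simp add: average_cmult_right)
qed

lemma average_mult_tendsto:
  assumes w: "integrable circle w" and F: "\<And>i. continuous_on UNIV (F i)" "continuous_on UNIV f"
    and u: "\<And>e. 0 < e \<Longrightarrow> \<exists>i0. \<forall>i\<ge>i0. \<forall>x. \<bar>F i x - f x\<bar> \<le> e"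
  shows "(\<lambda>i. AVG x. w x * F i x) \<longlonglongrightarrow> (AVG x. w x * f x)"
  unfolding LIMSEQ_def
proof (intro allI impI)
  fix e :: real assume e: "0 < e"
  define C where "C = (AVG x. \<bar>w x\<bar>) + 1"
  have C: "0 < C" using average_nonneg[of "\<lambda>x. \<bar>w x\<bar>"] by (simp add: C_def)
  have c: "continuous_on {0..2*pi} (F i)" "continuous_on {0..2*pi} f" for i
    by (auto intro: continuous_on_subset[OF F(1)] continuous_on_subset[OF F(2)])
  obtain i0 where i0: "\<forall>i\<ge>i0. \<forall>x. \<bar>F i x - f x\<bar> \<le> e / 2 / C" using u[of "e / 2 / C"] e C by auto
  have "dist (AVG x. w x * F i x) (AVG x. w x * f x) < e" if i: "i0 \<le> i" for i
  proof -
    have "\<bar>AVG x. w x * (F i x - f x)\<bar> \<le> (AVG x. \<bar>w x\<bar>) * (e / 2 / C)"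
      using i0 i by (intro abs_average_mult_le w continuous_on_diff c) auto
    also have "... \<le> C * (e / 2 / C)" using e C by (intro mult_right_mono) (auto simp: C_def)
    also have "... < e" using C e by simp
    finally show ?thesis
      using average_diff[OF integrable_mult_continuous[OF w c(1)] integrable_mult_continuous[OF w c(2)], of i]
      by (simp add: dist_real_def right_diff_distrib)
  qed
  then show "\<exists>no. \<forall>n\<ge>no. dist (AVG x. w x * F n x) (AVG x. w x * f x) < e" by blast
qed

section \<open>Passage to the limit in the time derivative\<close>

context flow_conv begin

text \<open>Uniform convergence reduces the bound to one discretisation, which takes only finitely
  many values in time.\<close>

lemma h_bounded:
  obtains M i0 where "0 \<le> M" "\<And>t x. 0 < t \<Longrightarrow> t \<le> 1 \<Longrightarrow> \<bar>h t x\<bar> \<le> M"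
    "\<And>i t x. i0 \<le> i \<Longrightarrow> 0 < t \<Longrightarrow> t \<le> 1 \<Longrightarrow> \<bar>H i t x\<bar> \<le> M"
proof -
  obtain i0 where i0: "\<forall>i\<ge>i0. \<forall>t x. 0 < t \<longrightarrow> t \<le> 1 \<longrightarrow> \<bar>H i t x - h t x\<bar> \<le> 1" using H_ulim[of 1] by auto
  obtain B where B: "0 \<le> B" "\<forall>t x. 0 < t \<longrightarrow> t \<le> 1 \<longrightarrow> \<bar>H i0 t x\<bar> \<le> B"
    using step_bounded[OF \<nu>1, of i0 "\<lambda>n. c (\<nu> i0) (Suc n)"] unfolding H_def cc_def by blast
  have *: "\<bar>h t x\<bar> \<le> B + 1" if "0 < t" "t \<le> 1" for t x
  proof -
    have "\<bar>H i0 t x - h t x\<bar> \<le> 1" "\<bar>H i0 t x\<bar> \<le> B" using i0 B that by auto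
    then show ?thesis by linarith
  qed
  have "\<bar>H i t x\<bar> \<le> B + 2" if i: "i0 \<le> i" and t: "0 < t" "t \<le> 1" for i t x
  proof -
    have "\<bar>H i t x - h t x\<bar> \<le> 1" using i0 i t by blast
    then show ?thesis using *[OF t, of x] by linarith
  qed
  moreover have "\<bar>h t x\<bar> \<le> B + 2" if "0 < t" "t \<le> 1" for t x using *[OF that, of x] by linarith
  ultimately show thesis using that[of "B + 2" i0] B(1) by simp
qed

lemma average_h_tendsto:
  assumes "integrable circle w" "0 < t" "t \<le> 1"
  shows "(\<lambda>i. AVG x. w x * H i t x) \<longlonglongrightarrow> (AVG x. w x * h t x)"
  by (rule average_mult_tendsto[OF assms(1) continuous_H continuous_h[OF assms(2,3)]]) (use H_ulim assms in blast)

lemma average_g_tendsto: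
  assumes "integrable circle w" "good t" "0 < t" "t \<le> 1"
  shows "(\<lambda>i. AVG x. w x * G i t x) \<longlonglongrightarrow> (AVG x. w x * g t x)"
  by (rule average_mult_tendsto[OF assms(1) continuous_G continuous_g[OF assms(2-4)] G_lim(2)[OF assms(2-4)]])

lemma average_H_measurable: "(\<lambda>t. AVG x. w x * H i t x) \<in> borel_measurable lebesgue"
  unfolding H_def cc_def by (rule borel_measurable_step[of "\<lambda>n. (AVG x. w x * trig (\<nu> i) (c (\<nu> i) (Suc n)) x)"])

lemma average_G_measurable: "(\<lambda>t. AVG x. w x * G i t x) \<in> borel_measurable lebesgue"
  unfolding G_def jj_def by (rule borel_measurable_step[of "\<lambda>n. (AVG x. w x * trig (\<nu> i) (j (\<nu> i) (Suc n)) x)"])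

lemma I01_measurable: "I01 \<in> borel_measurable lebesgue"
  by (rule borel_measurable_indicator) auto

lemma average_h_measurable:
  assumes w: "integrable circle w"
  shows "(\<lambda>t. I01 t * (AVG x. w x * h t x)) \<in> borel_measurable lebesgue"
proof (rule borel_measurable_LIMSEQ_real)
  show "(\<lambda>i. I01 t * (AVG x. w x * H i t x)) \<longlonglongrightarrow> I01 t * (AVG x. w x * h t x)" for t
    using average_h_tendsto[OF w] by (cases "t \<in> {0<..1}") (auto intro: tendsto_mult)
qed (intro borel_measurable_times I01_measurable average_H_measurable)

lemma average_g_measurable:
  assumes w: "integrable circle w"
  shows "(\<lambda>t. I01 t * (AVG x. w x * g t x)) \<in> borel_measurable lebesgue"
proof (rule borel_measurable_lebesgue_AE_limit)
  show "AE t in lebesgue. (\<lambda>i. I01 t * (AVG x. w x * G i t x)) \<longlonglongrightarrow> I01 t * (AVG x. w x * g t x)"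
    using good_AE by eventually_elim (use average_g_tendsto[OF w] in \<open>auto intro: tendsto_mult simp: indicator_def\<close>)
qed (intro borel_measurable_times I01_measurable average_G_measurable)

lemma average_h_bounded:
  assumes w: "integrable circle w"
  shows "\<exists>C\<ge>0. \<forall>t. 0 < t \<longrightarrow> t \<le> 1 \<longrightarrow> \<bar>AVG x. w x * h t x\<bar> \<le> C"
proof -
  obtain M where M: "0 \<le> M" "\<And>t x. 0 < t \<Longrightarrow> t \<le> 1 \<Longrightarrow> \<bar>h t x\<bar> \<le> M" using h_bounded by metis
  have "\<bar>AVG x. w x * h t x\<bar> \<le> (AVG x. \<bar>w x\<bar>) * M" if "0 < t" "t \<le> 1" for t
    using that by (intro abs_average_mult_le w M continuous_on_subset[OF continuous_h]) auto
  moreover have "0 \<le> (AVG x. \<bar>w x\<bar>) * M" using M by (intro mult_nonneg_nonneg average_nonneg) auto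
  ultimately show ?thesis by blast
qed

text \<open>Dominated convergence in \<open>discrete_time_deriv\<close>. The fluxes are dominated by
  the bound of one discretisation plus \<open>WW n\<close>, but only for t \<ge> 1 / (n + 1), which
  is why \<eta> has to vanish near 0. The boundary term at t = 1 is cancelled later by the constant
  continuation.\<close>

lemma time_deriv_weak:
  assumes w: "integrable circle w" "integrable circle w'" "\<And>k. coef w' k = dcoef (coef w) k"
    and \<eta>: "smooth \<eta>" "0 < a" "\<And>t. t < a \<Longrightarrow> \<eta> t = 0"
  shows "(\<integral>t. I01 t * (deriv \<eta> t * (AVG x. w x * h t x)) \<partial>lebesgue)
    = \<eta> 1 * (AVG x. w x * h 1 x)
      - (\<integral>t. I01 t * (\<eta> t * (AVG x. w' x * g t x)) \<partial>lebesgue)"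
    (is "?I = ?E - ?J")
proof -
  let ?s = "\<lambda>i t. real (step_idx (\<nu> i) t) / real (\<nu> i)"
  define Hw where "Hw i t = (AVG x. w x * H i t x)" for i t
  define Gw where "Gw i t = (AVG x. w' x * G i t x)" for i t
  define I where "I i = (\<integral>t. I01 t * (deriv \<eta> t * Hw i t) \<partial>lebesgue)" for i
  define J where "J i = (\<integral>t. I01 t * (\<eta> (?s i t) * Gw i t) \<partial>lebesgue)" for i
  have eq: "I i = \<eta> 1 * Hw i 1 - J i" for i
    unfolding I_def J_def Hw_def Gw_def H_def G_def
    using \<eta> by (intro discrete_time_deriv \<nu>1 w) auto
  have d: "(\<eta> has_real_derivative deriv \<eta> x) (at x)" for x using smooth_deriv[OF \<eta>(1), of 0] by simp
  have cd: "continuous_on UNIV (deriv \<eta>)" using smooth_continuous[OF \<eta>(1), of UNIV 1] by simp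
  have ce: "continuous_on UNIV \<eta>" using smooth_continuous[OF \<eta>(1), of UNIV 0] by simp
  have md: "deriv \<eta> \<in> borel_measurable lebesgue"
    using borel_measurable_continuous_onI[OF cd] by (simp add: measurable_completion)
  have me: "\<eta> \<in> borel_measurable lebesgue"
    using borel_measurable_continuous_onI[OF ce] by (simp add: measurable_completion)
  have "bounded (deriv \<eta> ` {0..1})" "bounded (\<eta> ` {0..1})"
    by (intro compact_imp_bounded compact_continuous_image continuous_on_subset[OF cd] continuous_on_subset[OF ce]; simp)+
  then obtain M M' where MM: "\<forall>t\<in>{0..1}. \<bar>deriv \<eta> t\<bar> \<le> M" "\<forall>t\<in>{0..1}. \<bar>\<eta> t\<bar> \<le> M'"
    unfolding bounded_iff by auto
  then have M: "\<And>t. t \<in> {0..1} \<Longrightarrow> \<bar>deriv \<eta> t\<bar> \<le> M" and M': "\<And>t. t \<in> {0..1} \<Longrightarrow> \<bar>\<eta> t\<bar> \<le> M'" by auto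
  have M0: "0 \<le> M" "0 \<le> M'" using M[of 0] M'[of 0] by auto
  have iind: "integrable lebesgue (\<lambda>t :: real. I01 t :: real)" by (rule integrable_real_indicator) auto
  have I_lim: "I \<longlonglongrightarrow> ?I"
  proof -
    obtain B i0 where B: "0 \<le> B" and HB: "\<And>i t x. i0 \<le> i \<Longrightarrow> 0 < t \<Longrightarrow> t \<le> 1 \<Longrightarrow> \<bar>H i t x\<bar> \<le> B"
      using h_bounded by metis
    let ?w = "\<lambda>t :: real. I01 t * (M * ((AVG x. \<bar>w x\<bar>) * B))"
    have "(\<lambda>i. I (i + i0)) \<longlonglongrightarrow> ?I"
      unfolding I_def
    proof (rule integral_dominated_convergence[where w = ?w])
      have lim: "(\<lambda>i. I01 t * (deriv \<eta> t * Hw i t)) \<longlonglongrightarrow> I01 t * (deriv \<eta> t * (AVG x. w x * h t x))" for t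
        using average_h_tendsto[OF w(1)] unfolding Hw_def by (cases "t \<in> {0<..1}") (auto intro!: tendsto_mult)
      show "AE t in lebesgue. (\<lambda>i. I01 t * (deriv \<eta> t * Hw (i + i0) t)) \<longlonglongrightarrow> I01 t * (deriv \<eta> t * (AVG x. w x * h t x))"
        using lim by (intro AE_I2 LIMSEQ_ignore_initial_segment)
      show "(\<lambda>t. I01 t * (deriv \<eta> t * (AVG x. w x * h t x))) \<in> borel_measurable lebesgue"
        by (rule borel_measurable_LIMSEQ_real[OF lim]) (unfold Hw_def, intro borel_measurable_times I01_measurable md average_H_measurable)
      show "(\<lambda>t. I01 t * (deriv \<eta> t * Hw (i + i0) t)) \<in> borel_measurable lebesgue" for i
        by (unfold Hw_def, intro borel_measurable_times I01_measurable md average_H_measurable)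
      show "integrable lebesgue ?w" using iind by (intro integrable_mult_left) auto
      show "AE t in lebesgue. norm (I01 t * (deriv \<eta> t * Hw (i + i0) t)) \<le> ?w t" for i
      proof (intro AE_I2)
        fix t
        show "norm (I01 t * (deriv \<eta> t * Hw (i + i0) t)) \<le> ?w t"
        proof (cases "t \<in> {0<..1}")
          case True
          have "\<bar>Hw (i + i0) t\<bar> \<le> (AVG x. \<bar>w x\<bar>) * B"
            unfolding Hw_def using True by (intro abs_average_mult_le w continuous_H HB) auto
          then have "\<bar>deriv \<eta> t\<bar> * \<bar>Hw (i + i0) t\<bar> \<le> M * ((AVG x. \<bar>w x\<bar>) * B)"
            using M[of t] True M0 by (intro mult_mono) auto
          then show ?thesis using True by (simp add: abs_mult)
        qed simp
      qed
    qed
    then show ?thesis by (rule LIMSEQ_offset)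
  qed
  have "J \<longlonglongrightarrow> ?J"
  proof -
    obtain n :: nat where n: "1 / a < real (Suc n)" using reals_Archimedean2 by (metis less_trans of_nat_less_iff lessI)
    have na: "1 / real (Suc n) \<le> a" using n \<eta>(2) by (simp add: field_simps)
    obtain B where B: "0 \<le> B" "\<And>t x. 0 < t \<Longrightarrow> t \<le> 1 \<Longrightarrow> \<bar>G n t x\<bar> \<le> B"
      using step_bounded[OF \<nu>1, of n "\<lambda>m. j (\<nu> n) (Suc m)"] unfolding G_def jj_def by blast
    define A where "A = (AVG x. \<bar>w' x\<bar>)"
    have A0: "0 \<le> A" unfolding A_def by (intro average_nonneg) auto
    let ?w = "\<lambda>t :: real. M' * (A * (B * I01 t + WW n t))"
    have me': "(\<lambda>t. \<eta> (?s i t)) \<in> borel_measurable lebesgue" for i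
      by (rule borel_measurable_step[of "\<lambda>m. \<eta> (real m / real (\<nu> i))"])
    have lim: "(\<lambda>i. I01 t * (\<eta> (?s i t) * Gw i t))
        \<longlonglongrightarrow> I01 t * (\<eta> t * (AVG x. w' x * g t x))" if t: "good t" for t
    proof (cases "t \<in> {0<..1}")
      case True
      have "(\<lambda>i. t - ?s i t) \<longlonglongrightarrow> 0"
      proof (rule Lim_null_comparison)
        show "\<forall>\<^sub>F i in sequentially. norm (t - ?s i t) \<le> 1 / real i"
          using eventually_ge_at_top[of 1]
        proof eventually_elim
          case (elim i)
          define s where "s = ?s i t"
          have "s < t" "t \<le> s + 1 / real (\<nu> i)"
            using step_idx[OF _ _ \<nu>1, of t i] True by (auto simp: s_def add_divide_distrib)
          moreover have "1 / real (\<nu> i) \<le> 1 / real i" using elim \<nu>_ge[of i] by (intro divide_left_mono) auto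
          ultimately show ?case unfolding s_def[symmetric] by simp
        qed
        show "(\<lambda>i. 1 / real i) \<longlonglongrightarrow> 0" by (rule lim_1_over_n)
      qed
      then have "(\<lambda>i. ?s i t) \<longlonglongrightarrow> t"
        using tendsto_diff[OF tendsto_const[of t]] by fastforce
      then have "(\<lambda>i. \<eta> (?s i t)) \<longlonglongrightarrow> \<eta> t"
        by (rule isCont_tendsto_compose[OF DERIV_isCont[OF d]])
      then show ?thesis
        using average_g_tendsto[OF w(2) t] True unfolding Gw_def by (intro tendsto_mult) auto
    qed simp
    have "(\<lambda>i. J (i + n)) \<longlonglongrightarrow> ?J"
      unfolding J_def
    proof (rule integral_dominated_convergence[where w = ?w])
      show "AE t in lebesgue. (\<lambda>i. I01 t * (\<eta> (?s (i + n) t) * Gw (i + n) t))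
          \<longlonglongrightarrow> I01 t * (\<eta> t * (AVG x. w' x * g t x))"
        using good_AE by eventually_elim (rule LIMSEQ_ignore_initial_segment[OF lim])
      have m: "(\<lambda>t. I01 t * (\<eta> (?s i t) * Gw i t)) \<in> borel_measurable lebesgue" for i
        by (unfold Gw_def, intro borel_measurable_times I01_measurable me' average_G_measurable)
      show "(\<lambda>t. I01 t * (\<eta> t * (AVG x. w' x * g t x))) \<in> borel_measurable lebesgue"
        by (rule borel_measurable_lebesgue_AE_limit[OF m eventually_mono[OF good_AE lim]])
      show "(\<lambda>t. I01 t * (\<eta> (?s (i + n) t) * Gw (i + n) t)) \<in> borel_measurable lebesgue" for i
        by (rule m)
      show "integrable lebesgue ?w" using iind WW_integrable by (intro integrable_mult_right Bochner_Integration.integrable_add) auto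
      show "AE t in lebesgue. norm (I01 t * (\<eta> (?s (i + n) t) * Gw (i + n) t)) \<le> ?w t" for i
        using good_AE
      proof eventually_elim
        case (elim t)
        have w0: "0 \<le> ?w t" using M0 A0 B(1) WW_nonneg[OF elim] by (intro mult_nonneg_nonneg add_nonneg_nonneg) auto
            show ?case
        proof (cases "t \<in> {0<..1} \<and> a \<le> t")
          case True
          then have t: "0 < t" "t \<le> 1" "1 / real (Suc n) \<le> t" using na by auto
          have s: "?s (i + n) t < t" using step_idx[OF t(1,2) \<nu>1, of "i + n"] by auto
          have G: "\<bar>G (i + n) t x\<bar> \<le> B + WW n t" for x
            using G_tail[OF elim t(3,2), of n "i + n" x] B(2)[OF t(1,2), of x] by auto
          have "\<bar>Gw (i + n) t\<bar> \<le> A * (B + WW n t)"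
            unfolding Gw_def A_def by (intro abs_average_mult_le w continuous_G G)
          then have "\<bar>\<eta> (?s (i + n) t)\<bar> * \<bar>Gw (i + n) t\<bar> \<le> M' * (A * (B + WW n t))"
            using M'[of "?s (i + n) t"] s t M0 by (intro mult_mono) auto
          then show ?thesis using True by (simp add: abs_mult)
        next
          case False
          have "\<eta> (?s (i + n) t) = 0" if t: "t \<in> {0<..1}"
          proof -
            have "?s (i + n) t < t" using step_idx[of t "\<nu> (i + n)"] t \<nu>1 by auto
            then show ?thesis using False t by (intro \<eta>(3)) auto
          qed
          then have "I01 t * (\<eta> (?s (i + n) t) * Gw (i + n) t) = 0" by (cases "t \<in> {0<..1}") auto
          then show ?thesis using w0 by (simp only: norm_zero)
        qed
      qed
    qed
    then show ?thesis by (rule LIMSEQ_offset)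
  qed
  then have "(\<lambda>i. \<eta> 1 * Hw i 1 - J i) \<longlonglongrightarrow> ?E - ?J"
    unfolding Hw_def by (intro tendsto_diff tendsto_mult tendsto_const average_h_tendsto w) auto
  then have "I \<longlonglongrightarrow> ?E - ?J" unfolding eq[symmetric] .
  with I_lim show ?thesis by (rule LIMSEQ_unique)
qed

end

section \<open>Sobolev spaces and their duals\<close>

lemma circle_integral_average: "(\<integral>x. f x \<partial>circle) = 2 * pi * average f"
  by (simp add: average_def)

lemma continuous_Lp:
  assumes "continuous_on UNIV f" "periodic f" "0 < p"
  shows "f \<in> Lp p"
proof -
  have "continuous_on UNIV (\<lambda>x. \<bar>f x\<bar> powr p)" using assms by (intro continuous_on_abs_powr)
  then show ?thesis
    using assms circle_integrable_UNIV[OF assms(1)] circle_integrable_UNIV unfolding Lp_def by blast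
qed

lemma abs_add_powr_le:
  assumes "0 < p"
  shows "\<bar>x + y\<bar> powr p \<le> 2 powr p * (\<bar>x\<bar> powr p + \<bar>y :: real\<bar> powr p)"
proof -
  have "\<bar>x + y\<bar> powr p \<le> (2 * max \<bar>x\<bar> \<bar>y\<bar>) powr p" using assms by (intro powr_mono2) auto
  also have "... = 2 powr p * max \<bar>x\<bar> \<bar>y\<bar> powr p" by (rule powr_mult)
  also have "... \<le> 2 powr p * (\<bar>x\<bar> powr p + \<bar>y\<bar> powr p)"
    by (intro mult_left_mono) (auto simp: max_def)
  finally show ?thesis .
qed

lemma average_powr_mono:
  assumes "continuous_on UNIV f" "0 < p" "\<And>x. \<bar>f x\<bar> \<le> C"
  shows "pavg p f \<le> C powr p"
proof (rule average_le_const)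
  show "integrable circle (\<lambda>x. \<bar>f x\<bar> powr p)"
    using assms by (intro circle_integrable_UNIV continuous_on_abs_powr)
  show "\<bar>f x\<bar> powr p \<le> C powr p" for x using assms by (intro powr_mono2) auto
qed

section \<open>Classically differentiable functions as elements of Sobolev spaces\<close>

locale classical =
  fixes d :: "nat \<Rightarrow> real \<Rightarrow> real" and k :: nat
  assumes deriv_d: "\<And>n x. n < k \<Longrightarrow> (d n has_real_derivative d (Suc n) x) (at x)"
    and cont: "\<And>n. n \<le> k \<Longrightarrow> continuous_on UNIV (d n)" and per: "\<And>n. n \<le> k \<Longrightarrow> periodic (d n)"
begin

lemma weak: "j \<le> k \<Longrightarrow> is_weak_deriv j (d 0) (d j)"
proof -
  have "is_weak_deriv j (d n) (d (n + j))" if "n + j \<le> k" for n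
    using that
  proof (induction j arbitrary: n)
    case 0
    then show ?case by (simp add: is_weak_deriv_0)
  next
    case (Suc j)
    have "is_weak_deriv j (d (Suc n)) (d (Suc n + j))" by (rule Suc.IH) (use Suc.prems in simp)
    then show ?case
      using is_weak_deriv_Suc[of "d n" "d (Suc n)" j "d (Suc n + j)"] deriv_d[of n] cont[of "Suc n"] per[of n] Suc.prems
      by simp
  qed
  from this[of 0] show "j \<le> k \<Longrightarrow> is_weak_deriv j (d 0) (d j)" by simp
qed

lemma in_Lp: "j \<le> k \<Longrightarrow> 0 < p \<Longrightarrow> d j \<in> Lp p"
  by (intro continuous_Lp cont per)

lemma in_Sobolev: "0 < p \<Longrightarrow> d 0 \<in> Sobolev k p"
  unfolding Sobolev_def using in_Lp weak by blast

lemma norm_eq: "Sobolev_norm k p (d 0) = (\<Sum>j\<le>k. pint p (d j)) powr (1 / p)"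
  by (rule Sobolev_norm_eq) (auto intro: in_Lp weak)

lemma weak_deriv_eq: "j \<le> k \<Longrightarrow> AE x in circle. weak_deriv j (d 0) x = d j x"
  by (rule weak_deriv_AE(3)[OF weak in_Lp]) auto

lemma norm_le:
  assumes p: "0 < p" and e: "\<And>j x. j \<le> k \<Longrightarrow> \<bar>d j x\<bar> \<le> e"
  shows "Sobolev_norm k p (d 0) \<le> (real (Suc k) * (2 * pi)) powr (1 / p) * e"
proof -
  have e0: "0 \<le> e" using e[of 0 0] by simp
  have i: "pint p (d j) \<le> 2 * pi * e powr p" if j: "j \<le> k" for j
    unfolding circle_integral_average using cont[OF j] p e[OF j] by (intro mult_left_mono average_powr_mono) auto
  have "(\<Sum>j\<le>k. pint p (d j)) \<le> (\<Sum>j\<le>k. 2 * pi * e powr p)"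
    by (rule sum_mono) (use i in auto)
  then have "Sobolev_norm k p (d 0) \<le> (\<Sum>j\<le>k. 2 * pi * e powr p) powr (1 / p)"
    unfolding norm_eq using p by (intro powr_mono2 sum_nonneg) auto
  also have "(\<Sum>j\<le>k. 2 * pi * e powr p) = (real (Suc k) * (2 * pi)) * e powr p" by simp
  also have "... powr (1 / p) = (real (Suc k) * (2 * pi)) powr (1 / p) * (e powr p) powr (1 / p)"
    by (rule powr_mult)
  also have "(e powr p) powr (1 / p) = e" using e0 p by (simp add: powr_powr)
  finally show ?thesis .
qed

end

lemma classical_diff:
  assumes "classical d k" "classical d' k"
  shows "classical (\<lambda>n x. d n x - d' n x) k"
proof -
  interpret A: classical d k by fact
  interpret B: classical d' k by fact
  show ?thesis
    using A.per B.per by unfold_locales (auto intro!: DERIV_diff A.deriv_d B.deriv_d continuous_on_diff A.cont B.cont simp: periodic_def)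
qed

lemma classical_trig: "classical (\<lambda>n. trig N ((dcoef ^^ n) c)) k"
proof
  show "((\<lambda>x. trig N ((dcoef ^^ n) c) x) has_real_derivative trig N ((dcoef ^^ Suc n) c) x) (at x)" for n x
    using trig_deriv[of N "(dcoef ^^ n) c"] by simp
qed (auto intro: periodic_trig continuous_on_trig[OF continuous_on_id])

lemma Sobolev_norm_tendsto_0:
  assumes d: "\<And>i. classical (d i) k" "classical d' k" and p: "0 < p"
    and u: "\<And>j. j \<le> k \<Longrightarrow> uniform_limit UNIV (\<lambda>i. d i j) (d' j) sequentially"
  shows "(\<lambda>i. Sobolev_norm k p (\<lambda>x. d' 0 x - d i 0 x)) \<longlonglongrightarrow> 0"
  unfolding LIMSEQ_def
proof (intro allI impI)
  fix e :: real assume e: "0 < e"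
  define K where "K = (real (Suc k) * (2 * pi)) powr (1 / p)"
  have K: "0 < K" by (simp add: K_def)
  define \<eta> where "\<eta> = e / (2 * K)"
  have \<eta>: "0 < \<eta>" using e K by (simp add: \<eta>_def)
  have "\<exists>i0. \<forall>i\<ge>i0. \<forall>x. \<bar>d i j x - d' j x\<bar> \<le> \<eta>" if "j \<le> k" for j
    using u[OF that] \<eta> unfolding uniform_limit_real_iff by (meson UNIV_I)
  then obtain I where I: "\<And>i j x. j \<le> k \<Longrightarrow> I j \<le> i \<Longrightarrow> \<bar>d i j x - d' j x\<bar> \<le> \<eta>" by metis
  have "dist (Sobolev_norm k p (\<lambda>x. d' 0 x - d i 0 x)) 0 < e" if i: "(\<Sum>j\<le>k. I j) \<le> i" for i
  proof -
    interpret A: classical "\<lambda>n x. d' n x - d i n x" k by (rule classical_diff[OF d(2,1)])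
    have "Sobolev_norm k p (\<lambda>x. d' 0 x - d i 0 x) \<le> K * \<eta>"
      unfolding K_def
    proof (rule A.norm_le[OF p])
      fix j x assume j: "j \<le> k"
      have "I j \<le> (\<Sum>j\<le>k. I j)" using j by (intro member_le_sum) auto
      then show "\<bar>d' j x - d i j x\<bar> \<le> \<eta>" using I[OF j, of i x] i by (simp add: abs_minus_commute)
    qed
    moreover have "K * \<eta> < e" using K e by (simp add: \<eta>_def)
    moreover have "0 \<le> Sobolev_norm k p (\<lambda>x. d' 0 x - d i 0 x)" by (simp add: Sobolev_norm_def)
    ultimately show ?thesis by simp
  qed
  then show "\<exists>no. \<forall>i\<ge>no. dist (Sobolev_norm k p (\<lambda>x. d' 0 x - d i 0 x)) 0 < e" by blast
qed

text \<open>Jensen's inequality up to the factor 2, from \<open>le_powr_split\<close> with l equal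
  to the power mean itself.\<close>

lemma average_abs_le_powr_average:
  assumes y: "integrable circle y" "integrable circle (\<lambda>x. \<bar>y x\<bar> powr (\<alpha> + 1))" and \<alpha>: "0 < \<alpha>"
  shows "(AVG x. \<bar>y x\<bar>) \<le> 2 * pavg (\<alpha> + 1) y powr (1 / (\<alpha> + 1))"
proof -
  define A where "A = pavg (\<alpha> + 1) y"
  have A0: "0 \<le> A" unfolding A_def by (intro average_nonneg) auto
  have *: "(AVG x. \<bar>y x\<bar>) \<le> l + l powr (- \<alpha>) * A" if l: "0 < l" for l
  proof -
    have "(AVG x. \<bar>y x\<bar>) \<le> (AVG x. l + l powr (- \<alpha>) * \<bar>y x\<bar> powr (\<alpha> + 1))"
      using y l \<alpha> by (intro average_mono le_powr_split) auto
    also have "... = l + l powr (- \<alpha>) * A"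
      using y by (simp add: average_add average_cmult average_const A_def)
    finally show ?thesis .
  qed
  show ?thesis
  proof (cases "A = 0")
    case True
    have "(AVG x. \<bar>y x\<bar>) \<le> 0" by (rule field_le_epsilon) (use * True in auto)
    then show ?thesis using A0 by (auto simp: A_def[symmetric] intro: order_trans)
  next
    case False
    then have A: "0 < A" using A0 by simp
    have "(A powr (1 / (\<alpha> + 1))) powr (- \<alpha>) * A = A powr (- \<alpha> / (\<alpha> + 1)) * A powr 1"
      using A by (simp add: powr_powr)
    also have "... = A powr (- \<alpha> / (\<alpha> + 1) + 1)" by (rule powr_add[symmetric])
    also have "- \<alpha> / (\<alpha> + 1) + 1 = 1 / (\<alpha> + 1)" using \<alpha> by (simp add: field_simps)
    finally show ?thesis using *[of "A powr (1 / (\<alpha> + 1))"] A unfolding A_def[symmetric] by simp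
  qed
qed

text \<open>Young's inequality with a free weight and without sharp constants: the case distinction
  decides which term alone dominates the product.\<close>

lemma mult_le_powr_split:
  fixes x y c \<alpha> :: real
  assumes "0 \<le> x" "0 \<le> y" "0 < c" "0 < \<alpha>"
  shows "x * y \<le> c * x powr (1 / \<alpha> + 1) + c powr (- \<alpha>) * y powr (\<alpha> + 1)"
proof (cases "y \<le> c * x powr (1 / \<alpha>)")
  case True
  then have "x * y \<le> x * (c * x powr (1 / \<alpha>))" using assms by (intro mult_left_mono)
  also have "... = c * x powr (1 / \<alpha> + 1)" using assms by (cases "x = 0") (auto simp: powr_add)
  finally show ?thesis using assms by (simp add: add_increasing2)
next
  case False
  then have "x powr (1 / \<alpha>) \<le> y / c" using assms by (simp add: field_simps)
  then have "(x powr (1 / \<alpha>)) powr \<alpha> \<le> (y / c) powr \<alpha>" using assms by (intro powr_mono2) auto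
  then have "x \<le> c powr (- \<alpha>) * y powr \<alpha>"
    using assms by (simp add: powr_powr powr_divide powr_minus field_simps)
  then have "x * y \<le> c powr (- \<alpha>) * y powr \<alpha> * y" using assms by (intro mult_right_mono)
  also have "... = c powr (- \<alpha>) * y powr (\<alpha> + 1)" using assms by (cases "y = 0") (auto simp: powr_add)
  finally show ?thesis using assms by (simp add: add_increasing)
qed

lemma weak_deriv_integrable:
  assumes "w \<in> Sobolev k p" "1 \<le> p" "j \<le> k"
  shows "integrable circle (weak_deriv j w)" "integrable circle (\<lambda>x. \<bar>weak_deriv j w x\<bar> powr p)"
proof -
  have L: "weak_deriv j w \<in> Lp p" by (rule Sobolev_weak_deriv(1)[OF assms])
  show "integrable circle (weak_deriv j w)" by (rule Lp_integrable[OF L assms(2)])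
  show "integrable circle (\<lambda>x. \<bar>weak_deriv j w x\<bar> powr p)" using L unfolding Lp_def by blast
qed

lemma Sobolev_integrable: "w \<in> Sobolev k p \<Longrightarrow> 1 \<le> p \<Longrightarrow> integrable circle w"
  unfolding Sobolev_def by (rule Lp_integrable) blast

lemma Lp_add:
  assumes f: "f \<in> Lp p" and g: "g \<in> Lp p" and p: "0 < p"
  shows "(\<lambda>x. f x + g x) \<in> Lp p"
proof -
  have fg: "periodic f" "periodic g" "f \<in> borel_measurable circle" "g \<in> borel_measurable circle"
    "integrable circle (\<lambda>x. \<bar>f x\<bar> powr p)" "integrable circle (\<lambda>x. \<bar>g x\<bar> powr p)"
    using f g unfolding Lp_def by blast+
  have m: "(\<lambda>x. \<bar>f x + g x\<bar> powr p) \<in> borel_measurable circle" using fg(3,4) by measurable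
  have "integrable circle (\<lambda>x. \<bar>f x + g x\<bar> powr p)"
  proof (rule Bochner_Integration.integrable_bound[OF _ m])
    show "integrable circle (\<lambda>x. 2 powr p * (\<bar>f x\<bar> powr p + \<bar>g x\<bar> powr p))" using fg(5,6) by simp
    show "AE x in circle. norm (\<bar>f x + g x\<bar> powr p) \<le> norm (2 powr p * (\<bar>f x\<bar> powr p + \<bar>g x\<bar> powr p))"
      using abs_add_powr_le[OF p] by (intro AE_I2) simp
  qed
  moreover have "(\<lambda>x. f x + g x) \<in> borel_measurable circle" using fg(3,4) by measurable
  moreover have "periodic (\<lambda>x. f x + g x)" using fg(1,2) by (simp add: periodic_def)
  ultimately show ?thesis unfolding Lp_def by blast
qed

lemma Lp_cmult:
  assumes f: "f \<in> Lp p"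
  shows "(\<lambda>x. a * f x) \<in> Lp p"
proof -
  have "(\<lambda>x. \<bar>a * f x\<bar> powr p) = (\<lambda>x. \<bar>a\<bar> powr p * \<bar>f x\<bar> powr p)" by (simp add: abs_mult powr_mult)
  then show ?thesis using f by (auto simp: Lp_def periodic_def)
qed

lemma Sobolev_add:
  assumes f: "f \<in> Sobolev k p" and g: "g \<in> Sobolev k p" and p: "1 \<le> p"
  shows "(\<lambda>x. f x + g x) \<in> Sobolev k p"
proof -
  have "\<exists>h\<in>Lp p. is_weak_deriv j (\<lambda>x. f x + g x) h" if j: "j \<le> k" for j
  proof
    show "is_weak_deriv j (\<lambda>x. f x + g x) (\<lambda>x. weak_deriv j f x + weak_deriv j g x)"
      by (intro is_weak_deriv_add Sobolev_weak_deriv(2)[OF f p j] Sobolev_weak_deriv(2)[OF g p j]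
          Sobolev_integrable[OF f p] Sobolev_integrable[OF g p] weak_deriv_integrable(1)[OF f p j] weak_deriv_integrable(1)[OF g p j])
    show "(\<lambda>x. weak_deriv j f x + weak_deriv j g x) \<in> Lp p"
      using p by (intro Lp_add Sobolev_weak_deriv(1)[OF f p j] Sobolev_weak_deriv(1)[OF g p j]) auto
  qed
  moreover have "(\<lambda>x. f x + g x) \<in> Lp p" using f g p unfolding Sobolev_def by (intro Lp_add) auto
  ultimately show ?thesis unfolding Sobolev_def by blast
qed

lemma Sobolev_cmult:
  assumes f: "f \<in> Sobolev k p" and p: "1 \<le> p"
  shows "(\<lambda>x. a * f x) \<in> Sobolev k p"
proof -
  have "\<exists>h\<in>Lp p. is_weak_deriv j (\<lambda>x. a * f x) h" if j: "j \<le> k" for j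
    using is_weak_deriv_cmult[OF Sobolev_weak_deriv(2)[OF f p j]] Lp_cmult[OF Sobolev_weak_deriv(1)[OF f p j]] by blast
  moreover have "(\<lambda>x. a * f x) \<in> Lp p" using f unfolding Sobolev_def by (intro Lp_cmult) auto
  ultimately show ?thesis unfolding Sobolev_def by blast
qed

lemma integral_weak_deriv_powr_le:
  assumes w: "w \<in> Sobolev k p" "0 < p" "j \<le> k"
  shows "pint p (weak_deriv j w) \<le> Sobolev_norm k p w powr p"
proof -
  have "pint p (weak_deriv j w) \<le> (\<Sum>j\<le>k. pint p (weak_deriv j w))"
    by (rule member_le_sum[where f = "\<lambda>j. pint p (weak_deriv j w)"]) (use w in auto)
  also have "... = Sobolev_norm k p w powr p"
    using w by (simp add: Sobolev_norm_def powr_powr sum_nonneg)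
  finally show ?thesis .
qed

text \<open>The functional represented by minus the derivative of q. The time derivative of the
  solution has this form, with q the flux.\<close>

definition pairing :: "(real \<Rightarrow> real) \<Rightarrow> (real \<Rightarrow> real) \<Rightarrow> real" where
  "pairing q w = (\<integral>x. q x * weak_deriv 1 w x \<partial>circle)"

lemma integrable_pairing:
  assumes "continuous_on {0..2*pi} q" "w \<in> Sobolev 1 p" "1 \<le> p"
  shows "integrable circle (\<lambda>x. q x * weak_deriv 1 w x)"
  using integrable_mult_continuous[OF weak_deriv_integrable(1)[OF assms(2,3), of 1] assms(1)] by (simp add: mult.commute)

lemma pairing_le:
  assumes q: "continuous_on {0..2*pi} q" "\<And>x. x \<in> {0..2*pi} \<Longrightarrow> \<bar>q x\<bar> \<le> C"
    and w: "w \<in> Sobolev 1 (\<alpha> + 1)" and \<alpha>: "0 < \<alpha>"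
  shows "\<bar>pairing q w\<bar> \<le> 4 * pi * C * Sobolev_norm 1 (\<alpha> + 1) w"
proof -
  note i = weak_deriv_integrable[OF w, of 1]
  have C: "0 \<le> C" using q(2)[of 0] by force
  let ?a = "pavg (\<alpha> + 1) (weak_deriv 1 w)"
  have "\<bar>(AVG x. weak_deriv 1 w x * q x)\<bar> \<le> (AVG x. \<bar>weak_deriv 1 w x\<bar>) * C"
    using i \<alpha> q by (intro abs_average_mult_le) auto
  also have "... \<le> (2 * ?a powr (1 / (\<alpha> + 1))) * C"
    using C i \<alpha> by (intro mult_right_mono average_abs_le_powr_average) auto
  finally have 1: "\<bar>(AVG x. weak_deriv 1 w x * q x)\<bar> \<le> 2 * C * ?a powr (1 / (\<alpha> + 1))" by (simp add: mult_ac)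
  have I0: "0 \<le> pint (\<alpha> + 1) (weak_deriv 1 w)" by (intro Bochner_Integration.integral_nonneg) auto
  have "?a \<le> 1 * pint (\<alpha> + 1) (weak_deriv 1 w)"
    unfolding average_def using pi_gt3 I0 by (intro mult_right_mono) (auto simp: field_simps)
  also have "... \<le> Sobolev_norm 1 (\<alpha> + 1) w powr (\<alpha> + 1)"
    using integral_weak_deriv_powr_le[OF w, of 1] \<alpha> by simp
  finally have "?a powr (1 / (\<alpha> + 1)) \<le> (Sobolev_norm 1 (\<alpha> + 1) w powr (\<alpha> + 1)) powr (1 / (\<alpha> + 1))"
    using \<alpha> by (intro powr_mono2 average_nonneg) auto
  also have "... = Sobolev_norm 1 (\<alpha> + 1) w"
    using \<alpha> by (simp add: powr_powr Sobolev_norm_def)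
  finally have "2 * C * ?a powr (1 / (\<alpha> + 1)) \<le> 2 * C * Sobolev_norm 1 (\<alpha> + 1) w" using C by (intro mult_left_mono) auto
  with 1 have "\<bar>(AVG x. weak_deriv 1 w x * q x)\<bar> \<le> 2 * C * Sobolev_norm 1 (\<alpha> + 1) w" by linarith
  then have "2 * pi * \<bar>(AVG x. weak_deriv 1 w x * q x)\<bar> \<le> 2 * pi * (2 * C * Sobolev_norm 1 (\<alpha> + 1) w)"
    by (intro mult_left_mono) auto
  then show ?thesis
    unfolding pairing_def circle_integral_average by (simp add: abs_mult mult_ac)
qed

text \<open>Hoelder's inequality up to constants, from \<open>mult_le_powr_split\<close> with weight
  e. Adding 1 to the integral keeps the base of e positive when q vanishes.\<close>

lemma pairing_le_powr:
  assumes q: "continuous_on {0..2*pi} q"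
    and w: "w \<in> Sobolev 1 (\<alpha> + 1)" "Sobolev_norm 1 (\<alpha> + 1) w \<le> 1" and \<alpha>: "0 < \<alpha>"
  shows "\<bar>pairing q w\<bar> \<le> 2 * (pint (1 / \<alpha> + 1) q + 1) powr (\<alpha> / (\<alpha> + 1))"
proof -
  define K where "K = pint (1 / \<alpha> + 1) q + 1"
  have K: "1 \<le> K" unfolding K_def by simp
  define e where "e = K powr (- 1 / (\<alpha> + 1))"
  have e: "0 < e" using K by (simp add: e_def)
  note i = weak_deriv_integrable[OF w(1), of 1]
  have iq: "integrable circle (\<lambda>x. \<bar>q x\<bar> powr (1 / \<alpha> + 1))"
    using \<alpha> by (intro circle_integrable continuous_on_abs_powr q) (simp add: add_pos_pos)
  have iqw: "integrable circle (\<lambda>x. q x * weak_deriv 1 w x)"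
    using \<alpha> by (intro integrable_pairing[OF q w(1)]) simp
  have "\<bar>pairing q w\<bar> \<le> (\<integral>x. \<bar>q x * weak_deriv 1 w x\<bar> \<partial>circle)"
    unfolding pairing_def using integral_norm_bound[of circle "\<lambda>x. q x * weak_deriv 1 w x"] by simp
  also have "... \<le> (\<integral>x. e * \<bar>q x\<bar> powr (1 / \<alpha> + 1) + e powr (- \<alpha>) * \<bar>weak_deriv 1 w x\<bar> powr (\<alpha> + 1) \<partial>circle)"
  proof (rule integral_mono)
    show "integrable circle (\<lambda>x. e * \<bar>q x\<bar> powr (1 / \<alpha> + 1) + e powr (- \<alpha>) * \<bar>weak_deriv 1 w x\<bar> powr (\<alpha> + 1))"
      using iq i \<alpha> by (intro Bochner_Integration.integrable_add integrable_mult_right) auto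
    show "\<bar>q x * weak_deriv 1 w x\<bar> \<le> e * \<bar>q x\<bar> powr (1 / \<alpha> + 1) + e powr (- \<alpha>) * \<bar>weak_deriv 1 w x\<bar> powr (\<alpha> + 1)" for x
      unfolding abs_mult using e \<alpha> by (intro mult_le_powr_split) auto
  qed (use iqw in auto)
  also have "... = e * pint (1 / \<alpha> + 1) q + e powr (- \<alpha>) * pint (\<alpha> + 1) (weak_deriv 1 w)"
    using iq i \<alpha> by simp
  also have "... \<le> e * K + e powr (- \<alpha>) * 1"
  proof (intro add_mono mult_left_mono)
    have "pint (\<alpha> + 1) (weak_deriv 1 w) \<le> Sobolev_norm 1 (\<alpha> + 1) w powr (\<alpha> + 1)"
      using integral_weak_deriv_powr_le[OF w(1), of 1] \<alpha> by simp
    also have "... \<le> 1 powr (\<alpha> + 1)" using w(2) \<alpha> by (intro powr_mono2) (auto simp: Sobolev_norm_def)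
    finally show "pint (\<alpha> + 1) (weak_deriv 1 w) \<le> 1" by simp
  qed (use e in \<open>auto simp: K_def\<close>)
  also have "e * K = K powr (\<alpha> / (\<alpha> + 1))"
  proof -
    have "e * K = K powr (- 1 / (\<alpha> + 1)) * K powr 1" using K by (simp add: e_def)
    also have "... = K powr (- 1 / (\<alpha> + 1) + 1)" by (rule powr_add[symmetric])
    also have "- 1 / (\<alpha> + 1) + 1 = \<alpha> / (\<alpha> + 1)" using \<alpha> by (simp add: field_simps)
    finally show ?thesis .
  qed
  also have "e powr (- \<alpha>) * 1 = K powr (\<alpha> / (\<alpha> + 1))" by (simp add: e_def powr_powr)
  finally show ?thesis by (simp add: K_def)
qed

lemma weak_deriv_add_AE:
  assumes f: "f \<in> Sobolev k p" and g: "g \<in> Sobolev k p" and p: "1 \<le> p" and j: "j \<le> k"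
  shows "AE x in circle. weak_deriv j (\<lambda>x. f x + g x) x = weak_deriv j f x + weak_deriv j g x"
proof (rule weak_deriv_AE(3))
  show "is_weak_deriv j (\<lambda>x. f x + g x) (\<lambda>x. weak_deriv j f x + weak_deriv j g x)"
    by (intro is_weak_deriv_add Sobolev_weak_deriv(2)[OF f p j] Sobolev_weak_deriv(2)[OF g p j]
        Sobolev_integrable[OF f p] Sobolev_integrable[OF g p] weak_deriv_integrable(1)[OF f p j] weak_deriv_integrable(1)[OF g p j])
  show "(\<lambda>x. weak_deriv j f x + weak_deriv j g x) \<in> Lp 1"
    by (intro Lp_subset_Lp_1[OF p] Lp_add Sobolev_weak_deriv(1)[OF f p j] Sobolev_weak_deriv(1)[OF g p j]) (use p in simp)
qed

lemma weak_deriv_cmult_AE: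
  assumes f: "f \<in> Sobolev k p" and p: "1 \<le> p" and j: "j \<le> k"
  shows "AE x in circle. weak_deriv j (\<lambda>x. a * f x) x = a * weak_deriv j f x"
  by (rule weak_deriv_AE(3)[OF is_weak_deriv_cmult[OF Sobolev_weak_deriv(2)[OF f p j]]])
     (rule Lp_subset_Lp_1[OF p Lp_cmult[OF Sobolev_weak_deriv(1)[OF f p j]]])

lemma pairing_dual:
  assumes q: "continuous_on {0..2*pi} q" and \<alpha>: "0 < \<alpha>" and l: "\<And>w. w \<in> Sobolev 1 (\<alpha> + 1) \<Longrightarrow> l w = pairing q w"
  shows "l \<in> Sobolev_dual 1 (\<alpha> + 1)"
  unfolding Sobolev_dual_def mem_Collect_eq
proof (intro conjI ballI allI)
  have p: "1 \<le> \<alpha> + 1" using \<alpha> by simp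
  have iqw: "integrable circle (\<lambda>x. q x * weak_deriv 1 w x)" if "w \<in> Sobolev 1 (\<alpha> + 1)" for w
    by (rule integrable_pairing[OF q that p])
  note S = Sobolev_add[OF _ _ p, of _ 1] and Sc = Sobolev_cmult[OF _ p, of _ 1]
  show "l (\<lambda>x. f x + g x) = l f + l g" if fg: "f \<in> Sobolev 1 (\<alpha> + 1)" "g \<in> Sobolev 1 (\<alpha> + 1)" for f g
  proof -
    have "pairing q (\<lambda>x. f x + g x) = (\<integral>x. q x * weak_deriv 1 f x + q x * weak_deriv 1 g x \<partial>circle)"
      unfolding pairing_def
    proof (rule integral_cong_AE)
      show "AE x in circle. q x * weak_deriv 1 (\<lambda>x. f x + g x) x = q x * weak_deriv 1 f x + q x * weak_deriv 1 g x"
        using weak_deriv_add_AE[OF fg p order_refl] by eventually_elim (simp add: distrib_left)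
    qed (use iqw fg S[OF fg] in \<open>auto intro: borel_measurable_integrable\<close>)
    also have "... = pairing q f + pairing q g" unfolding pairing_def using iqw fg by simp
    finally show ?thesis using l fg S[OF fg] by simp
  qed
  show "l (\<lambda>x. a * f x) = a * l f" if f: "f \<in> Sobolev 1 (\<alpha> + 1)" for f a
  proof -
    have "pairing q (\<lambda>x. a * f x) = (\<integral>x. a * (q x * weak_deriv 1 f x) \<partial>circle)"
      unfolding pairing_def
    proof (rule integral_cong_AE)
      show "AE x in circle. q x * weak_deriv 1 (\<lambda>x. a * f x) x = a * (q x * weak_deriv 1 f x)"
        using weak_deriv_cmult_AE[OF f p order_refl, of a] by eventually_elim simp
    qed (use iqw f Sc[OF f] in \<open>auto intro: borel_measurable_integrable\<close>)
    also have "... = a * pairing q f" unfolding pairing_def by simp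
    finally show ?thesis using l f Sc[OF f] by simp
  qed
  have "bounded (q ` {0..2*pi})" by (intro compact_imp_bounded compact_continuous_image q) auto
  then obtain C where C: "\<forall>x\<in>{0..2*pi}. \<bar>q x\<bar> \<le> C" unfolding bounded_iff by auto
  then show "\<exists>C. \<forall>f\<in>Sobolev 1 (\<alpha> + 1). \<bar>l f\<bar> \<le> C * Sobolev_norm 1 (\<alpha> + 1) f"
    using pairing_le[OF q _ _ \<alpha>, of C] l by (intro exI[of _ "4 * pi * C"]) auto
qed

lemma classical_zero: "classical (\<lambda>_ _. 0) k"
  by unfold_locales (auto simp: periodic_def)

lemma dual_norm_le:
  assumes "\<And>w. w \<in> Sobolev 1 p \<Longrightarrow> Sobolev_norm 1 p w \<le> 1 \<Longrightarrow> \<bar>l w\<bar> \<le> C" and p: "0 < p"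
  shows "Sobolev_dual_norm 1 p l \<le> C"
  unfolding Sobolev_dual_norm_def
proof (rule cSUP_least)
  interpret classical "\<lambda>_ _. 0" 1 by (rule classical_zero)
  have "Sobolev_norm 1 p (\<lambda>_. 0) = 0" using norm_eq[of p] p by simp
  then show "{f \<in> Sobolev 1 p. Sobolev_norm 1 p f \<le> 1} \<noteq> {}" using in_Sobolev[OF p] by force
qed (use assms in auto)

text \<open>The dual norm is a supremum of reals and needs an upper bound to be meaningful; C
  provides it.\<close>

lemma dual_norm_ge:
  assumes "w \<in> Sobolev 1 p" "Sobolev_norm 1 p w \<le> 1"
    and "\<And>w. w \<in> Sobolev 1 p \<Longrightarrow> Sobolev_norm 1 p w \<le> 1 \<Longrightarrow> \<bar>l w\<bar> \<le> C"
  shows "\<bar>l w\<bar> \<le> Sobolev_dual_norm 1 p l"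
  unfolding Sobolev_dual_norm_def by (rule cSUP_upper2[of _ _ w]) (use assms in \<open>auto intro!: bdd_aboveI[of _ C]\<close>)

lemma pairing_diff:
  assumes q: "continuous_on {0..2*pi} q" "continuous_on {0..2*pi} q'" and w: "w \<in> Sobolev 1 p" and p: "1 \<le> p"
  shows "pairing q w - pairing q' w = pairing (\<lambda>x. q x - q' x) w"
proof -
  show ?thesis unfolding pairing_def left_diff_distrib using integrable_pairing[OF _ w p] q by simp
qed

lemma pairing_bounded:
  assumes q: "continuous_on {0..2*pi} q" and \<alpha>: "0 < \<alpha>"
  obtains C where "\<And>w. w \<in> Sobolev 1 (\<alpha> + 1) \<Longrightarrow> Sobolev_norm 1 (\<alpha> + 1) w \<le> 1 \<Longrightarrow> \<bar>pairing q w\<bar> \<le> C"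
  using pairing_le_powr[OF q _ _ \<alpha>] by blast

lemma dual_norm_pairing_diff:
  assumes q: "continuous_on {0..2*pi} q" "continuous_on {0..2*pi} q'" and \<alpha>: "0 < \<alpha>"
    and l: "\<And>w. w \<in> Sobolev 1 (\<alpha> + 1) \<Longrightarrow> l w = pairing q w" "\<And>w. w \<in> Sobolev 1 (\<alpha> + 1) \<Longrightarrow> l' w = pairing q' w"
    and e: "\<And>x. x \<in> {0..2*pi} \<Longrightarrow> \<bar>q x - q' x\<bar> \<le> e"
  shows "Sobolev_dual_norm 1 (\<alpha> + 1) (\<lambda>w. l w - l' w) \<le> 4 * pi * e"
    "\<bar>Sobolev_dual_norm 1 (\<alpha> + 1) l - Sobolev_dual_norm 1 (\<alpha> + 1) l'\<bar> \<le> 4 * pi * e"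
    "0 \<le> Sobolev_dual_norm 1 (\<alpha> + 1) l"
    "0 \<le> Sobolev_dual_norm 1 (\<alpha> + 1) (\<lambda>w. l w - l' w)"
proof -
  let ?N = "Sobolev_dual_norm 1 (\<alpha> + 1)"
  have p: "0 < \<alpha> + 1" "1 \<le> \<alpha> + 1" using \<alpha> by auto
  have e0: "0 \<le> e" using e[of 0] by force
  have d: "\<bar>l w - l' w\<bar> \<le> 4 * pi * e" if w: "w \<in> Sobolev 1 (\<alpha> + 1)" "Sobolev_norm 1 (\<alpha> + 1) w \<le> 1" for w
  proof -
    have "\<bar>pairing (\<lambda>x. q x - q' x) w\<bar> \<le> 4 * pi * e * Sobolev_norm 1 (\<alpha> + 1) w"
      by (rule pairing_le[OF _ e w(1) \<alpha>]) (auto intro!: continuous_on_diff q)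
    also have "... \<le> 4 * pi * e * 1" using w e0 by (intro mult_left_mono) auto
    finally show ?thesis using pairing_diff[OF q w(1) p(2)] l w by simp
  qed
  show "?N (\<lambda>w. l w - l' w) \<le> 4 * pi * e" by (rule dual_norm_le[OF d p(1)])
  obtain C where C: "\<And>w. w \<in> Sobolev 1 (\<alpha> + 1) \<Longrightarrow> Sobolev_norm 1 (\<alpha> + 1) w \<le> 1 \<Longrightarrow> \<bar>l w\<bar> \<le> C"
    using pairing_bounded[OF q(1) \<alpha>] l by metis
  obtain C' where C': "\<And>w. w \<in> Sobolev 1 (\<alpha> + 1) \<Longrightarrow> Sobolev_norm 1 (\<alpha> + 1) w \<le> 1 \<Longrightarrow> \<bar>l' w\<bar> \<le> C'"
    using pairing_bounded[OF q(2) \<alpha>] l by metis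
  have "?N l \<le> ?N l' + 4 * pi * e"
  proof (rule dual_norm_le[OF _ p(1)])
    fix w assume w: "w \<in> Sobolev 1 (\<alpha> + 1)" "Sobolev_norm 1 (\<alpha> + 1) w \<le> 1"
    have "\<bar>l' w\<bar> \<le> ?N l'" by (rule dual_norm_ge[OF w C'])
    then show "\<bar>l w\<bar> \<le> ?N l' + 4 * pi * e" using d[OF w] by linarith
  qed
  moreover have "?N l' \<le> ?N l + 4 * pi * e"
  proof (rule dual_norm_le[OF _ p(1)])
    fix w assume w: "w \<in> Sobolev 1 (\<alpha> + 1)" "Sobolev_norm 1 (\<alpha> + 1) w \<le> 1"
    have "\<bar>l w\<bar> \<le> ?N l" by (rule dual_norm_ge[OF w C])
    then show "\<bar>l' w\<bar> \<le> ?N l + 4 * pi * e" using d[OF w] by linarith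
  qed
  ultimately show "\<bar>?N l - ?N l'\<bar> \<le> 4 * pi * e" by linarith
  interpret classical "\<lambda>_ _. 0" 1 by (rule classical_zero)
  have z: "(\<lambda>_. 0) \<in> Sobolev 1 (\<alpha> + 1)" "Sobolev_norm 1 (\<alpha> + 1) (\<lambda>_. 0) \<le> 1"
    using in_Sobolev[OF p(1)] norm_eq[of "\<alpha> + 1"] p by auto
  show "0 \<le> ?N l" using dual_norm_ge[where l = l, OF z C] by linarith
  show "0 \<le> ?N (\<lambda>w. l w - l' w)" using dual_norm_ge[where l = "\<lambda>w. l w - l' w", OF z d] by linarith
qed

section \<open>Bochner integrability\<close>

lemma borel_measurable_AE_limit_on:
  fixes F :: "nat \<Rightarrow> real \<Rightarrow> real"
  assumes I: "I \<in> sets lebesgue" and F: "\<And>i. F i \<in> borel_measurable (lebesgue_on I)"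
    and lim: "AE t in lebesgue_on I. (\<lambda>i. F i t) \<longlonglongrightarrow> f t"
  shows "f \<in> borel_measurable (lebesgue_on I)"
proof -
  have "(\<lambda>t. if t \<in> I then f t else 0) \<in> borel_measurable lebesgue"
  proof (rule borel_measurable_lebesgue_AE_limit)
    show "(\<lambda>t. if t \<in> I then F i t else 0) \<in> borel_measurable lebesgue" for i
      using F[of i] borel_measurable_if[OF I] by blast
    have "AE t in lebesgue. t \<in> I \<longrightarrow> (\<lambda>i. F i t) \<longlonglongrightarrow> f t"
      using lim I by (simp add: AE_restrict_space_iff)
    then show "AE t in lebesgue. (\<lambda>i. if t \<in> I then F i t else 0) \<longlonglongrightarrow> (if t \<in> I then f t else 0)"
      by eventually_elim auto
  qed
  then show ?thesis using borel_measurable_if[OF I] by blast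
qed

lemma simple_function_step:
  assumes I: "I \<in> sets lebesgue" "I \<subseteq> {0<..}" and N: "1 \<le> N"
  shows "simple_function (lebesgue_on I) (\<lambda>t. if t \<le> 1 then F (step_idx N t) else z)"
  unfolding simple_function_def
proof
  let ?f = "\<lambda>t. if t \<le> 1 then F (step_idx N t) else z"
  have "?f ` I \<subseteq> insert z (F ` {..<N})" using I N step_idx(1)[of _ N] by force
  then show "finite (?f ` space (lebesgue_on I))" by (auto intro: finite_subset)
  show "\<forall>y\<in>?f ` space (lebesgue_on I). ?f -` {y} \<inter> space (lebesgue_on I) \<in> sets (lebesgue_on I)"
  proof
    fix y
    have 1: "step_idx N -` {n. F n = y} \<in> sets lebesgue"
      using measurable_sets[OF measurable_step_idx[of N], of "{n. F n = y}"] by simp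
    have eq: "?f -` {y} \<inter> I = (I \<inter> {..1} \<inter> step_idx N -` {n. F n = y}) \<union> (if y = z then I \<inter> {1<..} else {})"
      by (auto split: if_splits)
    have "?f -` {y} \<inter> I \<in> sets lebesgue" unfolding eq using 1 I(1) by (intro sets.Un sets.Int) auto
    then show "?f -` {y} \<inter> space (lebesgue_on I) \<in> sets (lebesgue_on I)"
      using I(1) by (auto simp: sets_restrict_space_iff)
  qed
qed

lemma bochner_Lp_Sobolev:
  assumes p: "0 < p"
    and s: "\<And>n. simple_function (lebesgue_on I) (s n)" "\<And>n t. t \<in> I \<Longrightarrow> s n t = ds n t 0" "\<And>n t. t \<in> I \<Longrightarrow> classical (ds n t) k"
    and u: "AE t in lebesgue_on I. u t = d t 0 \<and> classical (d t) k \<and>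
      (\<forall>j\<le>k. uniform_limit UNIV (\<lambda>n. ds n t j) (d t j) sequentially)"
    and int: "integrable (lebesgue_on I) (\<lambda>t. Sobolev_norm k p (u t) powr p)"
  shows "u \<in> bochner_Lp p I (Sobolev k p) (Sobolev_norm k p)"
  unfolding bochner_Lp_def bochner_measurable_def mem_Collect_eq
proof (intro conjI exI[of _ s] allI ballI int s(1))
  show "s n t \<in> Sobolev k p" if "t \<in> I" for n t
    using classical.in_Sobolev[OF s(3)[OF that] p, of n] s(2)[OF that] by simp
  have I: "AE t in lebesgue_on I. t \<in> I" by (intro AE_I2) simp
  show "AE t in lebesgue_on I. u t \<in> Sobolev k p \<and> (\<lambda>n. Sobolev_norm k p (\<lambda>x. u t x - s n t x)) \<longlonglongrightarrow> 0"
    using u I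
  proof eventually_elim
    case (elim t)
    have c: "classical (d t) k" "\<And>j. j \<le> k \<Longrightarrow> uniform_limit UNIV (\<lambda>n. ds n t j) (d t j) sequentially"
      and eq: "u t = d t 0" using elim by auto
    show ?case
      using Sobolev_norm_tendsto_0[OF s(3)[OF elim(2)] c(1) p c(2)] classical.in_Sobolev[OF c(1) p]
      by (simp add: eq s(2)[OF elim(2)])
  qed
qed

text \<open>Uniform convergence of the representing functions implies convergence in the dual norm,
  and thus measurability of the norm of u as a limit of simple functions. For the size, the exponent
  (\<alpha> + 1) / \<alpha> undoes the power \<alpha> / (\<alpha> + 1) in
  \<open>pairing_le_powr\<close>.\<close>

lemma bochner_Lp_dual:
  assumes \<alpha>: "0 < \<alpha>" and I: "I \<in> sets lebesgue" "emeasure lebesgue I < \<infinity>"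
    and s: "\<And>n. simple_function (lebesgue_on I) (s n)" "\<And>n t. t \<in> I \<Longrightarrow> s n t = pairing (qs n t)"
      "\<And>n t. t \<in> I \<Longrightarrow> continuous_on UNIV (qs n t)"
    and u: "AE t in lebesgue_on I. (\<forall>w\<in>Sobolev 1 (\<alpha> + 1). u t w = pairing (q t) w) \<and> continuous_on UNIV (q t) \<and>
      uniform_limit UNIV (\<lambda>n. qs n t) (q t) sequentially"
    and int: "integrable (lebesgue_on I) (\<lambda>t. pint (1 / \<alpha> + 1) (q t))"
  shows "u \<in> bochner_Lp ((\<alpha> + 1) / \<alpha>) I (Sobolev_dual 1 (\<alpha> + 1)) (Sobolev_dual_norm 1 (\<alpha> + 1))"
  unfolding bochner_Lp_def bochner_measurable_def mem_Collect_eq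
proof (intro conjI exI[of _ s] allI ballI s(1))
  let ?N = "Sobolev_dual_norm 1 (\<alpha> + 1)"
  show "s n t \<in> Sobolev_dual 1 (\<alpha> + 1)" if "t \<in> I" for n t
    by (rule pairing_dual[OF continuous_on_subset[OF s(3)[OF that]] \<alpha>]) (simp_all add: s(2)[OF that])
  have AEI: "AE t in lebesgue_on I. t \<in> I" by (intro AE_I2) simp
  have key: "AE t in lebesgue_on I. u t \<in> Sobolev_dual 1 (\<alpha> + 1) \<and> (\<lambda>n. ?N (\<lambda>w. u t w - s n t w)) \<longlonglongrightarrow> 0 \<and>
      (\<lambda>n. ?N (s n t)) \<longlonglongrightarrow> ?N (u t) \<and> 0 \<le> ?N (u t) \<and>
      ?N (u t) \<le> 2 * (pint (1 / \<alpha> + 1) (q t) + 1) powr (\<alpha> / (\<alpha> + 1))"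
    using u AEI
  proof eventually_elim
    case (elim t)
    have c: "continuous_on {0..2*pi} (q t)" using elim(1) continuous_on_subset by blast
    have cs: "continuous_on {0..2*pi} (qs n t)" for n using continuous_on_subset[OF s(3)[OF elim(2)]] by blast
    have uw: "u t w = pairing (q t) w" if "w \<in> Sobolev 1 (\<alpha> + 1)" for w using elim(1) that by blast
    have sw: "s n t w = pairing (qs n t) w" for n w using s(2)[OF elim(2)] by simp
    let ?D = "\<lambda>n. ?N (\<lambda>w. u t w - s n t w)"
    let ?close = "\<lambda>n e. ?D n \<le> e \<and> 0 \<le> ?D n \<and> \<bar>?N (u t) - ?N (s n t)\<bar> \<le> e"
    have small: "\<exists>n0. \<forall>n\<ge>n0. ?close n e"
      if e: "0 < e" for e
    proof -
      have e': "0 < e / (4 * pi)" using e by simp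
      obtain n0 where n0: "\<forall>n\<ge>n0. \<forall>x\<in>UNIV. \<bar>qs n t x - q t x\<bar> \<le> e / (4 * pi)"
        using elim(1) e' unfolding uniform_limit_real_iff by blast
      have "?close n e" if "n0 \<le> n" for n
      proof -
        have "\<bar>q t x - qs n t x\<bar> \<le> e / (4 * pi)" for x using n0 that by (simp add: abs_minus_commute)
        then have "?D n \<le> 4 * pi * (e / (4 * pi)) \<and>
            \<bar>?N (u t) - ?N (s n t)\<bar> \<le> 4 * pi * (e / (4 * pi)) \<and> 0 \<le> ?D n"
          using uw sw by (intro conjI dual_norm_pairing_diff[OF c cs \<alpha>, where l = "u t" and l' = "s n t"]) auto
        then show ?thesis by simp
      qed
      then show ?thesis by blast
    qed
    have "(\<lambda>n. ?D n) \<longlonglongrightarrow> 0 \<and> (\<lambda>n. ?N (s n t)) \<longlonglongrightarrow> ?N (u t)"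
      unfolding LIMSEQ_def dist_real_def
    proof (intro conjI allI impI)
      fix e :: real assume e: "0 < e"
      then obtain n0 where "\<forall>n\<ge>n0. ?close n (e / 2)"
        using small[of "e / 2"] by auto
      then show "\<exists>n0. \<forall>n\<ge>n0. \<bar>?D n - 0\<bar> < e" "\<exists>n0. \<forall>n\<ge>n0. \<bar>?N (s n t) - ?N (u t)\<bar> < e"
        using e by (intro exI[of _ n0]; force simp: abs_minus_commute)+
    qed
    moreover have "?N (u t) \<le> 2 * (pint (1 / \<alpha> + 1) (q t) + 1) powr (\<alpha> / (\<alpha> + 1))"
      using \<alpha> pairing_le_powr[OF c _ _ \<alpha>] uw by (intro dual_norm_le) auto
    moreover have "0 \<le> ?N (u t)"
      using dual_norm_pairing_diff(3)[OF c c \<alpha> uw uw, of 0] by simp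
    moreover have "u t \<in> Sobolev_dual 1 (\<alpha> + 1)" by (rule pairing_dual[OF c \<alpha> uw])
    ultimately show ?case by blast
  qed
  then show "AE t in lebesgue_on I. u t \<in> Sobolev_dual 1 (\<alpha> + 1) \<and> (\<lambda>n. ?N (\<lambda>w. u t w - s n t w)) \<longlonglongrightarrow> 0"
    by eventually_elim blast
  have mN: "(\<lambda>t. ?N (u t)) \<in> borel_measurable (lebesgue_on I)"
  proof (rule borel_measurable_AE_limit_on[OF I(1)])
    show "(\<lambda>t. ?N (s n t)) \<in> borel_measurable (lebesgue_on I)" for n
      by (intro borel_measurable_simple_function simple_function_compose1[OF s(1)])
    show "AE t in lebesgue_on I. (\<lambda>n. ?N (s n t)) \<longlonglongrightarrow> ?N (u t)" using key by eventually_elim blast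
  qed
  show "integrable (lebesgue_on I) (\<lambda>t. ?N (u t) powr ((\<alpha> + 1) / \<alpha>))"
  proof (rule Bochner_Integration.integrable_bound)
    have "integrable (lebesgue_on I) (\<lambda>t. 1 :: real)"
      using I by (intro finite_measure.integrable_const finite_measureI) (auto simp: emeasure_restrict_space)
    then show "integrable (lebesgue_on I) (\<lambda>t. 2 powr ((\<alpha> + 1) / \<alpha>) * (pint (1 / \<alpha> + 1) (q t) + 1))"
      using int by (intro integrable_mult_right Bochner_Integration.integrable_add) auto
    show "(\<lambda>t. ?N (u t) powr ((\<alpha> + 1) / \<alpha>)) \<in> borel_measurable (lebesgue_on I)" using mN by measurable
    show "AE t in lebesgue_on I. norm (?N (u t) powr ((\<alpha> + 1) / \<alpha>)) \<le> norm (2 powr ((\<alpha> + 1) / \<alpha>) * (pint (1 / \<alpha> + 1) (q t) + 1))"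
      using key
    proof eventually_elim
      case (elim t)
      define J where "J = pint (1 / \<alpha> + 1) (q t) + 1"
      have J: "1 \<le> J" unfolding J_def by simp
      have "?N (u t) powr ((\<alpha> + 1) / \<alpha>) \<le> (2 * J powr (\<alpha> / (\<alpha> + 1))) powr ((\<alpha> + 1) / \<alpha>)"
        using elim \<alpha> unfolding J_def[symmetric] by (intro powr_mono2) auto
      also have "... = 2 powr ((\<alpha> + 1) / \<alpha>) * (J powr (\<alpha> / (\<alpha> + 1))) powr ((\<alpha> + 1) / \<alpha>)" by (rule powr_mult)
      also have "(J powr (\<alpha> / (\<alpha> + 1))) powr ((\<alpha> + 1) / \<alpha>) = J" using J \<alpha> by (simp add: powr_powr)
      finally show ?case using J unfolding J_def[symmetric] by simp
    qed
  qed
qed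

section \<open>Integrability in time of the third derivative\<close>

context flow_conv begin

text \<open>The energy bounds all modes except 1 and -1, for which \<open>cc_bounded\<close> is
  used. Unlike bounds through the cubic decay, this one does not deteriorate at t = 0.\<close>

lemma h1_square_bounded: "\<exists>C. \<forall>t. 0 < t \<longrightarrow> t \<le> 1 \<longrightarrow> (AVG x. (h1 t x)\<^sup>2) \<le> C"
proof -
  obtain B where B: "\<And>N t k. 1 \<le> N \<Longrightarrow> 0 < t \<Longrightarrow> t \<le> 1 \<Longrightarrow> \<bar>cc N t k\<bar> \<le> B" using cc_bounded by blast
  have "(AVG x. (h1 t x)\<^sup>2) \<le> 2 * (2 * B\<^sup>2 + 4 / 3 * Q0) + 2" if t: "0 < t" "t \<le> 1" for t
  proof -
    obtain i where i: "\<forall>x. \<bar>H1 i t x - h1 t x\<bar> \<le> 1" using H1_ulim[of 1 t] t by auto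
    let ?N = "\<nu> i" and ?c = "cc (\<nu> i) t"
    have c2: "(?c k)\<^sup>2 \<le> B\<^sup>2" for k using B[OF \<nu>1 t, of i k] abs_le_square_iff[of "?c k" B] by simp
    have "(AVG x. (H1 i t x)\<^sup>2) = (\<Sum>k\<in>modes ?N. (of_int (- k) * ?c (- k))\<^sup>2)"
      unfolding H1_def average_trig_sq dcoef_def by simp
    also have "... = (\<Sum>k\<in>modes ?N. (of_int k * ?c k)\<^sup>2)" by (rule sum_modes_uminus)
    also have "... \<le> 2 * B\<^sup>2 + 4 / 3 * qf ?N ?c" by (rule sum_modes_sq_le[OF \<nu>1 c2])
    also have "qf ?N ?c \<le> Q0" unfolding cc_def by (rule qf_c[OF \<nu>1])
    finally have 1: "(AVG x. (H1 i t x)\<^sup>2) \<le> 2 * B\<^sup>2 + 4 / 3 * Q0" by simp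
    have c: "continuous_on UNIV (h1 t)" "continuous_on UNIV (H1 i t)" by (rule continuous_h1[OF t], rule continuous_H1)
    have "(AVG x. (h1 t x)\<^sup>2) \<le> (AVG x. 2 * (H1 i t x)\<^sup>2 + 2)"
    proof (rule average_mono)
      show "(h1 t x)\<^sup>2 \<le> 2 * (H1 i t x)\<^sup>2 + 2" for x
      proof -
        have "(H1 i t x - h1 t x)\<^sup>2 \<le> 1\<^sup>2" using i by (subst abs_le_square_iff[symmetric]) simp
        moreover have "(h1 t x)\<^sup>2 \<le> 2 * (H1 i t x)\<^sup>2 + 2 * (H1 i t x - h1 t x)\<^sup>2"
          using zero_le_power2[of "2 * H1 i t x - h1 t x"] by (simp add: power2_eq_square algebra_simps)
        ultimately show ?thesis by simp
      qed
    qed (auto intro!: circle_integrable_UNIV continuous_intros c)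
    also have "... = 2 * (AVG x. (H1 i t x)\<^sup>2) + 2"
      using c by (subst average_add) (auto simp: average_cmult average_const intro!: circle_integrable_UNIV continuous_intros)
    also have "... \<le> 2 * (2 * B\<^sup>2 + 4 / 3 * Q0) + 2" using 1 by simp
    finally show ?thesis .
  qed
  then show ?thesis by blast
qed

lemma classical_hder: "good t \<Longrightarrow> 0 < t \<Longrightarrow> t \<le> 1 \<Longrightarrow> classical (\<lambda>n. hder n t) 3"
  by unfold_locales (auto intro: hder_deriv continuous_hder periodic_hder)

text \<open>The exponents match: p * \<rho> = \<rho> + 1, so the p-th power of the flux term is
  bounded by |g| powr (\<rho> + 1), which is integrable in time. The third derivative is the flux
  term minus h1, and the second is bounded by the third.\<close>

lemma hder_powr_average_le:
  defines "p \<equiv> 1 / \<rho> + 1"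
  shows "\<exists>K. \<forall>t. good t \<longrightarrow> 0 < t \<longrightarrow> t \<le> 1 \<longrightarrow> (\<Sum>n\<le>3. pavg p (hder n t))
    \<le> K * (1 + pavg (\<rho> + 1) (g t))"
proof -
  have p: "1 < p" "p \<le> 2" "0 < p" "\<rho> * p = \<rho> + 1" using \<rho> by (auto simp: p_def field_simps)
  obtain M where M: "0 \<le> M" "\<And>t x. 0 < t \<Longrightarrow> t \<le> 1 \<Longrightarrow> \<bar>h t x\<bar> \<le> M" using h_bounded by metis
  obtain C where C: "\<And>t. 0 < t \<Longrightarrow> t \<le> 1 \<Longrightarrow> (AVG x. (h1 t x)\<^sup>2) \<le> C" using h1_square_bounded by blast
  have C0: "0 \<le> C" using C[of 1] average_nonneg[of "\<lambda>x. (h1 1 x)\<^sup>2"] by simp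
  define K3 where "K3 = 2 powr p * (b1 powr p + (1 + C))"
  define K2 where "K2 = (2 * pi) powr p * 2 powr p * K3"
  define K where "K = M powr p + (1 + C) + K2 + K3"
  have K3: "0 \<le> K3" unfolding K3_def using C0 by (intro mult_nonneg_nonneg add_nonneg_nonneg) auto
  have "(\<Sum>n\<le>3. pavg p (hder n t)) \<le> K * (1 + pavg (\<rho> + 1) (g t))"
    if t: "good t" "0 < t" "t \<le> 1" for t
  proof -
    define \<Gamma> where "\<Gamma> = pavg (\<rho> + 1) (g t)"
    have \<Gamma>: "0 \<le> \<Gamma>" unfolding \<Gamma>_def by (intro average_nonneg) auto
    have ch: "continuous_on UNIV (hder n t)" if "n \<le> 3" for n by (rule continuous_hder[OF t that])
    have ip: "integrable circle (\<lambda>x. \<bar>f x\<bar> powr s)" if "continuous_on UNIV f" "0 < s" for f :: "real \<Rightarrow> real" and s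
      using that by (intro circle_integrable_UNIV continuous_on_abs_powr)
    have cg: "continuous_on UNIV (g t)" and cb: "continuous_on UNIV (bet t)" and c1: "continuous_on UNIV (h1 t)"
      by (rule continuous_g[OF t], rule continuous_bet[OF t], rule continuous_h1[OF t(2,3)])
    have A0: "pavg p (hder 0 t) \<le> M powr p"
      using M(2)[OF t(2,3)] ch[of 0] p unfolding hder_eq(1)[OF t] by (intro average_powr_mono) auto
    have A1: "pavg p (h1 t) \<le> 1 + C"
    proof -
      have "pavg p (h1 t) \<le> (AVG x. 1 + (h1 t x)\<^sup>2)"
      proof (rule average_mono)
        show "\<bar>h1 t x\<bar> powr p \<le> 1 + (h1 t x)\<^sup>2" for x
        proof (cases "\<bar>h1 t x\<bar> \<le> 1")
          case True
          then have "\<bar>h1 t x\<bar> powr p \<le> 1 powr p" using p by (intro powr_mono2) auto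
          then show ?thesis by (simp add: add_increasing2)
        next
          case False
          then have "\<bar>h1 t x\<bar> powr p \<le> \<bar>h1 t x\<bar> powr 2" using p by (intro powr_mono) auto
          also have "\<bar>h1 t x\<bar> powr 2 = (h1 t x)\<^sup>2" using False by (simp add: powr_numeral)
          finally show ?thesis by simp
        qed
      qed (use c1 p in \<open>auto intro!: circle_integrable_UNIV continuous_intros\<close>)
      also have "... = 1 + (AVG x. (h1 t x)\<^sup>2)"
        using c1 by (subst average_add) (auto simp: average_const intro!: circle_integrable_UNIV continuous_intros)
      finally show ?thesis using C[OF t(2,3)] by simp
    qed
    have A3: "pavg p (hder 3 t) \<le> K3 * (1 + \<Gamma>)"
    proof -
      have "pavg p (hder 3 t)
          \<le> (AVG x. 2 powr p * (b1 powr p * \<bar>g t x\<bar> powr (\<rho> + 1) + \<bar>h1 t x\<bar> powr p))"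
      proof (rule average_mono)
        show "\<bar>hder 3 t x\<bar> powr p \<le> 2 powr p * (b1 powr p * \<bar>g t x\<bar> powr (\<rho> + 1) + \<bar>h1 t x\<bar> powr p)" for x
        proof -
          have "\<bar>bet t x\<bar> \<le> b1 * \<bar>g t x\<bar> powr \<rho>"
            unfolding bet_def using b_le[of "h t x"] b_pos[of "h t x"] by (auto simp: abs_mult abs_spow intro!: mult_right_mono)
          then have "\<bar>bet t x\<bar> powr p \<le> (b1 * \<bar>g t x\<bar> powr \<rho>) powr p" using p by (intro powr_mono2) auto
          also have "... = b1 powr p * \<bar>g t x\<bar> powr (\<rho> + 1)" by (simp add: powr_mult powr_powr p(4))
          finally have 1: "\<bar>bet t x\<bar> powr p \<le> b1 powr p * \<bar>g t x\<bar> powr (\<rho> + 1)" .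
          have "\<bar>hder 3 t x\<bar> powr p \<le> 2 powr p * (\<bar>bet t x\<bar> powr p + \<bar>- h1 t x\<bar> powr p)"
            unfolding hder_eq(3)[OF t] using abs_add_powr_le[OF p(3), of "bet t x" "- h1 t x"] by simp
          also have "... \<le> 2 powr p * (b1 powr p * \<bar>g t x\<bar> powr (\<rho> + 1) + \<bar>h1 t x\<bar> powr p)"
            using 1 by (intro mult_left_mono add_mono) auto
          finally show ?thesis .
        qed
        show "integrable circle (\<lambda>x. 2 powr p * (b1 powr p * \<bar>g t x\<bar> powr (\<rho> + 1) + \<bar>h1 t x\<bar> powr p))"
          using ip[OF cg, of "\<rho> + 1"] ip[OF c1 p(3)] \<rho> by simp
      qed (use ip[OF ch p(3)] in auto)
      also have "... = 2 powr p * (b1 powr p * \<Gamma> + pavg p (h1 t))"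
        using ip[OF cg, of "\<rho> + 1"] ip[OF c1 p(3)] \<rho> by (simp add: average_cmult average_add \<Gamma>_def)
      also have "... \<le> 2 powr p * ((b1 powr p + (1 + C)) * (1 + \<Gamma>))"
      proof (intro mult_left_mono)
        have "b1 powr p * \<Gamma> \<le> b1 powr p * (1 + \<Gamma>)" by (intro mult_left_mono) auto
        moreover have "1 + C \<le> (1 + C) * (1 + \<Gamma>)" using C0 \<Gamma> by (simp add: mult_le_cancel_left1)
        ultimately show "b1 powr p * \<Gamma> + pavg p (h1 t) \<le> (b1 powr p + (1 + C)) * (1 + \<Gamma>)"
          using A1 unfolding distrib_right[of "b1 powr p"] by linarith
      qed simp
      finally show ?thesis by (simp add: K3_def mult.assoc)
    qed
    have A2: "pavg p (hder 2 t) \<le> K2 * (1 + \<Gamma>)"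
    proof -
      define a where "a = (AVG x. \<bar>hder 3 t x\<bar>)"
      define A where "A = pavg p (hder 3 t)"
      have a0: "0 \<le> a" and A0: "0 \<le> A" unfolding a_def A_def by (intro average_nonneg; simp)+
      have d: "(hder 1 t has_real_derivative hder 2 t x) (at x)" "(hder 2 t has_real_derivative hder 3 t x) (at x)" for x
        using hder_deriv[OF t, of 1] hder_deriv[OF t, of 2] by (simp_all add: numeral_2_eq_2 numeral_3_eq_3)
      have "pavg p (hder 2 t) \<le> (2 * pi * a) powr p"
        unfolding a_def
        by (intro average_powr_mono ch p periodic_deriv_average_bound[OF periodic_hder d(1) periodic_hder d(2)]) auto
      also have "... = (2 * pi) powr p * a powr p" by (rule powr_mult)
      also have "... \<le> (2 * pi) powr p * (2 powr p * A)"
      proof (intro mult_left_mono)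
        have "a \<le> 2 * A powr (1 / p)"
          using average_abs_le_powr_average[of "hder 3 t" "1 / \<rho>"] circle_integrable_UNIV[OF ch[of 3]] ip[OF ch[of 3] p(3)] \<rho>
          unfolding a_def A_def p_def by simp
        then have "a powr p \<le> (2 * A powr (1 / p)) powr p" using p a0 by (intro powr_mono2) auto
        also have "... = 2 powr p * A" using p A0 by (simp add: powr_mult powr_powr)
        finally show "a powr p \<le> 2 powr p * A" .
      qed simp
      also have "... \<le> (2 * pi) powr p * (2 powr p * (K3 * (1 + \<Gamma>)))"
        using A3 unfolding A_def by (intro mult_left_mono) auto
      finally show ?thesis by (simp add: K2_def mult.assoc)
    qed
    have "(\<Sum>n\<le>3. pavg p (hder n t)) = pavg p (hder 0 t)
        + pavg p (hder 1 t) + pavg p (hder 2 t) + pavg p (hder 3 t)"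
      by (simp add: numeral_3_eq_3 numeral_2_eq_2)
    also have "... \<le> M powr p + (1 + C) + K2 * (1 + \<Gamma>) + K3 * (1 + \<Gamma>)"
      using A0 A1 A2 A3 unfolding hder_eq(2)[OF t] by linarith
    also have "... \<le> K * (1 + \<Gamma>)"
    proof -
      have "M powr p \<le> M powr p * (1 + \<Gamma>)" "1 + C \<le> (1 + C) * (1 + \<Gamma>)"
        using \<Gamma> C0 by (auto simp: mult_le_cancel_left1)
      then show ?thesis unfolding K_def distrib_right[of _ _ "1 + \<Gamma>"] by linarith
    qed
    finally show ?thesis by (simp add: \<Gamma>_def)
  qed
  then show ?thesis by blast
qed

lemma hder_powr_integrable:
  defines "p \<equiv> 1 / \<rho> + 1"
  shows "integrable lebesgue (\<lambda>t. I01 t * (\<Sum>n\<le>3. pavg p (hder n t)))"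
proof -
  have p: "0 < p" using \<rho> by (simp add: p_def add_pos_pos)
  obtain K where K: "\<And>t. good t \<Longrightarrow> 0 < t \<Longrightarrow> t \<le> 1 \<Longrightarrow> (\<Sum>n\<le>3. pavg p (hder n t))
    \<le> K * (1 + pavg (\<rho> + 1) (g t))"
    using hder_powr_average_le unfolding p_def by blast
  let ?F = "\<lambda>t. I01 t * (\<Sum>n\<le>3. pavg p (hder n t))"
  let ?B = "\<lambda>t. K * (I01 t + I01 t * pavg (\<rho> + 1) (g t))"
  show ?thesis
  proof (rule Bochner_Integration.integrable_bound)
    have "integrable lebesgue (\<lambda>t :: real. I01 t :: real)" by (rule integrable_real_indicator) auto
    then show "integrable lebesgue ?B" using g_powr_integrable by (intro integrable_mult_right Bochner_Integration.integrable_add) auto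
    show "?F \<in> borel_measurable lebesgue"
    proof (rule borel_measurable_lebesgue_AE_limit)
      show "(\<lambda>t. I01 t * (\<Sum>n\<le>3. pavg p (sm n i t))) \<in> borel_measurable lebesgue" for i
      proof (intro borel_measurable_times borel_measurable_indicator)
        show "(\<lambda>t. \<Sum>n\<le>3. pavg p (sm n i t)) \<in> borel_measurable lebesgue"
          unfolding sm_def sc_def cc_def
          by (rule borel_measurable_step[of "\<lambda>m. \<Sum>n\<le>3. pavg p (trig (\<nu> i) ((dcoef ^^ n) (\<lambda>k. fejer_weight (\<nu> i) k * c (\<nu> i) (Suc m) k)))"])
      qed simp
      show "AE t in lebesgue. (\<lambda>i. I01 t * (\<Sum>n\<le>3. pavg p (sm n i t))) \<longlonglongrightarrow> ?F t"
        using good_AE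
      proof eventually_elim
        case (elim t)
        show ?case
        proof (cases "t \<in> {0<..1}")
          case True
          then have t: "0 < t" "t \<le> 1" by auto
          have "(\<lambda>i. pavg p (sm n i t)) \<longlonglongrightarrow> pavg p (hder n t)" if n: "n \<le> 3" for n
          proof (rule average_powr_tendsto[OF continuous_sm continuous_hder[OF elim t n] _ p])
            show "\<exists>i0. \<forall>i\<ge>i0. \<forall>x. \<bar>sm n i t x - hder n t x\<bar> \<le> e" if "0 < e" for e
              using hder_limit[OF elim t n] that unfolding uniform_limit_real_iff by blast
          qed
          then show ?thesis by (intro tendsto_mult tendsto_const tendsto_sum) auto
        qed simp
      qed
    qed
    show "AE t in lebesgue. norm (?F t) \<le> norm (?B t)"
      using good_AE
    proof eventually_elim
      case (elim t)
      show ?case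
      proof (cases "t \<in> {0<..1}")
        case True
        have "0 \<le> (\<Sum>n\<le>3. pavg p (hder n t))" by (intro sum_nonneg average_nonneg) auto
        then show ?thesis using K[OF elim] True by simp
      qed simp
    qed
  qed
qed

end

section \<open>The solution\<close>

lemma integrable_AE_eq_on:
  fixes f g :: "real \<Rightarrow> real"
  assumes I: "I \<in> sets lebesgue" and f: "integrable (lebesgue_on I) f" and eq: "AE t in lebesgue_on I. f t = g t"
  shows "integrable (lebesgue_on I) g"
proof -
  have "g \<in> borel_measurable (lebesgue_on I)"
    by (rule borel_measurable_AE_limit_on[OF I, of "\<lambda>_. f"]) (use f eq in auto)
  then show ?thesis using integrable_cong_AE[OF borel_measurable_integrable[OF f] _ eq] f by simp
qed

lemma AE_lebesgue_onI:
  assumes "I \<in> sets lebesgue" "AE t in lebesgue. P t"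
  shows "AE t in lebesgue_on I. P t"
proof -
  have "AE t in lebesgue. t \<in> I \<longrightarrow> P t" using assms(2) by eventually_elim simp
  then show ?thesis using assms(1) by (simp add: AE_restrict_space_iff)
qed

lemma integrable_lebesgue_onI:
  fixes f :: "real \<Rightarrow> real"
  assumes "I \<in> sets lebesgue" "integrable lebesgue f"
  shows "integrable (lebesgue_on I) f"
  using assms integrable_mult_indicator[of I lebesgue f] by (simp add: integrable_restrict_space)

lemma integrable_before_after_1:
  fixes A :: "real \<Rightarrow> real"
  assumes I: "I \<in> sets lebesgue" "emeasure lebesgue I < \<infinity>" "I \<subseteq> {0<..}"
    and A: "integrable lebesgue (\<lambda>t. I01 t * A t)"
  shows "integrable (lebesgue_on I) (\<lambda>t. if t \<le> 1 then A t else K)"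
proof -
  have sI: "I \<inter> space lebesgue \<in> sets lebesgue" using I(1) by simp
  have "finite_measure (lebesgue_on I)" using I by (intro finite_measureI) (auto simp: emeasure_restrict_space)
  then have "integrable (lebesgue_on I) (\<lambda>t. K)" by (rule finite_measure.integrable_const)
  then have "integrable lebesgue (\<lambda>t. indicator I t *\<^sub>R K)" unfolding integrable_restrict_space[OF sI] .
  then have "integrable lebesgue (\<lambda>t. indicator {1<..} t *\<^sub>R (indicator I t *\<^sub>R K))"
    by (rule integrable_mult_indicator[rotated]) simp
  then have "integrable (lebesgue_on I) (\<lambda>t. indicator {1<..} t *\<^sub>R K)"
    unfolding integrable_restrict_space[OF sI] by (simp only: real_scaleR_def mult.left_commute)
  then have "integrable (lebesgue_on I) (\<lambda>t. I01 t * A t + indicator {1<..} t *\<^sub>R K)"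
    by (rule Bochner_Integration.integrable_add[OF integrable_lebesgue_onI[OF I(1) A]])
  then show ?thesis
    by (rule Bochner_Integration.integrable_cong[THEN iffD1, rotated -1]) (use I(3) in \<open>auto simp: indicator_def\<close>)
qed

lemma abs_powr_2: "\<bar>x\<bar> powr 2 = (x :: real)\<^sup>2"
  by (cases "x = 0") (simp_all add: powr_numeral)

lemma Sobolev_norm_1_2_diff:
  assumes f: "f \<in> Lp 2" "f' \<in> Lp 2" "is_weak_deriv 1 f f'"
    and g: "g \<in> Lp 2" "g' \<in> Lp 2" "is_weak_deriv 1 g g'"
  shows "Sobolev_norm 1 2 (\<lambda>x. f x - g x) = sqrt (2 * pi * (AVG x. (f x - g x)\<^sup>2) + 2 * pi * (AVG x. (f' x - g' x)\<^sup>2))"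
proof -
  define d where "d j = (if j = 0 then (\<lambda>x. f x - g x) else (\<lambda>x. f' x - g' x))" for j :: nat
  have L: "(\<lambda>x. u x - v x) \<in> Lp 1" if "u \<in> Lp 2" "v \<in> Lp 2" for u v
    using Lp_add[OF that(1) Lp_cmult[OF that(2), of "-1"]] by (intro Lp_subset_Lp_1[of 2]) simp_all
  have w: "is_weak_deriv 1 (\<lambda>x. f x - g x) (\<lambda>x. f' x - g' x)"
    using f g Lp_integrable[of _ 2] by (intro is_weak_deriv_diff) auto
  have "d j \<in> Lp 1 \<and> is_weak_deriv j (\<lambda>x. f x - g x) (d j)" if "j \<le> 1" for j
    using that w L[OF f(1) g(1)] L[OF f(2) g(2)] by (cases "j = 0") (auto simp: d_def is_weak_deriv_0 le_Suc_eq)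
  from Sobolev_norm_eq[OF this, of 1 2] show ?thesis
    by (simp add: d_def abs_powr_2 circle_integral_average powr_half_sqrt average_nonneg)
qed

lemma exp_ii: "exp (- (\<i> * complex_of_real x)) = of_real (cos x) - \<i> * of_real (sin x)"
    "exp (\<i> * complex_of_real x) = of_real (cos x) + \<i> * of_real (sin x)"
  using cis_conv_exp[of x] cis_conv_exp[of "- x"] by (auto simp: complex_eq_iff)

lemma coef_weak_deriv: "is_weak_deriv 1 f f' \<Longrightarrow> coef f' k = dcoef (coef f) k"
proof -
  assume w: "is_weak_deriv 1 f f'"
  have "deriv (cas k) x = of_int k * cas (- k) x" for x by (rule DERIV_imp_deriv[OF cas_deriv])
  then have "coef f' k = - (AVG x. of_int k * (f x * cas (- k) x))"
    using weak_deriv_coef[OF w, of k] by (simp add: mult_ac)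
  then show ?thesis by (simp add: average_cmult dcoef_def coef_def)
qed

text \<open>The part of the Hartley coefficients that is even in k is the cosine coefficient, the
  odd part the sine coefficient.\<close>

lemma fourier_coeff_real:
  assumes f: "continuous_on {0..2*pi} f"
  shows "fourier_coeff 1 f = of_real ((coef f 1 + coef f (-1)) / 2) - \<i> * of_real ((coef f 1 - coef f (-1)) / 2)"
    "fourier_coeff (-1) f = of_real ((coef f 1 + coef f (-1)) / 2) + \<i> * of_real ((coef f 1 - coef f (-1)) / 2)"
proof -
  have i: "integrable circle (\<lambda>x. f x * cos x)" "integrable circle (\<lambda>x. f x * sin x)"
    by (intro circle_integrable continuous_intros f)+
  have ic: "integrable circle (\<lambda>x. complex_of_real (f x * cos x))" "integrable circle (\<lambda>x. complex_of_real (f x * sin x))"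
    using i by (auto intro: integrable_of_real simp del: of_real_mult)
  define C S where "C = (AVG x. f x * cos x)" and "S = (AVG x. f x * sin x)"
  have "coef f 1 = C + S" "coef f (-1) = C - S"
    unfolding coef_def C_def S_def cas_def average_add[OF i, symmetric] average_diff[OF i, symmetric]
    by (simp_all add: distrib_left right_diff_distrib)
  then have CS: "(coef f 1 + coef f (-1)) / 2 = C" "(coef f 1 - coef f (-1)) / 2 = S" by simp_all
  have lin: "1 / (2 * complex_of_real pi) * (\<integral>x. complex_of_real (f x * cos x) + z * complex_of_real (f x * sin x) \<partial>circle)
      = of_real C + z * of_real S" for z
  proof -
    have "(\<integral>x. complex_of_real (f x * cos x) + z * complex_of_real (f x * sin x) \<partial>circle)
        = (\<integral>x. complex_of_real (f x * cos x) \<partial>circle) + z * (\<integral>x. complex_of_real (f x * sin x) \<partial>circle)"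
      using ic by (subst Bochner_Integration.integral_add) (auto simp del: of_real_mult)
    also have "... = of_real (2 * pi * C) + z * of_real (2 * pi * S)"
      unfolding integral_complex_of_real circle_integral_average C_def S_def ..
    finally show ?thesis by (simp add: distrib_left)
  qed
  show "fourier_coeff 1 f = of_real ((coef f 1 + coef f (-1)) / 2) - \<i> * of_real ((coef f 1 - coef f (-1)) / 2)"
    unfolding CS using lin[of "- \<i>"] by (simp add: fourier_coeff_def exp_ii algebra_simps)
  show "fourier_coeff (-1) f = of_real ((coef f 1 + coef f (-1)) / 2) + \<i> * of_real ((coef f 1 - coef f (-1)) / 2)"
    unfolding CS using lin[of "\<i>"] by (simp add: fourier_coeff_def exp_ii algebra_simps)
qed

section \<open>The limit continued by its value at time 1\<close>

locale solution = flow_conv +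
  fixes \<alpha> m p q :: real and h0 :: "real \<Rightarrow> real"
  assumes \<alpha>: "0 < \<alpha>" and \<rho>_eq: "\<rho> = 1 / \<alpha>"
    and near: "\<And>t x s. 0 < t \<Longrightarrow> t \<le> 1 \<Longrightarrow> \<bar>h t x\<bar> powr (\<alpha> + 2) * \<psi> \<alpha> (b (h t x) * spow \<rho> s) = s"
    and extinct: "\<And>x. h 1 x = m + p * cas 1 x + q * cas (-1) x"
    and h0: "h0 \<in> Sobolev 1 2" "\<And>k. coef h0 k = c0 k"
begin

definition ec :: "int \<Rightarrow> real" where
  "ec k = (if k = 0 then m else if k = 1 then p else q)"

text \<open>After time 1 the function is frozen at \<open>h 1\<close>, a stationary state because
  the first plus the third derivative vanishes on the modes 0, 1 and -1. At time 0 the initial value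
  itself is inserted, since the limit h is constructed for positive times.\<close>

definition sol :: "real \<Rightarrow> real \<Rightarrow> real" where
  "sol t = (if t \<le> 0 then h0 else h (min t 1))"

definition dsol :: "real \<Rightarrow> nat \<Rightarrow> real \<Rightarrow> real" where
  "dsol t n = (if t \<le> 1 then hder n t else trig 1 ((dcoef ^^ n) ec))"

definition flux :: "real \<Rightarrow> (real \<Rightarrow> real) \<Rightarrow> real" where
  "flux t w = (\<integral>x. \<bar>sol t x\<bar> powr (\<alpha> + 2) * \<psi> \<alpha> (weak_deriv 1 (sol t) x + weak_deriv 3 (sol t) x)
      * weak_deriv 1 w x \<partial>circle)"

definition qsol :: "real \<Rightarrow> real \<Rightarrow> real" where
  "qsol t = (if t \<le> 1 then g t else (\<lambda>_. 0))"

lemma h_1: "h 1 = trig 1 ec"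
proof
  have "modes 1 = {-1, 0, 1}" by auto
  then show "h 1 x = trig 1 ec x" for x by (simp add: extinct trig_def ec_def)
qed

lemma exponents: "\<rho> + 1 = 1 / \<alpha> + 1" "1 / \<rho> + 1 = \<alpha> + 1"
  using \<rho>_eq by simp_all

lemma sol_dsol: "good t \<Longrightarrow> 0 < t \<Longrightarrow> sol t = dsol t 0"
  by (simp add: sol_def dsol_def hder_eq(1) h_1)

lemma good_AE_on:
  assumes I: "I \<in> sets lebesgue" "I \<subseteq> {0<..}"
  shows "AE t in lebesgue_on I. good t \<and> 0 < t"
proof -
  have "AE t in lebesgue_on I. t \<in> I" by (intro AE_I2) simp
  with AE_lebesgue_onI[OF I(1) good_AE] show ?thesis by eventually_elim (use I(2) in auto)
qed

lemma classical_dsol: "good t \<Longrightarrow> 0 < t \<Longrightarrow> classical (dsol t) 3"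
  using classical_hder[of t] classical_trig[of 1 ec 3] by (cases "t \<le> 1") (simp_all add: dsol_def[abs_def])

text \<open>The inverted relation is inverted back: the limit equation gives the first plus the
  third derivative as \<open>b\<close> times \<open>spow \<rho> g\<close>, and \<open>near\<close>
  recovers g from it. After time 1 both sides vanish.\<close>

lemma flux_eq:
  assumes t: "good t" "0 < t" and w: "w \<in> Sobolev 1 (\<alpha> + 1)"
  shows "flux t w = pairing (qsol t) w"
  unfolding flux_def pairing_def
proof (rule integral_cong_AE)
  interpret C: classical "dsol t" 3 by (rule classical_dsol[OF t])
  have eq: "sol t = dsol t 0" by (rule sol_dsol[OF t])
  have wm: "weak_deriv 1 w \<in> borel_measurable circle"
    using weak_deriv_integrable(1)[OF w, of 1] \<alpha> by (intro borel_measurable_integrable) auto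
  have cm: "f \<in> borel_measurable circle" if "continuous_on UNIV f" for f :: "real \<Rightarrow> real"
    using circle_integrable_UNIV[OF that] by (rule borel_measurable_integrable)
  have S: "sol t \<in> Sobolev 3 (\<alpha> + 1)" unfolding eq using \<alpha> by (intro C.in_Sobolev) auto
  have dm: "weak_deriv j (sol t) \<in> borel_measurable circle" if "j \<le> 3" for j
    using weak_deriv_integrable(1)[OF S _ that] \<alpha> by (intro borel_measurable_integrable) auto
  have sm: "sol t \<in> borel_measurable circle" unfolding eq by (intro cm C.cont) auto
  show "(\<lambda>y. \<bar>sol t y\<bar> powr (\<alpha> + 2) * \<psi> \<alpha> (weak_deriv 1 (sol t) y + weak_deriv 3 (sol t) y) * weak_deriv 1 w y) \<in> borel_measurable circle"
    unfolding \<psi>_def using wm sm dm[of 1] dm[of 3] by measurable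
  have qm: "qsol t \<in> borel_measurable circle"
    unfolding qsol_def using continuous_g[OF t] by (auto intro: cm)
  show "(\<lambda>x. qsol t x * weak_deriv 1 w x) \<in> borel_measurable circle" using qm wm by measurable
  show "AE y in circle. \<bar>sol t y\<bar> powr (\<alpha> + 2) * \<psi> \<alpha> (weak_deriv 1 (sol t) y + weak_deriv 3 (sol t) y) * weak_deriv 1 w y
      = qsol t y * weak_deriv 1 w y"
  proof -
    have "AE y in circle. weak_deriv 1 (sol t) y = dsol t 1 y" "AE y in circle. weak_deriv 3 (sol t) y = dsol t 3 y"
      unfolding eq by (intro C.weak_deriv_eq; simp)+
    then show ?thesis
    proof eventually_elim
      case (elim x)
      show ?case
      proof (cases "t \<le> 1")
        case True
        have "dsol t 1 x + dsol t 3 x = b (h t x) * spow \<rho> (g t x)"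
          using True by (simp add: dsol_def hder_eq[OF t True] hder_eq(2)[OF t True, unfolded One_nat_def] bet_def)
        then show ?thesis using near[OF t(2) True, of x "g t x"] t True elim by (simp add: sol_def qsol_def)
      next
        case False
        have "dsol t 1 x + dsol t 3 x = trig 1 (\<lambda>k. of_int k * lam k * ec (- k)) x"
          using False by (simp add: dsol_def trig_add dcoef_1_3)
        also have "... = 0"
        proof -
          have "lam k = 0" if "k \<in> modes 1" for k
          proof -
            have "k = -1 \<or> k = 0 \<or> k = 1" using that by auto
            then show ?thesis by (auto simp: lam_def)
          qed
          then show ?thesis unfolding trig_def by (intro sum.neutral) auto
        qed
        finally show ?thesis using elim False by (simp add: qsol_def \<psi>_def)
      qed
    qed
  qed
qed

lemma sol_bochner:
  assumes I: "I \<in> sets lebesgue" "emeasure lebesgue I < \<infinity>" "I \<subseteq> {0<..}"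
  shows "sol \<in> bochner_Lp (\<alpha> + 1) I (Sobolev 3 (\<alpha> + 1)) (Sobolev_norm 3 (\<alpha> + 1))"
proof -
  define F where "F i n = trig (\<nu> i) (\<lambda>k. fejer_weight (\<nu> i) k * c (\<nu> i) (Suc n) k)" for i n
  define ds where "ds i t n = (if t \<le> 1 then sm n i t else trig 1 ((dcoef ^^ n) ec))" for i t n
  note gAE = good_AE_on[OF I(1,3)]
  have p: "0 < \<alpha> + 1" using \<alpha> by simp
  define K where "K = (\<Sum>n\<le>3. pint (\<alpha> + 1) (trig 1 ((dcoef ^^ n) ec)))"
  have int: "integrable (lebesgue_on I) (\<lambda>t. if t \<le> 1 then 2 * pi * (\<Sum>n\<le>3. pavg (\<alpha> + 1) (hder n t)) else K)"
  proof (rule integrable_before_after_1[OF I])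
    have "integrable lebesgue (\<lambda>t. 2 * pi * (I01 t * (\<Sum>n\<le>3. pavg (\<alpha> + 1) (hder n t))))"
      using hder_powr_integrable unfolding exponents by (rule integrable_mult_right)
    then show "integrable lebesgue (\<lambda>t. I01 t * (2 * pi * (\<Sum>n\<le>3. pavg (\<alpha> + 1) (hder n t))))"
      by (simp only: mult_ac)
  qed
  show ?thesis
  \<comment> \<open>The approximating simple functions are the Fejer means of the discrete heights,
    which are step functions in time.\<close>
  proof (rule bochner_Lp_Sobolev[where s = "\<lambda>i t. if t \<le> 1 then F i (step_idx (\<nu> i) t) else trig 1 ec" and ds = ds and d = dsol])
    show "simple_function (lebesgue_on I) (\<lambda>t. if t \<le> 1 then F i (step_idx (\<nu> i) t) else trig 1 ec)" for i
      by (rule simple_function_step[OF I(1,3) \<nu>1])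
    show "(if t \<le> 1 then F i (step_idx (\<nu> i) t) else trig 1 ec) = ds i t 0" for i t
      by (simp add: F_def ds_def sm_def sc_def[abs_def] cc_def)
    show "classical (ds i t) 3" for i t
      using classical_trig[of "\<nu> i" "sc i t" 3] classical_trig[of 1 ec 3] by (cases "t \<le> 1") (simp_all add: ds_def[abs_def] sm_def)
    show "AE t in lebesgue_on I. sol t = dsol t 0 \<and> classical (dsol t) 3 \<and>
      (\<forall>j\<le>3. uniform_limit UNIV (\<lambda>n. ds n t j) (dsol t j) sequentially)"
      using gAE
    proof eventually_elim
      case (elim t)
      then show ?case using sol_dsol[of t] classical_dsol[of t] hder_limit[of t]
        by (cases "t \<le> 1") (auto simp: ds_def dsol_def intro: uniform_limit_const)
    qed
    show "integrable (lebesgue_on I) (\<lambda>t. Sobolev_norm 3 (\<alpha> + 1) (sol t) powr (\<alpha> + 1))"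
    proof (rule integrable_AE_eq_on[OF I(1) int])
      show "AE t in lebesgue_on I. (if t \<le> 1 then 2 * pi * (\<Sum>n\<le>3. pavg (\<alpha> + 1) (hder n t)) else K)
          = Sobolev_norm 3 (\<alpha> + 1) (sol t) powr (\<alpha> + 1)"
        using gAE
      proof eventually_elim
        case (elim t)
        interpret C: classical "dsol t" 3 using elim by (intro classical_dsol) auto
        have "Sobolev_norm 3 (\<alpha> + 1) (sol t) powr (\<alpha> + 1) = (\<Sum>n\<le>3. pint (\<alpha> + 1) (dsol t n))"
          using sol_dsol[of t] elim p by (simp add: C.norm_eq powr_powr sum_nonneg)
        then show ?case by (simp add: dsol_def K_def circle_integral_average sum_distrib_left)
      qed
    qed
  qed (rule p)
qed

lemma flux_bochner:
  assumes I: "I \<in> sets lebesgue" "emeasure lebesgue I < \<infinity>" "I \<subseteq> {0<..}"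
  shows "flux \<in> bochner_Lp ((\<alpha> + 1) / \<alpha>) I (Sobolev_dual 1 (\<alpha> + 1)) (Sobolev_dual_norm 1 (\<alpha> + 1))"
proof -
  define F where "F i n = pairing (trig (\<nu> i) (j (\<nu> i) (Suc n)))" for i n
  define qs where "qs i t = (if t \<le> 1 then G i t else (\<lambda>_. 0))" for i t
  note gAE = good_AE_on[OF I(1,3)]
  have "integrable lebesgue (\<lambda>t. 2 * pi * (I01 t * pavg (1 / \<alpha> + 1) (g t)))"
    using g_powr_integrable unfolding exponents by (rule integrable_mult_right)
  then have "integrable lebesgue (\<lambda>t. I01 t * (2 * pi * pavg (1 / \<alpha> + 1) (g t)))"
    by (simp only: mult_ac)
  note int = integrable_before_after_1[OF I this, of 0]
  show ?thesis
  proof (rule bochner_Lp_dual[OF \<alpha> I(1,2), where s = "\<lambda>i t. if t \<le> 1 then F i (step_idx (\<nu> i) t) else pairing (\<lambda>_. 0)" and qs = qs and q = qsol])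
    show "simple_function (lebesgue_on I) (\<lambda>t. if t \<le> 1 then F i (step_idx (\<nu> i) t) else pairing (\<lambda>_. 0))" for i
      by (rule simple_function_step[OF I(1,3) \<nu>1])
    show "(if t \<le> 1 then F i (step_idx (\<nu> i) t) else pairing (\<lambda>_. 0)) = pairing (qs i t)" for i t
      by (simp add: F_def qs_def G_def jj_def)
    show "continuous_on UNIV (qs i t)" for i t using continuous_G by (simp add: qs_def)
    show "AE t in lebesgue_on I. (\<forall>w\<in>Sobolev 1 (\<alpha> + 1). flux t w = pairing (qsol t) w) \<and> continuous_on UNIV (qsol t) \<and>
      uniform_limit UNIV (\<lambda>n. qs n t) (qsol t) sequentially"
      using gAE
    proof eventually_elim
      case (elim t)
      have "uniform_limit UNIV (\<lambda>n. G n t) (g t) sequentially" if "t \<le> 1"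
        using G_lim(2)[of t] elim that unfolding uniform_limit_real_iff by blast
      then show ?case using flux_eq elim continuous_g[of t]
        by (cases "t \<le> 1") (auto simp: qs_def qsol_def intro: uniform_limit_const)
    qed
    show "integrable (lebesgue_on I) (\<lambda>t. pint (1 / \<alpha> + 1) (qsol t))"
    proof (rule integrable_AE_eq_on[OF I(1) int], rule AE_I2)
      fix t
      show "(if t \<le> 1 then 2 * pi * pavg (1 / \<alpha> + 1) (g t) else 0) = pint (1 / \<alpha> + 1) (qsol t)"
        by (simp add: qsol_def circle_integral_average average_const)
    qed
  qed
qed

lemma classical_h: "0 < t \<Longrightarrow> t \<le> 1 \<Longrightarrow> classical (\<lambda>n. if n = 0 then h t else h1 t) 1"
  by unfold_locales (auto intro: h_deriv continuous_h continuous_h1 periodic_h periodic_h1)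

text \<open>At positive times h and h1 are uniformly continuous in time, with times beyond 1 mapped
  to 1; at time 0 the claim is \<open>initial_limit\<close>.\<close>

lemma sol_continuous: "sol \<in> continuous_into {0..} (Sobolev 1 2) (Sobolev_norm 1 2)"
  unfolding continuous_into_def mem_Collect_eq
proof (intro ballI conjI)
  fix t :: real assume "t \<in> {0..}"
  then have t0: "0 \<le> t" by simp
  have sS: "h t \<in> Sobolev 1 2" if "0 < t" "t \<le> 1" for t
    using classical.in_Sobolev[OF classical_h[OF that], of 2] by simp
  show "sol t \<in> Sobolev 1 2" using sS[of "min t 1"] h0(1) by (simp add: sol_def)
  show "((\<lambda>s. Sobolev_norm 1 2 (\<lambda>x. sol s x - sol t x)) \<longlongrightarrow> 0) (at t within {0..})"
    unfolding Lim_within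
  proof (intro allI impI)
    fix e :: real assume e: "0 < e"
    have nn: "0 \<le> Sobolev_norm 1 2 f" for f by (simp add: Sobolev_norm_def)
    show "\<exists>d>0. \<forall>s\<in>{0..}. 0 < dist s t \<and> dist s t < d \<longrightarrow> dist (Sobolev_norm 1 2 (\<lambda>x. sol s x - sol t x)) 0 < e"
    proof (cases "t = 0")
      case False
      then have t: "0 < t" using t0 by simp
      define K where "K = (real (Suc 1) * (2 * pi)) powr (1 / 2)"
      have K: "0 < K" by (simp add: K_def)
      define a where "a = min t 1 / 2"
      have a: "0 < a" "a < min t 1" using t by (auto simp: a_def)
      have "0 < e / (2 * K)" using e K by simp
      from time_continuity[OF this a(1)] obtain d where d: "0 < d" and
        D: "\<And>s t y. a \<le> s \<Longrightarrow> s \<le> t \<Longrightarrow> t \<le> 1 \<Longrightarrow> t - s \<le> d \<Longrightarrow> \<bar>h t y - h s y\<bar> \<le> e / (2 * K) \<and> \<bar>h1 t y - h1 s y\<bar> \<le> e / (2 * K)"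
        by blast
      have "Sobolev_norm 1 2 (\<lambda>x. sol s x - sol t x) < e" if s: "\<bar>s - t\<bar> < min d a" for s
      proof -
        define s' t' where "s' = min s 1" and "t' = min t 1"
        have st: "a \<le> s'" "a \<le> t'" "s' \<le> 1" "t' \<le> 1" "\<bar>s' - t'\<bar> \<le> d" "0 < s" "0 < s'" "0 < t'"
        proof -
          have "s - t < d" "t - s < d" "s - t < a" "t - s < a" using s by auto
          then show "a \<le> s'" "a \<le> t'" "s' \<le> 1" "t' \<le> 1" "\<bar>s' - t'\<bar> \<le> d" "0 < s" "0 < s'" "0 < t'"
            using t d unfolding s'_def t'_def a_def min_def abs_le_iff by (auto split: if_splits)
        qed
        have d': "\<bar>h s' y - h t' y\<bar> \<le> e / (2 * K) \<and> \<bar>h1 s' y - h1 t' y\<bar> \<le> e / (2 * K)" for y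
        proof (cases "s' \<le> t'")
          case True
          then show ?thesis using D[of s' t' y] st by (simp add: abs_minus_commute)
        next
          case False
          then show ?thesis using D[of t' s' y] st by simp
        qed
        interpret C: classical "\<lambda>n x. (if n = 0 then h s' else h1 s') x - (if n = 0 then h t' else h1 t') x" 1
          using st by (intro classical_diff classical_h)
        have "Sobolev_norm 1 2 (\<lambda>x. h s' x - h t' x) \<le> K * (e / (2 * K))"
          unfolding K_def using C.norm_le[of 2 "e / (2 * K)"] d' unfolding K_def by simp
        also have "... < e" using K e by simp
        finally show ?thesis using st t by (simp add: sol_def s'_def t'_def)
      qed
      then show ?thesis using d a nn by (intro exI[of _ "min d a"]) (auto simp: dist_real_def)
    next
      case True
      define g0 where "g0 = weak_deriv 1 h0"
      have g0: "g0 \<in> Lp 2" "is_weak_deriv 1 h0 g0" unfolding g0_def by (rule Sobolev_weak_deriv[OF h0(1)]; simp)+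
      have hL: "h0 \<in> Lp 2" using h0(1) by (simp add: Sobolev_def)
      have i0: "integrable circle h0" "integrable circle g0" by (rule Lp_integrable[OF hL], simp, rule Lp_integrable[OF g0(1)], simp)
      have i2: "integrable circle (\<lambda>x. (h0 x)\<^sup>2)" "integrable circle (\<lambda>x. (g0 x)\<^sup>2)"
        using hL g0(1) unfolding Lp_def abs_powr_2 by blast+
      have cg: "coef g0 k = dcoef c0 k" for k
        using coef_weak_deriv[OF g0(2), of k] h0(2) by (simp add: dcoef_def)
      \<comment> \<open>Two errors of 2 * pi * e' add up to e^2 / 2 under the square root.\<close>
      define e' where "e' = e\<^sup>2 / (8 * pi)"
      have e': "0 < e'" using e by (simp add: e'_def)
      obtain d where d: "0 < d" and D: "\<And>t. 0 < t \<Longrightarrow> t \<le> d \<Longrightarrow> t \<le> 1 \<Longrightarrow>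
          (AVG x. (h t x - h0 x)\<^sup>2) \<le> e' \<and> (AVG x. (h1 t x - g0 x)\<^sup>2) \<le> e'"
        using initial_limit[OF i0(1) i2(1) h0(2) i0(2) i2(2) cg e'] by blast
      have "Sobolev_norm 1 2 (\<lambda>x. sol s x - sol t x) < e" if s: "0 < s" "s < min d 1" for s
      proof -
        have s1: "s \<le> d" "s \<le> 1" using s by auto
        interpret C: classical "\<lambda>n. if n = 0 then h s else h1 s" 1 using s(1) s1(2) by (rule classical_h)
        have w: "is_weak_deriv 1 (h s) (h1 s)" "h s \<in> Lp 2" "h1 s \<in> Lp 2"
          using C.weak[of 1] C.in_Lp[of 0 2] C.in_Lp[of 1 2] by simp_all
        have "Sobolev_norm 1 2 (\<lambda>x. h s x - h0 x) = sqrt (2 * pi * (AVG x. (h s x - h0 x)\<^sup>2) + 2 * pi * (AVG x. (h1 s x - g0 x)\<^sup>2))"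
          by (rule Sobolev_norm_1_2_diff[OF w(2,3,1) hL g0])
        also have "... \<le> sqrt (2 * pi * e' + 2 * pi * e')"
          using D[OF s(1) s1] by (intro real_sqrt_le_mono add_mono mult_left_mono) auto
        also have "... = sqrt (e\<^sup>2 / 2)" by (simp add: e'_def)
        also have "... < sqrt (e\<^sup>2)" using e by (intro real_sqrt_less_mono) simp
        finally show ?thesis using e s True by (simp add: sol_def)
      qed
      then show ?thesis using d nn True by (intro exI[of _ "min d 1"]) (auto simp: dist_real_def)
    qed
  qed
qed

lemma sol_time_deriv: "is_time_deriv (\<alpha> + 1) T sol flux"
  unfolding is_time_deriv_def
proof (intro allI impI ballI)
  fix \<eta> a z w
  assume *: "smooth \<eta> \<and> 0 < a \<and> a < z \<and> z < T \<and> (\<forall>t. t \<notin> {a..z} \<longrightarrow> \<eta> t = 0)" and w: "w \<in> Sobolev 1 (\<alpha> + 1)"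
  then have \<eta>: "smooth \<eta>" "0 < a" "\<And>t. t < a \<Longrightarrow> \<eta> t = 0" "\<And>t. z < t \<Longrightarrow> \<eta> t = 0" and zT: "z < T" by auto
  have p: "1 \<le> \<alpha> + 1" using \<alpha> by simp
  let ?w' = "weak_deriv 1 w"
  have iw: "integrable circle w" "integrable circle ?w'" "\<And>k. coef ?w' k = dcoef (coef w) k"
    using Sobolev_integrable[OF w p] weak_deriv_integrable(1)[OF w p order_refl] coef_weak_deriv[OF Sobolev_weak_deriv(2)[OF w p order_refl]] by auto
  have d0: "deriv \<eta> t = 0" if "T \<le> t" for t
  proof -
    have "(\<eta> has_real_derivative deriv \<eta> t) (at t)" using smooth_deriv[OF \<eta>(1), of 0] by simp
    moreover have "(\<eta> has_real_derivative 0) (at t)"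
    proof (rule has_field_derivative_transform_within_open[of "\<lambda>_. 0" _ _ "{z<..}"])
      show "t \<in> {z<..}" using that zT by simp
    qed (use \<eta>(4) in auto)
    ultimately show ?thesis by (rule DERIV_unique)
  qed
  define W where "W t = (AVG x. w x * h t x)" for t
  \<comment> \<open>\<open>time_deriv_weak\<close> needs the whole interval up to 1, also when T <
    1. As \<eta> vanishes beyond z < T, extending the integrals up to S changes nothing.\<close>
  define S where "S = max T 1"
  note D = integral_deriv_interval[OF \<eta>(1), of 1 S]
  have S1: "1 \<le> S" "\<eta> S = 0" using zT \<eta>(4)[of S] by (auto simp: S_def)
  have cd: "continuous_on UNIV (deriv \<eta>)" using smooth_continuous[OF \<eta>(1), of UNIV 1] by simp
  have iW: "integrable lebesgue (\<lambda>t. I01 t * (deriv \<eta> t * W t))"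
  proof -
    obtain C where C: "0 \<le> C" "\<And>t. 0 < t \<Longrightarrow> t \<le> 1 \<Longrightarrow> \<bar>W t\<bar> \<le> C"
      using average_h_bounded[OF iw(1)] unfolding W_def by blast
    have "integrable lebesgue (\<lambda>t. I01 t * deriv \<eta> t)" by (rule integral_deriv_interval[OF \<eta>(1)]) simp
    then have "integrable lebesgue (\<lambda>t. C * (I01 t * deriv \<eta> t))" by (rule integrable_mult_right)
    then show ?thesis
    proof (rule Bochner_Integration.integrable_bound)
      have "(\<lambda>t. deriv \<eta> t * (I01 t * W t)) \<in> borel_measurable lebesgue"
        unfolding W_def using borel_measurable_continuous_onI[OF cd]
        by (intro borel_measurable_times average_h_measurable[OF iw(1)]) (simp add: measurable_completion)
      then show "(\<lambda>t. I01 t * (deriv \<eta> t * W t)) \<in> borel_measurable lebesgue" by (simp only: mult_ac)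
      show "AE t in lebesgue. norm (I01 t * (deriv \<eta> t * W t)) \<le> norm (C * (I01 t * deriv \<eta> t))"
      proof (intro AE_I2)
        fix t
        show "norm (I01 t * (deriv \<eta> t * W t)) \<le> norm (C * (I01 t * deriv \<eta> t))"
        proof (cases "t \<in> {0<..1}")
          case True
          then have "\<bar>deriv \<eta> t\<bar> * \<bar>W t\<bar> \<le> \<bar>deriv \<eta> t\<bar> * C" using C by (intro mult_left_mono) auto
          then show ?thesis using True C by (simp add: abs_mult mult.commute)
        qed simp
      qed
    qed
  qed
  have "(\<integral>t. deriv \<eta> t * (\<integral>y. sol t y * w y \<partial>circle) \<partial>lebesgue_on {0<..<T})
      = (\<integral>t. indicator {0<..<T} t * (deriv \<eta> t * (2 * pi * (AVG x. w x * sol t x))) \<partial>lebesgue)"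
    by (simp add: integral_restrict_space circle_integral_average mult.commute[of _ "w _"])
  also have "... = (\<integral>t. 2 * pi * (I01 t * (deriv \<eta> t * W t) + (indicator {1<..S} t * deriv \<eta> t) * W 1) \<partial>lebesgue)"
  proof (intro Bochner_Integration.integral_cong refl)
    fix t
    consider "t \<le> 0" | "0 < t" "t \<le> 1" | "1 < t" "t < T" | "1 < t" "T \<le> t" by linarith
    then show "indicator {0<..<T} t * (deriv \<eta> t * (2 * pi * (AVG x. w x * sol t x)))
      = 2 * pi * (I01 t * (deriv \<eta> t * W t) + (indicator {1<..S} t * deriv \<eta> t) * W 1)"
    proof cases
      case 2
      then show ?thesis using d0[of t] by (cases "t < T") (simp_all add: sol_def W_def indicator_def)
    qed (simp_all add: sol_def W_def S_def d0 indicator_def)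
  qed
  \<comment> \<open>On (1, S] the height is constant in time and \<eta> S = 0, so this part
    contributes - \<eta> 1 * W 1 and cancels the boundary term of
    \<open>time_deriv_weak\<close>.\<close>
  also have "... = 2 * pi * ((\<integral>t. I01 t * (deriv \<eta> t * W t) \<partial>lebesgue) + (\<eta> S - \<eta> 1) * W 1)"
    using iW D[OF S1(1)] by simp
  also have "(\<integral>t. I01 t * (deriv \<eta> t * W t) \<partial>lebesgue)
      = \<eta> 1 * W 1 - (\<integral>t. I01 t * (\<eta> t * (AVG x. ?w' x * g t x)) \<partial>lebesgue)"
    unfolding W_def by (rule time_deriv_weak[OF iw \<eta>(1-3)])
  finally have L: "(\<integral>t. deriv \<eta> t * (\<integral>y. sol t y * w y \<partial>circle) \<partial>lebesgue_on {0<..<T})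
      = - (2 * pi * (\<integral>t. I01 t * (\<eta> t * (AVG x. ?w' x * g t x)) \<partial>lebesgue))"
    using S1(2) by (simp add: algebra_simps)
  have "(\<integral>t. \<eta> t * flux t w \<partial>lebesgue_on {0<..<T}) = (\<integral>t. indicator {0<..<T} t * (\<eta> t * flux t w) \<partial>lebesgue)"
    by (simp add: integral_restrict_space)
  also have "... = (\<integral>t. 2 * pi * (I01 t * (\<eta> t * (AVG x. ?w' x * g t x))) \<partial>lebesgue)"
  proof (rule integral_cong_AE)
    have me: "\<eta> \<in> borel_measurable lebesgue"
      using borel_measurable_continuous_onI[OF smooth_continuous[OF \<eta>(1), of UNIV 0]] by (simp add: measurable_completion)
    have "(\<lambda>t. 2 * pi * (\<eta> t * (I01 t * (AVG x. ?w' x * g t x)))) \<in> borel_measurable lebesgue"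
      by (intro borel_measurable_times me average_g_measurable[OF iw(2)]) auto
    then show m: "(\<lambda>t. 2 * pi * (I01 t * (\<eta> t * (AVG x. ?w' x * g t x)))) \<in> borel_measurable lebesgue"
      by (simp only: mult.left_commute[of "\<eta> _"])
    show ae: "AE t in lebesgue. indicator {0<..<T} t * (\<eta> t * flux t w) = 2 * pi * (I01 t * (\<eta> t * (AVG x. ?w' x * g t x)))"
      using good_AE
    proof eventually_elim
      case (elim t)
      consider "t \<le> 0" | "0 < t" "T \<le> t" | "0 < t" "t < T" by linarith
      then show ?case
      proof cases
        case 2
        then have "\<eta> t = 0" using zT by (intro \<eta>(4)) simp
        then show ?thesis by simp
      next
        case 3
        have "flux t w = 2 * pi * (AVG x. ?w' x * qsol t x)"
          unfolding flux_eq[OF elim 3(1) w] pairing_def circle_integral_average by (simp only: mult.commute)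
        then show ?thesis using 3 by (cases "t \<le> 1") (simp_all add: qsol_def average_const)
      qed simp
    qed
    show "(\<lambda>t. indicator {0<..<T} t * (\<eta> t * flux t w)) \<in> borel_measurable lebesgue"
      by (rule borel_measurable_lebesgue_AE_limit[OF m]) (use ae in \<open>eventually_elim, simp only: tendsto_const\<close>)
  qed
  also have "... = 2 * pi * (\<integral>t. I01 t * (\<eta> t * (AVG x. ?w' x * g t x)) \<partial>lebesgue)"
    by simp
  finally show "(\<integral>t. deriv \<eta> t * (\<integral>y. sol t y * w y \<partial>circle) \<partial>lebesgue_on {0<..<T}) = - (\<integral>t. \<eta> t * flux t w \<partial>lebesgue_on {0<..<T})"
    unfolding L by simp
qed

lemma sol_weak_solution: "0 < T \<Longrightarrow> weak_solution \<alpha> T h0 sol"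
  unfolding weak_solution_def
proof (intro conjI bexI[of _ flux] ballI)
  assume T: "0 < T"
  have I: "{0<..<T} \<in> sets lebesgue" "emeasure lebesgue {0<..<T} < \<infinity>" "{0<..<T} \<subseteq> {0<..}" using T by auto
  show "sol \<in> bochner_Lp (\<alpha> + 1) {0<..<T} (Sobolev 3 (\<alpha> + 1)) (Sobolev_norm 3 (\<alpha> + 1))" by (rule sol_bochner[OF I])
  show "sol \<in> continuous_into {0..T} (Sobolev 1 2) (Sobolev_norm 1 2)"
    unfolding continuous_into_def mem_Collect_eq
  proof (intro ballI conjI)
    fix t assume t: "t \<in> {0..T}"
    then have "t \<in> {0..}" by simp
    note c = sol_continuous[unfolded continuous_into_def mem_Collect_eq, rule_format, OF this]
    show "sol t \<in> Sobolev 1 2" using c by blast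
    show "((\<lambda>s. Sobolev_norm 1 2 (\<lambda>x. sol s x - sol t x)) \<longlongrightarrow> 0) (at t within {0..T})"
      by (rule tendsto_within_subset[OF conjunct2[OF c]]) auto
  qed
  show "AE y in circle. sol 0 y = h0 y" by (simp add: sol_def)
  show "flux \<in> bochner_Lp ((\<alpha> + 1) / \<alpha>) {0<..<T} (Sobolev_dual 1 (\<alpha> + 1)) (Sobolev_dual_norm 1 (\<alpha> + 1))" by (rule flux_bochner[OF I])
  show "is_time_deriv (\<alpha> + 1) T sol flux" by (rule sol_time_deriv)
  show "(\<integral>t. flux t (\<phi> t) \<partial>lebesgue_on {0<..<T}) = (\<integral>t. (\<integral>y. \<bar>sol t y\<bar> powr (\<alpha> + 2)
      * \<psi> \<alpha> (weak_deriv 1 (sol t) y + weak_deriv 3 (sol t) y) * weak_deriv 1 (\<phi> t) y \<partial>circle) \<partial>lebesgue_on {0<..<T})" for \<phi>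
    by (simp add: flux_def)
qed

lemma sol_bochner_loc: "sol \<in> bochner_Lp_loc_pos (\<alpha> + 1) (Sobolev 3 (\<alpha> + 1)) (Sobolev_norm 3 (\<alpha> + 1))"
  unfolding bochner_Lp_loc_pos_def by (auto intro!: sol_bochner)

lemma sol_after_1: "1 \<le> t \<Longrightarrow> sol t = h 1"
  by (simp add: sol_def min_def)

lemma sol_fourier:
  assumes t: "1 \<le> t"
  shows "complex_of_real (sol t y) = complex_of_real m + (fourier_coeff (- 1) (sol 1) * exp (- \<i> * complex_of_real y) +
    fourier_coeff 1 (sol 1) * exp (\<i> * complex_of_real y))"
proof -
  have c: "continuous_on {0..2*pi} (h 1)" by (rule continuous_on_subset[OF continuous_h]) auto
  have k: "coef (h 1) 1 = p" "coef (h 1) (-1) = q" unfolding h_1 coef_trig by (auto simp: ec_def)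
  show ?thesis
    unfolding sol_after_1[OF t] sol_after_1[OF order_refl] fourier_coeff_real[OF c] k extinct
    by (simp add: exp_ii cas_def complex_eq_iff field_simps)
qed

end

section \<open>Choice of the parameters\<close>

text \<open>Makes the weight bounded, bounded away from 0 and Lipschitz, without changing it within
  m / 2 of the mean, where the solution turns out to stay.\<close>

definition clamp :: "real \<Rightarrow> real \<Rightarrow> real" where
  "clamp m s = max (m / 2) (min (3 * m / 2) s)"

lemma clamp_bounds:
  assumes "0 < m"
  shows "m / 2 \<le> clamp m s" "clamp m s \<le> 3 * m / 2" "\<bar>s - m\<bar> \<le> m / 2 \<Longrightarrow> clamp m s = s"
  using assms by (auto simp: clamp_def min_def max_def abs_if split: if_splits)

lemma powr_uminus_Lipschitz:
  fixes \<kappa> u :: real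
  assumes u: "0 < u" and \<kappa>: "0 < \<kappa>" and xy: "u \<le> x" "u \<le> y"
  shows "\<bar>x powr (- \<kappa>) - y powr (- \<kappa>)\<bar> \<le> \<kappa> * u powr (- \<kappa> - 1) * \<bar>x - y\<bar>"
proof -
  have "norm (x powr (- \<kappa>) - y powr (- \<kappa>)) \<le> \<kappa> * u powr (- \<kappa> - 1) * norm (x - y)"
  proof (rule field_differentiable_bound[of "{u..}" "\<lambda>x. x powr (- \<kappa>)" "\<lambda>x. - \<kappa> * x powr (- \<kappa> - 1)"])
    fix z assume z: "z \<in> {u..}"
    then have z0: "0 < z" using u by auto
    show "((\<lambda>x. x powr (- \<kappa>)) has_field_derivative - \<kappa> * z powr (- \<kappa> - 1)) (at z within {u..})"
      by (rule has_field_derivative_at_within[OF has_real_derivative_powr[OF z0]])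
    have "z powr (- \<kappa> - 1) \<le> u powr (- \<kappa> - 1)" using z u \<kappa> by (intro powr_mono2') auto
    then show "norm (- \<kappa> * z powr (- \<kappa> - 1)) \<le> \<kappa> * u powr (- \<kappa> - 1)" using \<kappa> by (simp add: abs_mult)
  qed (use xy in auto)
  then show ?thesis by simp
qed

lemma weight_powr:
  fixes \<kappa> m :: real
  assumes "0 < m" "0 < \<kappa>" "1 < \<rho>"
  shows "weight \<rho> ((3 * m / 2) powr (- \<kappa>)) ((m / 2) powr (- \<kappa>)) (\<kappa> * (m / 2) powr (- \<kappa> - 1)) (\<lambda>s. clamp m s powr (- \<kappa>))"
proof
  note c = clamp_bounds[OF assms(1)]
  have c0: "0 < clamp m x" for x using c(1)[of x] assms by linarith
  show "1 < \<rho>" "0 < (3 * m / 2) powr (- \<kappa>)" using assms by auto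
  show "(3 * m / 2) powr (- \<kappa>) \<le> clamp m x powr (- \<kappa>)" for x
    using c(2)[of x] c0[of x] assms by (intro powr_mono2') auto
  show "clamp m x powr (- \<kappa>) \<le> (m / 2) powr (- \<kappa>)" for x
    using c(1)[of x] assms by (intro powr_mono2') auto
  show "0 \<le> \<kappa> * (m / 2) powr (- \<kappa> - 1)" using assms by simp
  show "\<bar>clamp m x powr (- \<kappa>) - clamp m y powr (- \<kappa>)\<bar> \<le> \<kappa> * (m / 2) powr (- \<kappa> - 1) * \<bar>x - y\<bar>" for x y
  proof -
    have "\<bar>clamp m x powr (- \<kappa>) - clamp m y powr (- \<kappa>)\<bar> \<le> \<kappa> * (m / 2) powr (- \<kappa> - 1) * \<bar>clamp m x - clamp m y\<bar>"
      using c(1) assms by (intro powr_uminus_Lipschitz) auto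
    also have "... \<le> \<kappa> * (m / 2) powr (- \<kappa> - 1) * \<bar>x - y\<bar>"
      using assms by (intro mult_left_mono) (auto simp: clamp_def min_def max_def abs_if)
    finally show ?thesis .
  qed
qed

text \<open>Bessel's inequality for the weak derivative bounds the energy and the modes 1 and -1 at
  once by the H1 distance from the mean.\<close>

lemma initial_coefficients:
  assumes h0: "h0 \<in> Sobolev 1 2" and n: "Sobolev_norm 1 2 (\<lambda>y. h0 y - average h0) < \<delta>" and \<delta>: "0 < \<delta>"
  shows "coef h0 0 = average h0" "\<bar>coef h0 1\<bar> \<le> \<delta>" "\<bar>coef h0 (-1)\<bar> \<le> \<delta>" "qf N (coef h0) \<le> \<delta>\<^sup>2"
proof -
  define g0 where "g0 = weak_deriv 1 h0"
  have g0: "g0 \<in> Lp 2" "is_weak_deriv 1 h0 g0" unfolding g0_def by (rule Sobolev_weak_deriv[OF h0]; simp)+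
  have hL: "h0 \<in> Lp 2" using h0 by (simp add: Sobolev_def)
  have i0: "integrable circle h0" "integrable circle g0" by (rule Lp_integrable[OF hL], simp, rule Lp_integrable[OF g0(1)], simp)
  have i2: "integrable circle (\<lambda>x. (g0 x)\<^sup>2)" using g0(1) unfolding Lp_def abs_powr_2 by blast
  show "coef h0 0 = average h0" by (simp add: coef_def)
  let ?a = "average h0"
  interpret C: classical "\<lambda>n x. if n = 0 then ?a else 0" 1
    by unfold_locales (auto simp: periodic_def)
  have "is_weak_deriv 1 (\<lambda>x. ?a) (\<lambda>x. 0)" "(\<lambda>x. ?a) \<in> Lp 2" "(\<lambda>x. 0) \<in> Lp 2"
    using C.weak[of 1] C.in_Lp[of 0 2] C.in_Lp[of 1 2] by simp_all
  from Sobolev_norm_1_2_diff[OF hL g0 this(2,3,1)]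
  have "sqrt (2 * pi * (AVG x. (h0 x - ?a)\<^sup>2) + 2 * pi * (AVG x. (g0 x)\<^sup>2)) < \<delta>" using n by simp
  also have "\<delta> = sqrt (\<delta>\<^sup>2)" using \<delta> by simp
  finally have "2 * pi * (AVG x. (h0 x - ?a)\<^sup>2) + 2 * pi * (AVG x. (g0 x)\<^sup>2) < \<delta>\<^sup>2"
    by (simp only: real_sqrt_less_iff)
  moreover have "0 \<le> 2 * pi * (AVG x. (h0 x - ?a)\<^sup>2)" by (intro mult_nonneg_nonneg average_nonneg) auto
  moreover have "1 * (AVG x. (g0 x)\<^sup>2) \<le> 2 * pi * (AVG x. (g0 x)\<^sup>2)"
    using pi_gt3 by (intro mult_right_mono average_nonneg) auto
  ultimately have g2: "(AVG x. (g0 x)\<^sup>2) \<le> \<delta>\<^sup>2" by linarith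
  have b: "(\<Sum>k\<in>modes N. (of_int k * coef h0 k)\<^sup>2) \<le> \<delta>\<^sup>2" for N
  proof -
    have "(\<Sum>k\<in>modes N. (of_int k * coef h0 k)\<^sup>2) = (\<Sum>k\<in>modes N. (of_int (- k) * coef h0 (- k))\<^sup>2)"
      by (rule sum_modes_uminus[symmetric])
    also have "... = (\<Sum>k\<in>modes N. (coef g0 k)\<^sup>2)"
      by (intro sum.cong refl) (simp add: coef_weak_deriv[OF g0(2)] dcoef_def)
    also have "... \<le> (AVG x. (g0 x)\<^sup>2)" by (rule bessel[OF i0(2) i2])
    finally show ?thesis using g2 by linarith
  qed
  have "qf N (coef h0) \<le> (\<Sum>k\<in>modes N. (of_int k * coef h0 k)\<^sup>2)"
    unfolding qf_def power_mult_distrib by (intro sum_mono mult_right_mono) (auto simp: lam_def)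
  then show "qf N (coef h0) \<le> \<delta>\<^sup>2" using b[of N] by linarith
  have "modes 1 = {-1, 0, 1}" by auto
  then have "(coef h0 1)\<^sup>2 + (coef h0 (-1))\<^sup>2 \<le> \<delta>\<^sup>2" using b[of 1] by (simp add: power2_commute)
  then have "(coef h0 1)\<^sup>2 \<le> \<delta>\<^sup>2" "(coef h0 (-1))\<^sup>2 \<le> \<delta>\<^sup>2"
    using zero_le_power2[of "coef h0 1"] zero_le_power2[of "coef h0 (-1)"] by linarith+
  then show "\<bar>coef h0 1\<bar> \<le> \<delta>" "\<bar>coef h0 (-1)\<bar> \<le> \<delta>" using \<delta> by (auto dest: power2_le_imp_le simp: abs_le_square_iff[symmetric])
qed

lemma flow_conv_exists_initial:
  assumes W: "weight \<rho> b0 b1 L b" and Q: "\<And>N. qf N c0 \<le> Q0" "\<And>q. q \<le> Q0 \<Longrightarrow> weight.tame \<rho> b0 L q"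
  obtains c j \<nu> where "flow_conv \<rho> b0 b1 L b c0 c j Q0 \<nu>"
proof -
  interpret W: weight \<rho> b0 b1 L b by (rule W)
  have "\<exists>c j. scheme N (1 / real N) \<rho> b c j \<and> c 0 = (\<lambda>k. if k \<in> modes N then c0 k else 0)" for N
    by (rule scheme_exists[OF _ W.continuous_on_b W.b0 W.b_ge, of \<rho> "1 / real N" N "\<lambda>k. if k \<in> modes N then c0 k else 0"])
       (use W.\<rho> in \<open>auto simp: supp_def\<close>)
  then obtain c j where cj: "\<And>N. scheme N (1 / real N) \<rho> b (c N) (j N)" "\<And>N. c N 0 = (\<lambda>k. if k \<in> modes N then c0 k else 0)"
    by metis
  interpret F: flow_family \<rho> b0 b1 L b c0 c j Q0
    by unfold_locales (use cj Q in \<open>auto intro!: discrete_flow.intro W discrete_flow_axioms.intro\<close>)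
  show thesis
  proof (rule F.subsequence_exists)
    fix \<nu> :: "nat \<Rightarrow> nat"
    assume \<nu>: "strict_mono \<nu>" "\<And>i. 1 \<le> \<nu> i"
      "\<And>k e. 0 < e \<Longrightarrow> \<exists>i0. F.cc_close \<nu> k e i0"
    interpret X: flow_limit \<rho> b0 b1 L b c0 c j Q0 \<nu>
      by unfold_locales (fact \<nu>)+
    show thesis by (rule X.flow_conv_exists) (rule that)
  qed
qed

theorem theorem3p12:
  fixes \<alpha> m :: real
  assumes "0 < \<alpha>" and "\<alpha> < 1" and "0 < m"
  shows "\<exists>\<delta>>0. \<forall>h0 \<in> Sobolev 1 2.
    average h0 = m \<and> Sobolev_norm 1 2 (\<lambda>\<theta>. h0 \<theta> - average h0) < \<delta> \<longrightarrow>
    (\<exists>h. h \<in> continuous_into {0..} (Sobolev 1 2) (Sobolev_norm 1 2) \<and>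
         h \<in> bochner_Lp_loc_pos (\<alpha> + 1) (Sobolev 3 (\<alpha> + 1)) (Sobolev_norm 3 (\<alpha> + 1)) \<and>
         global_weak_solution \<alpha> h0 h \<and>
         (\<exists>tstar>0.
            (\<forall>t\<ge>tstar. \<forall>\<theta>. complex_of_real (h t \<theta>) =
               complex_of_real (average h0) +
               (fourier_coeff (- 1) (h tstar) * exp (- \<i> * complex_of_real \<theta>) +
                fourier_coeff 1 (h tstar) * exp (\<i> * complex_of_real \<theta>))) \<and>
            (\<forall>t\<ge>tstar. fourier_coeff 1 (h t) = fourier_coeff 1 (h tstar) \<and>
                       fourier_coeff (- 1) (h t) = fourier_coeff (- 1) (h tstar))))"
proof -
  define \<rho> where "\<rho> = 1 / \<alpha>"
  \<comment> \<open>Raised to the power \<alpha>, the weight becomes h powr (- (\<alpha> + 2)) and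
    cancels the mobility.\<close>
  define \<kappa> where "\<kappa> = (\<alpha> + 2) / \<alpha>"
  have pos: "1 < \<rho>" "0 < \<kappa>" using assms by (auto simp: \<rho>_def \<kappa>_def)
  define b where "b s = clamp m s powr (- \<kappa>)" for s
  define b0 b1 L where "b0 = (3 * m / 2) powr (- \<kappa>)" and "b1 = (m / 2) powr (- \<kappa>)" and "L = \<kappa> * (m / 2) powr (- \<kappa> - 1)"
  interpret W: weight \<rho> b0 b1 L b
    unfolding b_def[abs_def] b0_def b1_def L_def by (rule weight_powr[OF assms(3) pos(2,1)])
  obtain q0 where q0: "0 < q0" "\<And>q. q \<le> q0 \<Longrightarrow> W.tame q" using W.tame_exists by blast
  define \<gamma> where "\<gamma> = W.ext_exp"
  have \<gamma>: "0 < \<gamma>" "\<gamma> < 1" unfolding \<gamma>_def by (rule W.ext_exp)+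
  define D where "D = 1 - (1 / 2 :: real) powr (1 - \<gamma>)"
  have D: "0 < D"
  proof -
    have "(1 / 2 :: real) powr (1 - \<gamma>) < (1 / 2) powr 0" using \<gamma> by (intro powr_less_mono') auto
    then show ?thesis by (simp add: D_def)
  qed
  \<comment> \<open>Solves the smallness condition of \<open>extinct_at_1\<close> for Q: it reads Q
    powr (1 - \<gamma>) \<le> C.\<close>
  define C where "C = W.ext_const * D / (2 * 2 powr \<gamma>)"
  have C: "0 < C" using W.ext_const_pos D by (simp add: C_def)
  define l where "l = m / 64"
  have l: "0 < l" using assms by (simp add: l_def)
  \<comment> \<open>In this order the bounds serve the Gronwall estimate, extinction by time 1, the
    size of the initial modes together with the oscillation bounded by the energy, and the
    displacement of the modes 1 and -1. The last two keep h within m / 2 of m.\<close>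
  define Q where "Q = Min {q0, C powr (1 / (1 - \<gamma>)), (m / 64)\<^sup>2, m * b0 * l powr \<rho> / 64}"
  have Q: "0 < Q" "Q \<le> q0" "Q \<le> C powr (1 / (1 - \<gamma>))" "Q \<le> (m / 64)\<^sup>2" "Q \<le> m * b0 * l powr \<rho> / 64"
    unfolding Q_def using q0 C assms W.b0 l by auto
  define \<delta> where "\<delta> = sqrt Q"
  have "sqrt Q \<le> sqrt ((m / 64)\<^sup>2)" by (rule real_sqrt_le_mono[OF Q(4)])
  also have "... = m / 64" using assms by simp
  finally have \<delta>: "0 < \<delta>" "\<delta>\<^sup>2 = Q" "\<delta> \<le> m / 64" using Q(1) by (simp_all add: \<delta>_def)
  show ?thesis
  proof (intro exI[of _ \<delta>] conjI[OF \<delta>(1)] ballI impI, goal_cases)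
    case (1 h0)
    note h0 = 1(1) and a = 1(2)
    note ic = initial_coefficients[OF h0 conjunct2[OF a] \<delta>(1)]
    have c0: "coef h0 0 = m" using ic(1) a by simp
    obtain c j \<nu> where "flow_conv \<rho> b0 b1 L b (coef h0) c j Q \<nu>"
      using flow_conv_exists_initial[OF W.weight_axioms, of "coef h0" Q] ic(4) \<delta>(2) q0(2) Q(2) by (metis order_trans)
    then interpret F: flow_conv \<rho> b0 b1 L b "coef h0" c j Q \<nu> .
    have near: "\<bar>F.h t x - m\<bar> \<le> m / 2" if t: "0 < t" "t \<le> 1" for t x
    proof -
      have "\<bar>F.h t x - m\<bar> \<le> 2 * (\<bar>coef h0 1\<bar> + \<bar>coef h0 (-1)\<bar> + 4 * (l + l powr (- \<rho>) / b0 * Q)) + 2 * sqrt (2 * Q)"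
        using F.h_near_mean[OF l t, of x] c0 by simp
      \<comment> \<open>The right-hand side is 24 * m / 64, which is below m / 2.\<close>
      also have "... \<le> 2 * (m / 64 + m / 64 + 4 * (m / 64 + m / 64)) + 2 * (2 * (m / 64))"
      proof -
        have "l powr (- \<rho>) / b0 * Q \<le> l powr (- \<rho>) / b0 * (m * b0 * l powr \<rho> / 64)"
          using Q(5) W.b0 by (intro mult_left_mono) auto
        also have "... = m / 64" using l W.b0 by (simp add: powr_minus field_simps)
        finally have 1: "l powr (- \<rho>) / b0 * Q \<le> m / 64" .
        have "(2 * (m / 64))\<^sup>2 = 4 * (m / 64)\<^sup>2" by (simp add: power2_eq_square)
        then have "sqrt (2 * Q) \<le> sqrt ((2 * (m / 64))\<^sup>2)" using Q(1,4) by (intro real_sqrt_le_mono) linarith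
        also have "... = 2 * (m / 64)" using assms by simp
        finally have 2: "sqrt (2 * Q) \<le> 2 * (m / 64)" .
        have 3: "\<bar>coef h0 1\<bar> \<le> m / 64" "\<bar>coef h0 (-1)\<bar> \<le> m / 64" using ic(2,3) \<delta>(3) by auto
        show ?thesis using 1 2 3 by (intro add_mono mult_left_mono) (auto simp: l_def)
      qed
      also have "... \<le> m / 2" using assms by simp
      finally show ?thesis .
    qed
    have small: "2 powr W.ext_exp * Q powr (1 - W.ext_exp) / W.ext_const / (1 - (1 / 2) powr (1 - W.ext_exp)) \<le> 1 / 2"
    proof -
      have "Q powr (1 - \<gamma>) \<le> (C powr (1 / (1 - \<gamma>))) powr (1 - \<gamma>)" using Q \<gamma> by (intro powr_mono2) auto
      also have "... = C" using C \<gamma> by (simp add: powr_powr)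
      finally have "2 powr \<gamma> * Q powr (1 - \<gamma>) \<le> 2 powr \<gamma> * C" by simp
      then have "2 powr \<gamma> * Q powr (1 - \<gamma>) / W.ext_const / D \<le> 2 powr \<gamma> * C / W.ext_const / D"
        using D W.ext_const_pos by (intro divide_right_mono) auto
      also have "... = 1 / 2" using D W.ext_const_pos by (simp add: C_def)
      finally show ?thesis by (simp add: \<gamma>_def D_def)
    qed
    obtain p q where pq: "\<And>x. F.h 1 x = coef h0 0 + p * cas 1 x + q * cas (-1) x"
      using F.extinct_at_1[OF Q(1) order_refl small] by blast
    interpret S: solution \<rho> b0 b1 L b "coef h0" c j Q \<nu> \<alpha> m p q h0
    proof
      show "\<bar>F.h t x\<bar> powr (\<alpha> + 2) * \<psi> \<alpha> (b (F.h t x) * spow \<rho> s) = s" if t: "0 < t" "t \<le> 1" for t x s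
      proof -
        have h: "0 < F.h t x" using near[OF t, of x] assms(3) by linarith
        have be: "b (F.h t x) = F.h t x powr (- \<kappa>)" using clamp_bounds(3)[OF assms(3) near[OF t]] by (simp add: b_def)
        have "\<psi> \<alpha> (b (F.h t x) * spow \<rho> s) = b (F.h t x) powr \<alpha> * s"
          unfolding \<rho>_def by (rule \<psi>_spow[OF assms(1) W.b_pos])
        also have "b (F.h t x) powr \<alpha> = F.h t x powr (- (\<alpha> + 2))"
          unfolding be using assms by (simp add: powr_powr \<kappa>_def)
        also have "\<bar>F.h t x\<bar> powr (\<alpha> + 2) * (F.h t x powr (- (\<alpha> + 2)) * s) = s"
          using h by (simp add: mult.assoc[symmetric] powr_add[symmetric])
        finally show ?thesis .
      qed
    qed (use assms \<rho>_def pq c0 h0 in auto)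
    show ?case
    proof (intro exI[of _ S.sol] exI[of _ "1 :: real"] conjI allI impI)
      show "global_weak_solution \<alpha> h0 S.sol"
        unfolding global_weak_solution_def using S.sol_weak_solution by blast
      show "complex_of_real (S.sol t x) = complex_of_real (average h0) +
               (fourier_coeff (- 1) (S.sol 1) * exp (- \<i> * complex_of_real x) +
                fourier_coeff 1 (S.sol 1) * exp (\<i> * complex_of_real x))" if "1 \<le> t" for t x
        unfolding conjunct1[OF a] by (rule S.sol_fourier[OF that])
      show "fourier_coeff 1 (S.sol t) = fourier_coeff 1 (S.sol 1)"
        "fourier_coeff (- 1) (S.sol t) = fourier_coeff (- 1) (S.sol 1)" if "1 \<le> t" for t
        unfolding S.sol_after_1[OF that] S.sol_after_1[OF order_refl] by (rule refl)+
    qed (use S.sol_continuous S.sol_bochner_loc in auto)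
  qed
qed

end
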